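(* Let $Y$ be a compact metric space with $\operatorname{diam}(Y)\le 1$. For every $0<\kappa<1$ the function $ObsDiam_Y(\cdot,\kappa)$ on $\chi$ extends to $\overline{\chi}$ (by setting $ObsDiam_Y(\zeta,\kappa):=ObsDiam_Y(X,\kappa)$ for any qmm-space $X$ with $\tau(X)=\zeta$, which is well defined), and the extension is essentially upper semi-continuous: for any $0<\kappa'<\kappa<1$, if $\zeta_n,\zeta\in\overline{\chi}$ and $\zeta_n\to\zeta$ weakly, then $$\limsup_{n\to\infty}ObsDiam_Y(\zeta_n,\kappa)\le ObsDiam_Y(\zeta,\kappa').$$
   Context: An mm-space is a Polish space $(X,d_X)$ of diameter at most one equipped with a Borel probability measure $\mu_X$ of full support; $\chi$ is the set of mm-spaces up to measure-preserving isometry. $M_\infty$ is the compact metrizable space (entrywise convergence) of infinite real matrices $(d_{i,j})_{i,j\ge 1}$ with $0\le d_{i,j}\le 1$, $d_{i,j}=d_{j,i}$, $d_{i,i}=0$; $\mathcal{P}(M_\infty)$ carries the weak topology. For $X\in\chi$, $\tau(X)\in\mathcal{P}(M_\infty)$ is the push-forward of $\mu_X^{\otimes\mathbb{N}}$ under $(x_i)\mapsto(d_X(x_i,x_j))_{i,j}$; the map $\tau$ is injective on $\chi$ and $\chi$ is identified with $\tau(\chi)$. $\overline{\chi}$ is the closure of $\tau(\chi)$ in $\mathcal{P}(M_\infty)$. A qmm-space is a triple $(X,\mu,d^* )$ where $X$ is a standard Borel space, $\mu$ a Borel probability measure and $d^*:X\times X\to\mathcal{P}[0,1]$ a Borel map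 into the space of Borel probability measures on $[0,1]$ with $d^*(x,x)=\delta_0$, $d^*(x,y)=d^*(y,x)$, such that for $\mu^3$-almost every $(a,b,c)$, independent random lengths with laws $d^*(a,b),d^*(b,c),d^*(a,c)$ almost surely satisfy the triangle inequalities. For a qmm-space, $\tau(X)\in\mathcal{P}(M_\infty)$ is the law of the random matrix obtained by choosing $x_1,x_2,\dots$ i.i.d. with law $\mu$ and then, conditionally on $(x_i)$, choosing $d_{i,j}=d_{j,i}$, $i<j$, independently with laws $d^*(x_i,x_j)$ (and $d_{i,i}=0$). Every $\zeta\in\overline\chi$ equals $\tau(X)$ for some qmm-space $X$. Lipschitz maps: for an mm-space $X$, $Lip_1(X,Y)$ is the set of $1$-Lipschitz maps $X\to Y$. For a qmm-space $(X,\mu,d^* )$, $Lip_1(X,Y)$ is the set of measurable $f:X\to Y$ such that for $\mu\times\mu$-almost all $(x_1,x_2)$, $\downarrow d^*(x_1,x_2)\ge d_Y(f(x_1),f(x_2))$, where $\downarrow\nu$ is the infimum of the support of $\nu\in\mathcal{P}[0,1]$. For $\nu\in\mathcal{P}(Y)$ and $0<\kappa<1$, $diam(\nu,\kappa)$ is the infimum of the $D$ such that $Y$ contains a measurable subset $Y_0$ with $\operatorname{diam}(Y_0)\le D$ and $\nu(Y_0)\ge 1-\kappa$. For an mm-space or qmm-space $X$ with measure $\mu$, $ObsDiam_Y(X,\kappa)=\sup_{f\in Lip_1(X,Y)}diam(f_*(\mu),\kappa)$. *)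

theory Defs
  imports "HOL-Probability.Probability"
begin

definition weak_topology :: "'a::topological_space set \<Rightarrow> 'a measure topology" where
  "weak_topology S = topology_generated_by
     {{\<nu>. prob_space \<nu> \<and> sets \<nu> = sets (restrict_space borel S) \<and> (\<integral>x. f x \<partial>\<nu>) \<in> U} | f U.
        continuous_on S f \<and> bounded (f ` S) \<and> open (U :: real set)}"

lemma topspace_weak_topology:
  "topspace (weak_topology S) = {\<nu>. prob_space \<nu> \<and> sets \<nu> = sets (restrict_space borel S)}"
(is "_ = ?P")
proof
  show "topspace (weak_topology S) \<subseteq> ?P"
    unfolding weak_topology_def topology_generated_by_topspace by blast
  have "continuous_on S (\<lambda>_. 0::real)" and "bounded ((\<lambda>_. 0::real) ` S)"
    by (simp_all add: image_constant_conv)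
  then have "{\<nu>. prob_space \<nu> \<and> sets \<nu> = sets (restrict_space borel S) \<and>
      (\<integral>x. (\<lambda>_. 0) x \<partial>\<nu>) \<in> (UNIV :: real set)} \<subseteq> topspace (weak_topology S)"
    unfolding weak_topology_def topology_generated_by_topspace using open_UNIV by blast
  then show "?P \<subseteq> topspace (weak_topology S)"
    by simp
qed

definition dist_matrices :: "(nat \<Rightarrow> nat \<Rightarrow> real) set" where
  "dist_matrices = {D. \<forall>i j. 0 \<le> D i j \<and> D i j \<le> 1 \<and> D i j = D j i \<and> D i i = 0}"

abbreviation matrix_borel :: "(nat \<Rightarrow> nat \<Rightarrow> real) measure" where
  "matrix_borel \<equiv> restrict_space borel dist_matrices"

locale mm_space = prob_space M + Metric_space "space M" d
  for M :: "'a measure" and d :: "'a \<Rightarrow> 'a \<Rightarrow> real" +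
  assumes complete: "mcomplete"
    and separable: "separable_space mtopology"
    and sets_eq_borel: "sets M = sigma_sets (space M) {U. openin mtopology U}"
    and diam_le_1: "\<And>x y. x \<in> space M \<Longrightarrow> y \<in> space M \<Longrightarrow> d x y \<le> 1"
    and full_support: "\<And>U. openin mtopology U \<Longrightarrow> U \<noteq> {} \<Longrightarrow> measure M U > 0"

definition mm_tau :: "'a measure \<Rightarrow> ('a \<Rightarrow> 'a \<Rightarrow> real) \<Rightarrow> (nat \<Rightarrow> nat \<Rightarrow> real) measure" where
  "mm_tau M d = distr (\<Pi>\<^sub>M i\<in>(UNIV :: nat set). M) matrix_borel (\<lambda>x i j. d (x i) (x j))"

text \<open>
  A separable metric space has at most the cardinality of the continuum, so every mm-space is
  isometric, by a measure-preserving map, to one whose points are real numbers (the metric and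
  the \<open>\<sigma>\<close>-algebra being unrelated to the usual ones).
\<close>
definition chi :: "(nat \<Rightarrow> nat \<Rightarrow> real) measure set" where
  "chi = {mm_tau M d | (M :: real measure) d. mm_space M d}"

definition chi_closure :: "(nat \<Rightarrow> nat \<Rightarrow> real) measure set" where
  "chi_closure = weak_topology dist_matrices closure_of chi"

definition standard_borel :: "'a measure \<Rightarrow> bool" where
  "standard_borel M \<longleftrightarrow> (\<exists>T. completely_metrizable_space T \<and> separable_space T \<and>
     topspace T = space M \<and> sets M = sigma_sets (space M) {U. openin T U})"

abbreviation unit_borel :: "real measure" where
  "unit_borel \<equiv> restrict_space borel {0..1}"

text \<open>
  The \<open>\<sigma>\<close>-algebra of \<^const>\<open>prob_algebra\<close>, generated by the evaluations, is the Borel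
  \<open>\<sigma>\<close>-algebra of the weak topology on the probability measures on the unit interval.
\<close>
locale qmm_space = prob_space M
  for M :: "'a measure" and q :: "'a \<Rightarrow> 'a \<Rightarrow> real measure" +
  assumes standard_borel: "standard_borel M"
    and measurable_q: "(\<lambda>(x, y). q x y) \<in> M \<Otimes>\<^sub>M M \<rightarrow>\<^sub>M prob_algebra unit_borel"
    and q_refl: "\<And>x. x \<in> space M \<Longrightarrow> q x x = return unit_borel 0"
    and q_sym: "\<And>x y. x \<in> space M \<Longrightarrow> y \<in> space M \<Longrightarrow> q x y = q y x"
    and q_triangle: "AE (a, b, c) in M \<Otimes>\<^sub>M (M \<Otimes>\<^sub>M M).
          AE (r, s, t) in q a b \<Otimes>\<^sub>M (q b c \<Otimes>\<^sub>M q a c). t \<le> r + s \<and> r \<le> s + t \<and> s \<le> r + t"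

definition matrix_of_upper :: "(nat \<times> nat \<Rightarrow> real) \<Rightarrow> nat \<Rightarrow> nat \<Rightarrow> real" where
  "matrix_of_upper t i j = (if i < j then t (i, j) else if j < i then t (j, i) else 0)"

definition qmm_tau :: "'a measure \<Rightarrow> ('a \<Rightarrow> 'a \<Rightarrow> real measure) \<Rightarrow> (nat \<Rightarrow> nat \<Rightarrow> real) measure" where
  "qmm_tau M q = (\<Pi>\<^sub>M i\<in>(UNIV :: nat set). M) \<bind>
     (\<lambda>x. distr (\<Pi>\<^sub>M (i, j)\<in>{(i, j). i < j}. q (x i) (x j)) matrix_borel matrix_of_upper)"

definition mm_Lip1 :: "'a measure \<Rightarrow> ('a \<Rightarrow> 'a \<Rightarrow> real) \<Rightarrow> 'y::metric_space set \<Rightarrow> ('a \<Rightarrow> 'y) set" where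
  "mm_Lip1 M d Y = {f \<in> space M \<rightarrow> Y. \<forall>x\<in>space M. \<forall>x'\<in>space M. dist (f x) (f x') \<le> d x x'}"

definition support :: "'a::topological_space measure \<Rightarrow> 'a set" where
  "support \<nu> = {t \<in> space \<nu>. \<forall>U. open U \<and> t \<in> U \<longrightarrow> emeasure \<nu> (U \<inter> space \<nu>) > 0}"

definition qmm_Lip1 ::
  "'a measure \<Rightarrow> ('a \<Rightarrow> 'a \<Rightarrow> real measure) \<Rightarrow> 'y::metric_space set \<Rightarrow> ('a \<Rightarrow> 'y) set" where
  "qmm_Lip1 M q Y = {f \<in> M \<rightarrow>\<^sub>M restrict_space borel Y.
     AE (x, x') in M \<Otimes>\<^sub>M M. Inf (support (q x x')) \<ge> dist (f x) (f x')}"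

definition partial_diam :: "'y::metric_space measure \<Rightarrow> real \<Rightarrow> real" where
  "partial_diam \<nu> \<kappa> = Inf {D. \<exists>Y0\<in>sets \<nu>. diameter Y0 \<le> D \<and> measure \<nu> Y0 \<ge> 1 - \<kappa>}"

definition mm_ObsDiam ::
  "'y::metric_space set \<Rightarrow> 'a measure \<Rightarrow> ('a \<Rightarrow> 'a \<Rightarrow> real) \<Rightarrow> real \<Rightarrow> real" where
  "mm_ObsDiam Y M d \<kappa> =
     (SUP f\<in>mm_Lip1 M d Y. partial_diam (distr M (restrict_space borel Y) f) \<kappa>)"

definition qmm_ObsDiam ::
  "'y::metric_space set \<Rightarrow> 'a measure \<Rightarrow> ('a \<Rightarrow> 'a \<Rightarrow> real measure) \<Rightarrow> real \<Rightarrow> real" where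
  "qmm_ObsDiam Y M q \<kappa> =
     (SUP f\<in>qmm_Lip1 M q Y. partial_diam (distr M (restrict_space borel Y) f) \<kappa>)"

text \<open>
  As for mm-spaces, restricting to carriers consisting of real numbers loses no standard Borel space.
\<close>
definition ObsDiam :: "'y::metric_space set \<Rightarrow> (nat \<Rightarrow> nat \<Rightarrow> real) measure \<Rightarrow> real \<Rightarrow> real" where
  "ObsDiam Y \<zeta> \<kappa> = (THE v. \<exists>(M :: real measure) q.
     qmm_space M q \<and> qmm_tau M q = \<zeta> \<and> v = qmm_ObsDiam Y M q \<kappa>)"

end

(*
  A space is handled through a map \<Psi> such that \<Psi> x y u, for a uniform u, has law d^*(x,y); then tau is
  the law of a random array built from iid points and independent noise. A point of the closure of chi is an
  exchangeable dissociated array, and conditioning on the entries with odd indices (Aldous-Hoover) yields such a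
  \<Psi> on the unit interval.
  For semicontinuity, write the coded values of a 1-Lipschitz map on the diagonal of the sampled array. The laws
  of the labelled arrays have a weak limit, and it suffices to realise its label distribution, up to a small error
  on finitely many sets, by a Lipschitz map on any given model of the limit. Couple the model with the labelled
  array: given the distance array, labels and noise are asymptotically independent, so conditioning on the remote
  part of the array gives a random Lipschitz labelling with the right distribution. Choosing one label per cell of
  a fine partition makes it deterministic. Applied to a constant sequence, this shows that the observable diameter
  depends only on tau.
*)
theory Submission
 imports Defs "HOL-Analysis.Function_Metric"
begin

text \<open>A limit of Lipschitz labellings is a priori only a random labelling that may look at the
  whole array. Were it correlated with the noise in the distances, the Lipschitz bound could hold
  along the array and still fail against the essential infimum of the distance, which is what the
  definition asks for. Exchangeability excludes this: the correlation would repeat along infinitely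
  many edges, whose noise is independent given the points. Dissociation is what makes conditioning
  harmless. Given the remote part of the array, the law of a label, or of a subarray, is almost
  surely the unconditional one, so one typical remote part can be frozen. Freezing a single uniform
  number as well would keep the Lipschitz bound but not the distribution of labels, and independent
  numbers for all points would not give a measurable map; one number per cell does both in the limit
  of fine cells. The gap between \<kappa>' and \<kappa> is spent only in the weak limit, where just
  closed sets are sure to keep their mass. Passing between two models of the same law leaves
  \<kappa> unchanged.\<close>

notation pair_measure (infixr "><" 80) and measurable (infixr "->M" 60)
abbreviation Bm where "Bm N == borel_measurable N"
abbreviation Ind where "Ind == indicator"
abbreviation lims :: "(nat => 'a::topological_space) => 'a => bool" (infix "~~>" 60) where
 "X ~~> L == X \<longlonglongrightarrow> L"

lemmas m_comp = measurable_compose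
lemmas m_fst = measurable_fst
lemmas m_snd = measurable_snd
lemmas m_Pair = measurable_Pair
lemmas bm_times = borel_measurable_times
lemmas bm_ind = borel_measurable_indicator
lemmas b_cong = Bochner_Integration.integral_cong
lemmas m_cong_sets = measurable_cong_sets
lemmas sp_pair = space_pair_measure
lemmas bm_prod = borel_measurable_prod

section \<open>Uniform noise and the quantile transform\<close>

definition unif :: "real measure" where
 "unif = uniform_measure lborel {0..1}"

lemma prob_space_unif [simp]: "prob_space unif"
 unfolding unif_def by (rule prob_space_uniform_measure) auto

lemma sets_unif [measurable_cong, simp]: "sets unif = sets borel"
 and space_unif [simp]: "space unif = UNIV"
 by (simp_all add: unif_def)

lemma measure_unif_atMost: "0 <= t ==> t <= 1 ==> measure unif {..t} = t"
proof -
 assume t: "0 <= t" "t <= 1"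
 have "{0..1} Int {..t} = {0..t}" using t by auto
 thus ?thesis using t by (simp add: unif_def)
qed

lemma AE_unif_neq: "AE u in unif. u ~= a"
proof -
 have "AE u in lborel. u ~= a" by (rule AE_lborel_singleton)
 thus ?thesis unfolding unif_def
  by (intro AE_uniform_measureI) auto
qed

lemma (in finite_measure) integrable_bounded:
 fixes f :: "'a => real"
 assumes "f : Bm M" "!!x. x : space M ==> \<bar>f x\<bar> <= B"
 shows "integrable M f"
 by (rule integrable_const_bound[where B=B]) (use assms in auto)

text \<open>Lower quantile of a distribution function. Only rational arguments of \<open>G\<close>
  occur, so \<open>G\<close> may consist of countably many densities chosen separately; the inserted
  1 is the value when no rational qualifies.\<close>

definition qt :: "(rat => real) => real => real" where
 "qt G u = Inf (insert 1 {of_rat r | r. 0 <= r & r <= 1 & u <= G r})"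

lemma qt_bdd: "bdd_below (insert (1::real) {of_rat r | r. 0 <= r & r <= 1 & u <= G r})"
 by (intro bdd_belowI[where m=0]) auto

lemma qt_bounds: "0 <= qt G u" "qt G u <= 1"
 unfolding qt_def
 by (intro cInf_greatest, auto) (intro cInf_lower qt_bdd, auto)

text \<open>A strict inequality does not ask whether the infimum is attained: a rational witness
  below \<open>t\<close> is enough, for \<open>G\<close> of any regularity. Measurability in
  \<open>G\<close> and \<open>u\<close> becomes a countable union. For \<open>t <= 1\<close> the
  inserted 1 never counts.\<close>

lemma qt_less: "t <= 1 ==> qt G u < t \<longleftrightarrow> (EX r. 0 <= r & of_rat r < t & u <= G r)"
proof -
 assume t: "t <= 1"
 have *: "of_rat r < t ==> r <= 1" for r :: rat
 proof -
  assume "of_rat r < t"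
  hence "(of_rat r :: real) < 1" using t by (rule less_le_trans)
  thus "r <= 1" by (simp add: of_rat_less_1_iff)
 qed
 show ?thesis
  unfolding qt_def cInf_less_iff[OF _ qt_bdd, simplified]
  using t * by auto
qed

lemma measurable_qt [measurable]:
 assumes [measurable]: "!!r. G r : Bm N" "f : Bm N"
 shows "(%x. qt (%r. G r x) (f x)) : Bm N"
proof (rule borel_measurableI_less)
 fix a :: real
 show "{x : space N. qt (%r. G r x) (f x) < a} : sets N"
 proof (cases "a <= 1")
  case True
  thus ?thesis unfolding qt_less[OF True] by measurable
 next
  case False
  hence "{x : space N. qt (%r. G r x) (f x) < a} = space N"
   using qt_bounds(2) by (force intro: le_less_trans)
  thus ?thesis by simp
 qed
qed

lemma rat_seq_below:
 fixes t :: real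
 assumes "0 < t"
 obtains r :: "nat => rat" where "incseq r" "!!k. 0 <= r k" "!!k. of_rat (r k) < t"
  "!!s. s < t ==> EX k. s <= of_rat (r k)"
proof -
 \<comment> \<open>The intervals for successive \<open>k\<close> abut, which forces the chosen
   rationals to increase.\<close>
 have "\<exists>q::rat. t - t / (real k + 1) < of_rat q & of_rat q < t - t / (real k + 2)" for k :: nat
  by (rule of_rat_dense) (use assms in \<open>auto simp: field_simps\<close>)
 then obtain r :: "nat => rat" where
  r: "!!k. t - t / (real k + 1) < of_rat (r k)" "!!k. of_rat (r k) < t - t / (real k + 2)"
  by metis
 show thesis
 proof (rule that[of r])
  show "incseq r"
  proof (rule incseq_SucI)
   fix k
   have "(of_rat (r k) :: real) < of_rat (r (Suc k))"
    using r(2)[of k] r(1)[of "Suc k"] by (simp add: add.commute add.left_commute)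
   thus "r k <= r (Suc k)" by (simp add: of_rat_less)
  qed
  fix k
  have "t / (real k + 1) <= t" using assms by (simp add: field_simps)
  hence "(0::real) < of_rat (r k)" using r(1)[of k] by linarith
  thus "0 <= r k" by simp
  have "0 < t / (real k + 2)" using assms by simp
  thus "of_rat (r k) < t" using r(2)[of k] by linarith
 next
  fix s assume s: "s < t"
  obtain k :: nat where k: "t / (t - s) < real k" using reals_Archimedean2 by blast
  have "t / (real k + 1) <= t - s"
   using k s assms by (simp add: field_simps)
  thus "EX k. s <= of_rat (r k)" using r(1)[of k] by (intro exI[of _ k]) linarith
 qed
qed

text \<open>The event \<open>qt G u < t\<close> is the increasing union of the events
  \<open>u <= G (r k)\<close>, so its probability is the left limit of \<open>G\<close> at
  \<open>t\<close>.\<close>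

lemma qt_law:
 assumes G: "!!r. 0 <= G r" "!!r. G r <= 1" "!!r s. r <= s ==> G r <= G s"
  and t: "t <= 1"
  and r: "incseq r" "!!k. 0 <= r k" "!!k. of_rat (r k) < t"
   "!!s. s < t ==> EX k. s <= of_rat (r k :: rat)"
 shows "(%k. G (r k)) ~~> measure unif {u. qt G u < t}"
proof -
 interpret prob_space unif by simp
 have eq: "{u. qt G u < t} = (\<Union>k. {..G (r k)})"
 proof safe
  fix u assume "qt G u < t"
  then obtain q where q: "0 <= q" "of_rat q < t" "u <= G q" using t by (auto simp: qt_less)
  then obtain k where "(of_rat q :: real) <= of_rat (r k)" using r(4) by blast
  hence "u <= G (r k)" using q G(3)[of q "r k"] by (simp add: of_rat_less_eq)
  thus "u : (\<Union>k. {..G (r k)})" by auto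
 next
  fix u k assume "u <= G (r k)"
  thus "qt G u < t" using t r(2,3) by (auto simp: qt_less)
 qed
 have "(%k. measure unif {..G (r k)}) ~~> measure unif (\<Union>k. {..G (r k)})"
  using r(1) G(3) by (intro finite_Lim_measure_incseq) (auto simp: incseq_def intro: order_trans)
 thus ?thesis
  using G by (simp add: eq measure_unif_atMost)
qed

text \<open>Open half-lines are the generator because \<open>qt_less\<close> evaluates strict
  inequalities.\<close>

lemma real_measure_eqI:
 fixes P Q :: "real measure"
 assumes "finite_measure P" "finite_measure Q" and s: "sets P = sets borel" "sets Q = sets borel"
  and eq: "!!t. emeasure P {..<t} = emeasure Q {..<t}"
 shows "P = Q"
proof (rule measure_eqI_generator_eq[where E="range lessThan" and \<Omega>=UNIV and A="%i. {..<real i}"])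
 show "Int_stable (range (lessThan :: real => _))"
 proof (rule Int_stableI)
  fix A B :: "real set" assume "A : range lessThan" "B : range lessThan"
  then obtain a b where "A = {..<a}" "B = {..<b}" by auto
  hence "A Int B = {..<min a b}" by auto
  thus "A Int B : range lessThan" by blast
 qed
 show "sets P = sigma_sets UNIV (range lessThan)" "sets Q = sigma_sets UNIV (range lessThan)"
  unfolding s borel_Iio by simp_all
 show "(\<Union>i. {..<real i}) = UNIV" using reals_Archimedean2 by auto
 show "emeasure P {..<real i} ~= \<infinity>" for i
  using finite_measure.emeasure_finite[OF assms(1)] by simp
qed (use eq in auto)

section \<open>Outsourcing: conditional laws as functions of independent noise\<close>

text \<open>Unnormalised law of the second coordinate on the event that the first lies in
  \<open>A\<close>. It lets equality on a product be checked one coordinate at a time, each with its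
  own generator.\<close>

definition slice :: "('a \<times> 'b) measure => 'a set => 'b measure => 'b measure" where
 "slice P A N = distr (density P (Ind (A \<times> space N))) N snd"

lemma emeasure_slice:
 assumes P: "sets P = sets (N1 >< N2)" and A: "A : sets N1" and B: "B : sets N2"
 shows "emeasure (slice P A N2) B = emeasure P (A \<times> B)"
proof -
 note [measurable_cong] = P
 have sp: "space P = space N1 \<times> space N2"
  using P by (metis sets_eq_imp_space_eq sp_pair)
 have [measurable]: "A \<times> space N2 : sets P" unfolding P using A by (intro pair_measureI) auto
 have "emeasure (slice P A N2) B = emeasure (density P (Ind (A \<times> space N2))) (snd -` B Int space P)"
  unfolding slice_def using B by (subst emeasure_distr) auto
 also have "... = (\<integral>\<^sup>+x. Ind (A \<times> space N2) x * Ind (snd -` B Int space P) x \<partial>P)"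
  using B by (subst emeasure_density) auto
 also have "... = (\<integral>\<^sup>+x. Ind (A \<times> B) x \<partial>P)"
  using sets.sets_into_space[OF A] sets.sets_into_space[OF B]
  by (intro nn_integral_cong) (auto simp: sp split: split_indicator)
 also have "... = emeasure P (A \<times> B)"
  by (rule nn_integral_indicator) (unfold P, use A B in auto)
 finally show ?thesis .
qed

lemma slice_sets [simp]: "sets (slice P A N) = sets N"
 by (simp add: slice_def)

lemma finite_measure_slice:
 assumes "finite_measure P" and P: "sets P = sets (N1 >< N2)" and A: "A : sets N1"
 shows "finite_measure (slice P A N2)"
proof
 interpret finite_measure P by fact
 show "emeasure (slice P A N2) (space (slice P A N2)) ~= \<infinity>"
  using emeasure_slice[OF P A, of "space N2"] by (simp add: sets_eq_imp_space_eq[OF slice_sets])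
qed

lemma pair_rect_eqI:
 assumes "finite_measure P" "finite_measure Q"
  and P: "sets P = sets (N1 >< N2)" and Q: "sets Q = sets (N1 >< N2)"
  and eq: "!!A B. A : sets N1 ==> B : sets N2 ==> emeasure P (A \<times> B) = emeasure Q (A \<times> B)"
 shows "P = Q"
proof (rule measure_eqI_generator_eq[OF Int_stable_pair_measure_generator[of N1 N2]])
 show "sets P = sigma_sets (space N1 \<times> space N2) {a \<times> b |a b. a : sets N1 & b : sets N2}"
  "sets Q = sigma_sets (space N1 \<times> space N2) {a \<times> b |a b. a : sets N1 & b : sets N2}"
  by (simp_all add: P Q sets_pair_measure)
 show "{a \<times> b |a b. a : sets N1 & b : sets N2} <= Pow (space N1 \<times> space N2)"
  by (rule pair_measure_closed)
 show "range (%i::nat. space N1 \<times> space N2) <= {a \<times> b |a b. a : sets N1 & b : sets N2}"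
  by auto
 show "emeasure P (space N1 \<times> space N2) ~= \<infinity>"
  using finite_measure.emeasure_finite[OF assms(1)] by simp
qed (use eq in auto)

lemma pair_slice_eqI:
 assumes "finite_measure P" "finite_measure Q"
  and P: "sets P = sets (N1 >< N2)" and Q: "sets Q = sets (N1 >< N2)"
  and eq: "!!A. A : sets N1 ==> slice P A N2 = slice Q A N2"
 shows "P = Q"
proof (rule pair_rect_eqI[OF assms(1,2) P Q])
 fix A B assume "A : sets N1" "B : sets N2"
 thus "emeasure P (A \<times> B) = emeasure Q (A \<times> B)"
  using eq[of A] emeasure_slice[OF P] emeasure_slice[OF Q] by metis
qed

text \<open>Test on the set where \<open>g < f\<close>. If it had positive measure, the two
  integrals over it would be strictly ordered the other way, the smaller one being finite.\<close>

lemma AE_le_of_set_nn_integral_le: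
 fixes f g :: "'a => ennreal"
 assumes [measurable]: "f : Bm M" "g : Bm M"
  and le: "!!A. A : sets M ==> (\<integral>\<^sup>+x\<in>A. f x \<partial>M) <= (\<integral>\<^sup>+x\<in>A. g x \<partial>M)"
  and fin: "(\<integral>\<^sup>+x. g x \<partial>M) ~= \<infinity>"
 shows "AE x in M. f x <= g x"
proof (rule ccontr)
 assume not: "~ ?thesis"
 let ?B = "{x : space M. g x < f x}"
 have "(\<integral>\<^sup>+x\<in>?B. g x \<partial>M) < (\<integral>\<^sup>+x\<in>?B. f x \<partial>M)"
 proof (rule nn_integral_less)
  have "(\<integral>\<^sup>+x\<in>?B. g x \<partial>M) <= (\<integral>\<^sup>+x. g x \<partial>M)"
   by (intro nn_integral_mono) (auto split: split_indicator)
  thus "(\<integral>\<^sup>+x\<in>?B. g x \<partial>M) ~= \<infinity>" using fin by (auto simp: top_unique)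
  show "AE x in M. g x * Ind ?B x <= f x * Ind ?B x"
   by (auto split: split_indicator)
  show "~ (AE x in M. f x * Ind ?B x <= g x * Ind ?B x)"
  proof
   assume "AE x in M. f x * Ind ?B x <= g x * Ind ?B x"
   hence "AE x in M. f x <= g x"
    using AE_space by eventually_elim (auto split: split_indicator_asm simp: not_le[symmetric])
   with not show False by simp
  qed
 qed simp_all
 with le[of ?B] show False by auto
qed

text \<open>The conditional distribution function is assembled from Radon-Nikodym derivatives at
  rational levels. Outside a null set they are monotone and at most 1, and the quantile function of
  the result turns a uniform number into the conditional law.\<close>

theorem noise_outsourcing:
 fixes P :: "('n \<times> real) measure"
 assumes "prob_space P" and P: "sets P = sets (N >< borel)"
  and unit: "AE z in P. snd z : {0..1}"
 obtains Ph where "(%z. Ph (fst z) (snd z)) : Bm (N >< borel)"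
  "!!et u. 0 <= Ph et u & Ph et u <= 1"
  "P = distr (distr P N fst >< unif) (N >< borel) (%z. (fst z, Ph (fst z) (snd z)))"
proof -
 interpret P: prob_space P by fact
 note [measurable_cong] = P
 have spP: "space P = space N \<times> UNIV"
  using P by (metis sets_eq_imp_space_eq sp_pair space_borel)
 define rh where "rh = distr P N fst"
 have sets_rh [measurable_cong, simp]: "sets rh = sets N" and sprh [simp]: "space rh = space N"
  by (auto simp: rh_def)
 interpret R: prob_space rh unfolding rh_def by (rule P.prob_space_distr) measurable
 have rh_em: "emeasure rh B = emeasure P (B \<times> UNIV)" if "B : sets N" for B
 proof -
  have "fst -` B Int space P = B \<times> UNIV" using sets.sets_into_space[OF that] by (auto simp: spP)
  thus ?thesis unfolding rh_def using that by (subst emeasure_distr) auto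
 qed
 define nu where "nu r = distr (density P (Ind (space N \<times> {..real_of_rat r}))) N fst" for r
 have sets_nu: "sets (nu r) = sets N" for r by (simp add: nu_def)
 have rect [measurable]: "B \<times> C : sets P" if "B : sets N" "C : sets borel" for B C
  unfolding P using that by auto
 have nu_em: "emeasure (nu r) B = emeasure P (B \<times> {..of_rat r})" if B: "B : sets N" for B r
 proof -
  have [measurable]: "space N \<times> {..real_of_rat r} : sets P" by (rule rect) auto
  have "emeasure (nu r) B = emeasure (density P (Ind (space N \<times> {..real_of_rat r}))) (fst -` B Int space P)"
   unfolding nu_def using B by (subst emeasure_distr) auto
  also have "... = (\<integral>\<^sup>+x. Ind (space N \<times> {..real_of_rat r}) x * Ind (fst -` B Int space P) x \<partial>P)"
   using B by (subst emeasure_density) auto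
  also have "... = (\<integral>\<^sup>+x. Ind (B \<times> {..real_of_rat r}) x \<partial>P)"
   using sets.sets_into_space[OF B] by (intro nn_integral_cong) (auto simp: spP split: split_indicator)
  also have "... = emeasure P (B \<times> {..real_of_rat r})"
   by (rule nn_integral_indicator) (use rect[OF B] in auto)
  finally show ?thesis .
 qed
 \<comment> \<open>A version of the conditional probability of \<open>snd z <= r\<close> given the
   first coordinate.\<close>
 define g where "g r = RN_deriv rh (nu r)" for r
 have gm [measurable]: "g r : Bm N" for r
  using borel_measurable_RN_deriv[of rh "nu r"] by (simp add: g_def cong: m_cong_sets)
 have ac: "absolutely_continuous rh (nu r)" for r
 proof -
  have "emeasure (nu r) B = 0" if B: "B : sets N" "emeasure rh B = 0" for B
  proof -
   have "emeasure P (B \<times> {..real_of_rat r}) <= emeasure P (B \<times> UNIV)"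
    using rect[OF B(1), of UNIV] by (intro emeasure_mono) auto
   thus ?thesis using B nu_em rh_em by simp
  qed
  thus ?thesis unfolding absolutely_continuous_def null_sets_def by (auto simp: sets_nu)
 qed
 have g_int: "(\<integral>\<^sup>+x\<in>B. g r x \<partial>rh) = emeasure P (B \<times> {..of_rat r})" if B: "B : sets N" for B r
 proof -
  have "density rh (g r) = nu r"
   unfolding g_def by (rule R.density_RN_deriv[OF ac]) (simp add: sets_nu)
  hence "emeasure (density rh (g r)) B = emeasure P (B \<times> {..of_rat r})"
   using nu_em[OF B] by simp
  thus ?thesis using B by (subst (asm) emeasure_density) auto
 qed
 have g_fin: "(\<integral>\<^sup>+x. g r x \<partial>rh) ~= \<infinity>" for r
 proof -
  have "(\<integral>\<^sup>+x. g r x \<partial>rh) = (\<integral>\<^sup>+x\<in>space N. g r x \<partial>rh)"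
   by (intro nn_integral_cong) simp
  thus ?thesis using g_int[of "space N" r] by simp
 qed
 have g_mono: "AE x in rh. g r x <= g s x" if "r <= s" for r s
 proof (rule AE_le_of_set_nn_integral_le)
  fix A assume "A : sets rh"
  hence A: "A : sets N" by simp
  show "(\<integral>\<^sup>+x\<in>A. g r x \<partial>rh) <= (\<integral>\<^sup>+x\<in>A. g s x \<partial>rh)"
   unfolding g_int[OF A] using rect[OF A, of "{..of_rat s}"] \<open>r <= s\<close>
   by (intro emeasure_mono) (auto intro: order_trans simp: of_rat_less_eq)
 qed (use g_fin in auto)
 have g_le1: "AE x in rh. g r x <= 1" for r
 proof (rule AE_le_of_set_nn_integral_le)
  fix A assume "A : sets rh"
  hence A: "A : sets N" by simp
  have "(\<integral>\<^sup>+x\<in>A. g r x \<partial>rh) <= emeasure P (A \<times> UNIV)"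
   unfolding g_int[OF A] using rect[OF A, of UNIV] by (intro emeasure_mono) auto
  also have "... = (\<integral>\<^sup>+x\<in>A. 1 \<partial>rh)" using A rh_em by simp
  finally show "(\<integral>\<^sup>+x\<in>A. g r x \<partial>rh) <= (\<integral>\<^sup>+x\<in>A. 1 \<partial>rh)" .
 qed (use R.emeasure_finite in auto)
 have good: "AE x in rh. (ALL r. g r x <= 1) & (ALL r s. r <= s --> g r x <= g s x)"
  using g_le1 g_mono by (auto simp: AE_all_countable intro!: AE_conjI)
 define G where "G r x = enn2real (g r x)" for r x
 have [measurable]: "G r : Bm N" for r unfolding G_def by measurable
 define Ph where "Ph x u = qt (%r. G r x) u" for x u
 have Phm [measurable]: "(%z. Ph (fst z) (snd z)) : Bm (N >< borel)"
  unfolding Ph_def by measurable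
 define Q where "Q = distr (rh >< unif) (N >< borel) (%z. (fst z, Ph (fst z) (snd z)))"
 interpret unif: prob_space unif by simp
 interpret RU: pair_prob_space rh unif
  by (simp add: pair_prob_space_def pair_sigma_finite_def R.prob_space_axioms R.sigma_finite_measure_axioms prob_space_imp_sigma_finite)
 have [measurable_cong]: "sets (rh >< unif) = sets (N >< borel)" by (intro sets_pair_measure_cong) simp_all
 have Qprob: "prob_space Q"
  unfolding Q_def by (rule RU.prob_space_distr) measurable
 interpret Q: prob_space Q by fact
 have setsQ: "sets Q = sets (N >< borel)" by (simp add: Q_def)
 have Q_em: "emeasure Q (A \<times> {..<t}) = (\<integral>\<^sup>+x\<in>A. measure unif {u. Ph x u < t} \<partial>rh)" if A: "A : sets N" for A t
 proof -
  have [measurable]: "A \<times> {..<t} : sets (N >< borel)" using A by auto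
  have m: "{z\<in>space (N >< borel). (fst z, Ph (fst z) (snd z)) : A \<times> {..<t}} : sets (N >< borel)"
   by measurable
  have "emeasure Q (A \<times> {..<t}) = emeasure (rh >< unif) {z\<in>space (N >< borel). (fst z, Ph (fst z) (snd z)) : A \<times> {..<t}}"
   unfolding Q_def by (subst emeasure_distr) (auto simp: vimage_def Int_def sp_pair intro!: arg_cong2[where f=emeasure])
  also have "... = (\<integral>\<^sup>+x. emeasure unif (Pair x -` {z\<in>space (N >< borel). (fst z, Ph (fst z) (snd z)) : A \<times> {..<t}}) \<partial>rh)"
   by (rule unif.emeasure_pair_measure_alt) (use m in simp)
  also have "... = (\<integral>\<^sup>+x\<in>A. measure unif {u. Ph x u < t} \<partial>rh)"
  proof (rule nn_integral_cong)
   fix x assume "x : space rh"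
   hence "Pair x -` {z\<in>space (N >< borel). (fst z, Ph (fst z) (snd z)) : A \<times> {..<t}}
    = (if x : A then {u. Ph x u < t} else {})"
    by (auto simp: sp_pair)
   thus "emeasure unif (Pair x -` {z\<in>space (N >< borel). (fst z, Ph (fst z) (snd z)) : A \<times> {..<t}}) =
     ennreal (measure unif {u. Ph x u < t}) * Ind A x"
    by (simp add: unif.emeasure_eq_measure)
  qed
  finally show ?thesis .
 qed
 have meas_t [measurable]: "(%x. measure unif {u. Ph x u < t}) : Bm N" for t
 proof -
  have "{z : space (N >< unif). Ph (fst z) (snd z) < t} : sets (N >< unif)" by measurable
  from unif.measurable_emeasure_Pair[OF this]
  have "(%x. emeasure unif (Pair x -` {z : space (N >< unif). Ph (fst z) (snd z) < t})) : Bm N" .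
  hence "(%x. measure unif (Pair x -` {z : space (N >< unif). Ph (fst z) (snd z) < t})) : Bm N"
   unfolding measure_def by measurable
  thus ?thesis
   by (rule measurable_cong[THEN iffD1, rotated]) (auto simp: sp_pair intro!: arg_cong2[where f=measure])
 qed
 \<comment> \<open>Outside (0, 1] both sides are trivial by \<open>unit\<close>; inside, both are
   the limit of the mass of \<open>A \<times> {..r k}\<close> for rationals \<open>r k\<close>
   increasing to \<open>t\<close>.\<close>
 have main: "emeasure P (A \<times> {..<t}) = emeasure Q (A \<times> {..<t})" if A: "A : sets N" for A t
 proof -
  consider "t <= 0" | "1 < t" | "0 < t" "t <= 1" by linarith
  thus ?thesis
  proof cases
   case 1
   have "AE z in P. ~ snd z < 0" using unit by eventually_elim auto
   hence "emeasure P {z\<in>space P. snd z < 0} = 0" by (subst (asm) AE_iff_measurable) auto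
   moreover have "emeasure P (A \<times> {..<t}) <= emeasure P {z\<in>space P. snd z < 0}"
    using 1 sets.sets_into_space[OF A] by (intro emeasure_mono) (auto simp: spP)
   moreover have "{u. Ph x u < t} = {}" for x using 1 qt_bounds(1) by (auto simp: Ph_def not_less intro: order_trans)
   ultimately show ?thesis by (simp add: Q_em[OF A])
  next
   case 2
   have "{u. Ph x u < t} = UNIV" for x using 2 qt_bounds(2) by (auto simp: Ph_def intro: le_less_trans)
   hence "emeasure Q (A \<times> {..<t}) = emeasure P (A \<times> UNIV)"
    using A unif.prob_space by (simp add: Q_em rh_em)
   also have "... = emeasure P (A \<times> {..<t})"
    using unit 2 rect[OF A] by (intro emeasure_eq_AE) auto
   finally show ?thesis by simp
  next
   case 3
   obtain r :: "nat => rat" where r: "incseq r" "!!k. 0 <= r k" "!!k. of_rat (r k) < t"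
    "!!s. s < t ==> EX k. s <= of_rat (r k)" using rat_seq_below[OF 3(1)] by blast
   have "(%k. \<integral>\<^sup>+x\<in>A. g (r k) x \<partial>rh) ~~> (\<integral>\<^sup>+x\<in>A. measure unif {u. Ph x u < t} \<partial>rh)"
   proof (rule nn_integral_dominated_convergence[where w="%x. 1"])
    show "AE x in rh. g (r k) x * Ind A x <= 1" for k
     using good by eventually_elim (auto split: split_indicator)
    show "AE x in rh. (%k. g (r k) x * Ind A x) ~~> ennreal (measure unif {u. Ph x u < t}) * Ind A x"
     using good
    proof eventually_elim
     case (elim x)
     have fin: "g q x ~= \<top>" for q using elim by (metis ennreal_one_neq_top top_unique)
     have "(%k. G (r k) x) ~~> measure unif {u. qt (%r. G r x) u < t}"
     proof (rule qt_law[OF _ _ _ 3(2) r])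
      show "G q x <= 1" for q
       using elim unfolding G_def by (metis enn2real_1 enn2real_mono ennreal_one_less_top)
      show "G q x <= G s x" if "q <= s" for q s
       using elim that fin unfolding G_def by (intro enn2real_mono) (auto simp: less_top)
     qed (simp add: G_def)
     hence "(%k. ennreal (G (r k) x)) ~~> ennreal (measure unif {u. Ph x u < t})"
      unfolding Ph_def by (intro tendsto_ennrealI)
     moreover have "ennreal (G (r k) x) = g (r k) x" for k
      unfolding G_def using fin by (simp add: less_top)
     ultimately have "(%k. g (r k) x) ~~> ennreal (measure unif {u. Ph x u < t})" by simp
     thus ?case by (auto split: split_indicator)
    qed
   qed (use A R.emeasure_space_1 in auto)
   hence l1: "(%k. emeasure P (A \<times> {..real_of_rat (r k)})) ~~> emeasure Q (A \<times> {..<t})"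
    by (simp add: g_int[OF A] Q_em[OF A])
   have "(\<Union>k. A \<times> {..real_of_rat (r k)}) = A \<times> {..<t}"
    using r(3,4) by (fastforce intro: le_less_trans)
   moreover have "(%k. emeasure P (A \<times> {..real_of_rat (r k)})) ~~> emeasure P (\<Union>k. A \<times> {..real_of_rat (r k)})"
    using r(1) rect[OF A] by (intro Lim_emeasure_incseq) (auto simp: incseq_def of_rat_less_eq intro: order_trans)
   ultimately show ?thesis using l1 LIMSEQ_unique by metis
  qed
 qed
 have "P = Q"
 proof (rule pair_slice_eqI[OF P.finite_measure_axioms Q.finite_measure_axioms P setsQ])
  fix A assume A: "A : sets N"
  show "slice P A borel = slice Q A borel"
  proof (rule real_measure_eqI)
   show "finite_measure (slice P A borel)" "finite_measure (slice Q A borel)"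
    by (intro finite_measure_slice[OF _ _ A] P.finite_measure_axioms Q.finite_measure_axioms P setsQ)+
   show "emeasure (slice P A borel) {..<t} = emeasure (slice Q A borel) {..<t}" for t
    using main[OF A] by (simp add: emeasure_slice[OF P A] emeasure_slice[OF setsQ A])
  qed simp_all
 qed
 thus thesis
  using that[of Ph] Phm qt_bounds unfolding Q_def rh_def Ph_def by blast
qed

section \<open>Coding sequences by one real number, with continuous decoding\<close>

text \<open>A continuous 2-periodic substitute for reading a ternary digit, equal to 0 on [0, 1/3]
  and to 1 on [2/3, 1], as in Schoenberg's space-filling curve.\<close>

definition sw :: "real => real" where
 "sw t = max 0 (min 1 (1 / 2 - cos (pi * t)))"

text \<open>Coordinate \<open>k\<close> is rebuilt from the binary digits stored at the ternary
  places \<open>prod_encode (k, n)\<close>. The factor 2 undoes a halving in \<open>enc\<close>;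
  \<open>min 1\<close> keeps the values in [0,1] away from the range of \<open>enc\<close>.\<close>

definition dec :: "real => nat => real" where
 "dec t k = min 1 (2 * (\<Sum>n. sw (3 ^ prod_encode (k, n) * t) / 2 ^ Suc n))"

definition bdig :: "real => nat => nat" where
 "bdig x n = nat (\<lfloor>2 ^ Suc n * x\<rfloor> mod 2)"

text \<open>A point of the Cantor set whose ternary digits interleave the binary digits of all
  coordinates. Halving keeps each coordinate below 1, where its binary expansion by
  \<open>bdig\<close> is valid.\<close>

definition enc :: "(nat => real) => real" where
 "enc a = (\<Sum>j. 2 * real (bdig (a (fst (prod_decode j)) / 2) (snd (prod_decode j))) / 3 ^ Suc j)"

lemma bdig_le_1: "bdig x n <= 1"
 by (simp add: bdig_def)

lemma sums_thirds: "(%j. 2 / 3 ^ Suc j :: real) sums 1"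
 using sums_mult[OF geometric_sums[of "1/3::real"], of "2/3"]
 by (simp add: field_simps power_one_over)

lemma summable_ternary:
 fixes b :: "nat => nat"
 assumes "!!j. b j <= 1"
 shows "summable (%j. 2 * real (b j) / 3 ^ Suc j)"
 by (rule summable_comparison_test'[OF sums_summable[OF sums_thirds], where N=0])
  (use assms in \<open>auto simp: divide_right_mono\<close>)

lemma ternary_bounds:
 fixes b :: "nat => nat"
 assumes b: "!!j. b j <= 1"
 shows "0 <= (\<Sum>j. 2 * real (b j) / 3 ^ Suc j)" "(\<Sum>j. 2 * real (b j) / 3 ^ Suc j) <= 1"
proof -
 show "0 <= (\<Sum>j. 2 * real (b j) / 3 ^ Suc j)"
  by (intro suminf_nonneg summable_ternary b) simp
 have "(\<Sum>j. 2 * real (b j) / 3 ^ Suc j) <= (\<Sum>j. 2 / 3 ^ Suc j)"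
  by (rule suminf_le[OF _ summable_ternary[OF b] sums_summable[OF sums_thirds]])
   (use b in \<open>auto simp: divide_right_mono\<close>)
 thus "(\<Sum>j. 2 * real (b j) / 3 ^ Suc j) <= 1" using sums_thirds by (simp add: sums_iff)
qed

text \<open>Multiplication by \<open>3 ^ j\<close> leaves an even integer, two thirds of the digit,
  and a tail \<open>r\<close> in [0, 1/3]. The cosine forgets the even integer, and the tail cannot
  leave the plateau of \<open>sw\<close>.\<close>

lemma sw_ternary:
 fixes b :: "nat => nat"
 assumes b: "!!j. b j <= 1"
 shows "sw (3 ^ j * (\<Sum>i. 2 * real (b i) / 3 ^ Suc i)) = real (b j)"
proof -
 define f where "f i = 2 * real (b i) / 3 ^ Suc i" for i
 define r where "r = (\<Sum>i. 2 * real (b (i + Suc j)) / 3 ^ Suc i) / 3"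
 have r: "0 <= r" "r <= 1 / 3"
  using ternary_bounds[of "%i. b (i + Suc j)"] b by (auto simp: r_def)
 define m where "m = (\<Sum>i<j. b i * 3 ^ (j - Suc i))"
 have sf: "summable f" unfolding f_def by (rule summable_ternary[OF b])
 have "3 ^ j * suminf f = 3 ^ j * (\<Sum>i. f (i + Suc j)) + 3 ^ j * (\<Sum>i<Suc j. f i)"
  by (subst suminf_split_initial_segment[OF sf, of "Suc j"]) (simp add: algebra_simps)
 also have "3 ^ j * (\<Sum>i. f (i + Suc j)) = r"
 proof -
  have "3 ^ j * f (i + Suc j) = 2 * real (b (i + Suc j)) / 3 ^ Suc i / 3" for i
   by (simp add: f_def power_add)
  moreover have "3 ^ j * (\<Sum>i. f (i + Suc j)) = (\<Sum>i. 3 ^ j * f (i + Suc j))"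
   using sf by (intro suminf_mult[symmetric]) (subst summable_iff_shift)
  moreover have "(\<Sum>i. 2 * real (b (i + Suc j)) / 3 ^ Suc i / 3) = r"
   unfolding r_def by (intro suminf_divide summable_ternary b)
  ultimately show ?thesis by simp
 qed
 also have "3 ^ j * (\<Sum>i<Suc j. f i) = 2 * real m + 2 * real (b j) / 3"
 proof -
  have "3 ^ j * f i = 2 * (real (b i) * 3 ^ (j - Suc i))" if "i < j" for i
  proof -
   have "(3::real) ^ j = 3 ^ (j - Suc i) * 3 ^ Suc i"
    by (subst power_add[symmetric]) (use that in simp)
   thus ?thesis by (simp add: f_def)
  qed
  hence "3 ^ j * (\<Sum>i<j. f i) = 2 * real m"
   by (simp add: sum_distrib_left m_def)
  thus ?thesis by (simp add: algebra_simps) (simp add: f_def)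
 qed
 finally have t: "pi * (3 ^ j * suminf f) = pi * (2 * real (b j) / 3 + r) + 2 * real m * pi"
  by (simp add: algebra_simps)
 have "cos (pi * (3 ^ j * suminf f)) = cos (pi * (2 * real (b j) / 3 + r))"
  unfolding t cos_add[of _ "2 * real m * pi"] by (simp add: cos_2npi sin_2npi)
 moreover have "sw (3 ^ j * suminf f) = max 0 (min 1 (1 / 2 - cos (pi * (3 ^ j * suminf f))))"
  by (simp add: sw_def)
 moreover have "max 0 (min 1 (1 / 2 - cos (pi * (2 * real (b j) / 3 + r)))) = real (b j)"
 proof (cases "b j = 0")
  case True
  have "cos (pi / 3) <= cos (pi * r)"
   using r mult_left_mono[OF r(2), of pi] by (intro cos_monotone_0_pi_le) auto
  thus ?thesis using True by (simp add: cos_60)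
 next
  case False
  hence 1: "b j = 1" using b[of j] by simp
  have "cos (pi * (2 / 3 + r)) <= cos (2 * pi / 3)"
   using r mult_left_mono[OF r(2), of pi] by (intro cos_monotone_0_pi_le) (auto simp: field_simps)
  thus ?thesis using 1 cos_120 by (simp add: mult.commute)
 qed
 ultimately show ?thesis unfolding f_def by simp
qed

lemma bdig_sums:
 assumes x: "0 <= x" "x < 1"
 shows "(%n. real (bdig x n) / 2 ^ Suc n) sums x"
proof -
 have fl: "\<lfloor>2 ^ Suc n * x\<rfloor> = 2 * \<lfloor>2 ^ n * x\<rfloor> + int (bdig x n)" for n
 proof -
  have "\<lfloor>2 ^ n * x\<rfloor> = \<lfloor>2 ^ Suc n * x\<rfloor> div 2"
   using floor_divide_real_eq_div[of 2 "2 ^ Suc n * x"] by simp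
  thus ?thesis by (simp add: bdig_def)
 qed
 have part: "(\<Sum>n<N. real (bdig x n) / 2 ^ Suc n) = of_int \<lfloor>2 ^ N * x\<rfloor> / 2 ^ N" for N
 proof (induction N)
  case 0
  thus ?case using x by (simp add: floor_eq_iff)
 next
  case (Suc N)
  thus ?case unfolding sum.lessThan_Suc fl
   by (simp add: field_simps)
 qed
 have "(%N. x - of_int \<lfloor>2 ^ N * x\<rfloor> / 2 ^ N) ~~> 0"
 proof (rule tendsto_sandwich[where f="%_. 0" and h="%N. (1/2)^N"])
  show "\<forall>\<^sub>F N in sequentially. 0 <= x - of_int \<lfloor>2 ^ N * x\<rfloor> / 2 ^ N"
   by (rule always_eventually) (auto simp: field_simps)
  show "\<forall>\<^sub>F N in sequentially. x - of_int \<lfloor>2 ^ N * x\<rfloor> / 2 ^ N <= (1/2)^N"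
  proof (rule always_eventually, rule)
   fix N
   have "2 ^ N * x <= of_int \<lfloor>2 ^ N * x\<rfloor> + 1" by linarith
   thus "x - of_int \<lfloor>2 ^ N * x\<rfloor> / 2 ^ N <= (1/2)^N"
    using divide_right_mono[of "2 ^ N * x" "of_int \<lfloor>2 ^ N * x\<rfloor> + 1" "2 ^ N"]
    by (simp add: add_divide_distrib power_one_over)
  qed
  show "(%N. (1/2::real)^N) ~~> 0" by (rule LIMSEQ_realpow_zero) auto
 qed simp
 from tendsto_diff[OF tendsto_const[of x] this]
 show ?thesis unfolding sums_def part by simp
qed

text \<open>A continuous map with a Borel right inverse on the cube: laws of sequences become laws
  on the line, and weak limits on the line come back as weak limits of sequences.\<close>

lemma dec_enc:
 assumes "!!k. 0 <= a k & a k <= 1"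
 shows "dec (enc a) = a"
proof
 fix k
 have "sw (3 ^ prod_encode (k, n) * enc a) = real (bdig (a k / 2) n)" for n
  using sw_ternary[of "%j. bdig (a (fst (prod_decode j)) / 2) (snd (prod_decode j))" "prod_encode (k, n)", OF bdig_le_1]
  by (simp add: enc_def)
 moreover have "(\<Sum>n. real (bdig (a k / 2) n) / 2 ^ Suc n) = a k / 2"
  using assms[of k] by (intro sums_unique[symmetric] bdig_sums) auto
 ultimately show "dec (enc a) k = a k"
  using assms[of k] by (simp add: dec_def)
qed

lemma enc_bounds: "0 <= enc a" "enc a <= 1"
 unfolding enc_def by (intro ternary_bounds bdig_le_1)+

lemma sw_bounds: "0 <= sw t" "sw t <= 1"
 by (auto simp: sw_def)

lemma sw_term_bound: "norm (sw t / 2 ^ Suc n) <= (1/2)^n / 2"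
proof -
 have "norm (sw t / 2 ^ Suc n) <= 1 / 2 ^ Suc n"
  using sw_bounds[of t] divide_right_mono[of "sw t" 1 "2 ^ Suc n"] by simp
 also have "... = (1/2)^n / 2" by (simp add: power_one_over)
 finally show ?thesis .
qed

lemma summable_dec: "summable (%n. sw (g n) / 2 ^ Suc n)"
proof (rule summable_comparison_test'[where N=0 and g="%n. (1/2)^n / 2"])
 show "summable (%n. (1/2::real)^n / 2)" by (intro summable_divide summable_geometric) auto
 show "norm (sw (g n) / 2 ^ Suc n) <= (1/2)^n / 2" for n
  by (rule sw_term_bound)
qed

lemma dec_bounds: "0 <= dec t k" "dec t k <= 1"
proof -
 have "0 <= (\<Sum>n. sw (3 ^ prod_encode (k, n) * t) / 2 ^ Suc n)"
  by (intro suminf_nonneg summable_dec) (use sw_bounds in simp)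
 thus "0 <= dec t k" "dec t k <= 1" unfolding dec_def by auto
qed

lemma continuous_on_dec: "continuous_on UNIV dec"
proof (rule continuous_on_coordinatewise_then_product)
 fix k
 have "uniform_limit UNIV (%n t. \<Sum>i<n. sw (3 ^ prod_encode (k, i) * t) / 2 ^ Suc i)
   (%t. \<Sum>i. sw (3 ^ prod_encode (k, i) * t) / 2 ^ Suc i) sequentially"
 proof (rule Weierstrass_m_test[where M="%n. (1/2)^n / 2"])
  show "norm (sw (3 ^ prod_encode (k, n) * x) / 2 ^ Suc n) <= (1/2)^n / 2" for n x
   by (rule sw_term_bound)
  show "summable (%n. (1/2::real)^n / 2)" by (intro summable_divide summable_geometric) auto
 qed
 hence "continuous_on UNIV (%t. \<Sum>i. sw (3 ^ prod_encode (k, i) * t) / 2 ^ Suc i)"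
  by (rule uniform_limit_theorem[rotated])
   (auto simp: sw_def[abs_def] intro!: always_eventually continuous_intros)
 thus "continuous_on UNIV (%t. dec t k)"
  unfolding dec_def by (intro continuous_intros)
qed

lemma measurable_dec [measurable]: "dec : Bm borel"
 by (rule borel_measurable_continuous_onI[OF continuous_on_dec])

lemma measurable_enc [measurable]: "enc : Bm borel"
proof -
 have [measurable]: "(%x. real (bdig x n)) : Bm borel" for n
 proof -
  have "(%x::real. \<lfloor>2 ^ Suc n * x\<rfloor>) : borel ->M count_space UNIV" by measurable
  thus ?thesis unfolding bdig_def
   by (rule m_comp[where g="%i. real (nat (i mod 2))"]) simp
 qed
 show ?thesis unfolding enc_def by measurable
qed

text \<open>One uniform number suffices for a whole sequence, because the sequence is almost surely
  recovered by \<open>dec\<close> from a code in [0,1].\<close>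

theorem noise_outsourcing_seq:
 fixes P :: "('n \<times> (nat => real)) measure"
 assumes "prob_space P" and P: "sets P = sets (N >< borel)"
  and unit: "AE z in P. ALL k. 0 <= snd z k & snd z k <= 1"
 obtains Ph where "(%z. Ph (fst z) (snd z)) : Bm (N >< borel)"
  "!!et u k. 0 <= Ph et u k & Ph et u k <= 1"
  "P = distr (distr P N fst >< unif) (N >< borel) (%z. (fst z, Ph (fst z) (snd z)))"
proof -
 interpret P: prob_space P by fact
 note [measurable_cong] = P
 define Q where "Q = distr P (N >< borel) (%z. (fst z, enc (snd z)))"
 have pQ: "prob_space Q" unfolding Q_def by (rule P.prob_space_distr) measurable
 have uQ: "AE z in Q. snd z : {0..1}"
  unfolding Q_def using enc_bounds by (subst AE_distr_iff) auto
 have sQ: "sets Q = sets (N >< borel)" by (simp add: Q_def)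
 obtain Ph where [measurable]: "(%z. Ph (fst z) (snd z)) : Bm (N >< borel)"
  and Q: "Q = distr (distr Q N fst >< unif) (N >< borel) (%z. (fst z, Ph (fst z) (snd z)))"
  by (rule noise_outsourcing[OF pQ sQ uQ])
 note [measurable_cong] = sQ
 have QN: "distr Q N fst = distr P N fst"
  unfolding Q_def by (subst distr_distr) (auto simp: comp_def)
 have "P = distr P (N >< borel) (%z. z)"
  using P by (simp add: distr_id2)
 also have "... = distr P (N >< borel) (%z. (fst z, dec (enc (snd z))))"
  using unit by (intro distr_cong_AE) (auto simp: dec_enc)
 also have "... = distr Q (N >< borel) (%z. (fst z, dec (snd z)))"
  unfolding Q_def by (subst distr_distr) (auto simp: comp_def)
 also have "... = distr (distr P N fst >< unif) (N >< borel) (%z. (fst z, dec (Ph (fst z) (snd z))))"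
  by (subst Q, unfold QN, subst distr_distr) (auto simp: comp_def)
 finally have "P = distr (distr P N fst >< unif) (N >< borel) (%z. (fst z, dec (Ph (fst z) (snd z))))" .
 thus thesis
  by (intro that[of "%et u. dec (Ph et u)"]) (use dec_bounds in auto)
qed

section \<open>Enlarging the conditioning; correlations under exchangeability\<close>

text \<open>By equality in law, \<open>k (et' om)\<close> is the conditional expectation of
  \<open>\<xi>\<close> given the finer variable just as \<open>k (et om)\<close> is given the
  coarser one. The latter is the projection of the former and has the same second moment, so the two
  agree almost surely.\<close>

lemma (in prob_space) cond_exp_stable:
 fixes \<xi> :: "'a => real" and k :: "'n => real"
 assumes [measurable]: "\<xi> : Bm M" "et : M ->M N" "et' : M ->M N" "\<phi> : N ->M N"
   "k : Bm N"
  and \<xi>: "!!om. 0 <= \<xi> om & \<xi> om <= 1" and k: "!!x. 0 <= k x & k x <= 1"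
  and \<phi>: "!!om. om : space M ==> et om = \<phi> (et' om)"
  and law: "distr M (borel >< N) (%om. (\<xi> om, et om)) = distr M (borel >< N) (%om. (\<xi> om, et' om))"
  and ce: "!!G. G : Bm N ==> (!!x. 0 <= G x & G x <= (1::real)) ==>
   (LINT om|M. \<xi> om * G (et om)) = (LINT om|M. k (et om) * G (et om))"
 shows "AE om in M. k (et om) = k (et' om)"
  and "!!G. G : Bm N ==> (!!x. 0 <= G x & G x <= (1::real)) ==>
   (LINT om|M. \<xi> om * G (et' om)) = (LINT om|M. k (et om) * G (et' om))"
proof -
 have tr: "(LINT om|M. h (\<xi> om, et om)) = (LINT om|M. h (\<xi> om, et' om))"
  if [measurable]: "h : Bm (borel >< N)" for h :: "_ => real"
  using arg_cong[OF law, of "%P. integral\<^sup>L P h"] by (simp add: integral_distr)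
 have int: "integrable M (%om. a om * b om)"
  if [measurable]: "a : Bm M" "b : Bm M"
   and "!!om. 0 <= a om & a om <= 1" "!!om. 0 <= b om & b om <= 1" for a b :: "'a => real"
  by (rule integrable_bounded[where B=1]) (use that in \<open>auto simp: abs_mult intro!: mult_le_one\<close>)
 have ce': "(LINT om|M. \<xi> om * G (et' om)) = (LINT om|M. k (et' om) * G (et' om))"
  if [measurable]: "G : Bm N" and "!!x. 0 <= G x & G x <= (1::real)" for G
  using tr[of "%z. fst z * G (snd z)"] tr[of "%z. k (snd z) * G (snd z)"] ce[of G] that by simp
 have 1: "(LINT om|M. k (et om) * k (et' om)) = (LINT om|M. k (et om) * k (et om))"
 proof -
  have "(LINT om|M. k (et om) * k (et' om)) = (LINT om|M. k (et' om) * k (\<phi> (et' om)))"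
   by (intro b_cong) (auto simp: \<phi>)
  also have "... = (LINT om|M. \<xi> om * k (\<phi> (et' om)))"
   using ce'[of "%x. k (\<phi> x)"] k by simp
  also have "... = (LINT om|M. \<xi> om * k (et om))"
   by (intro b_cong) (auto simp: \<phi>)
  also have "... = (LINT om|M. k (et om) * k (et om))" using ce[of k] k by simp
  finally show ?thesis .
 qed
 have 2: "(LINT om|M. k (et' om) * k (et' om)) = (LINT om|M. k (et om) * k (et om))"
  using tr[of "%z. k (snd z) * k (snd z)"] by simp
 have "(LINT om|M. (k (et om) - k (et' om))\<^sup>2) =
   (LINT om|M. k (et om) * k (et om) + k (et' om) * k (et' om) - 2 * (k (et om) * k (et' om)))"
  by (intro b_cong) (auto simp: power2_eq_square algebra_simps)
 also have "... = 0"
  using k 1 2 by (simp add: int)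
 finally have "AE om in M. (k (et om) - k (et' om))\<^sup>2 = 0"
 proof (subst (asm) integral_nonneg_eq_0_iff_AE)
  have "\<bar>k (et om) - k (et' om)\<bar> <= 1" for om using k[of "et om"] k[of "et' om"] by auto
  thus "integrable M (%om. (k (et om) - k (et' om))\<^sup>2)"
   by (intro integrable_bounded[where B=1]) (auto simp: abs_square_le_1)
 qed auto
 thus AE: "AE om in M. k (et om) = k (et' om)" by simp
 fix G :: "'n => real" assume [measurable]: "G : Bm N" and G: "!!x. 0 <= G x & G x <= 1"
 show "(LINT om|M. \<xi> om * G (et' om)) = (LINT om|M. k (et om) * G (et' om))"
  unfolding ce'[OF \<open>G : _\<close> G] using AE by (intro integral_cong_AE) auto
qed

text \<open>Expand the second moment of the sum of \<open>N\<close> of the \<open>T j\<close> minus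
  \<open>N * a * h\<close>, which is nonnegative. Only the \<open>N\<close> diagonal terms differ
  from \<open>c\<close>, and they disappear after division by \<open>N * N\<close>. Equal
  correlation with infinitely many variables thus forces correlation among them.\<close>

lemma (in prob_space) exchangeable_Cauchy_Schwarz:
 fixes h :: "'a => real" and T :: "nat => 'a => real"
 assumes [measurable]: "h : Bm M" "!!j. T j : Bm M"
  and h: "!!om. om : space M ==> \<bar>h om\<bar> <= 1" and T: "!!j om. om : space M ==> \<bar>T j om\<bar> <= 1"
  and a: "!!j. (LINT om|M. h om * T j om) = a"
  and c: "!!j k. j ~= k ==> (LINT om|M. T j om * T k om) = c"
 shows "a\<^sup>2 <= c"
proof -
 have int: "integrable M (%om. f om * g om)"
  if [measurable]: "f : Bm M" "g : Bm M"
   and "!!om. om : space M ==> \<bar>f om\<bar> <= 1" "!!om. om : space M ==> \<bar>g om\<bar> <= 1" for f g :: "'a => real"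
  by (rule integrable_bounded[where B=1]) (use that in \<open>auto simp: abs_mult intro!: mult_le_one\<close>)
 have bound: "a\<^sup>2 <= c + (1 - c) / real N" if N: "N > 0" for N :: nat
 proof -
  have i1: "integrable M (%om. T i om * T j om)" for i j by (rule int) (use T in auto)
  have i2: "integrable M (%om. h om * T j om)" for j by (rule int) (use T h in auto)
  have d: "(LINT om|M. T i om * T i om) <= 1" for i
  proof -
   have "(LINT om|M. T i om * T i om) <= (LINT om|M. 1)"
    using i1[of i i] T[of _ i] by (intro integral_mono) (auto simp: abs_square_le_1 simp flip: power2_eq_square)
   thus ?thesis by (simp add: prob_space)
  qed
  have "0 <= (LINT om|M. ((\<Sum>j<N. T j om) - real N * a * h om)\<^sup>2)"
   by (rule Bochner_Integration.integral_nonneg) auto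
  also have "... = (LINT om|M. (\<Sum>i<N. \<Sum>j<N. T i om * T j om) - 2 * real N * a * (\<Sum>j<N. h om * T j om)
    + (real N * a)\<^sup>2 * (h om * h om))"
  proof (intro b_cong refl)
   fix om
   have "(S - real N * a * x)\<^sup>2 = S * S - 2 * real N * a * (x * S) + (real N * a)\<^sup>2 * (x * x)" for S x
    by (simp add: power2_eq_square algebra_simps)
   moreover have "(\<Sum>j<N. h om * T j om) = h om * (\<Sum>j<N. T j om)"
    by (simp add: sum_distrib_left)
   moreover have "(\<Sum>i<N. \<Sum>j<N. T i om * T j om) = (\<Sum>j<N. T j om) * (\<Sum>j<N. T j om)"
    by (simp only: sum_product)
   ultimately show "((\<Sum>j<N. T j om) - real N * a * h om)\<^sup>2 = (\<Sum>i<N. \<Sum>j<N. T i om * T j om)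
     - 2 * real N * a * (\<Sum>j<N. h om * T j om) + (real N * a)\<^sup>2 * (h om * h om)"
    by (simp only:)
  qed
  also have "... = (\<Sum>i<N. \<Sum>j<N. LINT om|M. T i om * T j om) - 2 * real N * a * (real N * a)
    + (real N * a)\<^sup>2 * (LINT om|M. h om * h om)"
   using i1 i2 int[of h h] h by (simp add: a)
  also have "... <= (\<Sum>i<N. \<Sum>j<N. if i = j then 1 else c) - 2 * real N * a * (real N * a) + (real N * a)\<^sup>2 * 1"
  proof -
   have "(LINT om|M. T i om * T j om) <= (if i = j then 1 else c)" for i j
    using c d by auto
   hence "(\<Sum>i<N. \<Sum>j<N. LINT om|M. T i om * T j om) <= (\<Sum>i<N. \<Sum>j<N. if i = j then 1 else c)"
    by (intro sum_mono)
   moreover have "(LINT om|M. h om * h om) <= (LINT om|M. 1)"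
    using int[of h h] h by (intro integral_mono) (auto simp: abs_square_le_1 simp flip: power2_eq_square)
   hence "(real N * a)\<^sup>2 * (LINT om|M. h om * h om) <= (real N * a)\<^sup>2 * 1"
    by (intro mult_left_mono) (auto simp: prob_space)
   ultimately show ?thesis by linarith
  qed
  also have "(\<Sum>i<N. \<Sum>j<N. if i = j then 1 else c) = real N * (real N * c + (1 - c))"
  proof -
   have "(\<Sum>j<N. if i = j then 1 else c) = real N * c + (1 - c)" if "i < N" for i
   proof -
    have "(\<Sum>j<N. if i = j then 1 else c) = (\<Sum>j<N. c + (if i = j then 1 - c else 0))"
     by (intro sum.cong) auto
    thus ?thesis using that by (simp add: sum.distrib)
   qed
   thus ?thesis by simp
  qed
  finally have "real N * (real N * a\<^sup>2) <= real N * (real N * c + (1 - c))"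
   by (simp add: power2_eq_square algebra_simps)
  hence "real N * a\<^sup>2 <= real N * c + (1 - c)" using N by simp
  thus ?thesis using N by (simp add: field_simps)
 qed
 have "(%N. c + (1 - c) / real N) ~~> c"
  using tendsto_add[OF tendsto_const[of c] lim_const_over_n[of "1 - c"]] by simp
 thus ?thesis
  by (rule LIMSEQ_le_const) (use bound in \<open>auto intro!: exI[of _ 1]\<close>)
qed

section \<open>Measures determined by continuous test functions\<close>

lemma closed_indicator_approx:
 fixes C :: "'a::metric_space set"
 assumes "closed C"
 shows "\<exists>F :: nat => 'a => real. (ALL n. continuous_on UNIV (F n)) & (ALL n x. 0 <= F n x & F n x <= 1) \<and>
  (ALL x. (%n. F n x) ~~> Ind C x)"
proof (cases "C = {}")
 case True
 thus ?thesis by (intro exI[of _ "%_ _. 0"]) auto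
next
 case False
 define F where "F n x = max 0 (1 - real n * infdist x C)" for n x
 show ?thesis
 proof (intro exI[of _ F] conjI allI)
  show "continuous_on UNIV (F n)" for n unfolding F_def by (intro continuous_intros)
  show "0 <= F n x" "F n x <= 1" for n x unfolding F_def by (auto simp: infdist_nonneg)
  fix x show "(%n. F n x) ~~> Ind C x"
  proof (cases "x : C")
   case True
   thus ?thesis by (simp add: F_def)
  next
   case nC: False
   hence d: "infdist x C > 0"
    using in_closed_iff_infdist_zero[OF assms False] infdist_nonneg[of x C] by (simp add: less_le)
   obtain N :: nat where "1 / infdist x C < real N" using reals_Archimedean2 by blast
   hence "1 < real N * infdist x C" using d by (simp add: field_simps)
   hence "F n x = 0" if "n \<ge> N" for n
   proof -
    have "real N * infdist x C <= real n * infdist x C" using that d by (intro mult_right_mono) auto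
    thus ?thesis using \<open>1 < _\<close> by (simp add: F_def)
   qed
   thus ?thesis using nC by (auto intro!: tendsto_eventually eventually_sequentiallyI)
  qed
 qed
qed

lemma measure_eqI_closed:
 fixes P Q :: "'a::topological_space measure"
 assumes "finite_measure P" and s: "sets P = sets borel" "sets Q = sets borel"
  and eq: "!!C. closed C ==> emeasure P C = emeasure Q C"
 shows "P = Q"
proof (rule measure_eqI_generator_eq[where E="Collect closed" and \<Omega>=UNIV and A="%i. UNIV"])
 show "Int_stable (Collect (closed :: 'a set => bool))" by (auto simp: Int_stable_def)
 show "sets P = sigma_sets UNIV (Collect closed)" "sets Q = sigma_sets UNIV (Collect closed)"
  unfolding s borel_eq_closed by simp_all
 show "emeasure P UNIV ~= \<infinity>" using finite_measure.emeasure_finite[OF assms(1)] by simp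
qed (use eq in auto)

lemma closed_integral_limit:
 fixes P :: "'a::metric_space measure"
 assumes "prob_space P" "sets P = sets borel" "closed C"
  and F: "!!n. continuous_on UNIV (F n)" "!!n x. 0 <= F n x & F n x <= (1::real)"
  "!!x. (%n. F n x) ~~> Ind C x"
 shows "(%n. LINT x|P. F n x) ~~> measure P C"
proof -
 interpret prob_space P by fact
 note [measurable_cong] = assms(2)
 have [measurable]: "F n : Bm borel" for n
  by (rule borel_measurable_continuous_onI[OF F(1)])
 have [measurable]: "C : sets borel" using assms(3) by simp
 have "(%n. LINT x|P. F n x) ~~> (LINT x|P. Ind C x)"
  by (rule integral_dominated_convergence[where w="%_. 1"]) (use F in auto)
 thus ?thesis using assms(2,3) by (simp add: sets_eq_imp_space_eq[OF assms(2)])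
qed

lemma measure_eqI_continuous:
 fixes P Q :: "'a::metric_space measure"
 assumes P: "prob_space P" "sets P = sets borel" and Q: "prob_space Q" "sets Q = sets borel"
  and eq: "!!F :: 'a => real. continuous_on UNIV F ==> (!!x. 0 <= F x & F x <= 1) ==> (LINT x|P. F x) = (LINT x|Q. F x)"
 shows "P = Q"
proof (rule measure_eqI_closed)
 interpret P: prob_space P by fact
 interpret Q: prob_space Q by fact
 show "finite_measure P" by (rule P.finite_measure_axioms)
 fix C :: "'a set" assume C: "closed C"
 obtain F :: "nat => 'a => real" where F: "!!n. continuous_on UNIV (F n)"
  "!!n x. 0 <= F n x & F n x <= 1" "!!x. (%n. F n x) ~~> Ind C x"
  using closed_indicator_approx[OF C] by metis
 have "(%n. LINT x|P. F n x) ~~> measure P C" "(%n. LINT x|Q. F n x) ~~> measure Q C"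
  by (rule closed_integral_limit[OF P C F] closed_integral_limit[OF Q C F])+
 moreover have "(%n. LINT x|P. F n x) = (%n. LINT x|Q. F n x)" using eq[OF F(1,2)] by blast
 ultimately show "emeasure P C = emeasure Q C"
  using LIMSEQ_unique by (metis P.emeasure_eq_measure Q.emeasure_eq_measure)
qed fact+

text \<open>Product test functions reach closed rectangles. The two factors are then extended to
  Borel sets one after the other, since the sigma-algebra is the product of the two Borel
  ones.\<close>

lemma pair_measure_eqI_continuous:
 fixes P1 :: "'a::metric_space measure" and P2 :: "'b::metric_space measure"
 assumes P1: "prob_space P1" "sets P1 = sets borel" and P2: "prob_space P2" "sets P2 = sets borel"
  and Q: "prob_space Q" "sets Q = sets (borel >< borel)"
  and eq: "!!(F :: 'a => real) (G :: 'b => real). continuous_on UNIV F ==> (!!x. 0 <= F x & F x <= 1) ==>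
   continuous_on UNIV G ==> (!!x. 0 <= G x & G x <= 1) ==>
   (LINT z|Q. F (fst z) * G (snd z)) = (LINT x|P1. F x) * (LINT x|P2. G x)"
 shows "Q = P1 >< P2"
proof -
 interpret P1: prob_space P1 by fact
 interpret P2: prob_space P2 by fact
 interpret Q: prob_space Q by fact
 interpret P12: pair_prob_space P1 P2 ..
 note [measurable_cong] = P1(2) P2(2) Q(2)
 have spQ: "space Q = UNIV" using Q(2) sets_eq_imp_space_eq by (fastforce simp: sp_pair)
 have cc: "measure Q (C \<times> D) = measure P1 C * measure P2 D" if "closed C" "closed D" for C D
 proof -
  obtain F :: "nat => 'a => real" where F: "!!n. continuous_on UNIV (F n)"
   "!!n x. 0 <= F n x & F n x <= 1" "!!x. (%n. F n x) ~~> Ind C x"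
   using closed_indicator_approx[OF \<open>closed C\<close>] by metis
  obtain G :: "nat => 'b => real" where G: "!!n. continuous_on UNIV (G n)"
   "!!n x. 0 <= G n x & G n x <= 1" "!!x. (%n. G n x) ~~> Ind D x"
   using closed_indicator_approx[OF \<open>closed D\<close>] by metis
  have [measurable]: "F n : Bm borel" "G n : Bm borel" for n
   using F(1) G(1) by (auto intro: borel_measurable_continuous_onI)
  have [measurable]: "C : sets borel" "D : sets borel" using that by auto
  have CD: "C \<times> D : sets (borel >< borel)" by auto
  have "(%n. (LINT x|P1. F n x) * (LINT x|P2. G n x)) ~~> measure P1 C * measure P2 D"
   by (intro tendsto_mult closed_integral_limit P1 P2 that F G)
  moreover have "(%n. LINT z|Q. F n (fst z) * G n (snd z)) ~~> (LINT z|Q. Ind (C \<times> D) z)"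
  proof (rule integral_dominated_convergence[where w="%_. 1"])
   show "AE z in Q. (%n. F n (fst z) * G n (snd z)) ~~> Ind (C \<times> D) z"
   proof (rule AE_I2)
    fix z show "(%n. F n (fst z) * G n (snd z)) ~~> Ind (C \<times> D) z"
     using tendsto_mult[OF F(3)[of "fst z"] G(3)[of "snd z"]]
     by (cases z) (auto simp: indicator_times)
   qed
   show "AE z in Q. norm (F n (fst z) * G n (snd z)) <= 1" for n
    using F(2) G(2) by (auto simp: abs_mult intro!: mult_le_one)
  qed (use CD in auto)
  moreover have "(LINT z|Q. Ind (C \<times> D) z) = measure Q (C \<times> D)"
   using CD Q(2) by (simp add: spQ)
  ultimately show ?thesis using eq[OF F(1,2) G(1,2)] LIMSEQ_unique by fastforce
 qed
 have sets_rect: "A \<times> B : sets Q" if "A : sets borel" "B : sets borel" for A B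
  unfolding Q(2) using that by auto
 have 1: "measure Q (C \<times> B) = measure P1 C * measure P2 B" if C: "closed C" and B: "B : sets borel" for C B
 proof -
  have C': "C : sets borel" "C : sets P1" using C P1(2) by auto
  have s12: "sets (P1 >< P2) = sets (borel >< borel)" by (intro sets_pair_measure_cong P1 P2)
  have "slice Q C borel = slice (P1 >< P2) C borel"
  proof (rule measure_eqI_closed)
   show "finite_measure (slice Q C borel)"
    by (rule finite_measure_slice[OF Q.finite_measure_axioms Q(2) C'(1)])
   fix D :: "'b set" assume D: "closed D"
   hence "D : sets P2" using P2(2) by auto
   thus "emeasure (slice Q C borel) D = emeasure (slice (P1 >< P2) C borel) D"
    using cc[OF C D] C' D
    by (simp add: emeasure_slice[OF Q(2)] emeasure_slice[OF s12] Q.emeasure_eq_measure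
      P2.emeasure_pair_measure_Times P1.emeasure_eq_measure P2.emeasure_eq_measure ennreal_mult)
  qed simp_all
  hence "emeasure Q (C \<times> B) = emeasure (P1 >< P2) (C \<times> B)"
   using emeasure_slice[OF Q(2) C'(1) B] emeasure_slice[OF s12 C'(1) B] by simp
  also have "... = ennreal (measure P1 C * measure P2 B)"
   using C' B P2(2) by (simp add: P2.emeasure_pair_measure_Times P1.emeasure_eq_measure P2.emeasure_eq_measure ennreal_mult)
  finally show ?thesis by (simp add: Q.emeasure_eq_measure)
 qed
 have 2: "measure Q (A \<times> B) = measure P1 A * measure P2 B" if A: "A : sets borel" and B: "B : sets borel" for A B
 proof -
  define Q' where "Q' = density Q (Ind (UNIV \<times> B))"
  have [measurable]: "UNIV \<times> B : sets (borel >< borel)" using B by auto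
  have em: "emeasure (distr Q' borel fst) A' = ennreal (measure Q (A' \<times> B))" if A': "A' : sets borel" for A'
  proof -
   have [measurable]: "A' : sets borel" by fact
   have "emeasure (distr Q' borel fst) A' = emeasure Q' (fst -` A' Int space Q)"
    unfolding Q'_def by (subst emeasure_distr) auto
   also have "... = (\<integral>\<^sup>+z. Ind (UNIV \<times> B) z * Ind (fst -` A' Int space Q) z \<partial>Q)"
    unfolding Q'_def by (subst emeasure_density) auto
   also have "... = (\<integral>\<^sup>+z. Ind (A' \<times> B) z \<partial>Q)"
    by (intro nn_integral_cong) (auto simp: spQ split: split_indicator)
   also have "... = emeasure Q (A' \<times> B)"
    by (rule nn_integral_indicator) (rule sets_rect[OF A' B])
   finally show ?thesis by (simp add: Q.emeasure_eq_measure)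
  qed
  have "distr Q' borel fst = scale_measure (ennreal (measure P2 B)) P1"
  proof (rule measure_eqI_closed)
   show "finite_measure (distr Q' borel fst)"
    by standard (use em[of UNIV] in simp)
   fix C :: "'a set" assume C: "closed C"
   thus "emeasure (distr Q' borel fst) C = emeasure (scale_measure (ennreal (measure P2 B)) P1) C"
    using em[of C] 1[OF C B] by (simp add: P1.emeasure_eq_measure ennreal_mult mult.commute)
  qed (simp_all add: P1(2))
  hence "ennreal (measure Q (A \<times> B)) = ennreal (measure P1 A * measure P2 B)"
   using em[OF A] by (simp add: P1.emeasure_eq_measure ennreal_mult mult.commute)
  thus ?thesis by simp
 qed
 show ?thesis
 proof (rule pair_measure_eqI[symmetric])
  show "sets (P1 >< P2) = sets Q" unfolding Q(2) by (intro sets_pair_measure_cong P1 P2)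
  fix A B assume "A : sets P1" "B : sets P2"
  thus "emeasure P1 A * emeasure P2 B = emeasure Q (A \<times> B)"
   using 2[of A B] P1(2) P2(2)
   by (simp add: Q.emeasure_eq_measure P1.emeasure_eq_measure P2.emeasure_eq_measure ennreal_mult)
 qed (unfold_locales)
qed

section \<open>Infinite product measures: reindexing and independence\<close>

lemma restrict_UNIV_eq: "restrict f UNIV = f"
 by (rule ext) (simp add: restrict_def)

lemma distr_PiM_reindex_UNIV:
 assumes "prob_space M" "inj f"
 shows "distr (\<Pi>\<^sub>M i\<in>UNIV. M) (\<Pi>\<^sub>M i\<in>UNIV. M) (%x i. x (f i)) = (\<Pi>\<^sub>M i\<in>UNIV. M)"
 using distr_PiM_reindex[of UNIV "%_. M" f UNIV] assms by (simp add: restrict_UNIV_eq)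

lemma indep_vars_PiM_UNIV:
 assumes "prob_space M"
 shows "prob_space.indep_vars (\<Pi>\<^sub>M i\<in>UNIV. M) (%_. M) (%i x. x i) (UNIV :: 'i set)"
proof -
 interpret P: prob_space "\<Pi>\<^sub>M i\<in>(UNIV::'i set). M" by (rule prob_space_PiM) (rule assms)
 have c: "distr (\<Pi>\<^sub>M i\<in>UNIV. M) M (%x. x i) = M" for i :: 'i
  using distr_PiM_component[of UNIV "%_. M" i] assms by simp
 show ?thesis
  by (subst P.indep_vars_iff_distr_eq_PiM') (auto simp: distr_id2 restrict_UNIV_eq intro!: PiM_cong c[symmetric])
qed

lemma distr_PiM_split:
 fixes f :: "'j => 'i" and g :: "'j => 'i"
 assumes M: "prob_space M" and inj: "inj f" "inj g" "range f Int range g = {}"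
 shows "distr (\<Pi>\<^sub>M i\<in>UNIV. M) ((\<Pi>\<^sub>M i\<in>UNIV. M) >< (\<Pi>\<^sub>M i\<in>UNIV. M)) (%x. (%i. x (f i), %i. x (g i)))
  = (\<Pi>\<^sub>M i\<in>UNIV. M) >< (\<Pi>\<^sub>M i\<in>UNIV. M)"
proof -
 interpret P: prob_space "\<Pi>\<^sub>M i\<in>(UNIV::'i set). M" by (rule prob_space_PiM) (rule M)
 have "P.indep_var (PiM (range f) (%_. M)) (%om. \<lambda>i\<in>range f. om i) (PiM (range g) (%_. M)) (%om. \<lambda>i\<in>range g. om i)"
  using P.indep_var_restrict[OF indep_vars_PiM_UNIV[OF M]] inj by auto
 hence "P.indep_var (\<Pi>\<^sub>M i\<in>UNIV. M) ((%y i. y (f i)) o (%om. \<lambda>i\<in>range f. om i))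
   (\<Pi>\<^sub>M i\<in>UNIV. M) ((%y i. y (g i)) o (%om. \<lambda>i\<in>range g. om i))"
  by (rule P.indep_var_compose) (auto intro!: measurable_PiM_single' simp: space_PiM PiE_iff)
 hence "P.indep_var (\<Pi>\<^sub>M i\<in>UNIV. M) (%x i. x (f i)) (\<Pi>\<^sub>M i\<in>UNIV. M) (%x i. x (g i))"
  by (simp add: comp_def)
 thus ?thesis
  unfolding P.indep_var_distribution_eq by (simp add: distr_PiM_reindex_UNIV[OF M] inj)
qed

lemma integral_PiM_prod:
 fixes g :: "'i => 'a => real"
 assumes M: "prob_space M" and J: "finite J" and g: "!!j. j : J ==> g j : Bm M"
  and b: "!!j x. j : J ==> x : space M ==> \<bar>g j x\<bar> <= B"
 shows "(LINT x|(\<Pi>\<^sub>M i\<in>UNIV. M). (\<Prod>j\<in>J. g j (x j))) = (\<Prod>j\<in>J. LINT x|M. g j x)"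
proof -
 interpret P: prob_space "\<Pi>\<^sub>M i\<in>(UNIV::'i set). M" by (rule prob_space_PiM) (rule M)
 have ind: "P.indep_vars (%_. borel) (%j x. g j (x j)) J"
  by (rule P.indep_vars_compose2[OF P.indep_vars_subset[OF indep_vars_PiM_UNIV[OF M]]]) (use g in auto)
 have "(LINT x|(\<Pi>\<^sub>M i\<in>UNIV. M). (\<Prod>j\<in>J. g j (x j))) = (\<Prod>j\<in>J. LINT x|(\<Pi>\<^sub>M i\<in>UNIV. M). g j (x j))"
 proof (rule P.indep_vars_lebesgue_integral[OF J ind])
  fix j assume j: "j : J"
  show "integrable (\<Pi>\<^sub>M i\<in>UNIV. M) (%x. g j (x j))"
   by (rule P.integrable_bounded[where B=B])
    (use g[OF j] b[OF j] in \<open>auto simp: space_PiM PiE_iff intro: m_comp[OF measurable_component_singleton]\<close>)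
 qed
 also have "... = (\<Prod>j\<in>J. LINT x|M. g j x)"
 proof (rule prod.cong[OF refl])
  fix j assume j: "j : J"
  have "(LINT x|distr (\<Pi>\<^sub>M i\<in>UNIV. M) M (%x. x j). g j x) = (LINT x|(\<Pi>\<^sub>M i\<in>UNIV. M). g j (x j))"
   by (rule integral_distr) (use g[OF j] in auto)
  thus "(LINT x|(\<Pi>\<^sub>M i\<in>UNIV. M). g j (x j)) = (LINT x|M. g j x)"
   using distr_PiM_component[of UNIV "%_. M" j] M by simp
 qed
 finally show ?thesis .
qed

section \<open>Arrays: exchangeability, dissociation, weak compactness\<close>

type_synonym arr = "nat => nat => real"

lemma measurable_entry:
 fixes f :: "'a => arr"
 assumes "f : Bm M"
 shows "(%x. f x i j) : Bm M"
 by (rule measurable_product_then_coordinatewise[OF measurable_product_then_coordinatewise[OF assms]])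

lemma measurable_arr_entry: "(%A :: arr. A i j) : Bm borel"
 by (rule measurable_entry[of "%A. A"]) simp

lemma sets_arr_unit: "{A :: arr. ALL i j. 0 <= A i j & A i j <= 1} : sets borel"
proof -
 have "{A :: arr. 0 <= A i j & A i j <= 1} : sets borel" for i j
  using measurable_sets[OF measurable_arr_entry[of i j], of "{0..1}"] by (simp add: vimage_def)
 hence "(\<Inter>i. \<Inter>j. {A :: arr. 0 <= A i j & A i j <= 1}) : sets borel"
  by (intro sets.countable_INT'') auto
 also have "(\<Inter>i. \<Inter>j. {A :: arr. 0 <= A i j & A i j <= 1}) = {A. ALL i j. 0 <= A i j & A i j <= 1}"
  by auto
 finally show ?thesis .
qed

lemma measurable_arrI:
 fixes f :: "'a => arr"
 assumes "!!i j. (%x. f x i j) : Bm M"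
 shows "f : Bm M"
 by (rule measurable_coordinatewise_then_product, rule measurable_coordinatewise_then_product, rule assms)

lemma continuous_on_entry [continuous_intros]:
 "continuous_on S f ==> continuous_on S (%x. (f x :: arr) i j)"
 by (rule continuous_on_product_then_coordinatewise[OF continuous_on_product_then_coordinatewise])

lemma continuous_on_arrI:
 "(!!i j. continuous_on S (%x. f x i j)) ==> continuous_on S (f :: 'a::topological_space => arr)"
 by (rule continuous_on_coordinatewise_then_product, rule continuous_on_coordinatewise_then_product)

definition sub :: "(nat => nat) => arr => arr" where
 "sub pq A i j = A (pq i) (pq j)"

lemma measurable_sub [measurable]: "sub pq : Bm borel"
 unfolding sub_def[abs_def] by (rule measurable_arrI) (rule measurable_arr_entry)

lemma continuous_on_sub: "continuous_on UNIV (sub pq)"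
 unfolding sub_def[abs_def] by (rule continuous_on_arrI, rule continuous_on_entry, rule continuous_on_id)

text \<open>Injections rather than permutations, so that passing to an infinite subarray is
  included.\<close>

definition exchangeable :: "arr measure => bool" where
 "exchangeable L \<longleftrightarrow> (\<forall>pq. inj pq --> distr L borel (sub pq) = L)"

definition evens :: "nat => nat" where "evens i = 2 * i"
definition odds :: "nat => nat" where "odds i = 2 * i + 1"

lemma inj_evens: "inj evens" and inj_odds: "inj odds" and evens_odds: "range evens Int range odds = {}"
 by (auto simp: inj_def evens_def odds_def) presburger

text \<open>Once \<open>L\<close> is exchangeable, the even and odd indices stand for any two
  disjoint infinite index sets.\<close>

definition dissociated :: "arr measure => bool" where
 "dissociated L \<longleftrightarrow> distr L (borel >< borel) (%A. (sub evens A, sub odds A)) = L >< L"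

text \<open>The codes of arrays lie in [0,1], so their laws are tight on the line. Decoding is
  continuous, hence a continuous test function on arrays pulls back to one on codes, and the limit
  is the decoded limit law.\<close>

theorem arr_weak_compactness:
 fixes L :: "nat => arr measure"
 assumes L: "!!n. prob_space (L n)" "!!n. sets (L n) = sets borel"
  and unit: "!!n. AE A in L n. ALL i j. 0 <= A i j & A i j <= 1"
 obtains r La where "strict_mono (r :: nat => nat)" "prob_space La" "sets La = sets borel"
  "AE A in La. ALL i j. 0 <= A i j & A i j <= 1"
  "!!F :: arr => real. !!B. continuous_on UNIV F ==> (!!A. \<bar>F A\<bar> <= B) ==> (%n. LINT A|L (r n). F A) ~~> (LINT A|La. F A)"
proof -
 define e :: "arr => real" where "e A = enc (%n. A (fst (prod_decode n)) (snd (prod_decode n)))" for A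
 define d :: "real => arr" where "d t i j = dec t (prod_encode (i, j))" for t i j
 have de: "d (e A) = A" if "ALL i j. 0 <= A i j & A i j <= 1" for A
  using that by (intro ext) (simp add: d_def e_def dec_enc)
 have [measurable]: "e : Bm borel" unfolding e_def[abs_def]
  by (rule m_comp[OF _ measurable_enc], rule measurable_coordinatewise_then_product, rule measurable_arr_entry)
 have dc: "continuous_on UNIV d" unfolding d_def[abs_def]
  by (rule continuous_on_arrI, rule continuous_on_product_then_coordinatewise, rule continuous_on_dec)
 have [measurable]: "d : Bm borel" by (rule borel_measurable_continuous_onI[OF dc])
 note [measurable_cong] = L(2)
 define \<mu> where "\<mu> n = distr (L n) borel e" for n
 have rd: "real_distribution (\<mu> n)" for n
 proof -
  interpret prob_space "L n" by (rule L)
  show ?thesis unfolding \<mu>_def by (rule real_distribution_distr) measurable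
 qed
 have "tight \<mu>"
  unfolding tight_def
 proof (intro conjI allI impI rd)
  fix ep :: real assume "0 < ep"
  \<comment> \<open>Tightness is phrased with left-open intervals; starting at -1 keeps the code 0
    inside.\<close>
  have "measure (\<mu> n) {-1<..1} = 1" for n
  proof -
   interpret prob_space "L n" by (rule L)
   have "-1 < e A" "e A <= 1" for A
    unfolding e_def using enc_bounds[of "%n. A (fst (prod_decode n)) (snd (prod_decode n))"] by auto
   hence "e -` {-1<..1} Int space (L n) = space (L n)" by auto
   thus ?thesis unfolding \<mu>_def by (subst measure_distr) (auto simp: prob_space)
  qed
  thus "EX a b. a < b & (ALL n. 1 - ep < measure (\<mu> n) {a<..b})"
   using \<open>0 < ep\<close> by (intro exI[of _ "-1"] exI[of _ 1]) auto
 qed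
 from tight_imp_convergent_subsubsequence[OF this strict_mono_id]
 obtain r N where r: "strict_mono (r :: nat => nat)" "real_distribution N" "weak_conv_m (\<mu> o id o r) N" by blast
 interpret N: real_distribution N by fact
 define La where "La = distr N borel d"
 have dN: "d : Bm N"
  unfolding m_cong_sets[OF N.events_eq_borel refl] by fact
 show thesis
 proof (rule that[of r La])
  show "prob_space La" unfolding La_def by (rule N.prob_space_distr[OF dN])
  show "AE A in La. ALL i j. 0 <= A i j & A i j <= 1"
   unfolding La_def using dec_bounds by (subst AE_distr_iff[OF dN]) (simp_all add: d_def sets_arr_unit)
  fix F :: "arr => real" and B assume F: "continuous_on UNIV F" "!!A. \<bar>F A\<bar> <= B"
  have [measurable]: "F : Bm borel" by (rule borel_measurable_continuous_onI[OF F(1)])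
  have "continuous_on UNIV (%t. F (d t))"
   using continuous_on_compose2[OF F(1) dc] by simp
  hence "(%n. LINT t|(\<mu> o id o r) n. F (d t)) ~~> (LINT t|N. F (d t))"
   by (intro weak_conv_imp_integral_bdd_continuous_conv[where B=B])
    (use r rd F in \<open>auto simp: continuous_on_eq_continuous_at comp_def\<close>)
  moreover have "(LINT t|(\<mu> o id o r) n. F (d t)) = (LINT A|L (r n). F A)" for n
  proof -
   have "(LINT t|(\<mu> o id o r) n. F (d t)) = (LINT A|L (r n). F (d (e A)))"
    by (simp add: \<mu>_def integral_distr)
   also have "... = (LINT A|L (r n). F A)"
   proof (rule integral_cong_AE)
    show "AE A in L (r n). F (d (e A)) = F A"
     using unit[of "r n"] by eventually_elim (simp add: de)
   qed measurable
   finally show ?thesis .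
  qed
  moreover have "(LINT t|N. F (d t)) = (LINT A|La. F A)" by (simp add: La_def integral_distr[OF dN])
  ultimately show "(%n. LINT A|L (r n). F A) ~~> (LINT A|La. F A)" by simp
 qed (use r La_def in auto)
qed

section \<open>Rearranging independent factors\<close>

lemma nn_integral_pair_prod:
 assumes "sigma_finite_measure N" and [measurable]: "f : Bm M" "g : Bm N"
 shows "(\<integral>\<^sup>+z. f (fst z) * g (snd z) \<partial>(M >< N)) = (\<integral>\<^sup>+x. f x \<partial>M) * (\<integral>\<^sup>+y. g y \<partial>N)"
proof -
 interpret N: sigma_finite_measure N by fact
 have "(\<integral>\<^sup>+z. f (fst z) * g (snd z) \<partial>(M >< N)) = (\<integral>\<^sup>+x. \<integral>\<^sup>+y. f x * g y \<partial>N \<partial>M)"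
  by (subst N.nn_integral_fst[symmetric]) auto
 also have "... = (\<integral>\<^sup>+x. f x * (\<integral>\<^sup>+y. g y \<partial>N) \<partial>M)"
  by (intro nn_integral_cong nn_integral_cmult) auto
 also have "... = (\<integral>\<^sup>+x. f x \<partial>M) * (\<integral>\<^sup>+y. g y \<partial>N)"
  by (rule nn_integral_multc) auto
 finally show ?thesis .
qed

lemma distr_pair_swap_middle:
 assumes "prob_space X1" "prob_space X2" "prob_space W1" "prob_space W2"
 shows "distr ((X1 >< X2) >< (W1 >< W2)) ((X1 >< W1) >< (X2 >< W2))
   (%z. ((fst (fst z), fst (snd z)), (snd (fst z), snd (snd z)))) = (X1 >< W1) >< (X2 >< W2)"
proof (rule pair_measure_eqI[symmetric])
 interpret X1: prob_space X1 by fact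
 interpret X2: prob_space X2 by fact
 interpret W1: prob_space W1 by fact
 interpret W2: prob_space W2 by fact
 interpret X: pair_prob_space X1 X2 ..
 interpret W: pair_prob_space W1 W2 ..
 interpret P1: pair_prob_space X1 W1 ..
 interpret P2: pair_prob_space X2 W2 ..
 show "sigma_finite_measure (X1 >< W1)" "sigma_finite_measure (X2 >< W2)" by unfold_locales
 fix A B assume [measurable]: "A : sets (X1 >< W1)" "B : sets (X2 >< W2)"
 let ?r = "%z. ((fst (fst z), fst (snd z)), (snd (fst z), snd (snd z)))"
 have "emeasure (distr ((X1 >< X2) >< (W1 >< W2)) ((X1 >< W1) >< (X2 >< W2)) ?r) (A \<times> B)
  = (\<integral>\<^sup>+z. Ind (A \<times> B) z \<partial>distr ((X1 >< X2) >< (W1 >< W2)) ((X1 >< W1) >< (X2 >< W2)) ?r)"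
  by (subst nn_integral_indicator) auto
 also have "... = (\<integral>\<^sup>+z. Ind A (fst (fst z), fst (snd z)) * Ind B (snd (fst z), snd (snd z))
   \<partial>((X1 >< X2) >< (W1 >< W2)))"
  by (subst nn_integral_distr) (auto simp: indicator_times)
 also have "... = (\<integral>\<^sup>+p. \<integral>\<^sup>+q. Ind A (fst p, fst q) * Ind B (snd p, snd q) \<partial>(W1 >< W2) \<partial>(X1 >< X2))"
  by (subst W.nn_integral_fst[symmetric]) auto
 also have "... = (\<integral>\<^sup>+p. (\<integral>\<^sup>+w. Ind A (fst p, w) \<partial>W1) * (\<integral>\<^sup>+w. Ind B (snd p, w) \<partial>W2) \<partial>(X1 >< X2))"
 proof (rule nn_integral_cong)
  fix p assume p: "p : space (X1 >< X2)"
  hence [simp]: "fst p : space X1" "snd p : space X2" by (auto simp: sp_pair)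
  have [measurable]: "(%w. Ind A (fst p, w) :: ennreal) : Bm W1"
   by (rule m_comp[OF measurable_Pair1'[of "fst p" X1 W1]]) auto
  have [measurable]: "(%w. Ind B (snd p, w) :: ennreal) : Bm W2"
   by (rule m_comp[OF measurable_Pair1'[of "snd p" X2 W2]]) auto
  show "(\<integral>\<^sup>+q. Ind A (fst p, fst q) * Ind B (snd p, snd q) \<partial>(W1 >< W2)) =
   (\<integral>\<^sup>+w. Ind A (fst p, w) \<partial>W1) * (\<integral>\<^sup>+w. Ind B (snd p, w) \<partial>W2)"
   by (rule nn_integral_pair_prod[OF W2.sigma_finite_measure_axioms]) auto
 qed
 also have "... = (\<integral>\<^sup>+x. \<integral>\<^sup>+w. Ind A (x, w) \<partial>W1 \<partial>X1) * (\<integral>\<^sup>+x. \<integral>\<^sup>+w. Ind B (x, w) \<partial>W2 \<partial>X2)"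
  by (rule nn_integral_pair_prod[OF X2.sigma_finite_measure_axioms]) auto
 also have "... = emeasure (X1 >< W1) A * emeasure (X2 >< W2) B"
  by (simp add: W1.nn_integral_fst W2.nn_integral_fst)
 finally show "emeasure (X1 >< W1) A * emeasure (X2 >< W2) B = emeasure (distr ((X1 >< X2) >< (W1 >< W2))
   ((X1 >< W1) >< (X2 >< W2)) ?r) (A \<times> B)" ..
qed simp

lemma distr_PiM_pair:
 assumes M: "prob_space M" and ij: "i ~= (j :: 'i)"
 shows "distr (\<Pi>\<^sub>M i\<in>UNIV. M) (M >< M) (%x. (x i, x j)) = M >< M"
proof -
 interpret P: prob_space "\<Pi>\<^sub>M i\<in>(UNIV::'i set). M" by (rule prob_space_PiM) (rule M)
 have "P.indep_var (PiM {i} (%_. M)) (%om. \<lambda>i\<in>{i}. om i) (PiM {j} (%_. M)) (%om. \<lambda>i\<in>{j}. om i)"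
  using P.indep_var_restrict[OF indep_vars_PiM_UNIV[OF M], of "{i}" "{j}"] ij by auto
 hence "P.indep_var M ((%y. y i) o (%om. \<lambda>i\<in>{i}. om i)) M ((%y. y j) o (%om. \<lambda>i\<in>{j}. om i))"
  by (rule P.indep_var_compose) auto
 hence "P.indep_var M (%x. x i) M (%x. x j)"
  by (simp add: comp_def)
 thus ?thesis
  unfolding P.indep_var_distribution_eq
  using distr_PiM_component[of UNIV "%_. M" i] distr_PiM_component[of UNIV "%_. M" j] M by simp
qed

section \<open>Random arrays sampled from a model\<close>

definition seqs :: "'a measure => (nat => 'a) measure" where
 "seqs M = (\<Pi>\<^sub>M i\<in>UNIV. M)"

text \<open>Indexed by all ordered pairs although an array reads only those with
  \<open>i < j\<close>: on the full index set every change of indices is a map of one product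
  space.\<close>

definition noise :: "(nat \<times> nat => real) measure" where
 "noise = (\<Pi>\<^sub>M e\<in>UNIV. unif)"

definition samp :: "'a measure => ((nat => 'a) \<times> (nat \<times> nat => real)) measure" where
 "samp M = seqs M >< noise"

lemma measurable_seqs_component: "(%x. x i) : seqs M ->M M"
 unfolding seqs_def by measurable

lemma measurable_unif_eq: "N ->M unif = Bm N"
 by (rule m_cong_sets[OF refl sets_unif])

lemma measurable_noise_component: "(%u. u e) : Bm noise"
proof -
 have "(%u. u e) : noise ->M unif" unfolding noise_def by measurable
 thus ?thesis unfolding measurable_unif_eq .
qed

lemma measurable_seqsI:
 assumes "!!i. (%x. f x i) : N ->M M"
 shows "f : N ->M seqs M"
 unfolding seqs_def
proof (rule measurable_PiM_single')
 show "f : space N \<rightarrow> (\<Pi>\<^sub>E i\<in>UNIV. space M)"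
  using measurable_space[OF assms] by (simp add: PiE_iff Pi_iff)
qed (rule assms)

lemma measurable_noiseI:
 assumes "!!i. (%x. f x i) : Bm N"
 shows "f : N ->M noise"
 unfolding noise_def
proof (rule measurable_PiM_single')
 show "(%x. f x i) : N ->M unif" for i
  unfolding measurable_unif_eq by (rule assms)
qed simp

lemma space_seqs: "space (seqs M) = {x. ALL i. x i : space M}"
 by (auto simp: seqs_def space_PiM PiE_iff)

lemma prob_space_noise [simp]: "prob_space noise"
 unfolding noise_def by (rule prob_space_PiM) simp

lemma prob_space_seqs: "prob_space M ==> prob_space (seqs M)"
 unfolding seqs_def by (rule prob_space_PiM)

lemma prob_space_pair: "prob_space M ==> prob_space N ==> prob_space (M >< N)"
proof -
 assume "prob_space M" "prob_space N"
 then interpret M: prob_space M + N: prob_space N .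
 show ?thesis
  by (rule prob_spaceI) (simp add: sp_pair N.emeasure_pair_measure_Times M.emeasure_space_1 N.emeasure_space_1)
qed

lemma prob_space_samp: "prob_space M ==> prob_space (samp M)"
 unfolding samp_def by (intro prob_space_pair prob_space_seqs) auto

lemma measurable_samp_x: "(%z. fst z i) : samp M ->M M"
 unfolding samp_def by (rule m_comp[OF m_fst measurable_seqs_component])

lemma measurable_samp_u: "(%z. snd z e) : Bm (samp M)"
 unfolding samp_def by (rule m_comp[OF m_snd measurable_noise_component])

definition smat :: "('a => 'a => real => real) => ('a => real) => (nat => 'a) \<times> (nat \<times> nat => real) => arr" where
 "smat Ps c z i j = (if i < j then Ps (fst z i) (fst z j) (snd z (i, j))
  else if j < i then Ps (fst z j) (fst z i) (snd z (j, i)) else c (fst z i))"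

text \<open>Covers both kinds of spaces: \<open>Ps x y u\<close> is \<open>d x y\<close> for an
  mm-space and a quantile of \<open>q x y\<close> at level \<open>u\<close> for a qmm-space.
  \<open>Ps_refl\<close> later makes labels on an atom nonrandom.\<close>

locale sample_model = prob_space M for M :: "'a measure" +
 fixes Ps :: "'a => 'a => real => real"
 assumes Ps_meas: "(%z. Ps (fst (fst z)) (snd (fst z)) (snd z)) : Bm ((M >< M) >< borel)"
  and Ps_sym: "!!x y u. x : space M ==> y : space M ==> Ps x y u = Ps y x u"
  and Ps_bounds: "!!x y u. x : space M ==> y : space M ==> 0 <= Ps x y u & Ps x y u <= 1"
  and Ps_refl: "!!x u. x : space M ==> Ps x x u = 0"
begin

lemma measurable_Ps:
 assumes "f : N ->M M" "g : N ->M M" "h : Bm N"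
 shows "(%x. Ps (f x) (g x) (h x)) : Bm N"
proof -
 have "(%x. ((f x, g x), h x)) : N ->M (M >< M) >< borel"
  by (intro m_Pair assms)
 from m_comp[OF this Ps_meas] show ?thesis by (simp only: fst_conv snd_conv)
qed

lemma measurable_smat:
 assumes "c : Bm M"
 shows "smat Ps c : Bm (samp M)"
proof (rule measurable_arrI)
 fix i j
 have m1: "(%z. Ps (fst z i) (fst z j) (snd z (k, l))) : Bm (samp M)" for i j k l
  by (intro measurable_Ps measurable_samp_x measurable_samp_u)
 have m2: "(%z. c (fst z i)) : Bm (samp M)"
  by (rule m_comp[OF measurable_samp_x assms])
 have eq: "(%z. smat Ps c z i j) = (if i < j then (%z. Ps (fst z i) (fst z j) (snd z (i, j)))
   else if j < i then (%z. Ps (fst z j) (fst z i) (snd z (j, i))) else (%z. c (fst z i)))"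
  by (simp add: smat_def fun_eq_iff)
 show "(%z. smat Ps c z i j) : Bm (samp M)"
  unfolding eq using m1 m2 by presburger
qed

definition law :: "('a => real) => arr measure" where
 "law c = distr (samp M) borel (smat Ps c)"

lemma sets_law [simp]: "sets (law c) = sets borel" by (simp add: law_def)

lemma space_law [simp]: "space (law c) = UNIV" by (simp add: law_def)

lemma prob_space_law: "c : Bm M ==> prob_space (law c)"
 unfolding law_def by (intro prob_space.prob_space_distr prob_space_samp measurable_smat prob_space_axioms)

text \<open>The change of noise indices that follows a change \<open>pq\<close> of point indices. A
  pair above the diagonal goes to the sorted image pair, the one \<open>smat\<close> reads; the
  values on the other pairs keep the map injective, so that reindexing preserves the law of the
  noise.\<close>

definition edge :: "(nat => nat) => nat \<times> nat => nat \<times> nat" where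
 "edge pq e = (if fst e < snd e then (min (pq (fst e)) (pq (snd e)), max (pq (fst e)) (pq (snd e)))
  else if snd e < fst e then (max (pq (fst e)) (pq (snd e)), min (pq (fst e)) (pq (snd e)))
  else (pq (fst e), pq (fst e)))"

lemma inj_edge:
 assumes "inj pq" shows "inj (edge pq)"
proof (rule injI)
 fix e f :: "nat \<times> nat" assume eq: "edge pq e = edge pq f"
 obtain a b where [simp]: "e = (a, b)" by (cases e)
 obtain c d where [simp]: "f = (c, d)" by (cases f)
 have inj: "pq x = pq y \<longleftrightarrow> x = y" for x y using assms by (auto simp: inj_def)
 have "{pq a, pq b} = {pq c, pq d}"
  using eq by (auto simp: edge_def min_def max_def split: if_splits)
 hence "pq ` {a, b} = pq ` {c, d}" by simp
 hence s: "{a, b} = {c, d}" by (simp only: inj_image_eq_iff[OF assms])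
 have "a < b \<longleftrightarrow> c < d"
  using eq by (auto simp: edge_def min_def max_def inj split: if_splits)
 thus "e = f" using s by (auto simp: doubleton_eq_iff)
qed

definition shift :: "(nat => nat) => (nat => 'a) \<times> (nat \<times> nat => real) => (nat => 'a) \<times> (nat \<times> nat => real)" where
 "shift pq z = (%i. fst z (pq i), %e. snd z (edge pq e))"

lemma measurable_shift [measurable]: "shift pq : samp M ->M samp M"
proof -
 have "shift pq : samp M ->M seqs M >< noise"
  unfolding shift_def[abs_def]
  by (intro m_Pair measurable_seqsI measurable_noiseI measurable_samp_x measurable_samp_u)
 thus ?thesis by (simp only: samp_def)
qed

text \<open>Sorting in \<open>edge\<close> may exchange the two points of an entry, which
  \<open>Ps_sym\<close> absorbs.\<close>

lemma sub_smat:
 assumes z: "z : space (samp M)" and "inj pq"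
 shows "sub pq (smat Ps c z) = smat Ps c (shift pq z)"
proof (intro ext)
 fix i j
 have [simp]: "fst z k : space M" for k
  using z by (auto simp: samp_def sp_pair space_seqs)
 have inj: "pq x = pq y \<longleftrightarrow> x = y" for x y using assms by (auto simp: inj_def)
 show "sub pq (smat Ps c z) i j = smat Ps c (shift pq z) i j"
  using inj[of i j] Ps_sym
  by (auto simp: sub_def smat_def shift_def edge_def min_def max_def)
qed

lemma distr_shift:
 assumes "inj pq"
 shows "distr (samp M) (samp M) (shift pq) = samp M"
proof -
 have mx: "(%x i. x (pq i)) : seqs M ->M seqs M"
  by (intro measurable_seqsI measurable_seqs_component)
 have mu: "(%u e. u (edge pq e)) : noise ->M noise"
  by (intro measurable_noiseI measurable_noise_component)
 have "distr (seqs M) (seqs M) (%x i. x (pq i)) >< distr noise noise (%u e. u (edge pq e))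
  = distr (samp M) (samp M) (%(x, u). (%i. x (pq i), %e. u (edge pq e)))"
  unfolding samp_def
  by (rule pair_measure_distr[OF mx mu])
   (rule prob_space_imp_sigma_finite[OF prob_space.prob_space_distr[OF prob_space_noise mu]])
 moreover have "distr (seqs M) (seqs M) (%x i. x (pq i)) = seqs M"
  unfolding seqs_def by (rule distr_PiM_reindex_UNIV[OF prob_space_axioms assms])
 moreover have "distr noise noise (%u e. u (edge pq e)) = noise"
  unfolding noise_def by (rule distr_PiM_reindex_UNIV[OF prob_space_unif inj_edge[OF assms]])
 moreover have "(%(x, u). (%i. x (pq i), %e. u (edge pq e))) = shift pq"
  by (auto simp: shift_def fun_eq_iff)
 ultimately show ?thesis by (simp only: samp_def)
qed

lemma exchangeable_law:
 assumes "c : Bm M"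
 shows "exchangeable (law c)"
 unfolding exchangeable_def
proof (intro allI impI)
 fix pq :: "nat => nat" assume pq: "inj pq"
 note m = measurable_smat[OF assms]
 have "distr (law c) borel (sub pq) = distr (samp M) borel (sub pq o smat Ps c)"
  unfolding law_def by (rule distr_distr[OF measurable_sub m])
 also have "... = distr (samp M) borel (smat Ps c o shift pq)"
  by (rule distr_cong[OF refl refl]) (simp add: sub_smat pq)
 also have "... = distr (distr (samp M) (samp M) (shift pq)) borel (smat Ps c)"
  by (rule distr_distr[OF m measurable_shift, symmetric])
 finally show "distr (law c) borel (sub pq) = law c"
  unfolding distr_shift[OF pq] law_def .
qed

lemma distr_shift_evens_odds:
 "distr (samp M) (samp M >< samp M) (%z. (shift evens z, shift odds z)) = samp M >< samp M"
proof -
 interpret X: prob_space "seqs M" by (rule prob_space_seqs[OF prob_space_axioms])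
 have ev: "edge evens e ~= edge odds f" for e f
  by (auto simp: edge_def evens_def odds_def min_def max_def split: if_splits) presburger+
 define sx where "sx x = (%i. x (evens i), %i. x (odds i))" for x :: "nat => 'a"
 define su where "su u = (%e. u (edge evens e), %e. u (edge odds e))" for u :: "nat \<times> nat => real"
 define r where "r z = ((fst (fst z), fst (snd z)), (snd (fst z), snd (snd z)))"
  for z :: "((nat => 'a) \<times> (nat => 'a)) \<times> (nat \<times> nat => real) \<times> (nat \<times> nat => real)"
 have msx: "sx : seqs M ->M seqs M >< seqs M"
  unfolding sx_def[abs_def] by (intro m_Pair measurable_seqsI measurable_seqs_component)
 have msu: "su : noise ->M noise >< noise"
  unfolding su_def[abs_def] by (intro m_Pair measurable_noiseI measurable_noise_component)
 have mr: "r : (seqs M >< seqs M) >< (noise >< noise) ->M (seqs M >< noise) >< (seqs M >< noise)"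
  unfolding r_def[abs_def] by measurable
 have dx: "distr (seqs M) (seqs M >< seqs M) sx = seqs M >< seqs M"
  unfolding seqs_def sx_def[abs_def] by (rule distr_PiM_split[OF prob_space_axioms inj_evens inj_odds evens_odds])
 have du: "distr noise (noise >< noise) su = noise >< noise"
  unfolding noise_def su_def[abs_def]
  by (rule distr_PiM_split[OF prob_space_unif inj_edge[OF inj_evens] inj_edge[OF inj_odds]]) (use ev in blast)
 have sf: "sigma_finite_measure (distr noise (noise >< noise) su)"
  unfolding du by (intro prob_space_imp_sigma_finite prob_space_pair prob_space_noise)
 have mp: "(%(x, u). (sx x, su u)) : samp M ->M (seqs M >< seqs M) >< (noise >< noise)"
  unfolding samp_def case_prod_unfold
  by (intro m_Pair m_comp[OF m_fst msx] m_comp[OF m_snd msu])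
 have "samp M >< samp M = distr ((seqs M >< seqs M) >< (noise >< noise)) ((seqs M >< noise) >< (seqs M >< noise)) r"
  unfolding samp_def r_def[abs_def]
  by (rule distr_pair_swap_middle[symmetric]) (intro X.prob_space_axioms prob_space_noise)+
 also have "(seqs M >< seqs M) >< (noise >< noise) =
  distr (samp M) ((seqs M >< seqs M) >< (noise >< noise)) (%(x, u). (sx x, su u))"
  using pair_measure_distr[OF msx msu sf] unfolding dx du by (simp only: samp_def)
 also have "distr ... ((seqs M >< noise) >< (seqs M >< noise)) r =
   distr (samp M) ((seqs M >< noise) >< (seqs M >< noise)) (r o (%(x, u). (sx x, su u)))"
  by (rule distr_distr[OF mr mp])
 also have "r o (%(x, u). (sx x, su u)) = (%z. (shift evens z, shift odds z))"
  by (auto simp: r_def sx_def su_def shift_def fun_eq_iff)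
 finally show ?thesis by (simp only: samp_def)
qed

lemma dissociated_law:
 assumes "c : Bm M"
 shows "dissociated (law c)"
proof -
 note m = measurable_smat[OF assms]
 interpret S: prob_space "samp M" by (rule prob_space_samp[OF prob_space_axioms])
 have mp: "(%z. (shift evens z, shift odds z)) : samp M ->M samp M >< samp M"
  by (intro m_Pair measurable_shift)
 have mq: "(%(z, z'). (smat Ps c z, smat Ps c z')) : samp M >< samp M ->M borel >< borel"
  unfolding case_prod_unfold
  by (intro m_Pair m_comp[OF m_fst m] m_comp[OF m_snd m])
 have ms: "(%A. (sub evens A, sub odds A)) : borel ->M borel >< borel"
  by (intro m_Pair measurable_sub)
 have "distr (law c) (borel >< borel) (%A. (sub evens A, sub odds A))
  = distr (samp M) (borel >< borel) ((%A. (sub evens A, sub odds A)) o smat Ps c)"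
  unfolding law_def by (rule distr_distr[OF ms m])
 also have "... = distr (samp M) (borel >< borel)
   ((%(z, z'). (smat Ps c z, smat Ps c z')) o (%z. (shift evens z, shift odds z)))"
  by (rule distr_cong[OF refl refl]) (simp add: sub_smat inj_evens inj_odds)
 also have "... = distr (samp M >< samp M) (borel >< borel) (%(z, z'). (smat Ps c z, smat Ps c z'))"
  using distr_distr[OF mq mp] unfolding distr_shift_evens_odds by (rule sym)
 also have "... = law c >< law c"
  unfolding law_def
  by (rule pair_measure_distr[OF m m, symmetric]) (rule prob_space_imp_sigma_finite[OF S.prob_space_distr[OF m]])
 finally show ?thesis unfolding dissociated_def .
qed

lemma distr_samp_pair:
 assumes "i < j"
 shows "distr (samp M) ((M >< M) >< unif) (%z. ((fst z i, fst z j), snd z (i, j))) = (M >< M) >< unif"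
proof -
 have u: "distr noise unif (%u. u (i, j)) = unif"
  unfolding noise_def by (rule distr_PiM_component) auto
 have m: "(%u. u (i, j)) : noise ->M unif" unfolding measurable_unif_eq by (rule measurable_noise_component)
 have mx: "(%x. (x i, x j)) : seqs M ->M M >< M"
  by (intro m_Pair measurable_seqs_component)
 have "distr (seqs M) (M >< M) (%x. (x i, x j)) >< distr noise unif (%u. u (i, j)) =
  distr (samp M) ((M >< M) >< unif) (%(x, u). ((x i, x j), u (i, j)))"
  unfolding samp_def
  by (rule pair_measure_distr[OF mx m]) (simp add: u prob_space_imp_sigma_finite)
 moreover have "distr (seqs M) (M >< M) (%x. (x i, x j)) = M >< M"
  unfolding seqs_def by (rule distr_PiM_pair[OF prob_space_axioms]) (use assms in simp)
 ultimately show ?thesis by (simp add: u case_prod_unfold)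
qed

end

section \<open>Labels on the diagonal and their coupling with a model\<close>

definition offd :: "arr => arr" where
 "offd A i j = (if i = j then 0 else A i j)"

definition diag :: "arr => nat => real" where
 "diag A i = A i i"

definition fill :: "arr => (nat => real) => arr" where
 "fill D l i j = (if i = j then l i else D i j)"

lemma fill_offd_diag: "fill (offd A) (diag A) = A"
 by (auto simp: fill_def offd_def diag_def fun_eq_iff)

lemma offd_fill: "(!!i. D i i = 0) ==> offd (fill D l) = D"
 by (auto simp: fill_def offd_def fun_eq_iff)

lemma sub_fill: "inj pq ==> sub pq (fill D l) = fill (sub pq D) (%i. l (pq i))"
 by (auto simp: fill_def sub_def fun_eq_iff inj_def)

lemma measurable_offd: "offd : Bm borel"
proof (rule measurable_arrI)
 fix i j show "(%A. offd A i j) : Bm borel"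
  by (cases "i = j") (simp_all add: offd_def measurable_arr_entry)
qed

lemma continuous_on_offd: "continuous_on UNIV offd"
proof (rule continuous_on_arrI)
 fix i j show "continuous_on UNIV (%A. offd A i j)"
  by (cases "i = j") (auto simp: offd_def intro: continuous_on_entry)
qed

lemma measurable_diag: "diag : Bm borel"
 unfolding diag_def[abs_def] by (rule measurable_coordinatewise_then_product) (rule measurable_arr_entry)

lemma measurable_fill: "(%z. fill (fst z) (snd z)) : borel >< borel ->M borel"
proof (rule measurable_arrI)
 fix i j
 have "(%z :: arr \<times> (nat => real). snd z i) : Bm (borel >< borel)"
  by (rule m_comp[OF m_snd measurable_product_coordinates])
 moreover have "(%z :: arr \<times> (nat => real). fst z i j) : Bm (borel >< borel)"
  by (rule m_comp[OF m_fst measurable_arr_entry])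
 ultimately show "(%z. fill (fst z) (snd z) i j) : Bm (borel >< borel)"
  by (cases "i = j") (simp_all only: fill_def if_True if_False simp_thms)
qed

lemma measurable_reindex: "(%(l :: nat => real) (i :: nat). l (pq i)) : Bm borel"
 by (rule measurable_coordinatewise_then_product) (rule measurable_product_coordinates)

lemma measurable_snd_unif: "snd : Bm (N >< unif)"
 by (rule m_comp[OF m_snd measurable_ident_sets[OF sets_unif]])

lemma sub_offd: "inj pq ==> offd (sub pq A) = sub pq (offd A)"
 by (auto simp: offd_def sub_def fun_eq_iff inj_def)

lemma sub_sub: "sub \<sigma> (sub pq A) = sub (%i. pq (\<sigma> i)) A"
 by (simp add: sub_def fun_eq_iff)

lemma sub_id: "sub (%i. i) A = A"
 by (simp add: sub_def fun_eq_iff)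

lemma diag_sub: "diag (sub pq A) = (%i. diag A (pq i))"
 by (simp add: sub_def diag_def fun_eq_iff)

lemma sets_all_unit:
 fixes f :: "nat => 'a => real"
 assumes [measurable]: "!!k. f k : Bm N"
 shows "{z : space N. ALL k. 0 <= f k z & f k z <= 1} : sets N"
 by measurable

text \<open>\<open>J_offd\<close> fixes the joint law of points and distances. How the diagonal
  depends on both is restricted by exchangeability alone.\<close>

locale coupling = sample_model M Ps for M :: "'a measure" and Ps +
 fixes J :: "((nat => 'a) \<times> arr) measure"
 assumes J_prob: "prob_space J"
  and J_sets: "sets J = sets (seqs M >< borel)"
  and J_exch: "!!pq. bij pq ==> distr J (seqs M >< borel) (%z. (%i. fst z (pq i), sub pq (snd z))) = J"
  and J_offd: "distr J (seqs M >< borel) (%z. (fst z, offd (snd z)))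
   = distr (samp M) (seqs M >< borel) (%z. (fst z, smat Ps (%_. 0) z))"

text \<open>The model and \<open>La\<close> are glued along their common distance array: given the
  array, labels are drawn from their conditional law under \<open>La\<close> with fresh noise,
  independently of the points. The sampling function \<open>Ph\<close> has no symmetry of its own,
  so exchangeability is proved for the conditional kernel it induces.\<close>

theorem (in sample_model) coupling_exists:
 assumes La: "prob_space La" "sets La = sets borel" "exchangeable La"
  and unit: "AE A in La. ALL i. 0 <= A i i & A i i <= 1"
  and marg: "distr La borel offd = law (%_. 0)"
 obtains J where "coupling M Ps J" "distr J borel snd = La"
proof -
 interpret La: prob_space La by fact
 interpret unif: prob_space unif by simp
 interpret S: prob_space "samp M" by (rule prob_space_samp[OF prob_space_axioms])
 have mLa: "f : Bm La" if "f : Bm borel" for f :: "arr => 'z::topological_space"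
  using that m_cong_sets[OF La(2) refl] by blast
 define D where "D = smat Ps (%_. 0)"
 have mD: "D : Bm (samp M)" unfolding D_def by (rule measurable_smat) simp
 define dl where "dl A = (offd A, diag A)" for A
 have mdl: "dl : borel ->M borel >< borel"
  unfolding dl_def[abs_def] by (intro m_Pair measurable_offd measurable_diag)
 have mdl': "dl : La ->M borel >< borel"
  using mdl m_cong_sets[OF La(2) refl] by blast
 define P where "P = distr La (borel >< borel) dl"
 have P: "prob_space P" "sets P = sets (borel >< borel)"
  unfolding P_def by (rule La.prob_space_distr[OF mdl']) simp
 have Pfst: "distr P borel fst = law (%_. 0)"
  unfolding P_def marg[symmetric] by (subst distr_distr[OF m_fst mdl']) (simp add: comp_def dl_def)
 have "AE z in P. ALL k. 0 <= snd z k & snd z k <= 1"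
 proof -
  have "(%z :: arr \<times> (nat => real). snd z k) : Bm (borel >< borel)" for k :: nat
   by (rule m_comp[OF m_snd measurable_product_coordinates])
  from sets_all_unit[OF this]
  have m: "{z : space (borel >< borel). ALL k. 0 <= snd z k & snd z k <= 1} : sets ((borel :: arr measure) >< (borel :: (nat => real) measure))" .
  show ?thesis unfolding P_def AE_distr_iff[OF mdl' m]
   using unit by (simp only: dl_def diag_def snd_conv)
 qed
 from noise_outsourcing_seq[OF P this, unfolded Pfst]
 obtain Ph where Ph: "(%z. Ph (fst z) (snd z)) : Bm (borel >< borel)"
  and P_eq: "P = distr (law (%_. 0) >< unif) (borel >< borel) (%z. (fst z, Ph (fst z) (snd z)))"
  .
 define \<Omega> where "\<Omega> = samp M >< unif"
 have pO: "prob_space \<Omega>" unfolding \<Omega>_def by (intro prob_space_pair S.prob_space_axioms) simp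
 interpret O: prob_space \<Omega> by fact
 have mDw: "(%z. (D (fst z), snd z)) : \<Omega> ->M borel >< borel"
  unfolding \<Omega>_def
  by (intro m_Pair m_comp[OF m_fst mD] measurable_snd_unif)
 have ml: "(%z. Ph (D (fst z)) (snd z)) : Bm \<Omega>"
  using m_comp[OF mDw Ph] by (simp only: fst_conv snd_conv)
 have mx: "(%z. fst (fst z)) : \<Omega> ->M seqs M"
  unfolding \<Omega>_def samp_def by (rule m_comp[OF m_fst m_fst])
 have mD': "(%z. D (fst z)) : Bm \<Omega>"
  unfolding \<Omega>_def by (rule m_comp[OF m_fst mD])
 define T where "T z = (fst (fst z), (D (fst z), Ph (D (fst z)) (snd z)))" for z
 have mT: "T : \<Omega> ->M seqs M >< (borel >< borel)"
  unfolding T_def[abs_def] by (intro m_Pair mx mD' ml)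
 have law_unif: "law (%_. 0) >< unif = distr \<Omega> (borel >< unif) (%(z, w). (D z, w))"
 proof -
  have "distr (samp M) borel D >< distr unif unif (%w. w) = distr \<Omega> (borel >< unif) (%(z, w). (D z, w))"
   unfolding \<Omega>_def by (rule pair_measure_distr[OF mD measurable_ident_sets[OF refl]]) (simp add: distr_id2 prob_space_imp_sigma_finite)
  thus ?thesis by (simp add: law_def D_def distr_id2)
 qed
 have mDwu: "(%(z, w). (D z, w)) : \<Omega> ->M borel >< unif"
  unfolding \<Omega>_def case_prod_unfold by (intro m_Pair m_comp[OF m_fst mD] m_snd)
 have Ph': "(%z. Ph (fst z) (snd z)) : Bm (borel >< unif)"
  using Ph m_cong_sets[OF sets_pair_measure_cong[OF refl sets_unif] refl] by blast
 have mP: "(%z. (fst z, Ph (fst z) (snd z))) : borel >< unif ->M borel >< borel"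
  by (intro m_Pair m_fst Ph')
 have mP': "(%z. (fst z, Ph (fst z) (snd z))) : law (%_. 0) >< unif ->M borel >< borel"
  using mP m_cong_sets[OF sets_pair_measure_cong[OF sets_law[of "%_. 0"] refl] refl] by blast
 have T2: "distr \<Omega> (borel >< borel) (snd o T) = P"
 proof -
  have "P = distr \<Omega> (borel >< borel) ((%z. (fst z, Ph (fst z) (snd z))) o (%(z, w). (D z, w)))"
   unfolding P_eq law_unif by (rule distr_distr[OF mP mDwu])
  also have "(%z. (fst z, Ph (fst z) (snd z))) o (%(z, w). (D z, w)) = snd o T"
   by (auto simp: T_def fun_eq_iff)
  finally show ?thesis by (rule sym)
 qed
 define g where "g z = (fst z, fill (fst (snd z)) (snd (snd z)))" for z :: "(nat => 'a) \<times> arr \<times> (nat => real)"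
 have mg: "g : seqs M >< (borel >< borel) ->M seqs M >< borel"
  unfolding g_def[abs_def] by (intro m_Pair m_fst m_comp[OF m_snd measurable_fill])
 define K where "K = distr \<Omega> (seqs M >< (borel >< borel)) T"
 have Ksets: "sets K = sets (seqs M >< (borel >< borel))" by (simp add: K_def)
 have Kprob: "prob_space K" unfolding K_def by (rule O.prob_space_distr[OF mT])
 define J where "J = distr K (seqs M >< borel) g"
 have mgK: "g : K ->M seqs M >< borel" using mg m_cong_sets[OF Ksets refl] by blast
 have J_eq: "J = distr \<Omega> (seqs M >< borel) (g o T)"
  unfolding J_def K_def by (rule distr_distr[OF mg mT])
 have mgT: "g o T : \<Omega> ->M seqs M >< borel" by (rule measurable_comp[OF mT mg])
 have D0: "D z i i = 0" for z i by (simp add: D_def smat_def)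
 show thesis
 proof (rule that)
  show snd: "distr J borel snd = La"
  proof -
   have "distr J borel snd = distr \<Omega> borel (snd o (g o T))"
    unfolding J_eq by (rule distr_distr[OF m_snd mgT])
   also have "snd o (g o T) = (%z. fill (fst z) (snd z)) o (snd o T)"
    by (auto simp: g_def fun_eq_iff)
   also have "distr \<Omega> borel ... = distr P borel (%z. fill (fst z) (snd z))"
    unfolding T2[symmetric] by (rule distr_distr[symmetric, OF measurable_fill measurable_comp[OF mT m_snd]])
   also have "... = distr La borel ((%z. fill (fst z) (snd z)) o dl)"
    unfolding P_def by (rule distr_distr[OF measurable_fill mdl'])
   also have "(%z. fill (fst z) (snd z)) o dl = (%A. A)"
    by (simp add: fun_eq_iff dl_def fill_offd_diag)
   finally show ?thesis using La(2) by (simp add: distr_id2)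
  qed
  show "coupling M Ps J"
  proof (intro coupling.intro coupling_axioms.intro sample_model_axioms)
   show "prob_space J" unfolding J_eq by (rule O.prob_space_distr[OF mgT])
   show Js: "sets J = sets (seqs M >< borel)" by (simp add: J_def)
   have mo: "(%z. (fst z, offd (snd z))) : seqs M >< borel ->M seqs M >< borel"
    by (intro m_Pair m_fst m_comp[OF m_snd measurable_offd])
   have mxD: "(%z. (fst z, D z)) : samp M ->M seqs M >< borel"
    by (rule m_Pair[OF _ mD]) (simp add: samp_def)
   have "distr J (seqs M >< borel) (%z. (fst z, offd (snd z))) =
    distr \<Omega> (seqs M >< borel) ((%z. (fst z, offd (snd z))) o (g o T))"
    unfolding J_eq by (rule distr_distr[OF mo mgT])
   also have "(%z. (fst z, offd (snd z))) o (g o T) = (%z. (fst z, D z)) o fst"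
    by (auto simp: g_def T_def fun_eq_iff offd_fill D0)
   also have "distr \<Omega> (seqs M >< borel) ... = distr (distr \<Omega> (samp M) fst) (seqs M >< borel) (%z. (fst z, D z))"
    unfolding \<Omega>_def by (rule distr_distr[OF mxD m_fst, symmetric])
   also have "distr \<Omega> (samp M) fst = samp M"
    unfolding \<Omega>_def by (rule unif.distr_pair_fst)
   finally show "distr J (seqs M >< borel) (%z. (fst z, offd (snd z)))
    = distr (samp M) (seqs M >< borel) (%z. (fst z, smat Ps (%_. 0) z))"
    unfolding D_def .
   fix pq :: "nat => nat" assume pq: "bij pq"
   hence inj: "inj pq" by (rule bij_is_inj)
   define p where "p z = (%i. fst z (pq i), (sub pq (fst (snd z)), %i. snd (snd z) (pq i)))"
    for z :: "(nat => 'a) \<times> arr \<times> (nat => real)"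
   have mre: "(%x i. x (pq i)) : seqs M ->M seqs M" by (intro measurable_seqsI measurable_seqs_component)
   have mp: "p : seqs M >< (borel >< borel) ->M seqs M >< (borel >< borel)"
    unfolding p_def[abs_def]
    by (intro m_Pair m_comp[OF m_fst mre]
      m_comp[OF m_comp[OF m_snd m_fst] measurable_sub]
      m_comp[OF m_comp[OF m_snd m_snd] measurable_reindex])
   have mpK: "p : K ->M seqs M >< (borel >< borel)" using mp m_cong_sets[OF Ksets refl] by blast
   have mq: "(%z. (%i. fst z (pq i), sub pq (snd z))) : seqs M >< borel ->M seqs M >< borel"
    by (intro m_Pair m_comp[OF m_fst mre] m_comp[OF m_snd measurable_sub])
   have key: "distr K (seqs M >< (borel >< borel)) p = K"
   proof (rule pair_slice_eqI)
    let ?N = "seqs M >< (borel >< borel)"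
    let ?K' = "distr K ?N p"
    have pK': "prob_space ?K'" by (rule prob_space.prob_space_distr[OF Kprob mpK])
    have sK': "sets ?K' = sets ?N" by simp
    show fK: "finite_measure ?K'" "finite_measure K"
     by (rule prob_space.finite_measure[OF pK'] prob_space.finite_measure[OF Kprob])+
    show "sets ?K' = sets ?N" "sets K = sets ?N" by (rule sK' Ksets)+
    fix B1 :: "(nat => 'a) set" assume B1: "B1 : sets (seqs M)"
    show "slice ?K' B1 (borel >< borel) = slice K B1 (borel >< borel)"
    proof (rule pair_rect_eqI)
     show "finite_measure (slice ?K' B1 (borel >< borel))" "finite_measure (slice K B1 (borel >< borel))"
      by (rule finite_measure_slice[OF fK(1) sK' B1] finite_measure_slice[OF fK(2) Ksets B1])+
     fix B2 :: "arr set" and B3 :: "(nat => real) set"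
     assume B2: "B2 : sets borel" and B3: "B3 : sets borel"
     \<comment> \<open>Conditional probability, given the distance array \<open>A\<close>, that the
       label sequence lies in \<open>C\<close>.\<close>
     define \<kappa> where "\<kappa> C A = (\<integral>\<^sup>+w. Ind C (Ph A w) \<partial>unif)" for C A
     have mi: "(%z. Ind C (Ph (fst z) (snd z)) :: ennreal) : Bm (borel >< unif)"
      if "C : sets borel" for C
      by (rule m_comp[OF Ph' bm_ind[OF that]])
     have m\<kappa>: "\<kappa> C : Bm borel" if "C : sets borel" for C
      unfolding \<kappa>_def[abs_def] using unif.borel_measurable_nn_integral_fst[OF mi[OF that]] by (simp only: fst_conv snd_conv)
     define B3' where "B3' = (%l i. l (pq i)) -` B3"
     have B3': "B3' : sets borel"
      using measurable_sets[OF measurable_reindex B3, of pq] by (simp add: B3'_def)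
     have P_rect: "emeasure P (B \<times> C) = (\<integral>\<^sup>+A\<in>B. \<kappa> C A \<partial>law (%_. 0))"
      if B: "B : sets borel" and C: "C : sets borel" for B C
     proof -
      have BC: "B \<times> C : sets (borel >< borel)" using B C by auto
      have mBC: "(%z. Ind B (fst z) * Ind C (Ph (fst z) (snd z)) :: ennreal) : Bm (law (%_. 0) >< unif)"
       unfolding m_cong_sets[OF sets_pair_measure_cong[OF sets_law refl] refl]
       by (intro borel_measurable_times_ennreal mi[OF C] m_comp[OF m_fst bm_ind[OF B]])
      have "emeasure P (B \<times> C) = (\<integral>\<^sup>+z. Ind (B \<times> C) z \<partial>P)"
       using BC P(2) by simp
      also have "... = (\<integral>\<^sup>+z. Ind B (fst z) * Ind C (Ph (fst z) (snd z)) \<partial>(law (%_. 0) >< unif))"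
       unfolding P_eq
       by (subst nn_integral_distr[OF mP'], unfold measurable_distr_eq1, rule bm_ind[OF BC])
        (simp only: indicator_times fst_conv snd_conv)
      also have "... = (\<integral>\<^sup>+A. \<integral>\<^sup>+w. Ind B A * Ind C (Ph A w) \<partial>unif \<partial>law (%_. 0))"
       by (subst unif.nn_integral_fst[symmetric, OF mBC]) (simp only: fst_conv snd_conv)
      also have "... = (\<integral>\<^sup>+A\<in>B. \<kappa> C A \<partial>law (%_. 0))"
      proof (rule nn_integral_cong)
       fix A
       have "(%w. Ind C (Ph A w) :: ennreal) : Bm unif"
        using m_comp[OF measurable_Pair1'[of A borel unif] mi[OF C]]
        by (simp only: fst_conv snd_conv space_borel UNIV_I simp_thms)
       thus "(\<integral>\<^sup>+w. Ind B A * Ind C (Ph A w) \<partial>unif) = \<kappa> C A * Ind B A"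
        unfolding \<kappa>_def by (subst nn_integral_cmult) (simp_all only: mult.commute)
      qed
      finally show ?thesis .
     qed
     \<comment> \<open>Equivariance of the kernel. Since \<open>La\<close> and the law of the
       distances are both exchangeable, the two sides have equal integrals over every event of the
       array.\<close>
     have ae: "AE A in law (%_. 0). \<kappa> B3' A = \<kappa> B3 (sub pq A)"
     proof -
      have eq: "(\<integral>\<^sup>+A\<in>B. \<kappa> B3' A \<partial>law (%_. 0)) = (\<integral>\<^sup>+A\<in>B. \<kappa> B3 (sub pq A) \<partial>law (%_. 0))"
       if "B : sets (law (%_. 0))" for B
      proof -
       have B: "B : sets borel" using that by simp
       define B' where "B' = sub (inv pq) -` B"
       have B': "B' : sets borel" using measurable_sets[OF measurable_sub B, of "inv pq"] by (simp add: B'_def)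
       have inB': "sub pq A : B' \<longleftrightarrow> A : B" for A
        using pq by (simp add: B'_def sub_sub bij_is_surj surj_f_inv_f sub_id)
       have BC: "B \<times> B3' : sets (borel >< borel)" "B' \<times> B3 : sets (borel >< borel)"
        using B B3 B' B3' by auto
       have "(\<integral>\<^sup>+A\<in>B. \<kappa> B3 (sub pq A) \<partial>law (%_. 0)) = (\<integral>\<^sup>+A. \<kappa> B3 (sub pq A) * Ind B' (sub pq A) \<partial>law (%_. 0))"
        by (intro nn_integral_cong) (simp add: inB' indicator_def)
       also have "... = (\<integral>\<^sup>+A. \<kappa> B3 A * Ind B' A \<partial>distr (law (%_. 0)) borel (sub pq))"
       proof (rule nn_integral_distr[symmetric])
        show "sub pq : Bm (law (%_. 0))"
         unfolding m_cong_sets[OF sets_law refl] by (rule measurable_sub)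
        show "(%A. \<kappa> B3 A * Ind B' A) : Bm (distr (law (%_. 0)) borel (sub pq))"
         unfolding measurable_distr_eq1
         by (intro borel_measurable_times_ennreal m\<kappa>[OF B3] bm_ind B')
       qed
       also have "... = (\<integral>\<^sup>+A\<in>B'. \<kappa> B3 A \<partial>law (%_. 0))"
        using exchangeable_law[of "%_. 0"] inj unfolding exchangeable_def by simp
       also have "... = emeasure P (B' \<times> B3)" by (rule P_rect[OF B' B3, symmetric])
       also have "... = emeasure La (dl -` (B' \<times> B3))"
        unfolding P_def by (subst emeasure_distr[OF mdl' BC(2)]) (simp add: sets_eq_imp_space_eq[OF La(2)])
       also have "... = emeasure (distr La borel (sub pq)) (dl -` (B' \<times> B3))"
        using La(3) inj unfolding exchangeable_def by simp
       also have "... = emeasure La (sub pq -` (dl -` (B' \<times> B3)))"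
        using measurable_sets[OF mdl BC(2)]
        by (subst emeasure_distr[OF mLa[OF measurable_sub]]) (simp_all add: sets_eq_imp_space_eq[OF La(2)])
       also have "sub pq -` (dl -` (B' \<times> B3)) = dl -` (B \<times> B3')"
        by (auto simp: dl_def sub_offd[OF inj] inB' diag_sub B3'_def)
       also have "emeasure La (dl -` (B \<times> B3')) = emeasure P (B \<times> B3')"
        unfolding P_def by (subst emeasure_distr[OF mdl' BC(1)]) (simp add: sets_eq_imp_space_eq[OF La(2)])
       also have "... = (\<integral>\<^sup>+A\<in>B. \<kappa> B3' A \<partial>law (%_. 0))" by (rule P_rect[OF B B3'])
       finally show ?thesis by simp
      qed
      have m1: "\<kappa> B3' : Bm (law (%_. 0))"
       unfolding m_cong_sets[OF sets_law refl] by (rule m\<kappa>[OF B3'])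
      have m2: "(%A. \<kappa> B3 (sub pq A)) : Bm (law (%_. 0))"
       unfolding m_cong_sets[OF sets_law refl] by (rule m_comp[OF measurable_sub m\<kappa>[OF B3]])
      have le1: "\<kappa> C A <= 1" for C A
      proof -
       have "\<kappa> C A <= (\<integral>\<^sup>+w. 1 \<partial>unif)" unfolding \<kappa>_def by (intro nn_integral_mono) (simp add: indicator_def)
       thus ?thesis using unif.emeasure_space_1 by simp
      qed
      have fin: "(\<integral>\<^sup>+A. f A \<partial>law (%_. 0)) ~= \<infinity>" if "!!A. f A <= 1" for f
      proof -
       interpret L: prob_space "law (%_. 0)" by (rule prob_space_law) simp
       have "(\<integral>\<^sup>+A. f A \<partial>law (%_. 0)) <= (\<integral>\<^sup>+A. 1 \<partial>law (%_. 0))" by (intro nn_integral_mono that)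
       thus ?thesis using L.emeasure_space_1 by (auto simp: top_unique)
      qed
      have "AE A in law (%_. 0). \<kappa> B3' A <= \<kappa> B3 (sub pq A)"
       by (rule AE_le_of_set_nn_integral_le[OF m1 m2 _ fin[OF le1]]) (simp only: eq order_refl)
      moreover have "AE A in law (%_. 0). \<kappa> B3 (sub pq A) <= \<kappa> B3' A"
       by (rule AE_le_of_set_nn_integral_le[OF m2 m1 _ fin[OF le1]]) (simp only: eq order_refl)
      ultimately show ?thesis by eventually_elim (rule antisym)
     qed
     \<comment> \<open>Points, array and label event are parameters here, so that one computation
       serves both \<open>T\<close> and \<open>p o T\<close>.\<close>
     have rect: "emeasure (distr \<Omega> ?N m) (B1 \<times> (B2 \<times> B3)) =
       (\<integral>\<^sup>+z. Ind B1 (ma z) * Ind B2 (mb z) * \<kappa> C (D z) \<partial>samp M)"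
      if m: "m : \<Omega> ->M ?N" and C: "C : sets borel"
       and eq: "!!z w. fst (m (z, w)) = ma z" "!!z w. fst (snd (m (z, w))) = mb z"
        "!!z w. snd (snd (m (z, w))) : B3 \<longleftrightarrow> Ph (D z) w : C"
      for m ma mb C
     proof -
      have BC: "B1 \<times> (B2 \<times> B3) : sets ?N" using B1 B2 B3 by auto
      have mI: "(%om. Ind (B1 \<times> (B2 \<times> B3)) (m om) :: ennreal) : Bm (samp M >< unif)"
       using m_comp[OF m bm_ind[OF BC]] unfolding \<Omega>_def .
      have "emeasure (distr \<Omega> ?N m) (B1 \<times> (B2 \<times> B3)) = (\<integral>\<^sup>+om. Ind (B1 \<times> (B2 \<times> B3)) om \<partial>distr \<Omega> ?N m)"
       using BC by simp
      also have "... = (\<integral>\<^sup>+om. Ind (B1 \<times> (B2 \<times> B3)) (m om) \<partial>\<Omega>)"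
       by (rule nn_integral_distr[OF m]) (unfold measurable_distr_eq1, rule bm_ind[OF BC])
      also have "... = (\<integral>\<^sup>+z. \<integral>\<^sup>+w. Ind (B1 \<times> (B2 \<times> B3)) (m (z, w)) \<partial>unif \<partial>samp M)"
       unfolding \<Omega>_def by (rule unif.nn_integral_fst[symmetric, OF mI])
      also have "... = (\<integral>\<^sup>+z. Ind B1 (ma z) * Ind B2 (mb z) * \<kappa> C (D z) \<partial>samp M)"
      proof (rule nn_integral_cong)
       fix z assume "z : space (samp M)"
       have mm: "(%w. Ind C (Ph (D z) w) :: ennreal) : Bm unif"
        using m_comp[OF measurable_Pair1'[of "D z" borel unif] mi[OF C]]
        by (simp only: fst_conv snd_conv space_borel UNIV_I simp_thms)
       have "(\<integral>\<^sup>+w. Ind (B1 \<times> (B2 \<times> B3)) (m (z, w)) \<partial>unif) =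
        (\<integral>\<^sup>+w. Ind B1 (ma z) * Ind B2 (mb z) * Ind C (Ph (D z) w) \<partial>unif)"
        by (intro nn_integral_cong) (simp add: eq indicator_def mem_Times_iff)
       also have "... = Ind B1 (ma z) * Ind B2 (mb z) * \<kappa> C (D z)"
        unfolding \<kappa>_def by (rule nn_integral_cmult[OF mm])
       finally show "(\<integral>\<^sup>+w. Ind (B1 \<times> (B2 \<times> B3)) (m (z, w)) \<partial>unif) =
        Ind B1 (ma z) * Ind B2 (mb z) * \<kappa> C (D z)" .
      qed
      finally show ?thesis .
     qed
     have "emeasure ?K' (B1 \<times> (B2 \<times> B3)) = emeasure (distr \<Omega> ?N (p o T)) (B1 \<times> (B2 \<times> B3))"
      unfolding K_def by (simp only: distr_distr[OF mp mT])
     also have "... = (\<integral>\<^sup>+z. Ind B1 (%i. fst z (pq i)) * Ind B2 (sub pq (D z)) * \<kappa> B3' (D z) \<partial>samp M)"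
      by (rule rect[OF measurable_comp[OF mT mp] B3'])
       (simp_all add: p_def T_def B3'_def)
     also have "... = (\<integral>\<^sup>+z. Ind B1 (fst (shift pq z)) * Ind B2 (D (shift pq z)) * \<kappa> B3 (D (shift pq z)) \<partial>samp M)"
     proof (rule nn_integral_cong_AE)
      have "AE z in samp M. \<kappa> B3' (D z) = \<kappa> B3 (sub pq (D z))"
       using ae AE_distrD[OF mD] unfolding law_def D_def[symmetric] by blast
      thus "AE z in samp M. Ind B1 (%i. fst z (pq i)) * Ind B2 (sub pq (D z)) * \<kappa> B3' (D z) =
       Ind B1 (fst (shift pq z)) * Ind B2 (D (shift pq z)) * \<kappa> B3 (D (shift pq z))"
       using AE_space
      proof eventually_elim
       case (elim z)
       have "sub pq (D z) = D (shift pq z)" unfolding D_def by (rule sub_smat[OF elim(2) inj])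
       thus ?case using elim(1) by (simp add: shift_def)
      qed
     qed
     also have "... = (\<integral>\<^sup>+z. Ind B1 (fst z) * Ind B2 (D z) * \<kappa> B3 (D z) \<partial>distr (samp M) (samp M) (shift pq))"
     proof (rule nn_integral_distr[OF measurable_shift, symmetric])
      have "fst : samp M ->M seqs M" by (simp add: samp_def)
      note mB1 = m_comp[OF this bm_ind[OF B1]]
      show "(%z. Ind B1 (fst z) * Ind B2 (D z) * \<kappa> B3 (D z)) : Bm (distr (samp M) (samp M) (shift pq))"
       unfolding measurable_distr_eq1
       by (intro borel_measurable_times_ennreal mB1 m_comp[OF mD bm_ind[OF B2]]
         m_comp[OF mD m\<kappa>[OF B3]])
     qed
     also have "... = (\<integral>\<^sup>+z. Ind B1 (fst z) * Ind B2 (D z) * \<kappa> B3 (D z) \<partial>samp M)"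
      unfolding distr_shift[OF inj] ..
     also have "... = emeasure K (B1 \<times> (B2 \<times> B3))"
      unfolding K_def
      by (rule rect[OF mT B3, symmetric]) (simp_all add: T_def)
     finally show "emeasure (slice ?K' B1 (borel >< borel)) (B2 \<times> B3) = emeasure (slice K B1 (borel >< borel)) (B2 \<times> B3)"
      using B2 B3 by (simp add: emeasure_slice[OF sK' B1] emeasure_slice[OF Ksets B1])
    qed simp_all
   qed
   have "distr J (seqs M >< borel) (%z. (%i. fst z (pq i), sub pq (snd z))) =
    distr K (seqs M >< borel) ((%z. (%i. fst z (pq i), sub pq (snd z))) o g)"
    unfolding J_def by (rule distr_distr[OF mq mgK])
   also have "(%z. (%i. fst z (pq i), sub pq (snd z))) o g = g o p"
    by (auto simp: g_def p_def fun_eq_iff sub_fill[OF inj])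
   also have "distr K (seqs M >< borel) (g o p) = distr (distr K (seqs M >< (borel >< borel)) p) (seqs M >< borel) g"
    by (rule distr_distr[OF mg mpK, symmetric])
   finally show "distr J (seqs M >< borel) (%z. (%i. fst z (pq i), sub pq (snd z))) = J"
    unfolding key J_def .
  qed
 qed
qed

section \<open>Labels are orthogonal to the noise in the distances\<close>

text \<open>A coupling is invariant under bijections, while the correlation arguments prescribe the
  images of finitely many indices. The extension adds one transposition per index.\<close>

lemma extend_inj_to_bij:
 fixes f :: "nat => nat"
 assumes "inj_on f {..<n}"
 shows "\<exists>pq. bij pq & (\<forall>i<n. pq i = f i)"
 using assms
proof (induction n)
 case 0
 show ?case by (intro exI[of _ id] conjI bij_id) simp
next
 case (Suc n)
 then obtain pq where pq: "bij pq" "\<forall>i<n. pq i = f i" by (force simp: inj_on_def)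
 define \<sigma> where "\<sigma> = Transposition.transpose (pq n) (f n) o pq"
 have "\<sigma> i = f i" if "i < Suc n" for i
 proof (cases "i = n")
  case False
  hence i: "i < n" using that by simp
  have "f i ~= f n" using Suc.prems i by (auto simp: inj_on_def)
  moreover have "pq i ~= pq n" using pq(1) i by (auto simp: bij_def inj_def)
  ultimately show ?thesis using pq(2) i by (simp add: \<sigma>_def Transposition.transpose_def)
 qed (simp add: \<sigma>_def)
 moreover have "bij \<sigma>" unfolding \<sigma>_def using pq(1) by (intro bij_comp) auto
 ultimately show ?case by blast
qed

lemma bij_three:
 fixes a b c :: nat
 assumes "a ~= b" "a ~= c" "b ~= c"
 obtains pq :: "nat => nat" where "bij pq" "pq 0 = a" "pq 1 = b" "pq 2 = c"
proof -
 let ?f = "%i::nat. if i = 0 then a else if i = 1 then b else c"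
 have "inj_on ?f {..<3}" using assms by (auto simp: inj_on_def)
 from extend_inj_to_bij[OF this] obtain pq where "bij pq" "\<forall>i<3. pq i = ?f i" by blast
 thus thesis by (intro that[of pq]) auto
qed

context sample_model
begin

text \<open>\<open>W r x y = 0\<close> says that the distance is almost surely at least
  \<open>r\<close>. In this way the infimum of a support enters without forming supports.\<close>

definition W :: "real => 'a => 'a => real" where
 "W r x y = (LINT u|unif. Ind {..<r} (Ps x y u))"

lemma measurable_Ps_section:
 "x : space M ==> y : space M ==> (%u. Ps x y u) : Bm unif"
 by (rule measurable_Ps) (auto simp: measurable_unif_eq[symmetric] intro: measurable_ident_sets)

lemma measurable_ind_Ps:
 "x : space M ==> y : space M ==> (%u. Ind {..<r} (Ps x y u) :: real) : Bm unif"
 by (rule m_comp[OF measurable_Ps_section]) auto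

lemma W_bounds: "0 <= W r x y" "W r x y <= 1"
proof -
 interpret unif: prob_space unif by simp
 show "0 <= W r x y" unfolding W_def by (rule Bochner_Integration.integral_nonneg) simp
 show "W r x y <= 1"
 proof (cases "integrable unif (%u. Ind {..<r} (Ps x y u) :: real)")
  case True
  hence "W r x y <= (LINT u|unif. 1)" unfolding W_def
   by (intro integral_mono) (auto simp: indicator_def)
  also have "... = 1" using unif.prob_space by simp
  finally show ?thesis .
 next
  case False
  thus ?thesis unfolding W_def by (simp add: not_integrable_integral_eq)
 qed
qed

lemma W_sym: "x : space M ==> y : space M ==> W r x y = W r y x"
 unfolding W_def using Ps_sym[of x y] by simp

lemma measurable_W: "(%p. W r (fst p) (snd p)) : Bm (M >< M)"
proof -
 interpret unif: prob_space unif by simp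
 have "(%z. Ps (fst (fst z)) (snd (fst z)) (snd z)) : Bm ((M >< M) >< unif)"
  using Ps_meas m_cong_sets[OF sets_pair_measure_cong[OF refl sets_unif] refl] by blast
 from m_comp[OF this, of "Ind {..<r} :: real => real"]
 have "(%(p, u). Ind {..<r} (Ps (fst p) (snd p) u) :: real) : Bm ((M >< M) >< unif)"
  by (simp add: case_prod_unfold)
 from unif.borel_measurable_lebesgue_integral[OF this]
 show ?thesis unfolding W_def .
qed

lemma W_eq_0_AE:
 assumes "x : space M" "y : space M" "W r x y = 0"
 shows "AE u in unif. r <= Ps x y u"
proof -
 interpret unif: prob_space unif by simp
 have "AE u in unif. Ind {..<r} (Ps x y u) = (0::real)"
  using assms(3) unfolding W_def
  by (subst (asm) integral_nonneg_eq_0_iff_AE)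
   (use assms in \<open>auto intro!: unif.integrable_bounded[where B=1] measurable_ind_Ps\<close>)
 thus ?thesis by eventually_elim (auto simp: indicator_def split: if_splits)
qed

text \<open>Given the points, the four edges of the cycle through \<open>i\<close>, 1,
  \<open>k\<close>, 2 are distinct and use independent noise, so each centred factor integrates to 0
  separately.\<close>

lemma four_cycle:
 assumes dist: "i ~= k" "i ~= 1" "i ~= 2" "k ~= 1" "k ~= (2::nat)"
  and R: "!!i j z. R i j z = Ind {..<r} (smat Ps (%_. 0) z i j) - W r (fst z i) (fst z j)"
 shows "(LINT z|samp M. (R i 1 z * R i 2 z) * (R k 1 z * R k 2 z)) = 0"
proof -
 interpret unif: prob_space unif by simp
 interpret S: prob_space "samp M" by (rule prob_space_samp[OF prob_space_axioms])
 interpret X: prob_space "seqs M" by (rule prob_space_seqs[OF prob_space_axioms])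
 interpret U: prob_space noise by simp
 interpret P: pair_sigma_finite "seqs M" noise ..
 define en where "en i j = (min i j, max i j)" for i j :: nat
 define g where "g x e v = Ind {..<r} (Ps (x (fst e)) (x (snd e)) v) - W r (x (fst e)) (x (snd e))"
  for x :: "nat => 'a" and e :: "nat \<times> nat" and v
 have Rm: "R i j : Bm (samp M)" for i j
 proof -
  have "(%z. smat Ps (%_. 0) z i j) : Bm (samp M)"
   by (rule measurable_entry[OF measurable_smat]) simp
  from m_comp[OF this, of "Ind {..<r} :: real => real"]
  have 1: "(%z. Ind {..<r} (smat Ps (%_. 0) z i j) :: real) : Bm (samp M)" by simp
  have 2: "(%z. W r (fst z i) (fst z j)) : Bm (samp M)"
   using m_comp[OF m_Pair[OF measurable_samp_x measurable_samp_x] measurable_W] by (simp only: fst_conv snd_conv)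
  show ?thesis unfolding R[abs_def] by (rule borel_measurable_diff[OF 1 2])
 qed
 have R1: "\<bar>R i j z\<bar> <= 1" for i j z
  unfolding R using W_bounds[of r "fst z i" "fst z j"] by (auto simp: indicator_def)
 define Q where "Q z = (R i 1 z * R i 2 z) * (R k 1 z * R k 2 z)" for z
 have "integrable (samp M) Q"
 proof (rule S.integrable_bounded)
  show "Q : Bm (samp M)" unfolding Q_def[abs_def] by (intro bm_times Rm)
  have m: "\<bar>a * b\<bar> <= 1" if "\<bar>a\<bar> <= 1" "\<bar>b\<bar> <= 1" for a b :: real
   using that by (simp add: abs_mult mult_le_one)
  show "\<bar>Q z\<bar> <= 1" for z unfolding Q_def by (intro m R1)
 qed
 hence "(LINT z|samp M. Q z) = (LINT x|seqs M. LINT u|noise. Q (x, u))"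
  unfolding samp_def by (rule P.integral_fst'[symmetric])
 also have "... = (LINT x|seqs M. 0)"
 proof (rule b_cong[OF refl])
  fix x assume "x : space (seqs M)"
  hence x: "x i : space M" for i by (simp add: space_seqs)
  define E where "E = {en i 1, en i 2, en k 1, en k 2}"
  have Rg: "R i j (x, u) = g x (en i j) (u (en i j))" if "i ~= j" for i j u
   using that Ps_sym[OF x x] W_sym[OF x x]
   by (cases "i < j") (auto simp: R smat_def g_def en_def min_def max_def)
  have "Q (x, u) = (\<Prod>e\<in>E. g x e (u e))" for u
  proof -
   have "en i 1 ~= en i 2" "en i 1 ~= en k 1" "en i 1 ~= en k 2" "en i 2 ~= en k 1" "en i 2 ~= en k 2" "en k 1 ~= en k 2"
    using dist by (auto simp: en_def min_def max_def)
   thus ?thesis unfolding E_def Q_def using dist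
    by (simp add: Rg)
  qed
  hence "(LINT u|noise. Q (x, u)) = (LINT u|(\<Pi>\<^sub>M e\<in>UNIV. unif). (\<Prod>e\<in>E. g x e (u e)))"
   by (simp add: noise_def)
  also have "... = (\<Prod>e\<in>E. LINT v|unif. g x e v)"
  proof (rule integral_PiM_prod[where B=1])
   show "g x e : Bm unif" for e
    unfolding g_def[abs_def] by (intro borel_measurable_diff measurable_ind_Ps x) simp
   show "\<bar>g x e v\<bar> <= 1" for e v
    unfolding g_def using W_bounds[of r "x (fst e)" "x (snd e)"] by (auto simp: indicator_def)
  qed (auto simp: E_def)
  also have "... = 0"
  proof (rule prod_zero)
   have "integrable unif (%v. Ind {..<r} (Ps (x (fst e)) (x (snd e)) v) :: real)" for e
    by (rule unif.integrable_bounded[where B=1]) (auto intro!: measurable_ind_Ps x)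
   hence "(LINT v|unif. g x e v) = 0" for e
    unfolding g_def W_def using unif.prob_space by simp
   thus "\<exists>e\<in>E. (LINT v|unif. g x e v) = 0" by (intro bexI[of _ "en i 1"]) (simp_all add: E_def)
  qed (simp add: E_def)
  finally show "(LINT u|noise. Q (x, u)) = 0" .
 qed
 finally show ?thesis by (simp add: Q_def)
qed

end

context coupling
begin

lemma measurable_J: "J ->M L = seqs M >< borel ->M L"
 by (rule m_cong_sets[OF J_sets refl])

lemma mX: "(%z. fst z i) : J ->M M"
 unfolding measurable_J by (rule m_comp[OF m_fst measurable_seqs_component])

lemma mA: "(%z. snd z i j) : Bm J"
 unfolding measurable_J by (rule m_comp[OF m_snd measurable_arr_entry])

definition perm :: "(nat => nat) => (nat => 'a) \<times> arr => (nat => 'a) \<times> arr" where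
 "perm pq z = (%i. fst z (pq i), sub pq (snd z))"

lemma fst_perm: "fst (perm pq z) i = fst z (pq i)" and snd_perm: "snd (perm pq z) i j = snd z (pq i) (pq j)"
 by (simp_all add: perm_def sub_def)

lemma measurable_perm: "perm pq : J ->M seqs M >< borel"
 unfolding perm_def[abs_def]
 by (intro m_Pair measurable_seqsI mX m_comp[OF _ measurable_sub])
  (simp only: measurable_J m_snd)

lemma distr_perm: "bij pq ==> distr J (seqs M >< borel) (perm pq) = J"
 using J_exch unfolding perm_def[abs_def] .

lemma integral_perm:
 fixes G :: "_ => real"
 assumes "bij pq" "G : Bm J"
 shows "(LINT z|J. G (perm pq z)) = (LINT z|J. G z)"
proof -
 have "(LINT z|distr J (seqs M >< borel) (perm pq). G z) = (LINT z|J. G (perm pq z))"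
  by (rule integral_distr[OF measurable_perm]) (use assms(2) in \<open>simp only: measurable_J\<close>)
 thus ?thesis using J_exch[OF assms(1)] unfolding perm_def[abs_def] by simp
qed

lemma AE_perm:
 assumes "bij pq" "AE z in J. Q z"
 shows "AE z in J. Q (perm pq z)"
 by (rule AE_distrD[OF measurable_perm]) (simp only: distr_perm[OF assms(1)] assms(2))

definition R :: "real => nat => nat => (nat => 'a) \<times> arr => real" where
 "R r i j z = Ind {..<r} (snd z i j) - W r (fst z i) (fst z j)"

lemma R_perm: "R r i j (perm pq z) = R r (pq i) (pq j) z"
 by (simp add: R_def fst_perm snd_perm)

lemma R_bound: "\<bar>R r i j z\<bar> <= 1"
 unfolding R_def using W_bounds[of r "fst z i" "fst z j"] by (auto simp: indicator_def)

lemma measurable_R: "R r i j : Bm J"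
proof -
 have 1: "(%z. Ind {..<r} (snd z i j) :: real) : Bm J"
  by (rule m_comp[OF mA]) simp
 have 2: "(%z. W r (fst z i) (fst z j)) : Bm J"
  using m_comp[OF m_Pair[OF mX mX] measurable_W] by (simp only: fst_conv snd_conv)
 show ?thesis unfolding R_def[abs_def] by (rule borel_measurable_diff[OF 1 2])
qed

lemma integral_J_offd:
 fixes G :: "_ => real"
 assumes G: "G : Bm J"
 shows "(LINT z|J. G (fst z, offd (snd z))) = (LINT z|samp M. G (fst z, smat Ps (%_. 0) z))"
proof -
 have G': "G : Bm (seqs M >< borel)" using G by (simp only: measurable_J)
 have 1: "(%z. (fst z, offd (snd z))) : J ->M seqs M >< borel"
  unfolding measurable_J
  by (intro m_Pair m_fst m_comp[OF m_snd measurable_offd])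
 have 2: "(%z. (fst z, smat Ps (%_. 0) z)) : samp M ->M seqs M >< borel"
  by (intro m_Pair measurable_smat) (simp_all add: samp_def)
 show ?thesis
  unfolding integral_distr[OF 1 G', symmetric] integral_distr[OF 2 G', symmetric] J_offd ..
qed

lemma four_cycle_J:
 assumes "i ~= k" "i ~= 1" "i ~= 2" "k ~= 1" "k ~= (2::nat)"
 shows "(LINT z|J. (R r i 1 z * R r i 2 z) * (R r k 1 z * R r k 2 z)) = 0"
proof -
 define G where "G z = (R r i 1 z * R r i 2 z) * (R r k 1 z * R r k 2 z)" for z
 have G: "G : Bm J" unfolding G_def[abs_def] by (intro bm_times measurable_R)
 have "G z = G (fst z, offd (snd z))" for z
  using assms by (simp add: G_def R_def offd_def)
 hence "(LINT z|J. G z) = (LINT z|samp M. G (fst z, smat Ps (%_. 0) z))"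
  using integral_J_offd[OF G] by simp
 also have "... = 0"
  unfolding G_def by (rule four_cycle[OF assms]) (simp add: R_def)
 finally show ?thesis unfolding G_def .
qed

lemma abs_mult_le_1: "\<bar>a\<bar> <= 1 ==> \<bar>b\<bar> <= 1 ==> \<bar>a * b\<bar> <= (1::real)"
 by (simp add: abs_mult mult_le_one)

text \<open>
 The noise in the distances is invisible to the labels, however these depend on the matrix:
 two applications of the Cauchy-Schwarz inequality reduce the correlation to a four-cycle
 of centred noise variables.
\<close>
lemma labels_orthogonal_noise:
 fixes H1 H2 :: "real => real"
 assumes H: "H1 : Bm borel" "H2 : Bm borel"
  and b: "!!v. \<bar>H1 v\<bar> <= 1" "!!v. \<bar>H2 v\<bar> <= 1"
 shows "(LINT z|J. H1 (snd z 0 0) * (R r 0 1 z * H2 (snd z 1 1))) = 0"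
proof -
 interpret J: prob_space J by (rule J_prob)
 have mH: "(%z. H1 (snd z i i)) : Bm J" "(%z. H2 (snd z i i)) : Bm J" for i
  by (rule m_comp[OF mA H(1)] m_comp[OF mA H(2)])+
 define a where "a = (LINT z|J. H1 (snd z 0 0) * (R r 0 1 z * H2 (snd z 1 1)))"
 define c where "c = (LINT z|J. (H2 (snd z 1 1) * H2 (snd z 2 2)) * (R r 0 1 z * R r 0 2 z))"
 have "a\<^sup>2 <= c"
 \<comment> \<open>The label of index 0 is tested against infinitely many neighbours; it is absent
   from the remaining pair correlation \<open>c\<close>.\<close>
 proof (rule J.exchangeable_Cauchy_Schwarz[where h="%z. H1 (snd z 0 0)" and T="%j z. R r 0 (Suc j) z * H2 (snd z (Suc j) (Suc j))"])
  fix j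
  have "bij (Transposition.transpose 1 (Suc j))" by simp
  from integral_perm[OF this, of "%z. H1 (snd z 0 0) * (R r 0 1 z * H2 (snd z 1 1))"]
  show "(LINT z|J. H1 (snd z 0 0) * (R r 0 (Suc j) z * H2 (snd z (Suc j) (Suc j)))) = a"
   by (simp add: a_def R_perm snd_perm Transposition.transpose_def bm_times measurable_R mH)
 next
  fix j k :: nat assume "j ~= k"
  hence ne: "0 ~= Suc j" "0 ~= Suc k" "Suc j ~= Suc k" by auto
  from bij_three[OF ne] obtain pq :: "nat => nat" where pq: "bij pq" "pq 0 = 0" "pq 1 = Suc j" "pq 2 = Suc k" .
  have "(LINT z|J. (H2 (snd z (Suc j) (Suc j)) * H2 (snd z (Suc k) (Suc k))) * (R r 0 (Suc j) z * R r 0 (Suc k) z)) = c"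
   using integral_perm[OF pq(1), of "%z. (H2 (snd z 1 1) * H2 (snd z 2 2)) * (R r 0 1 z * R r 0 2 z)"]
   unfolding c_def R_perm snd_perm pq(2-4)
   by (simp only: bm_times measurable_R mH)
  thus "(LINT z|J. R r 0 (Suc j) z * H2 (snd z (Suc j) (Suc j)) * (R r 0 (Suc k) z * H2 (snd z (Suc k) (Suc k)))) = c"
   by (simp only: mult_ac)
 qed (intro bm_times measurable_R mH b abs_mult_le_1 R_bound)+
 moreover have "c\<^sup>2 <= 0"
 \<comment> \<open>Now the labels of 1 and 2 are tested against infinitely many common neighbours,
   numbered 0, 3, 4, ... to avoid 1 and 2; no label survives.\<close>
 proof (rule J.exchangeable_Cauchy_Schwarz[where h="%z. H2 (snd z 1 1) * H2 (snd z 2 2)"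
    and T="%j z. R r (if j = 0 then 0 else j + 2) 1 z * R r (if j = 0 then 0 else j + 2) 2 z"])
  fix j :: nat
  have ne: "(if j = 0 then 0 else j + 2) ~= 1" "(if j = 0 then 0 else j + 2) ~= 2" "(1::nat) ~= 2" by auto
  from bij_three[OF ne] obtain pq :: "nat => nat" where pq: "bij pq" "pq 0 = (if j = 0 then 0 else j + 2)" "pq 1 = 1" "pq 2 = 2" .
  show "(LINT z|J. (H2 (snd z 1 1) * H2 (snd z 2 2)) * (R r (if j = 0 then 0 else j + 2) 1 z * R r (if j = 0 then 0 else j + 2) 2 z)) = c"
   using integral_perm[OF pq(1), of "%z. (H2 (snd z 1 1) * H2 (snd z 2 2)) * (R r 0 1 z * R r 0 2 z)"]
   unfolding c_def R_perm snd_perm pq(2-4)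
   by (simp only: bm_times measurable_R mH)
 next
  fix j k :: nat assume "j ~= k"
  thus "(LINT z|J. (R r (if j = 0 then 0 else j + 2) 1 z * R r (if j = 0 then 0 else j + 2) 2 z) *
   (R r (if k = 0 then 0 else k + 2) 1 z * R r (if k = 0 then 0 else k + 2) 2 z)) = 0"
   by (intro four_cycle_J) auto
 qed (intro bm_times measurable_R mH b abs_mult_le_1 R_bound)+
 ultimately show ?thesis unfolding a_def[symmetric] by simp
qed

end

section \<open>Label gaps bounded by the essential infimum of the distance\<close>

text \<open>A label gap above \<open>r\<close> is allowed only where the distance is almost surely
  at least \<open>r\<close>. The threshold \<open>a\<close> separates the gap into one condition on
  each label, the product form in which labels can be tested against the noise.\<close>

definition (in sample_model) compatible :: "(nat => real => real) => ('a \<times> real) \<times> ('a \<times> real) => bool" where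
 "compatible e p \<longleftrightarrow> (ALL k. \<forall>a r :: rat. of_rat a + of_rat r < e k (snd (fst p)) --> e k (snd (snd p)) <= of_rat a -->
  W (of_rat r) (fst (fst p)) (fst (snd p)) = 0)"

lemma (in sample_model) compatible_AE:
 assumes "compatible e ((x, v), (x', v'))" "x : space M" "x' : space M"
 shows "AE u in unif. ALL k. e k v - e k v' <= Ps x x' u"
proof -
 have "AE u in unif. of_rat a + of_rat r < e k v --> e k v' <= of_rat a --> of_rat r <= Ps x x' u" for k and a r :: rat
  using assms(1) W_eq_0_AE[OF assms(2,3), of "of_rat r"] by (auto simp: compatible_def)
 hence "AE u in unif. ALL k. \<forall>a r :: rat. of_rat a + of_rat r < e k v --> e k v' <= of_rat a --> of_rat r <= Ps x x' u"
  by (simp add: AE_all_countable)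
 thus ?thesis
 proof eventually_elim
  case (elim u)
  show ?case
  proof (rule allI, rule ccontr)
   fix k assume "~ e k v - e k v' <= Ps x x' u"
   then obtain r :: rat where r: "Ps x x' u < of_rat r" "of_rat r < e k v - e k v'"
    using of_rat_dense[of "Ps x x' u" "e k v - e k v'"] by auto
   then obtain a :: rat where "e k v' < of_rat a" "of_rat a < e k v - of_rat r"
    using of_rat_dense[of "e k v'" "e k v - of_rat r"] by auto
   thus False using elim[rule_format, where k=k and a=a and r=r] r by linarith
  qed
 qed
qed

lemma (in sample_model) measurable_compatible:
 assumes e: "!!k. e k : Bm borel"
 shows "{p : space ((M >< borel) >< (M >< borel)). compatible e p} : sets ((M >< borel) >< (M >< borel))"
proof -
 let ?N = "(M >< borel) >< (M >< borel)"
 have [measurable]: "(%p. e k (snd (fst p))) : Bm ?N" "(%p. e k (snd (snd p))) : Bm ?N" for k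
  by (rule m_comp[OF _ e], simp)+
 have "(%p. (fst (fst p), fst (snd p))) : ?N ->M M >< M"
  by (intro m_Pair m_comp[OF m_fst m_fst] m_comp[OF m_snd m_fst])
 from m_comp[OF this measurable_W]
 have [measurable]: "(%p. W r (fst (fst p)) (fst (snd p))) : Bm ?N" for r
  by (simp only: fst_conv snd_conv)
 show ?thesis unfolding compatible_def by measurable
qed

text \<open>\<open>H1\<close> and \<open>H2\<close> select labels on either side of the threshold.
  The Lipschitz bound kills the indicator term, so orthogonality to the centred noise leaves
  integral zero for the nonnegative product of \<open>H1\<close>, \<open>W\<close> and
  \<open>H2\<close>.\<close>

lemma (in coupling) labels_compatible:
 assumes e: "!!k. e k : Bm borel"
  and lip: "AE z in J. ALL k. e k (snd z 0 0) - e k (snd z 1 1) <= snd z 0 1"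
 shows "AE z in J. compatible e ((fst z 0, snd z 0 0), (fst z 1, snd z 1 1))"
proof -
 interpret J: prob_space J by (rule J_prob)
 have "AE z in J. of_rat a + of_rat r < e k (snd z 0 0) --> e k (snd z 1 1) <= of_rat a --> W (of_rat r) (fst z 0) (fst z 1) = 0"
  for k and a r :: rat
 proof -
  define H1 where "H1 v = (Ind {v. of_rat a + of_rat r < e k v} v :: real)" for v
  define H2 where "H2 v = (Ind {v. e k v <= of_rat a} v :: real)" for v
  note [measurable] = e
  have mH: "H1 : Bm borel" "H2 : Bm borel"
   unfolding H1_def[abs_def] H2_def[abs_def] by measurable
  have mHA: "(%z. H1 (snd z i i)) : Bm J" "(%z. H2 (snd z i i)) : Bm J" for i
   by (rule m_comp[OF mA mH(1)] m_comp[OF mA mH(2)])+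
  have b: "\<bar>H1 v\<bar> <= 1" "\<bar>H2 v\<bar> <= 1" "0 <= H1 v" "0 <= H2 v" for v by (auto simp: H1_def H2_def)
  have mW: "(%z. W (of_rat r) (fst z 0) (fst z 1)) : Bm J"
   using m_comp[OF m_Pair[OF mX mX] measurable_W] by (simp only: fst_conv snd_conv)
  define Y where "Y z = H1 (snd z 0 0) * (W (of_rat r) (fst z 0) (fst z 1) * H2 (snd z 1 1))" for z :: "(nat => 'a) \<times> arr"
  have mY: "Y : Bm J" unfolding Y_def[abs_def] by (intro bm_times mHA mW)
  have "AE z in J. H1 (snd z 0 0) * (R (of_rat r) 0 1 z * H2 (snd z 1 1)) = - Y z"
   using lip
  proof eventually_elim
   case (elim z)
   have "H1 (snd z 0 0) * (Ind {..<of_rat r} (snd z 0 1) * H2 (snd z 1 1)) = 0"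
    using elim[rule_format, of k] by (auto simp: H1_def H2_def indicator_def)
   thus ?case by (simp add: R_def Y_def algebra_simps)
  qed
  hence "(LINT z|J. - Y z) = 0"
   unfolding labels_orthogonal_noise[OF mH b(1,2), of "of_rat r", symmetric]
   by (intro integral_cong_AE) (auto intro!: bm_times mHA measurable_R borel_measurable_uminus mY elim: eventually_mono)
  hence "(LINT z|J. Y z) = 0" by simp
  hence "AE z in J. Y z = 0"
  proof (subst (asm) integral_nonneg_eq_0_iff_AE)
   show "integrable J Y"
    by (rule J.integrable_bounded[OF mY, where B=1])
     (unfold Y_def, intro abs_mult_le_1 b, use W_bounds in auto)
   show "AE z in J. 0 <= Y z" unfolding Y_def by (intro AE_I2 mult_nonneg_nonneg b W_bounds)
  qed simp
  thus ?thesis by eventually_elim (auto simp: Y_def H1_def H2_def)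
 qed
 thus ?thesis unfolding compatible_def by (simp add: AE_all_countable)
qed

text \<open>Fixes 0 and sends 1, 3, 5, ... to 2, 1, 3, ..., which inserts 2 in front of the odd
  indices; the positive even indices move up by two to make room.\<close>

definition push :: "nat => nat" where
 "push n = (if n = 0 then 0 else if n = 1 then 2 else if odd n then n - 2 else n + 2)"

lemma distr_pair_assoc:
 assumes "prob_space A" "prob_space B" "prob_space C"
 shows "distr ((A >< B) >< C) (A >< (B >< C)) (%z. (fst (fst z), (snd (fst z), snd z))) = A >< (B >< C)"
proof (rule pair_measure_eqI[symmetric])
 interpret A: prob_space A by fact
 interpret B: prob_space B by fact
 interpret C: prob_space C by fact
 interpret BC: pair_prob_space B C ..
 show "sigma_finite_measure A" "sigma_finite_measure (B >< C)" by unfold_locales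
 fix X E assume [measurable]: "X : sets A" "E : sets (B >< C)"
 let ?f = "%z. (fst (fst z), (snd (fst z), snd z))"
 have "emeasure (distr ((A >< B) >< C) (A >< (B >< C)) ?f) (X \<times> E) =
  (\<integral>\<^sup>+z. Ind (X \<times> E) z \<partial>distr ((A >< B) >< C) (A >< (B >< C)) ?f)"
  by (subst nn_integral_indicator) auto
 also have "... = (\<integral>\<^sup>+z. Ind X (fst (fst z)) * Ind E (snd (fst z), snd z) \<partial>((A >< B) >< C))"
  by (subst nn_integral_distr) (auto simp: indicator_times)
 also have "... = (\<integral>\<^sup>+p. \<integral>\<^sup>+c. Ind X (fst p) * Ind E (snd p, c) \<partial>C \<partial>(A >< B))"
  by (subst C.nn_integral_fst[symmetric]) auto
 also have "... = (\<integral>\<^sup>+p. Ind X (fst p) * (\<integral>\<^sup>+c. Ind E (snd p, c) \<partial>C) \<partial>(A >< B))"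
 proof (intro nn_integral_cong nn_integral_cmult)
  fix p assume "p : space (A >< B)"
  hence "snd p : space B" by (auto simp: sp_pair)
  thus "(%c. Ind E (snd p, c)) : Bm C"
   by (intro m_comp[OF measurable_Pair1'[of "snd p" B C]]) auto
 qed
 also have "... = (\<integral>\<^sup>+a. Ind X a \<partial>A) * (\<integral>\<^sup>+b. \<integral>\<^sup>+c. Ind E (b, c) \<partial>C \<partial>B)"
  by (rule nn_integral_pair_prod[OF B.sigma_finite_measure_axioms]) auto
 also have "... = emeasure A X * emeasure (B >< C) E"
  by (simp add: C.nn_integral_fst)
 finally show "emeasure A X * emeasure (B >< C) E =
  emeasure (distr ((A >< B) >< C) (A >< (B >< C)) ?f) (X \<times> E)" ..
qed simp

lemma bij_push: "bij push"
proof (rule bijI)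
 show "inj push"
  by (rule injI) (auto simp: push_def split: if_splits; presburger)
 show "surj push"
 proof (rule surjI)
  fix m :: nat
  show "push (if m = 0 then 0 else if m = 2 then 1 else if odd m then m + 2 else m - 2) = m"
   by (auto simp: push_def)
 qed
qed

lemma push_simps: "push 0 = 0" "push (odds 0) = 2" "push (odds (Suc k)) = odds k"
 by (auto simp: push_def odds_def)

section \<open>Conditioning on the labelled points with odd indices\<close>

context coupling
begin

definition past :: "(nat => nat) => (nat => 'a) \<times> arr => (nat => 'a) \<times> (nat => real)" where
 "past \<theta> z = (%k. fst z (\<theta> k), %k. snd z (\<theta> k) (\<theta> k))"

abbreviation PN :: "((nat => 'a) \<times> (nat => real)) measure" where
 "PN \<equiv> seqs M >< borel"

lemma measurable_past: "past \<theta> : J ->M PN"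
 unfolding past_def[abs_def]
 by (intro m_Pair measurable_seqsI mX) (rule measurable_coordinatewise_then_product, rule mA)

lemma past_perm: "past \<theta> (perm pq z) = past (%k. pq (\<theta> k)) z"
 by (simp add: past_def fst_perm snd_perm)

definition point :: "nat => (nat => 'a) \<times> arr => 'a \<times> real" where
 "point i z = (fst z i, snd z i i)"

lemma measurable_point: "point i : J ->M M >< borel"
 unfolding point_def[abs_def] by (intro m_Pair mX mA)

lemma point_perm: "point i (perm pq z) = point (pq i) z"
 by (simp add: point_def fst_perm snd_perm)

lemma distr_J_fst: "distr J (seqs M) fst = seqs M"
proof -
 interpret noise: prob_space noise by simp
 have 1: "(%z. (fst z, offd (snd z))) : J ->M seqs M >< borel"
  unfolding measurable_J
  by (intro m_Pair m_fst m_comp[OF m_snd measurable_offd])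
 have 2: "(%z. (fst z, smat Ps (%_. 0) z)) : samp M ->M seqs M >< borel"
  by (intro m_Pair measurable_smat) (simp_all add: samp_def)
 have "distr J (seqs M) (fst o (%z. (fst z, offd (snd z)))) = distr (samp M) (seqs M) (fst o (%z. (fst z, smat Ps (%_. 0) z)))"
  unfolding distr_distr[OF m_fst 1, symmetric] distr_distr[OF m_fst 2, symmetric] J_offd ..
 moreover have "distr (samp M) (seqs M) fst = seqs M"
  unfolding samp_def by (rule noise.distr_pair_fst)
 ultimately show ?thesis by (simp add: comp_def)
qed

text \<open>Points with even indices all have the same correlation with a function of the odd ones.
  As their \<open>g\<close>-values are pairwise uncorrelated, that correlation is zero.\<close>

lemma independent_of_past:
 fixes g :: "'a \<times> real => real" and G :: "(nat => 'a) \<times> (nat => real) => real"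
 assumes g: "g : Bm (M >< borel)" "!!p. \<bar>g p\<bar> <= 1"
  and G: "G : Bm PN" "!!p. \<bar>G p\<bar> <= 1"
  and centred: "(LINT z|J. g (point 0 z) * g (point 1 z)) = 0"
 shows "(LINT z|J. G (past odds z) * g (point 0 z)) = 0"
proof -
 interpret J: prob_space J by (rule J_prob)
 have mG: "(%z. G (past \<theta> z)) : Bm J" for \<theta> by (rule m_comp[OF measurable_past G(1)])
 have mg: "(%z. g (point i z)) : Bm J" for i by (rule m_comp[OF measurable_point g(1)])
 define a where "a = (LINT z|J. G (past odds z) * g (point 0 z))"
 have "a\<^sup>2 <= 0"
 proof (rule J.exchangeable_Cauchy_Schwarz[where h="%z. G (past odds z)" and T="%j z. g (point (evens j) z)"])
  fix j
  have "Transposition.transpose 0 (evens j) (odds k) = odds k" for k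
   by (auto simp: Transposition.transpose_def evens_def odds_def; presburger)
  moreover have "bij (Transposition.transpose 0 (evens j))" by simp
  ultimately show "(LINT z|J. G (past odds z) * g (point (evens j) z)) = a"
   using integral_perm[of "Transposition.transpose 0 (evens j)" "%z. G (past odds z) * g (point 0 z)"]
   unfolding a_def past_perm point_perm by (simp only: bm_times mG mg transpose_apply_first simp_thms)
 next
  fix j k :: nat assume "j ~= k"
  hence "inj_on (%i::nat. if i = 0 then evens j else evens k) {..<2}"
   by (auto simp: inj_on_def evens_def)
  from extend_inj_to_bij[OF this] obtain pq :: "nat => nat"
   where pq: "bij pq" "\<forall>i<2. pq i = (if i = 0 then evens j else evens k)" by blast
  hence pq': "pq 0 = evens j" "pq 1 = evens k" by auto
  show "(LINT z|J. g (point (evens j) z) * g (point (evens k) z)) = 0"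
   using integral_perm[OF pq(1), of "%z. g (point 0 z) * g (point 1 z)"]
   unfolding point_perm pq' centred by (simp only: bm_times mg)
 qed (intro mG mg G g)+
 thus ?thesis unfolding a_def[symmetric] by simp
qed

lemma integral_J_fst:
 fixes f :: "(nat => 'a) => real"
 assumes "f : Bm (seqs M)"
 shows "(LINT z|J. f (fst z)) = (LINT x|seqs M. f x)"
proof -
 have "fst : J ->M seqs M" unfolding measurable_J by (rule m_fst)
 from integral_distr[OF this assms] show ?thesis unfolding distr_J_fst by simp
qed

lemma indicator_point_fst:
 assumes B: "B : sets M"
 shows "(LINT z|J. Ind B (fst z i)) = measure M B"
proof -
 have m: "(%x. Ind B (x i) :: real) : Bm (seqs M)"
  by (rule m_comp[OF measurable_seqs_component bm_ind[OF B]])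
 have "(LINT x|(\<Pi>\<^sub>M i\<in>UNIV. M). (\<Prod>j\<in>{i}. Ind B (x j) :: real)) = (\<Prod>j\<in>{i}. LINT x|M. Ind B x)"
  by (rule integral_PiM_prod[where g="%_. Ind B" and B=1]) (use B prob_space_axioms in \<open>auto simp: indicator_def\<close>)
 thus ?thesis
  unfolding integral_J_fst[OF m] using B by (simp add: seqs_def sets.sets_into_space Int_absorb2)
qed

text \<open>The past contains labels that may depend on the whole array, so independence is not
  immediate. It follows from \<open>independent_of_past\<close> for the centred indicator of
  \<open>B\<close>, because the points themselves are iid.\<close>

lemma point_independent_of_past:
 assumes B: "B : sets M" and C: "C : sets PN"
 shows "measure J {z : space J. fst z 0 : B & past odds z : C} = measure M B * measure (distr J PN (past odds)) C"
proof -
 interpret J: prob_space J by (rule J_prob)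
 have mB: "(%z. Ind B (fst z i) :: real) : Bm J" for i
  by (rule m_comp[OF mX bm_ind[OF B]])
 have mC: "(%z. Ind C (past odds z) :: real) : Bm J"
  by (rule m_comp[OF measurable_past bm_ind[OF C]])
 have iB: "integrable J (%z. Ind B (fst z i) :: real)" for i
  by (rule J.integrable_bounded[OF mB, where B=1]) (simp add: indicator_def)
 have iC: "integrable J (%z. Ind C (past odds z) :: real)"
  by (rule J.integrable_bounded[OF mC, where B=1]) (simp add: indicator_def)
 have iBB: "integrable J (%z. Ind B (fst z 0) * Ind B (fst z 1) :: real)"
  by (rule J.integrable_bounded[OF bm_times[OF mB mB], where B=1]) (simp add: indicator_def)
 have iBC: "integrable J (%z. Ind C (past odds z) * Ind B (fst z 0) :: real)"
  by (rule J.integrable_bounded[OF bm_times[OF mC mB], where B=1]) (simp add: indicator_def)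
 define b where "b = measure M B"
 have b: "0 <= b" "b <= 1" unfolding b_def by auto
 have mBB: "(%x. Ind B (x 0) * Ind B (x 1) :: real) : Bm (seqs M)"
  by (intro bm_times m_comp[OF measurable_seqs_component bm_ind[OF B]])
 have "(LINT z|J. Ind B (fst z 0) * Ind B (fst z 1)) = b * b"
 proof -
  have "(LINT x|(\<Pi>\<^sub>M i\<in>UNIV. M). (\<Prod>j\<in>{0, 1::nat}. Ind B (x j) :: real)) = (\<Prod>j\<in>{0, 1::nat}. LINT x|M. Ind B x)"
   by (rule integral_PiM_prod[where g="%_. Ind B" and B=1]) (use B prob_space_axioms in \<open>auto simp: indicator_def\<close>)
  thus ?thesis
   unfolding integral_J_fst[OF mBB] using B by (simp add: seqs_def b_def sets.sets_into_space Int_absorb2)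
 qed
 note bb = this
 have "(LINT z|J. Ind C (past odds z) * (Ind B (fst (point 0 z)) - b)) = 0"
 proof (rule independent_of_past[where g="%p. Ind B (fst p) - b"])
  show "(%p. Ind B (fst p) - b) : Bm (M >< borel)"
   by (intro borel_measurable_diff m_comp[OF m_fst bm_ind[OF B]]) simp
  show "\<bar>indicator B (fst p) - b\<bar> <= 1" for p :: "'a \<times> real" using b by (simp add: indicator_def)
  show "Ind C : Bm PN" using C by simp
  show "\<bar>indicator C p\<bar> <= (1::real)" for p by (simp add: indicator_def)
  have "(LINT z|J. (Ind B (fst (point 0 z)) - b) * (Ind B (fst (point 1 z)) - b)) =
   (LINT z|J. Ind B (fst z 0) * Ind B (fst z 1) - b * Ind B (fst z 0) - b * Ind B (fst z 1) + b * b)"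
   by (intro b_cong) (auto simp: point_def algebra_simps)
  also have "... = 0"
   using iB iBB bb indicator_point_fst[OF B] by (simp add: J.prob_space b_def)
  finally show "(LINT z|J. (Ind B (fst (point 0 z)) - b) * (Ind B (fst (point 1 z)) - b)) = 0" .
 qed
 hence "(LINT z|J. Ind C (past odds z) * Ind B (fst z 0) - b * Ind C (past odds z)) = 0"
  by (simp add: point_def algebra_simps)
 hence "(LINT z|J. Ind C (past odds z) * Ind B (fst z 0)) = b * (LINT z|J. Ind C (past odds z))"
  using iC iBC by simp
 moreover have "(LINT z|J. Ind C (past odds z) * Ind B (fst z 0)) = measure J {z : space J. fst z 0 : B & past odds z : C}"
 proof -
  have "(LINT z|J. Ind C (past odds z) * Ind B (fst z 0)) = (LINT z|J. Ind {z : space J. fst z 0 : B & past odds z : C} z :: real)"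
   by (intro b_cong) (auto simp: indicator_def)
  also have "... = measure J ({z : space J. fst z 0 : B & past odds z : C} Int space J)"
   by (rule Bochner_Integration.integral_indicator)
  also have "{z : space J. fst z 0 : B & past odds z : C} Int space J = {z : space J. fst z 0 : B & past odds z : C}"
   by auto
  finally show ?thesis .
 qed
 moreover have "(LINT z|J. Ind C (past odds z)) = measure (distr J PN (past odds)) C"
 proof -
  have "(LINT z|distr J PN (past odds). Ind C z) = (LINT z|J. Ind C (past odds z) :: real)"
   by (rule integral_distr[OF measurable_past]) (use C in simp)
  thus ?thesis using C sets.sets_into_space[OF C] by (simp add: Int_absorb2 sp_pair)
 qed
 ultimately show ?thesis unfolding b_def by simp
qed

text \<open>
 De Finetti's theorem for the labelled points: conditionally on the points with odd indices,
 two further labelled points are independent and have the same law, whose first marginal is \<open>M\<close>.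
\<close>
theorem conditional_sampler:
 assumes e: "!!k. e k : Bm borel"
  and lip: "AE z in J. ALL k. e k (snd z 0 0) - e k (snd z 1 1) <= snd z 0 1"
  and unit: "AE z in J. 0 <= snd z 0 0 & snd z 0 0 <= 1"
  and diss: "!!V. V : sets borel ==>
   (LINT z|J. Ind V (snd z 0 0) * Ind V (snd z 1 1)) = (LINT z|J. Ind V (snd z 0 0)) * (LINT z|J. Ind V (snd z 0 0) :: real)"
  and \<V>: "finite \<V>" "\<V> <= sets borel"
 obtains F :: "'a => real => real" where "(%p. F (fst p) (snd p)) : Bm (M >< unif)"
  "AE p in (M >< unif) >< (M >< unif). compatible e ((fst (fst p), F (fst (fst p)) (snd (fst p))),
   (fst (snd p), F (fst (snd p)) (snd (snd p))))"
  "!!V. V : \<V> ==> (LINT p|(M >< unif). Ind V (F (fst p) (snd p))) = (LINT z|J. Ind V (snd z 0 0) :: real)"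
proof -
 interpret J: prob_space J by (rule J_prob)
 interpret unif: prob_space unif by simp
 define rh where "rh = distr J PN (past odds)"
 have rh_sets: "sets rh = sets PN" by (simp add: rh_def)
 interpret R: prob_space rh unfolding rh_def by (rule J.prob_space_distr[OF measurable_past])
 define MU where "MU = M >< unif"
 interpret MU: prob_space MU unfolding MU_def by (intro prob_space_pair prob_space_axioms prob_space_unif)
 let ?W = "M >< (borel :: real measure)"
 have m0: "(%z. (past odds z, fst z 0)) : J ->M PN >< M" by (intro m_Pair measurable_past mX)
 have m1: "(%z. ((past odds z, fst z 0), snd z 0 0)) : J ->M (PN >< M) >< borel"
  by (intro m_Pair measurable_past mX mA)
 define Q where "Q = distr J ((PN >< M) >< borel) (%z. ((past odds z, fst z 0), snd z 0 0))"
 have Qp: "prob_space Q" unfolding Q_def by (rule J.prob_space_distr[OF m1])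
 have Qs: "sets Q = sets ((PN >< M) >< borel)" by (simp add: Q_def)
 have Qu: "AE q in Q. snd q : {0..1}"
 proof -
  have "{q : space ((PN >< M) >< borel). snd q : {0..1}} : sets ((PN >< M) >< (borel :: real measure))"
   using measurable_sets[OF m_snd, of "{0..1::real}" borel "PN >< M"] by (simp only: vimage_def Int_def mem_Collect_eq conj_commute) simp
  from AE_distr_iff[OF m1 this] show ?thesis unfolding Q_def using unit by simp
 qed
 \<comment> \<open>The point is independent of the past, so freezing the past later leaves
   \<open>M\<close> as the law of the point.\<close>
 have Qf: "distr Q (PN >< M) fst = rh >< M"
 proof -
  have "distr Q (PN >< M) fst = distr J (PN >< M) (%z. (past odds z, fst z 0))"
   unfolding Q_def by (subst distr_distr[OF m_fst m1]) (simp add: comp_def)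
  also have "... = rh >< M"
  proof (rule pair_measure_eqI[symmetric])
   show "sigma_finite_measure rh" "sigma_finite_measure M" by unfold_locales
   show "sets (rh >< M) = sets (distr J (PN >< M) (%z. (past odds z, fst z 0)))"
    by (simp add: rh_sets cong: sets_pair_measure_cong)
   fix C B assume "C : sets rh" and B: "B : sets M"
   hence C: "C : sets PN" by (simp add: rh_sets)
   have "emeasure (distr J (PN >< M) (%z. (past odds z, fst z 0))) (C \<times> B) =
    emeasure J {z : space J. fst z 0 : B & past odds z : C}"
    by (subst emeasure_distr[OF m0]) (use B C in \<open>auto intro!: arg_cong[where f="emeasure J"]\<close>)
   also have "... = emeasure rh C * emeasure M B"
    unfolding J.emeasure_eq_measure R.emeasure_eq_measure emeasure_eq_measure point_independent_of_past[OF B C] rh_def[symmetric]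
    by (simp add: ennreal_mult mult.commute)
   finally show "emeasure rh C * emeasure M B = emeasure (distr J (PN >< M) (%z. (past odds z, fst z 0))) (C \<times> B)" ..
  qed
  finally show ?thesis .
 qed
 from noise_outsourcing[OF Qp Qs Qu, unfolded Qf]
 obtain Ph where Ph: "(%q. Ph (fst q) (snd q)) : Bm ((PN >< M) >< borel)"
  and Q_eq: "Q = distr ((rh >< M) >< unif) ((PN >< M) >< borel) (%q. (fst q, Ph (fst q) (snd q)))" .
 define w where "w ze p = (fst p, Ph (ze, fst p) (snd p))" for ze p
 have s1: "sets (rh >< MU) = sets (PN >< (M >< borel))"
  unfolding MU_def by (intro sets_pair_measure_cong rh_sets refl sets_unif)
 have s2: "sets ((rh >< M) >< unif) = sets ((PN >< M) >< borel)"
  by (intro sets_pair_measure_cong rh_sets refl sets_unif)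
 have mw: "(%q. w (fst q) (snd q)) : rh >< MU ->M ?W"
  unfolding w_def m_cong_sets[OF s1 refl]
 proof (intro m_Pair m_comp[OF m_snd m_fst])
  have "(%q. ((fst q, fst (snd q)), snd (snd q))) : PN >< (M >< borel) ->M (PN >< M) >< (borel :: real measure)"
   by (intro m_Pair m_fst m_comp[OF m_snd m_fst] m_comp[OF m_snd m_snd])
  from m_comp[OF this Ph]
  show "(%q. Ph (fst q, fst (snd q)) (snd (snd q))) : Bm (PN >< (M >< borel))"
   by (simp only: fst_conv snd_conv)
 qed
 have mw1: "w ze : MU ->M ?W" if "ze : space rh" for ze
  using m_comp[OF measurable_Pair1'[OF that] mw] by (simp only: fst_conv snd_conv)
 have mfw: "(%q. (fst q, w (fst q) (snd q))) : rh >< MU ->M PN >< ?W"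
  by (rule m_Pair[OF _ mw]) (simp add: m_cong_sets[OF refl rh_sets, symmetric])
 have mpp: "(%z. (past odds z, point 0 z)) : J ->M PN >< ?W"
  by (intro m_Pair measurable_past measurable_point)
 have law1: "distr J (PN >< ?W) (%z. (past odds z, point 0 z)) = distr (rh >< MU) (PN >< ?W) (%q. (fst q, w (fst q) (snd q)))"
 proof -
  let ?as = "%q. (fst (fst q), (snd (fst q), snd q))"
  have ma: "?as : (PN >< M) >< borel ->M PN >< ?W"
   by (intro m_Pair m_comp[OF m_fst m_fst] m_comp[OF m_fst m_snd] m_snd)
  have ma': "?as : (rh >< M) >< unif ->M rh >< MU" unfolding MU_def
   by (intro m_Pair m_comp[OF m_fst m_fst] m_comp[OF m_fst m_snd] m_snd)
  have mq: "(%q. (fst q, Ph (fst q) (snd q))) : (rh >< M) >< unif ->M (PN >< M) >< borel"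
   unfolding m_cong_sets[OF s2 refl] by (intro m_Pair m_fst Ph)
  have "distr J (PN >< ?W) (%z. (past odds z, point 0 z)) = distr Q (PN >< ?W) ?as"
   unfolding Q_def by (subst distr_distr[OF ma m1]) (simp add: comp_def point_def)
  also have "... = distr ((rh >< M) >< unif) (PN >< ?W) (?as o (%q. (fst q, Ph (fst q) (snd q))))"
   unfolding Q_eq by (rule distr_distr[OF ma mq])
  also have "?as o (%q. (fst q, Ph (fst q) (snd q))) = (%q. (fst q, w (fst q) (snd q))) o ?as"
   by (simp add: fun_eq_iff w_def)
  also have "distr ((rh >< M) >< unif) (PN >< ?W) ... =
   distr (distr ((rh >< M) >< unif) (rh >< MU) ?as) (PN >< ?W) (%q. (fst q, w (fst q) (snd q)))"
   by (rule distr_distr[OF mfw ma', symmetric])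
  also have "distr ((rh >< M) >< unif) (rh >< MU) ?as = rh >< MU"
   unfolding MU_def by (rule distr_pair_assoc[OF R.prob_space_axioms prob_space_axioms prob_space_unif])
  finally show ?thesis .
 qed
 \<comment> \<open>Conditional law of a labelled point given the past.\<close>
 define k :: "('a \<times> real) set => _ => real" where "k B ze = (LINT p|MU. Ind B (w ze p))" for B ze
 have miw: "(%(ze, p). Ind B (w ze p) :: real) : Bm (rh >< MU)" if "B : sets ?W" for B
  using m_comp[OF mw bm_ind[OF that]] by (simp only: case_prod_unfold)
 have mk: "k B : Bm PN" if "B : sets ?W" for B
  using MU.borel_measurable_lebesgue_integral[OF miw[OF that]] unfolding k_def[abs_def] m_cong_sets[OF rh_sets refl] .
 have k01: "0 <= k B ze & k B ze <= 1" for B ze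
 proof
  show "0 <= k B ze" unfolding k_def by (rule Bochner_Integration.integral_nonneg) simp
  show "k B ze <= 1"
  proof (cases "integrable MU (%p. Ind B (w ze p) :: real)")
   case True
   hence "k B ze <= (LINT p|MU. 1)" unfolding k_def
    by (intro integral_mono) (auto simp: indicator_def)
   thus ?thesis by (simp add: MU.prob_space)
  qed (simp add: k_def not_integrable_integral_eq)
 qed
 interpret RM: pair_sigma_finite rh MU ..
 interpret RMP: prob_space "rh >< MU" by (rule prob_space_pair) unfold_locales
 have int_past: "(LINT z|J. f (past odds z)) = (LINT ze|rh. f ze)" if "f : Bm PN" for f :: "_ => real"
  unfolding rh_def by (rule integral_distr[OF measurable_past that, symmetric])
 have ce: "(LINT z|J. Ind B (point 0 z) * G (past odds z)) = (LINT z|J. k B (past odds z) * G (past odds z))"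
  if B: "B : sets ?W" and G: "G : Bm PN" "!!ze. 0 <= G ze & G ze <= (1::real)" for B G
 proof -
  have mH: "(%q. Ind B (snd q) * G (fst q) :: real) : Bm (PN >< ?W)"
   by (intro bm_times m_comp[OF m_snd bm_ind[OF B]] m_comp[OF m_fst G(1)])
  have mH': "(%q. Ind B (w (fst q) (snd q)) * G (fst q) :: real) : Bm (rh >< MU)"
   using m_comp[OF mfw mH] by (simp only: fst_conv snd_conv)
  have int: "integrable (rh >< MU) (%q. Ind B (w (fst q) (snd q)) * G (fst q) :: real)"
   by (rule RMP.integrable_bounded[OF mH', where B=1]) (use G(2) in \<open>auto simp: indicator_def\<close>)
  have "(LINT z|J. Ind B (point 0 z) * G (past odds z)) =
   (LINT q|distr J (PN >< ?W) (%z. (past odds z, point 0 z)). Ind B (snd q) * G (fst q))"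
   by (subst integral_distr[OF mpp mH]) (simp only: fst_conv snd_conv)
  also have "... = (LINT q|(rh >< MU). Ind B (w (fst q) (snd q)) * G (fst q))"
   unfolding law1 by (subst integral_distr[OF mfw mH]) (simp only: fst_conv snd_conv)
  also have "... = (LINT ze|rh. LINT p|MU. Ind B (w ze p) * G ze)"
   using RM.integral_fst'[OF int] by (simp only: fst_conv snd_conv)
  also have "... = (LINT ze|rh. k B ze * G ze)"
   unfolding k_def by (simp only: Bochner_Integration.integral_mult_left_zero)
  also have "... = (LINT z|J. k B (past odds z) * G (past odds z))"
   by (rule int_past[symmetric]) (intro bm_times mk B G)
  finally show ?thesis .
 qed
 define tl where "tl q = (%k. fst q (Suc k), %k. snd q (Suc k))" for q :: "(nat => 'a) \<times> (nat => real)"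
 have mtl: "tl : PN ->M PN"
  unfolding tl_def[abs_def]
  by (intro m_Pair measurable_seqsI m_comp[OF m_fst measurable_seqs_component]
    m_comp[OF m_snd measurable_reindex])
 define odds' where "odds' k = push (odds k)" for k
 have tl_past: "tl (past odds' z) = past odds z" for z
  by (simp add: tl_def past_def odds'_def push_simps)
 have hd_past: "(fst (past odds' z) 0, snd (past odds' z) 0) = point 2 z" for z
  by (simp add: past_def odds'_def push_simps point_def)
 \<comment> \<open>The past together with the labelled point 2 is again a past up to
   \<open>push\<close>. By \<open>cond_exp_stable\<close> the conditional law of point 0 is the same
   for both, so points 0 and 2 are conditionally iid.\<close>
 have triple: "(LINT z|J. Ind B (point 0 z) * (Ind C (point 2 z) * Ind D (past odds z))) =
   (LINT ze|rh. k B ze * (k C ze * Ind D ze))"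
  if B: "B : sets ?W" and C: "C : sets ?W" and D: "D : sets PN" for B C D
 proof -
  define G where "G q = (Ind C (fst q 0, snd q 0) * Ind D (tl q) :: real)" for q
  have mG: "G : Bm PN"
   unfolding G_def[abs_def]
   by (intro bm_times m_comp[OF mtl bm_ind[OF D]]
     m_comp[OF _ bm_ind[OF C]] m_Pair
     m_comp[OF m_fst measurable_seqs_component] m_comp[OF m_snd measurable_product_coordinates])
  have G01: "0 <= G q & G q <= 1" for q by (simp add: G_def indicator_def)
  have Gp: "G (past odds' z) = Ind C (point 2 z) * Ind D (past odds z)" for z
   unfolding G_def hd_past tl_past ..
  have mpo: "(%z. (Ind B (point 0 z) :: real, past odds z)) : J ->M borel >< PN"
   by (intro m_Pair measurable_past m_comp[OF measurable_point bm_ind[OF B]])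
  have mpo': "(%z. (Ind B (point 0 z) :: real, past odds z)) : seqs M >< borel ->M borel >< PN"
   using mpo unfolding measurable_J .
  have lw: "distr J (borel >< PN) (%z. (Ind B (point 0 z) :: real, past odds z)) =
   distr J (borel >< PN) (%z. (Ind B (point 0 z), past odds' z))"
  proof -
   have "distr (distr J (seqs M >< borel) (perm push)) (borel >< PN) (%z. (Ind B (point 0 z) :: real, past odds z)) =
    distr J (borel >< PN) ((%z. (Ind B (point 0 z), past odds z)) o perm push)"
    by (rule distr_distr[OF mpo' measurable_perm])
   moreover have "(%z. (Ind B (point 0 z) :: real, past odds z)) o perm push = (%z. (Ind B (point 0 z), past odds' z))"
    by (simp add: fun_eq_iff point_perm past_perm push_simps odds'_def[abs_def])
   ultimately show ?thesis unfolding distr_perm[OF bij_push] by simp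
  qed
  have "(LINT z|J. Ind B (point 0 z) * G (past odds' z)) = (LINT z|J. k B (past odds z) * G (past odds' z))"
   by (rule J.cond_exp_stable(2)[where N=PN and \<phi>=tl and k="k B" and et="past odds",
      OF m_comp[OF measurable_point bm_ind[OF B]] measurable_past measurable_past mtl mk[OF B]
      _ k01 tl_past[symmetric] lw ce[OF B] mG G01]) (simp_all add: indicator_def)
  also have "... = (LINT z|J. k B (past odds z) * (Ind C (point 2 z) * Ind D (past odds z)))"
   unfolding Gp ..
  also have "... = (LINT z|J. k B (past odds z) * (Ind C (point 0 z) * Ind D (past odds z)))"
  proof -
   have b: "bij (Transposition.transpose 0 (2::nat))" by simp
   have t: "Transposition.transpose 0 2 (odds k) = odds k" for k
    by (auto simp: Transposition.transpose_def odds_def; presburger)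
   have m: "(%z. k B (past odds z) * (Ind C (point 0 z) * Ind D (past odds z))) : Bm J"
    by (intro bm_times m_comp[OF measurable_past mk[OF B]]
      m_comp[OF measurable_point bm_ind[OF C]] m_comp[OF measurable_past bm_ind[OF D]])
   show ?thesis using integral_perm[OF b m] unfolding past_perm point_perm t transpose_apply_first .
  qed
  also have "... = (LINT z|J. Ind C (point 0 z) * (k B (past odds z) * Ind D (past odds z)))"
   by (intro b_cong) (simp_all only: mult.left_commute)
  also have "... = (LINT z|J. k C (past odds z) * (k B (past odds z) * Ind D (past odds z)))"
  proof (rule ce[OF C])
   show "(%ze. k B ze * Ind D ze) : Bm PN"
    by (intro bm_times mk B bm_ind D)
   show "0 <= k B ze * Ind D ze & k B ze * Ind D ze <= 1" for ze
    using k01[of B ze] by (simp add: indicator_def)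
  qed
  also have "... = (LINT ze|rh. k C ze * (k B ze * Ind D ze))"
   by (rule int_past) (intro bm_times mk B C bm_ind D)
  finally show ?thesis unfolding Gp by (simp only: mult.left_commute)
 qed
 define wp where "wp q = (fst q, (w (fst q) (fst (snd q)), w (fst q) (snd (snd q))))" for q
 have MUMU: "prob_space (MU >< MU)" by (rule prob_space_pair) unfold_locales
 interpret MM: prob_space "MU >< MU" by fact
 have mwp: "wp : rh >< (MU >< MU) ->M PN >< (?W >< ?W)"
 proof -
  have a: "(%q. (fst q, fst (snd q))) : rh >< (MU >< MU) ->M rh >< MU"
   by (intro m_Pair m_fst m_comp[OF m_snd m_fst])
  have b: "(%q. (fst q, snd (snd q))) : rh >< (MU >< MU) ->M rh >< MU"
   by (intro m_Pair m_fst m_comp[OF m_snd m_snd])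
  have c: "fst : rh >< (MU >< MU) ->M PN"
   unfolding m_cong_sets[OF refl rh_sets, symmetric] by (rule m_fst)
  show ?thesis unfolding wp_def[abs_def]
   using m_Pair[OF c m_Pair[OF m_comp[OF a mw] m_comp[OF b mw]]]
   by (simp only: fst_conv snd_conv)
 qed
 have mp2: "(%z. (past odds z, (point 0 z, point 2 z))) : J ->M PN >< (?W >< ?W)"
  by (intro m_Pair measurable_past measurable_point)
 have law2: "distr J (PN >< (?W >< ?W)) (%z. (past odds z, (point 0 z, point 2 z))) =
  distr (rh >< (MU >< MU)) (PN >< (?W >< ?W)) wp" (is "?L = ?R")
 proof (rule pair_slice_eqI)
  have sL: "sets ?L = sets (PN >< (?W >< ?W))" and sR: "sets ?R = sets (PN >< (?W >< ?W))" by simp_all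
  show "sets ?L = sets (PN >< (?W >< ?W))" "sets ?R = sets (PN >< (?W >< ?W))" by (rule sL sR)+
  have fR: "prob_space ?R"
   by (intro prob_space.prob_space_distr[OF _ mwp] prob_space_pair MUMU) unfold_locales
  show fLR: "finite_measure ?L" "finite_measure ?R"
   by (rule prob_space.finite_measure[OF J.prob_space_distr[OF mp2]] prob_space.finite_measure[OF fR])+
  fix D assume D: "D : sets PN"
  show "slice ?L D (?W >< ?W) = slice ?R D (?W >< ?W)"
  proof (rule pair_rect_eqI)
   show "finite_measure (slice ?L D (?W >< ?W))" "finite_measure (slice ?R D (?W >< ?W))"
    by (rule finite_measure_slice[OF fLR(1) sL D] finite_measure_slice[OF fLR(2) sR D])+
   fix B C assume B: "B : sets ?W" and C: "C : sets ?W"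
   have DBC: "D \<times> (B \<times> C) : sets (PN >< (?W >< ?W))" using B C D by auto
   have mi: "(%p. Ind X (w ze p) :: ennreal) : Bm MU" if "X : sets ?W" "ze : space rh" for X ze
    by (rule m_comp[OF mw1[OF that(2)] bm_ind[OF that(1)]])
   have mir: "(%p. Ind X (w ze p) :: real) : Bm MU" if "X : sets ?W" "ze : space rh" for X ze
    by (rule m_comp[OF mw1[OF that(2)] bm_ind[OF that(1)]])
   have kn: "(\<integral>\<^sup>+p. Ind X (w ze p) \<partial>MU) = ennreal (k X ze)" if "X : sets ?W" "ze : space rh" for X ze
   proof -
    have "integrable MU (%p. Ind X (w ze p) :: real)"
     by (rule MU.integrable_bounded[OF mir[OF that], where B=1]) (simp add: indicator_def)
    from nn_integral_eq_integral[OF this] show ?thesis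
     unfolding k_def by (simp add: ennreal_indicator)
   qed
   have "emeasure ?L (D \<times> (B \<times> C)) = emeasure J ((%z. (past odds z, (point 0 z, point 2 z))) -` (D \<times> (B \<times> C)) Int space J)" (is "_ = emeasure J ?S")
    by (rule emeasure_distr[OF mp2 DBC])
   also have "... = ennreal (LINT z|J. Ind ?S z :: real)"
    using measurable_sets[OF mp2 DBC] by (simp add: J.emeasure_eq_measure Int_absorb2)
   also have "(LINT z|J. Ind ?S z :: real) = (LINT z|J. Ind B (point 0 z) * (Ind C (point 2 z) * Ind D (past odds z)))"
    by (intro b_cong) (auto simp: indicator_def)
   also have "... = (LINT ze|rh. k B ze * (k C ze * Ind D ze))" by (rule triple[OF B C D])
   also have "ennreal ... = (\<integral>\<^sup>+ze. ennreal (k B ze * (k C ze * Ind D ze)) \<partial>rh)"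
   proof (rule nn_integral_eq_integral[symmetric])
    have "(%ze. k B ze * (k C ze * Ind D ze)) : Bm rh"
     unfolding m_cong_sets[OF rh_sets refl]
     by (intro bm_times mk B C bm_ind D)
    thus "integrable rh (%ze. k B ze * (k C ze * Ind D ze))"
    proof (rule R.integrable_bounded[where B=1])
     fix ze show "\<bar>k B ze * (k C ze * Ind D ze)\<bar> <= 1"
      using k01[of B ze] k01[of C ze] by (auto simp: indicator_def abs_mult mult_le_one)
    qed
    show "AE ze in rh. 0 <= k B ze * (k C ze * Ind D ze)" using k01 by simp
   qed
   also have "... = (\<integral>\<^sup>+ze. \<integral>\<^sup>+p. Ind (D \<times> (B \<times> C)) (wp (ze, p)) \<partial>(MU >< MU) \<partial>rh)"
   proof (rule nn_integral_cong)
    fix ze assume ze: "ze : space rh"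
    have "(\<integral>\<^sup>+p. Ind (D \<times> (B \<times> C)) (wp (ze, p)) \<partial>(MU >< MU)) =
     (\<integral>\<^sup>+p. (Ind D ze * Ind B (w ze (fst p))) * Ind C (w ze (snd p)) \<partial>(MU >< MU))"
     by (intro nn_integral_cong) (simp add: wp_def indicator_def)
    also have "... = (\<integral>\<^sup>+p. Ind D ze * Ind B (w ze p) \<partial>MU) * (\<integral>\<^sup>+p. Ind C (w ze p) \<partial>MU)"
     by (rule nn_integral_pair_prod[OF MU.sigma_finite_measure_axioms])
      (intro borel_measurable_times_ennreal borel_measurable_const mi B C ze)+
    also have "... = ennreal (k B ze * (k C ze * Ind D ze))"
     using kn[OF B ze] kn[OF C ze] k01[of B ze] k01[of C ze]
     by (subst nn_integral_cmult[OF mi[OF B ze]]) (simp add: ennreal_mult[symmetric] indicator_def)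
    finally show "ennreal (k B ze * (k C ze * Ind D ze)) = (\<integral>\<^sup>+p. Ind (D \<times> (B \<times> C)) (wp (ze, p)) \<partial>(MU >< MU))" ..
   qed
   also have "... = (\<integral>\<^sup>+q. Ind (D \<times> (B \<times> C)) (wp q) \<partial>(rh >< (MU >< MU)))"
    by (rule MM.nn_integral_fst[OF m_comp[OF mwp bm_ind[OF DBC]]])
   also have "... = (\<integral>\<^sup>+q. Ind (D \<times> (B \<times> C)) q \<partial>?R)"
    by (rule nn_integral_distr[OF mwp, symmetric]) (unfold measurable_distr_eq1, rule bm_ind[OF DBC])
   also have "... = emeasure ?R (D \<times> (B \<times> C))"
    by (rule nn_integral_indicator) (use DBC in simp)
   finally show "emeasure (slice ?L D (?W >< ?W)) (B \<times> C) = emeasure (slice ?R D (?W >< ?W)) (B \<times> C)"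
    using B C by (simp add: emeasure_slice[OF sL D] emeasure_slice[OF sR D])
  qed simp_all
 qed
 \<comment> \<open>Index 2 replaces index 1, which belongs to the past.\<close>
 have good1: "AE ze in rh. AE p in MU >< MU. compatible e (w ze (fst p), w ze (snd p))"
 proof -
  have b: "bij (Transposition.transpose 1 (2::nat))" by simp
  have "AE z in J. compatible e (point 0 z, point 2 z)"
   using AE_perm[OF b labels_compatible[OF e lip]]
   by (simp add: fst_perm snd_perm point_def Transposition.transpose_def)
  moreover have mc: "{q : space (PN >< (?W >< ?W)). compatible e (snd q)} : sets (PN >< (?W >< ?W))"
  proof -
   have "snd -` {p : space (?W >< ?W). compatible e p} Int space (PN >< (?W >< ?W)) : sets (PN >< (?W >< ?W))"
    by (rule measurable_sets[OF m_snd measurable_compatible[OF e]])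
   also have "snd -` {p : space (?W >< ?W). compatible e p} Int space (PN >< (?W >< ?W)) =
    {q : space (PN >< (?W >< ?W)). compatible e (snd q)}"
    by (auto simp: sp_pair)
   finally show ?thesis .
  qed
  ultimately have "AE q in distr J (PN >< (?W >< ?W)) (%z. (past odds z, (point 0 z, point 2 z))). compatible e (snd q)"
   by (subst AE_distr_iff[OF mp2 mc]) (simp only: snd_conv)
  hence "AE q in rh >< (MU >< MU). compatible e (snd (wp q))"
   unfolding law2 AE_distr_iff[OF mwp mc] .
  interpret RMM: pair_sigma_finite rh "MU >< MU" ..
  from RMM.AE_pair[OF \<open>AE q in rh >< (MU >< MU). compatible e (snd (wp q))\<close>]
  show ?thesis unfolding wp_def fst_conv snd_conv .
 qed
 \<comment> \<open>By \<open>diss\<close> the label events of two points are uncorrelated, so the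
   conditional probability of \<open>V\<close> has mean \<open>l\<close> and second moment
   \<open>l * l\<close>: it is almost surely constant.\<close>
 have good2: "AE ze in rh. k (space M \<times> V) ze = (LINT z|J. Ind V (snd z 0 0))" if V: "V : sets borel" for V
 proof -
  define l where "l = (LINT z|J. Ind V (snd z 0 0) :: real)"
  have mV: "(%z. Ind V (snd z i i) :: real) : Bm J" for i
   by (rule m_comp[OF mA bm_ind[OF V]])
  have iV: "integrable J (%z. Ind V (snd z i i) :: real)" for i
   by (rule J.integrable_bounded[OF mV, where B=1]) (simp add: indicator_def)
  have iVV: "integrable J (%z. Ind V (snd z 0 0) * Ind V (snd z 1 1) :: real)"
   by (rule J.integrable_bounded[OF bm_times[OF mV mV], where B=1]) (simp add: indicator_def)
  have l01: "0 <= l" "l <= 1"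
  proof -
   show "0 <= l" unfolding l_def by (rule Bochner_Integration.integral_nonneg) simp
   have "l <= (LINT z|J. 1)" unfolding l_def by (intro integral_mono iV) (auto simp: indicator_def)
   thus "l <= 1" by (simp add: J.prob_space)
  qed
  have l1: "(LINT z|J. Ind V (snd z 1 1)) = l"
  proof -
   have "bij (Transposition.transpose 0 (1::nat))" by simp
   from integral_perm[OF this mV[of 0]] show ?thesis unfolding l_def snd_perm by simp
  qed
  have WV: "space M \<times> V : sets ?W" using V by auto
  have kG: "(LINT z|J. k (space M \<times> V) (past odds z) * G (past odds z)) = l * (LINT z|J. G (past odds z))"
   if G: "G : Bm PN" "!!ze. 0 <= G ze & G ze <= (1::real)" for G
  proof -
   have mGp: "(%z. G (past odds z)) : Bm J" by (rule m_comp[OF measurable_past G(1)])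
   have "(LINT z|J. G (past odds z) * (Ind V (snd (point 0 z)) - l)) = 0"
   proof (rule independent_of_past[where g="%p. Ind V (snd p) - l"])
    show "(%p. Ind V (snd p) - l) : Bm ?W"
     by (intro borel_measurable_diff m_comp[OF m_snd bm_ind[OF V]]) simp
    show "\<bar>indicator V (snd p) - l\<bar> <= 1" for p :: "'a \<times> real" using l01 by (simp add: indicator_def)
    show "\<bar>G p\<bar> <= 1" for p using G(2)[of p] by simp
    have "(LINT z|J. (Ind V (snd (point 0 z)) - l) * (Ind V (snd (point 1 z)) - l)) =
     (LINT z|J. Ind V (snd z 0 0) * Ind V (snd z 1 1) - l * Ind V (snd z 0 0) - l * Ind V (snd z 1 1) + l * l)"
     by (intro b_cong) (auto simp: point_def algebra_simps)
    also have "... = 0"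
     using iV iVV diss[OF V] l1 by (simp add: J.prob_space l_def[symmetric])
    finally show "(LINT z|J. (Ind V (snd (point 0 z)) - l) * (Ind V (snd (point 1 z)) - l)) = 0" .
   qed (rule G(1))
   hence "(LINT z|J. Ind V (snd z 0 0) * G (past odds z) - l * G (past odds z)) = 0"
    by (simp add: point_def algebra_simps)
   moreover have "integrable J (%z. G (past odds z))"
    by (rule J.integrable_bounded[OF mGp, where B=1]) (use G(2) in auto)
   moreover have "integrable J (%z. Ind V (snd z 0 0) * G (past odds z))"
    by (rule J.integrable_bounded[OF bm_times[OF mV mGp], where B=1]) (use G(2) in \<open>auto simp: indicator_def\<close>)
   ultimately have "(LINT z|J. Ind V (snd z 0 0) * G (past odds z)) = l * (LINT z|J. G (past odds z))"
    by simp
   moreover have "(LINT z|J. Ind V (snd z 0 0) * G (past odds z)) = (LINT z|J. Ind (space M \<times> V) (point 0 z) * G (past odds z))"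
   proof (rule b_cong[OF refl])
    fix z assume "z : space J"
    hence "fst z 0 : space M" using measurable_space[OF mX[of 0]] by simp
    thus "Ind V (snd z 0 0) * G (past odds z) = Ind (space M \<times> V) (point 0 z) * G (past odds z)"
     by (simp add: point_def indicator_def)
   qed
   ultimately show ?thesis using ce[OF WV G] by simp
  qed
  let ?k = "k (space M \<times> V)"
  have mkJ: "(%z. ?k (past odds z)) : Bm J" by (rule m_comp[OF measurable_past mk[OF WV]])
  have i1: "integrable J (%z. ?k (past odds z))"
   by (rule J.integrable_bounded[OF mkJ, where B=1]) (use k01 in auto)
  have i2: "integrable J (%z. ?k (past odds z) * ?k (past odds z))"
   by (rule J.integrable_bounded[OF bm_times[OF mkJ mkJ], where B=1]) (use k01 in \<open>auto simp: abs_mult mult_le_one\<close>)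
  have e1: "(LINT z|J. ?k (past odds z)) = l" using kG[of "%_. 1"] by (simp add: J.prob_space)
  have e2: "(LINT z|J. ?k (past odds z) * ?k (past odds z)) = l * l" using kG[OF mk[OF WV] k01] e1 by simp
  have "(LINT z|J. (?k (past odds z) - l)\<^sup>2) = (LINT z|J. ?k (past odds z) * ?k (past odds z) - 2 * l * ?k (past odds z) + l * l)"
   by (intro b_cong) (auto simp: power2_eq_square algebra_simps)
  also have "... = 0" using i1 i2 e1 e2 by (simp add: J.prob_space)
  finally have z0: "(LINT ze|rh. (?k ze - l)\<^sup>2) = 0"
   using int_past[of "%ze. (?k ze - l)\<^sup>2"] mk[OF WV] by simp
  have "AE ze in rh. (?k ze - l)\<^sup>2 = 0"
  proof (subst integral_nonneg_eq_0_iff_AE[symmetric])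
   have "(%ze. (?k ze - l)\<^sup>2) : Bm rh"
    unfolding m_cong_sets[OF rh_sets refl]
    by (intro borel_measurable_power borel_measurable_diff mk WV) simp
   thus "integrable rh (%ze. (?k ze - l)\<^sup>2)"
   proof (rule R.integrable_bounded[where B=1])
    fix ze have "\<bar>?k ze - l\<bar> <= 1" using k01[of "space M \<times> V" ze] l01 by auto
    thus "\<bar>(?k ze - l)\<^sup>2\<bar> <= 1" by (simp add: abs_square_le_1)
   qed
  qed (simp_all add: z0)
  thus ?thesis unfolding l_def[symmetric] by simp
 qed
 \<comment> \<open>Finitely many label events and compatibility hold together for almost every past;
   one such past is fixed.\<close>
 have "AE ze in rh. \<forall>V\<in>\<V>. k (space M \<times> V) ze = (LINT z|J. Ind V (snd z 0 0))"
  using \<V> good2 by (subst AE_ball_countable) (auto simp: countable_finite)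
 hence "AE ze in rh. ze : space rh & (AE p in MU >< MU. compatible e (w ze (fst p), w ze (snd p))) \<and>
  (\<forall>V\<in>\<V>. k (space M \<times> V) ze = (LINT z|J. Ind V (snd z 0 0)))"
  using good1 AE_space by eventually_elim simp
 from eventually_happens'[OF R.ae_filter_bot this]
 obtain ze where ze: "ze : space rh" "AE p in MU >< MU. compatible e (w ze (fst p), w ze (snd p))"
  "!!V. V : \<V> ==> k (space M \<times> V) ze = (LINT z|J. Ind V (snd z 0 0))"
  by blast
 show thesis
 proof (rule that[of "%x u. Ph (ze, x) u"])
  have "snd : ?W ->M borel" by simp
  from m_comp[OF mw1[OF ze(1)] this]
  show "(%p. Ph (ze, fst p) (snd p)) : Bm (M >< unif)"
   unfolding MU_def w_def by simp
  show "AE p in (M >< unif) >< (M >< unif). compatible e ((fst (fst p), Ph (ze, fst (fst p)) (snd (fst p))),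
   (fst (snd p), Ph (ze, fst (snd p)) (snd (snd p))))"
   using ze(2) unfolding MU_def w_def .
  fix V assume V: "V : \<V>"
  have "(LINT p|MU. Ind V (Ph (ze, fst p) (snd p))) = k (space M \<times> V) ze"
   unfolding k_def
   by (intro b_cong refl) (auto simp: MU_def sp_pair w_def indicator_def)
  thus "(LINT p|(M >< unif). Ind V (Ph (ze, fst p) (snd p))) = (LINT z|J. Ind V (snd z 0 0) :: real)"
   using ze(3)[OF V] unfolding MU_def by simp
 qed
qed

end

section \<open>From randomised to deterministic labellings\<close>

context sample_model
begin

lemma distr_MM_fst: "distr (M >< M) M fst = M"
 by (rule distr_pair_fst)

lemma distr_MM_snd: "distr (M >< M) M snd = M"
proof (rule measure_eqI)
 fix A assume "A : sets (distr (M >< M) M snd)"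
 hence A: "A : sets M" by simp
 have "emeasure (distr (M >< M) M snd) A = emeasure (M >< M) (space M \<times> A)"
  by (subst emeasure_distr[OF m_snd A])
   (use sets.sets_into_space[OF A] in \<open>auto simp: sp_pair intro!: arg_cong[where f="emeasure (M >< M)"]\<close>)
 also have "... = emeasure M A" using A by (simp add: emeasure_pair_measure_Times emeasure_space_1)
 finally show "emeasure (distr (M >< M) M snd) A = emeasure M A" .
qed simp

lemma AE_MM:
 assumes "AE x in M. P x"
 shows "AE q in M >< M. P (fst q) & P (snd q)"
proof -
 have "AE q in M >< M. P (fst q)" by (rule AE_distrD[OF m_fst]) (simp only: distr_MM_fst assms)
 moreover have "AE q in M >< M. P (snd q)" by (rule AE_distrD[OF m_snd]) (simp only: distr_MM_snd assms)
 ultimately show ?thesis by eventually_elim simp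
qed

text \<open>
 A randomised labelling is made deterministic by drawing one random number for each cell of a fine
 partition. The distribution of the labels concentrates because distinct cells are independent, and
 because on an atom of \<open>M\<close> (where the distance to itself vanishes) the labelling is not random.
\<close>
theorem pure_selection:
 fixes F :: "'a => real => real" and h :: "'a => real" and e :: "nat => real => real"
 assumes h: "h : Bm M" "inj_on h (space M)"
  and F: "(%p. F (fst p) (snd p)) : Bm (M >< unif)"
  and e: "!!k. e k : Bm borel"
  and good: "AE p in (M >< unif) >< (M >< unif). compatible e ((fst (fst p), F (fst (fst p)) (snd (fst p))),
   (fst (snd p), F (fst (snd p)) (snd (snd p))))"
  and \<V>: "finite \<V>" "!!V. V : \<V> ==> V : sets borel"
   "!!V v v'. V : \<V> ==> (!!k. e k v = e k v') ==> v : V \<longleftrightarrow> v' : V"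
  and ep: "0 < ep"
 shows "\<exists>f\<in>Bm M. (AE q in M >< M. compatible e ((fst q, f (fst q)), (snd q, f (snd q)))) \<and>
  (\<forall>V\<in>\<V>. \<bar>measure M {x : space M. f x : V} - (LINT p|(M >< unif). Ind V (F (fst p) (snd p)))\<bar> < ep)"
proof -
 interpret unif: prob_space unif by simp
 interpret UU: pair_prob_space unif unif ..
 interpret MMp: pair_prob_space M M ..
 interpret MU: pair_prob_space M unif ..
 interpret MM: prob_space "M >< M" by (rule prob_space_pair) unfold_locales
 interpret UUp: prob_space "unif >< unif" by (rule prob_space_pair) unfold_locales
 interpret MMUU: pair_sigma_finite "M >< M" "unif >< unif" ..
 define \<Omega> where "\<Omega> = (\<Pi>\<^sub>M i\<in>(UNIV :: int set). unif)"
 interpret O: prob_space \<Omega> unfolding \<Omega>_def by (rule prob_space_PiM) simp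
 interpret MO: pair_prob_space M \<Omega> ..
 interpret OMM: pair_sigma_finite \<Omega> "M >< M" ..
 interpret OMMp: prob_space "\<Omega> >< (M >< M)" by (rule prob_space_pair) unfold_locales
 note bounded_MU = finite_measure.integrable_bounded[OF prob_space.axioms(1)[OF prob_space_pair[OF prob_space_axioms unif.prob_space_axioms]]]
 note bounded_MM = finite_measure.integrable_bounded[OF prob_space.axioms(1)[OF prob_space_pair[OF prob_space_axioms prob_space_axioms]]]
 note bounded_OMM = finite_measure.integrable_bounded[OF prob_space.axioms(1)[OF prob_space_pair[OF O.prob_space_axioms prob_space_pair[OF prob_space_axioms prob_space_axioms]]]]
 note bounded_O = finite_measure.integrable_bounded[OF prob_space.axioms(1)[OF O.prob_space_axioms]]
 have mcomp: "(%om. om i) : \<Omega> ->M unif" for i unfolding \<Omega>_def by (rule measurable_component_singleton) simp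
 have FS: "(%u. F x u) : Bm unif" if "x : space M" for x
  using m_comp[OF measurable_Pair1'[OF that] F] by (simp only: fst_conv snd_conv)
 \<comment> \<open>Dyadic cells of the injective real coordinate \<open>h\<close>; any two distinct
   points are eventually separated.\<close>
 define cell where "cell k x = \<lfloor>2 ^ k * h x\<rfloor>" for k :: nat and x
 have mcell: "cell k : M ->M count_space UNIV" for k
  unfolding cell_def[abs_def] by (intro m_comp[OF _ measurable_real_floor] bm_times h) simp
 define f where "f k om x = F x (om (cell k x))" for k om x
 have mf: "(%q. f k (snd q) (fst q)) : Bm (M >< \<Omega>)" for k
 proof -
  have "(%q. snd q (cell k (fst q))) : M >< \<Omega> ->M unif"
   by (rule measurable_compose_countable[where f="%i q. snd q i" and g="%q. cell k (fst q)"])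
    (rule m_comp[OF m_snd mcomp], rule m_comp[OF m_fst mcell])
  from m_comp[OF m_Pair[OF m_fst this] F]
  show ?thesis by (simp only: f_def fst_conv snd_conv)
 qed
 have mf1: "f k om : Bm M" if "om : space \<Omega>" for k om
  using m_comp[OF measurable_Pair2'[OF that] mf] by (simp only: fst_conv snd_conv)
 have good': "AE q in M >< M. AE p in unif >< unif. compatible e ((fst q, F (fst q) (fst p)), (snd q, F (snd q) (snd p)))"
 proof -
  let ?r = "%z. ((fst (fst z), fst (snd z)), (snd (fst z), snd (snd z)))"
  have mr: "?r : (M >< M) >< (unif >< unif) ->M (M >< unif) >< (M >< unif)" by measurable
  have "AE z in (M >< M) >< (unif >< unif). compatible e ((fst (fst (?r z)), F (fst (fst (?r z))) (snd (fst (?r z)))),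
   (fst (snd (?r z)), F (fst (snd (?r z))) (snd (snd (?r z)))))"
   by (rule AE_distrD[OF mr])
    (use good in \<open>simp only: distr_pair_swap_middle[OF prob_space_axioms prob_space_axioms prob_space_unif prob_space_unif]\<close>)
  from MMUU.AE_pair[OF this] show ?thesis by (simp only: fst_conv snd_conv)
 qed
 \<comment> \<open>Every rational half-line containing a coordinate \<open>e j v\<close> has
   positive probability under the label law at \<open>x\<close>. Two points of one cell share their
   noise, so compatibility for independent noise does not apply to them directly; for values in such
   supports it does.\<close>
 define G where "G x v \<longleftrightarrow> (ALL j. \<forall>a :: rat. (of_rat a < e j v --> measure unif {u. of_rat a < e j (F x u)} ~= 0) \<and>
  (e j v <= of_rat a --> measure unif {u. e j (F x u) <= of_rat a} ~= 0))" for x v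
 have SF: "{u. a < e j (F x u)} : sets unif" "{u. e j (F x u) <= a} : sets unif" if "x : space M" for x j a
 proof -
  have "(%u. e j (F x u)) : Bm unif" by (rule m_comp[OF FS[OF that] e])
  from measurable_sets[OF this, of "{a<..}"] measurable_sets[OF this, of "{..a}"]
  show "{u. a < e j (F x u)} : sets unif" "{u. e j (F x u) <= a} : sets unif"
   by (simp_all add: vimage_def)
 qed
 have G_AE: "AE u in unif. G x (F x u)" if x: "x : space M" for x
 proof -
  have "AE u in unif. of_rat a < e j (F x u) --> measure unif {u. of_rat a < e j (F x u)} ~= 0" for j and a :: rat
  proof (cases "measure unif {u. of_rat a < e j (F x u)} = 0")
   case True
   have "AE u in unif. u \<notin> {u. of_rat a < e j (F x u)}"
    by (rule AE_not_in) (use SF(1)[OF x] True in \<open>simp add: null_sets_def unif.emeasure_eq_measure\<close>)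
   thus ?thesis by eventually_elim simp
  qed simp
  moreover have "AE u in unif. e j (F x u) <= of_rat a --> measure unif {u. e j (F x u) <= of_rat a} ~= 0" for j and a :: rat
  proof (cases "measure unif {u. e j (F x u) <= of_rat a} = 0")
   case True
   have "AE u in unif. u \<notin> {u. e j (F x u) <= of_rat a}"
    by (rule AE_not_in) (use SF(2)[OF x] True in \<open>simp add: null_sets_def unif.emeasure_eq_measure\<close>)
   thus ?thesis by eventually_elim simp
  qed simp
  ultimately show ?thesis unfolding G_def by (simp add: AE_all_countable)
 qed
 \<comment> \<open>A violation would persist on a product of two noise events of positive
   probability.\<close>
 have comp: "compatible e ((x, v), (x', v'))"
  if x: "x : space M" "x' : space M" and AE: "AE p in unif >< unif. compatible e ((x, F x (fst p)), (x', F x' (snd p)))"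
   and Gx: "G x v" "G x' v'" for x x' v v'
  unfolding compatible_def fst_conv snd_conv
 proof (intro allI impI, rule ccontr)
  fix j and a r :: rat assume l: "of_rat a + of_rat r < e j v" "e j v' <= of_rat a" and W: "W (of_rat r) x x' ~= 0"
  let ?A = "{u. of_rat (a + r) < e j (F x u)}" and ?B = "{u. e j (F x' u) <= of_rat a}"
  have AB: "?A : sets unif" "?B : sets unif" using SF x by blast+
  have pos: "measure unif ?A ~= 0" "measure unif ?B ~= 0"
   using l Gx unfolding G_def by (simp_all only: of_rat_add[symmetric] simp_thms not_False_eq_True)
  have "AE p in unif >< unif. p \<notin> ?A \<times> ?B"
   using AE by eventually_elim (use W in \<open>auto simp: compatible_def of_rat_add\<close>)
  moreover have "?A \<times> ?B : sets (unif >< unif)" using AB by (rule pair_measureI)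
  ultimately have "emeasure (unif >< unif) (?A \<times> ?B) = 0"
   by (subst AE_iff_null_sets[symmetric, THEN iffD1, THEN null_setsD1]) auto
  thus False using pos AB by (simp add: unif.emeasure_pair_measure_Times unif.emeasure_eq_measure)
 qed
 have mUN: "(%x. measure unif {u. u : space unif & (x, u) : S}) : Bm M" if "S : sets (M >< unif)" for S
 proof -
  have "(%x. emeasure unif (Pair x -` S)) : Bm M" by (rule unif.measurable_emeasure_Pair[OF that])
  hence "(%x. enn2real (emeasure unif (Pair x -` S))) : Bm M" by (rule m_comp) simp
  thus ?thesis by (simp add: measure_def vimage_def)
 qed
 have Gset: "{q : space (M >< \<Omega>). G (fst q) (f k (snd q) (fst q))} : sets (M >< \<Omega>)" for k
 proof -
  have eF: "(%p. e j (F (fst p) (snd p))) : Bm (M >< unif)" for j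
   by (rule m_comp[OF F e])
  have "(%x. measure unif {u. a < e j (F x u)}) : Bm M" for a j
  proof -
   have "{p : space (M >< unif). a < e j (F (fst p) (snd p))} : sets (M >< unif)"
    using eF by (rule borel_measurable_less[OF borel_measurable_const])
   from mUN[OF this] show ?thesis
    by (rule measurable_cong[THEN iffD1, rotated]) (simp add: sp_pair)
  qed
  from m_comp[OF m_fst this]
  have [measurable]: "(%q. measure unif {u. a < e j (F (fst q) u)}) : Bm (M >< \<Omega>)" for a j .
  have "(%x. measure unif {u. e j (F x u) <= a}) : Bm M" for a j
  proof -
   have "{p : space (M >< unif). e j (F (fst p) (snd p)) <= a} : sets (M >< unif)"
    using eF by (rule borel_measurable_le[OF _ borel_measurable_const])
   from mUN[OF this] show ?thesis
    by (rule measurable_cong[THEN iffD1, rotated]) (simp add: sp_pair)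
  qed
  from m_comp[OF m_fst this]
  have [measurable]: "(%q. measure unif {u. e j (F (fst q) u) <= a}) : Bm (M >< \<Omega>)" for a j .
  have [measurable]: "(%q. e j (f k (snd q) (fst q))) : Bm (M >< \<Omega>)" for j
   by (rule m_comp[OF mf e])
  show ?thesis unfolding G_def by measurable
 qed
 have lip: "AE om in \<Omega>. AE q in M >< M. compatible e ((fst q, f k om (fst q)), (snd q, f k om (snd q)))" for k
 proof -
  have "AE x in M. AE om in \<Omega>. G x (f k om x)"
  proof (rule AE_I2)
   fix x assume x: "x : space M"
   show "AE om in \<Omega>. G x (f k om x)"
    unfolding \<Omega>_def f_def by (rule AE_PiM_component[where i="cell k x"]) (use G_AE[OF x] in auto)
  qed
  hence "AE om in \<Omega>. AE x in M. G x (f k om x)"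
   by (subst MO.AE_commute[OF Gset, symmetric])
  thus ?thesis
  proof eventually_elim
   case (elim om)
   from AE_MM[OF elim] good' AE_space show ?case
    by eventually_elim (rule comp, auto simp: sp_pair)
  qed
 qed
 define c where "c V x = (LINT u|unif. Ind V (F x u) :: real)" for V x
 have mIF: "(%(x, u). Ind V (F x u) :: real) : Bm (M >< unif)" if "V : \<V>" for V
  using m_comp[OF F bm_ind[OF \<V>(2)[OF that]]] by (simp only: case_prod_unfold)
 have mc: "c V : Bm M" if "V : \<V>" for V
  using unif.borel_measurable_lebesgue_integral[OF mIF[OF that]] unfolding c_def[abs_def] .
 have mIu: "(%u. Ind V (F x u) :: real) : Bm unif" if "V : \<V>" "x : space M" for V x
  by (rule m_comp[OF FS[OF that(2)] bm_ind[OF \<V>(2)[OF that(1)]]])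
 have iIu: "integrable unif (%u. Ind V (F x u) :: real)" if "V : \<V>" "x : space M" for V x
  by (rule unif.integrable_bounded[OF mIu[OF that], where B=1]) (simp add: indicator_def)
 have c01: "0 <= c V x & c V x <= 1" if "V : \<V>" "x : space M" for V x
 proof
  show "0 <= c V x" unfolding c_def by (rule Bochner_Integration.integral_nonneg) simp
  have "c V x <= (LINT u|unif. 1)" unfolding c_def
   by (rule integral_mono[OF iIu[OF that]]) (auto simp: indicator_def)
  thus "c V x <= 1" using unif.prob_space by simp
 qed
 define g where "g V k om x = Ind V (f k om x) - c V x" for V k om x
 have g1: "\<bar>g V k om x\<bar> <= 1" if "V : \<V>" "x : space M" for V k om x
  using c01[OF that] by (auto simp: g_def indicator_def)
 have mg: "(%q. g V k (snd q) (fst q)) : Bm (M >< \<Omega>)" if "V : \<V>" for V k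
  unfolding g_def
  by (intro borel_measurable_diff m_comp[OF mf bm_ind[OF \<V>(2)[OF that]]]
    m_comp[OF m_fst mc[OF that]])
 have mg1: "g V k om : Bm M" if "V : \<V>" "om : space \<Omega>" for V k om
  using m_comp[OF measurable_Pair2'[OF that(2)] mg[OF that(1)]] by (simp only: fst_conv snd_conv)
 have ig: "integrable M (g V k om)" if "V : \<V>" "om : space \<Omega>" for V k om
  by (rule integrable_bounded[OF mg1[OF that], where B=1]) (rule g1[OF that(1)])
 define D where "D V k om = (LINT x|M. g V k om x)" for V k om
 have D_eq: "D V k om = measure M {x : space M. f k om x : V} - (LINT p|(M >< unif). Ind V (F (fst p) (snd p)))"
  if V: "V : \<V>" and om: "om : space \<Omega>" for V k om
 proof -
  have m1: "(%x. Ind V (f k om x) :: real) : Bm M"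
   by (rule m_comp[OF mf1[OF om] bm_ind[OF \<V>(2)[OF V]]])
  have i1: "integrable M (%x. Ind V (f k om x) :: real)"
   by (rule integrable_bounded[OF m1, where B=1]) (simp add: indicator_def)
  have i2: "integrable M (c V)" by (rule integrable_bounded[OF mc[OF V], where B=1]) (use c01[OF V] in auto)
  have "(LINT x|M. Ind V (f k om x)) = (LINT x|M. Ind {x : space M. f k om x : V} x :: real)"
   by (intro b_cong) (auto simp: indicator_def)
  also have "... = measure M ({x : space M. f k om x : V} Int space M)"
   by (rule Bochner_Integration.integral_indicator)
  also have "{x : space M. f k om x : V} Int space M = {x : space M. f k om x : V}" by auto
  finally have e1: "(LINT x|M. Ind V (f k om x)) = measure M {x : space M. f k om x : V}" .
  have "integrable (M >< unif) (%p. Ind V (F (fst p) (snd p)) :: real)"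
  proof -
   show ?thesis
    by (rule bounded_MU[where B=1]) (use mIF[OF V] in \<open>auto simp: indicator_def case_prod_unfold\<close>)
  qed
  from MU.integral_fst'[OF this]
  have "(LINT x|M. c V x) = (LINT p|(M >< unif). Ind V (F (fst p) (snd p)))"
   unfolding c_def by (simp only: fst_conv snd_conv)
  thus ?thesis unfolding D_def g_def using i1 i2 e1 by simp
 qed
 define T where "T V x x' = (LINT u|unif. (Ind V (F x u) - c V x) * (Ind V (F x' u) - c V x'))" for V x x'
 have mT: "(%q. T V (fst q) (snd q)) : Bm (M >< M)" if V: "V : \<V>" for V
 proof -
  have 1: "(%z. Ind V (F (fst (fst z)) (snd z)) - c V (fst (fst z))) : Bm ((M >< M) >< unif)"
   using m_comp[OF m_Pair[OF m_comp[OF m_fst m_fst] m_snd] mIF[OF V]]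
    m_comp[OF m_comp[OF m_fst m_fst] mc[OF V]]
   by (simp only: case_prod_conv) (rule borel_measurable_diff)
  have 2: "(%z. Ind V (F (snd (fst z)) (snd z)) - c V (snd (fst z))) : Bm ((M >< M) >< unif)"
   using m_comp[OF m_Pair[OF m_comp[OF m_fst m_snd] m_snd] mIF[OF V]]
    m_comp[OF m_comp[OF m_fst m_snd] mc[OF V]]
   by (simp only: case_prod_conv) (rule borel_measurable_diff)
  have "(%(q, u). (Ind V (F (fst q) u) - c V (fst q)) * (Ind V (F (snd q) u) - c V (snd q))) : Bm ((M >< M) >< unif)"
   using bm_times[OF 1 2] by (simp only: case_prod_unfold)
  from unif.borel_measurable_lebesgue_integral[OF this] show ?thesis unfolding T_def .
 qed
 have mI: "(%u. Ind V (F x u) - c V x) : Bm unif" if "V : \<V>" "x : space M" for V x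
  by (rule borel_measurable_diff[OF mIu[OF that]]) simp
 have I1: "\<bar>indicator V (F x u) - c V x\<bar> <= 1" if "V : \<V>" "x : space M" for V x u
  using c01[OF that] by (auto simp: indicator_def)
 have T1: "\<bar>T V x x'\<bar> <= 1" if V: "V : \<V>" and x: "x : space M" "x' : space M" for V x x'
 proof -
  have m: "(%u. (Ind V (F x u) - c V x) * (Ind V (F x' u) - c V x')) : Bm unif"
   by (intro bm_times mI V x)
  have b: "\<bar>(Ind V (F x u) - c V x) * (Ind V (F x' u) - c V x')\<bar> <= 1" for u
   using I1[OF V x(1), of u] I1[OF V x(2), of u] by (simp add: abs_mult mult_le_one)
  have "\<bar>T V x x'\<bar> <= (LINT u|unif. \<bar>(Ind V (F x u) - c V x) * (Ind V (F x' u) - c V x')\<bar>)"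
   unfolding T_def by (rule integral_abs_bound)
  also have "... <= (LINT u|unif. 1)"
   by (rule integral_mono) (use b in \<open>auto intro!: integrable_abs unif.integrable_bounded[OF m, where B=1]\<close>)
  finally show ?thesis using unif.prob_space by simp
 qed
 have cov: "(LINT om|\<Omega>. g V k om x * g V k om x') = (if cell k x = cell k x' then T V x x' else 0)"
  if V: "V : \<V>" and x: "x : space M" "x' : space M" for V k x x'
 proof (cases "cell k x = cell k x'")
  case True
  have "(LINT u|distr \<Omega> unif (%om. om (cell k x)). (Ind V (F x u) - c V x) * (Ind V (F x' u) - c V x')) =
   (LINT om|\<Omega>. (Ind V (F x (om (cell k x))) - c V x) * (Ind V (F x' (om (cell k x))) - c V x'))"
   by (rule integral_distr[OF mcomp]) (intro bm_times mI V x)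
  moreover have "distr \<Omega> unif (%om. om (cell k x)) = unif"
   unfolding \<Omega>_def by (rule distr_PiM_component) auto
  ultimately show ?thesis using True by (simp add: g_def f_def T_def)
 next
  case False
  define gg where "gg i u = (if i = cell k x then Ind V (F x u) - c V x else Ind V (F x' u) - c V x')" for i u
  have "(LINT om|\<Omega>. (\<Prod>i\<in>{cell k x, cell k x'}. gg i (om i))) = (\<Prod>i\<in>{cell k x, cell k x'}. LINT u|unif. gg i u)"
   unfolding \<Omega>_def
  proof (rule integral_PiM_prod[where B=1])
   show "gg j : Bm unif" for j
    unfolding gg_def[abs_def] by (cases "j = cell k x") (use mI[OF V x(1)] mI[OF V x(2)] in simp_all)
   show "\<bar>gg j u\<bar> <= 1" for j u unfolding gg_def using I1[OF V x(1)] I1[OF V x(2)] by simp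
  qed simp_all
  moreover have "(LINT u|unif. gg (cell k x) u) = 0"
   using iIu[OF V x(1)] unif.prob_space by (simp add: gg_def c_def)
  ultimately have "(LINT om|\<Omega>. (\<Prod>i\<in>{cell k x, cell k x'}. gg i (om i))) = 0" using False by simp
  thus ?thesis using False by (simp add: gg_def g_def f_def)
 qed
 \<comment> \<open>The deviation has mean zero, and by independence across cells only pairs of
   points in a common cell contribute to its second moment.\<close>
 have ED: "(LINT om|\<Omega>. (D V k om)\<^sup>2) = (LINT q|(M >< M). (if cell k (fst q) = cell k (snd q) then T V (fst q) (snd q) else 0))"
  if V: "V : \<V>" for V k
 proof -
  have mq: "(%z. g V k (fst z) (fst (snd z)) * g V k (fst z) (snd (snd z))) : Bm (\<Omega> >< (M >< M))"
  proof (rule bm_times)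
   have a: "(%z. (fst (snd z), fst z)) : \<Omega> >< (M >< M) ->M M >< \<Omega>"
    by (intro m_Pair m_fst m_comp[OF m_snd m_fst])
   have b: "(%z. (snd (snd z), fst z)) : \<Omega> >< (M >< M) ->M M >< \<Omega>"
    by (intro m_Pair m_fst m_comp[OF m_snd m_snd])
   show "(%z. g V k (fst z) (fst (snd z))) : Bm (\<Omega> >< (M >< M))"
    using m_comp[OF a mg[OF V]] by (simp only: fst_conv snd_conv)
   show "(%z. g V k (fst z) (snd (snd z))) : Bm (\<Omega> >< (M >< M))"
    using m_comp[OF b mg[OF V]] by (simp only: fst_conv snd_conv)
  qed
  have "integrable (\<Omega> >< (M >< M)) (%z. g V k (fst z) (fst (snd z)) * g V k (fst z) (snd (snd z)))"
  proof (rule bounded_OMM[OF mq, where B=1])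
   fix z assume "z : space (\<Omega> >< (M >< M))"
   hence "fst (snd z) : space M" "snd (snd z) : space M" by (auto simp: sp_pair)
   thus "\<bar>g V k (fst z) (fst (snd z)) * g V k (fst z) (snd (snd z))\<bar> <= 1"
    using g1[OF V] by (simp add: abs_mult mult_le_one)
  qed
  hence "integrable (\<Omega> >< (M >< M)) (%(om, q). g V k om (fst q) * g V k om (snd q))"
   by (simp only: case_prod_unfold)
  from OMM.Fubini_integral[OF this]
  have "(LINT om|\<Omega>. LINT q|(M >< M). g V k om (fst q) * g V k om (snd q)) =
   (LINT q|(M >< M). LINT om|\<Omega>. g V k om (fst q) * g V k om (snd q))" by simp
  moreover have "(LINT q|(M >< M). g V k om (fst q) * g V k om (snd q)) = (D V k om)\<^sup>2" if om: "om : space \<Omega>" for om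
  proof -
   have "integrable (M >< M) (%q. g V k om (fst q) * g V k om (snd q))"
   proof (rule bounded_MM[where B=1])
    show "(%q. g V k om (fst q) * g V k om (snd q)) : Bm (M >< M)"
     by (intro bm_times m_comp[OF m_fst mg1[OF V om]] m_comp[OF m_snd mg1[OF V om]])
    fix q assume "q : space (M >< M)"
    hence "fst q : space M" "snd q : space M" by (auto simp: sp_pair)
    thus "\<bar>g V k om (fst q) * g V k om (snd q)\<bar> <= 1" using g1[OF V] by (simp add: abs_mult mult_le_one)
   qed
   from MMp.integral_fst'[OF this]
   have "(LINT q|(M >< M). g V k om (fst q) * g V k om (snd q)) = (LINT x|M. LINT x'|M. g V k om x * g V k om x')" by simp
   also have "... = (D V k om)\<^sup>2" unfolding D_def by (simp add: power2_eq_square)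
   finally show ?thesis .
  qed
  hence "(LINT om|\<Omega>. LINT q|(M >< M). g V k om (fst q) * g V k om (snd q)) = (LINT om|\<Omega>. (D V k om)\<^sup>2)"
   by (intro b_cong) auto
  moreover have "(LINT q|(M >< M). LINT om|\<Omega>. g V k om (fst q) * g V k om (snd q)) =
   (LINT q|(M >< M). (if cell k (fst q) = cell k (snd q) then T V (fst q) (snd q) else 0))"
   by (intro b_cong refl cov V) (auto simp: sp_pair)
  ultimately show ?thesis by simp
 qed
 \<comment> \<open>At distance 0 compatibility holds with \<open>W r x x = 1\<close> for every
   positive \<open>r\<close>. Used in both directions it forces equal coordinates for two
   independent draws of the label, and \<open>V\<close> sees nothing else.\<close>
 have diag0: "AE q in M >< M. fst q = snd q --> T V (fst q) (snd q) = 0" if V: "V : \<V>" for V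
  using good' AE_space
 proof eventually_elim
  case (elim q)
  show ?case
  proof
   assume q: "fst q = snd q"
   define x where "x = fst q"
   have x: "x : space M" using elim(2) by (auto simp: x_def sp_pair)
   have W1: "W r x x = 1" if "0 < r" for r
    using that x unif.prob_space by (simp add: W_def Ps_refl)
   have le: "e j v <= e j v'" if "compatible e ((x, v), (x, v'))" for j v v'
   proof (rule ccontr)
    assume "~ e j v <= e j v'"
    then obtain a :: rat where a: "e j v' < of_rat a" "of_rat a < e j v" using of_rat_dense[of "e j v'" "e j v"] by auto
    then obtain r :: rat where r: "0 < real_of_rat r" "real_of_rat r < e j v - of_rat a" using of_rat_dense[of 0 "e j v - of_rat a"] by auto
    have "W (of_rat r) x x = 0"
    proof -
     have "ALL k a r. of_rat a + of_rat r < e k v --> e k v' <= of_rat a --> W (of_rat r) x x = 0"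
      using that unfolding compatible_def fst_conv snd_conv .
     from this[rule_format, of a r j] show ?thesis using a r by simp
    qed
    thus False using W1[OF r(1)] by simp
   qed
   have c1: "AE p in unif >< unif. compatible e ((x, F x (fst p)), (x, F x (snd p)))"
    using elim(1) q unfolding x_def by simp
   have ms: "(%(y, z). (z, y)) : unif >< unif ->M unif >< unif" by (rule measurable_pair_swap')
   have "AE p in unif >< unif. compatible e ((x, F x (fst (case p of (y, z) => (z, y)))), (x, F x (snd (case p of (y, z) => (z, y)))))"
    by (rule AE_distrD[OF ms], unfold UU.distr_pair_swap[symmetric], rule c1)
   hence "AE p in unif >< unif. Ind V (F x (fst p)) = (Ind V (F x (snd p)) :: real)"
    using c1
   proof eventually_elim
    case (elim p)
    have "e j (F x (fst p)) = e j (F x (snd p))" for j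
     using le[OF elim(2), of j] le[of "F x (snd p)" "F x (fst p)" j] elim(1) by (simp add: case_prod_unfold)
    from \<V>(3)[OF V this] show ?case by (simp add: indicator_def)
   qed
   from UU.AE_pair[OF this]
   have "AE u in unif. AE u' in unif. Ind V (F x u) = (Ind V (F x u') :: real)" by simp
   hence "AE u in unif. Ind V (F x u) - c V x = 0"
   proof eventually_elim
    case (elim u)
    have "c V x = (LINT u'|unif. Ind V (F x u))" unfolding c_def
     by (rule integral_cong_AE) (use elim mIu[OF V x] in auto)
    thus ?case using unif.prob_space by simp
   qed
   hence "T V x x = (LINT u|unif. 0)" unfolding T_def
    by (intro integral_cong_AE) (auto intro!: bm_times mI V x elim: eventually_mono)
   thus "T V (fst q) (snd q) = 0" using q by (simp add: x_def)
  qed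
 qed
 have lim: "(%k. LINT om|\<Omega>. (D V k om)\<^sup>2) ~~> 0" if V: "V : \<V>" for V
 proof -
  have "(%k. LINT q|(M >< M). (if cell k (fst q) = cell k (snd q) then T V (fst q) (snd q) else 0)) ~~> (LINT q|(M >< M). 0)"
  proof (rule integral_dominated_convergence[where w="%_. 1"])
   show "(%q. if cell k (fst q) = cell k (snd q) then T V (fst q) (snd q) else 0) : Bm (M >< M)" for k
   proof (rule measurable_If[OF mT[OF V]])
    have [measurable]: "(%q. cell k (fst q)) : M >< M ->M count_space UNIV" "(%q. cell k (snd q)) : M >< M ->M count_space UNIV"
     by (rule m_comp[OF m_fst mcell] m_comp[OF m_snd mcell])+
    show "{q : space (M >< M). cell k (fst q) = cell k (snd q)} : sets (M >< M)" by measurable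
   qed simp
   show "AE q in M >< M. (%k. if cell k (fst q) = cell k (snd q) then T V (fst q) (snd q) else 0) ~~> 0"
    using diag0[OF V] AE_space
   proof eventually_elim
    case (elim q)
    show ?case
    proof (cases "fst q = snd q")
     case True
     thus ?thesis using elim by simp
    next
     case False
     hence hq: "h (fst q) ~= h (snd q)" 
     proof -
      have sp: "fst q : space M" "snd q : space M" using elim(2) unfolding sp_pair by (rule SigmaE; simp)+
      show ?thesis using inj_on_eq_iff[OF h(2) sp] False by simp
     qed
     define \<delta> where "\<delta> = \<bar>h (fst q) - h (snd q)\<bar>"
     have \<delta>: "0 < \<delta>" using hq by (simp add: \<delta>_def)
     obtain N :: nat where N: "1 / \<delta> < 2 ^ N" using real_arch_pow[of 2 "1 / \<delta>"] by auto
     have "cell k (fst q) ~= cell k (snd q)" if "N <= k" for k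
     proof
      assume eq: "cell k (fst q) = cell k (snd q)"
      have "\<bar>2 ^ k * h (fst q) - 2 ^ k * h (snd q)\<bar> < 1"
       using eq unfolding cell_def by linarith
      hence "2 ^ k * \<delta> < 1" unfolding \<delta>_def by (simp add: abs_mult flip: right_diff_distrib)
      moreover have "1 < 2 ^ N * \<delta>" using N \<delta> by (simp add: field_simps)
      moreover have "2 ^ N * \<delta> <= 2 ^ k * \<delta>" using that \<delta> by (intro mult_right_mono power_increasing) auto
      ultimately show False by linarith
     qed
     thus ?thesis by (auto intro!: tendsto_eventually eventually_sequentiallyI[of N])
    qed
   qed
   show "AE q in M >< M. norm (if cell k (fst q) = cell k (snd q) then T V (fst q) (snd q) else 0) <= 1" for k
    using T1[OF V] by (intro AE_I2) (auto simp: sp_pair)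
  qed simp_all
  thus ?thesis by (simp add: ED[OF V])
 qed
 \<comment> \<open>Summing squares handles all events of \<open>\<V>\<close> at once: some outcome
   outside the exceptional null set stays below the bound on the mean.\<close>
 have "(%k. \<Sum>V\<in>\<V>. LINT om|\<Omega>. (D V k om)\<^sup>2) ~~> (\<Sum>V\<in>\<V>. 0)" by (intro tendsto_sum lim)
 hence "\<forall>\<^sub>F k in sequentially. (\<Sum>V\<in>\<V>. LINT om|\<Omega>. (D V k om)\<^sup>2) < ep\<^sup>2"
  by (rule order_tendstoD(2)) (use ep in simp)
 then obtain k where k: "(\<Sum>V\<in>\<V>. LINT om|\<Omega>. (D V k om)\<^sup>2) < ep\<^sup>2" by (auto simp: eventually_sequentially)
 have iD: "integrable \<Omega> (%om. (D V k om)\<^sup>2)" if V: "V : \<V>" for V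
 proof (rule bounded_O[where B=1])
  have "(%z. (snd z, fst z)) : \<Omega> >< M ->M M >< \<Omega>" by (intro m_Pair m_fst m_snd)
  from m_comp[OF this mg[OF V, of k]]
  have "(%(om, x). g V k om x) : Bm (\<Omega> >< M)" by (simp only: fst_conv snd_conv case_prod_unfold)
  from borel_measurable_lebesgue_integral[OF this]
  have "D V k : Bm \<Omega>" unfolding D_def[abs_def] .
  thus "(%om. (D V k om)\<^sup>2) : Bm \<Omega>" by (rule borel_measurable_power)
  fix om assume om: "om : space \<Omega>"
  have "\<bar>D V k om\<bar> <= (LINT x|M. \<bar>g V k om x\<bar>)" unfolding D_def by (rule integral_abs_bound)
  also have "... <= (LINT x|M. 1)" by (rule integral_mono) (use ig[OF V om] g1[OF V] in \<open>auto intro: integrable_abs\<close>)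
  finally show "\<bar>(D V k om)\<^sup>2\<bar> <= 1" by (simp add: prob_space abs_square_le_1)
 qed
 have "\<exists>om. om : space \<Omega> & (AE q in M >< M. compatible e ((fst q, f k om (fst q)), (snd q, f k om (snd q)))) & (\<Sum>V\<in>\<V>. (D V k om)\<^sup>2) < ep\<^sup>2"
 proof (rule ccontr)
  assume no: "~ ?thesis"
  have "AE om in \<Omega>. ep\<^sup>2 <= (\<Sum>V\<in>\<V>. (D V k om)\<^sup>2)"
   using lip[of k] AE_space by eventually_elim (use no in \<open>auto simp: not_less\<close>)
  hence "(LINT om|\<Omega>. ep\<^sup>2) <= (LINT om|\<Omega>. (\<Sum>V\<in>\<V>. (D V k om)\<^sup>2))"
   by (intro integral_mono_AE Bochner_Integration.integrable_sum iD) auto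
  also have "... = (\<Sum>V\<in>\<V>. LINT om|\<Omega>. (D V k om)\<^sup>2)" by (intro Bochner_Integration.integral_sum iD)
  finally show False using k by (simp add: O.prob_space)
 qed
 then obtain om where om: "om : space \<Omega>" "AE q in M >< M. compatible e ((fst q, f k om (fst q)), (snd q, f k om (snd q)))"
  "(\<Sum>V\<in>\<V>. (D V k om)\<^sup>2) < ep\<^sup>2" by blast
 show ?thesis
 proof (intro bexI[of _ "f k om"] conjI ballI om(2) mf1[OF om(1)])
  fix V assume V: "V : \<V>"
  have "(D V k om)\<^sup>2 <= (\<Sum>V\<in>\<V>. (D V k om)\<^sup>2)" by (rule member_le_sum[OF V]) (use \<V>(1) in auto)
  hence "(D V k om)\<^sup>2 < ep\<^sup>2" using om(3) by simp
  hence "\<bar>D V k om\<bar> < ep" using ep power_mono[of ep "\<bar>D V k om\<bar>" 2] by (auto simp: not_le[symmetric])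
  thus "\<bar>measure M {x : space M. f k om x : V} - (LINT p|(M >< unif). Ind V (F (fst p) (snd p)))\<bar> < ep"
   unfolding D_eq[OF V om(1)] .
 qed
qed

end

section \<open>Coding a compact target space\<close>

lemma compact_dense_sequence:
 fixes Y :: "'y::metric_space set"
 assumes "compact Y" "Y ~= {}"
 obtains s :: "nat => 'y" where "!!k. s k : Y" "!!y et. y : Y ==> 0 < et ==> EX k. dist y (s k) < et"
proof -
 have "\<forall>n::nat. EX K. finite K & K <= Y & Y <= (\<Union>x\<in>K. ball x (1 / Suc n))"
  using compact_imp_seq_compact[OF assms(1), THEN seq_compact_imp_totally_bounded] by auto
 then obtain K where K: "!!n::nat. finite (K n)" "!!n. K n <= Y" "!!n. Y <= (\<Union>x\<in>K n. ball x (1 / Suc n))"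
  by metis
 define D where "D = (\<Union>n. K n)"
 have "K 0 ~= {}" using K(3)[of 0] assms(2) by auto
 hence D: "D ~= {}" "D <= Y" using K(2) by (auto simp: D_def)
 have cD: "countable D" unfolding D_def using countable_finite[OF K(1)] by simp
 show thesis
 proof (rule that[of "from_nat_into D"])
  show "from_nat_into D k : Y" for k using from_nat_into[OF D(1)] D(2) by blast
  fix y et assume y: "y : Y" "0 < (et::real)"
  obtain n where n: "1 / Suc n < et" using nat_approx_posE[OF y(2)] by blast
  obtain x where x: "x : K n" "dist x y < 1 / Suc n" using K(3)[of n] y(1) by auto
  have "x : D" using x(1) by (auto simp: D_def)
  then obtain k where k: "from_nat_into D k = x" using from_nat_into_surj[OF cD] by blast
  have "dist y (from_nat_into D k) < et" unfolding k using x(2) n dist_commute[of y x] by linarith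
  thus "EX k. dist y (from_nat_into D k) < et" ..
 qed
qed

text \<open>Turns a bound on a distance in \<open>Y\<close> into countably many inequalities between
  real coordinates. These stand in for joint measurability of \<open>dist\<close> and are the
  coordinates \<open>e k\<close> of labels.\<close>

lemma dist_le_iff_dense:
 assumes s: "!!y et. y : Y ==> 0 < et ==> EX k. dist y (s k) < et" and y: "y' : Y"
 shows "dist y y' <= r \<longleftrightarrow> (\<forall>k::nat. dist y (s k) - dist y' (s k) <= r)"
proof
 assume "dist y y' <= r"
 thus "ALL k. dist y (s k) - dist y' (s k) <= r"
  using dist_triangle[of y _ y'] by (auto simp: algebra_simps) (meson order_trans add_left_mono add_mono_thms_linordered_semiring(3))
next
 assume le: "ALL k. dist y (s k) - dist y' (s k) <= r"
 show "dist y y' <= r"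
 proof (rule field_le_epsilon)
  fix et :: real assume "0 < et"
  then obtain k where k: "dist y' (s k) < et / 2" using s[OF y, of "et / 2"] by auto
  have "dist y y' <= dist y (s k) + dist y' (s k)" by (rule dist_triangle2)
  thus "dist y y' <= r + et" using le[rule_format, of k] k by linarith
 qed
qed

text \<open>Distances to a dense sequence embed \<open>Y\<close> in the cube, the diameter bound
  placing them in [0,1]. By compactness the inverse of the embedding is continuous, so
  \<open>C\<close> is closed and \<open>b\<close> is continuous on it: limits of coded labels are
  again coded labels.\<close>

lemma compact_coding:
 fixes Y :: "'y::metric_space set"
 assumes Y: "compact Y" "diameter Y <= 1" "Y ~= {}"
 obtains C and b :: "real => 'y" and code where "closed C" "C <= {0..1}" "continuous_on C b"
  "b : Bm borel" "range b <= Y" "code : Bm (restrict_space borel Y)"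
  "\<forall>y\<in>Y. code y : C" "\<forall>y\<in>Y. b (code y) = y"
proof -
 obtain s where s: "!!k::nat. s k : Y" "!!y et. y : Y ==> 0 < et ==> EX k. dist y (s k) < et"
  using compact_dense_sequence[OF Y(1,3)] by blast
 obtain y0 where y0: "y0 : Y" using Y(3) by blast
 define \<phi> where "\<phi> y = (%k. dist y (s k))" for y
 have c: "continuous_on S \<phi>" for S unfolding \<phi>_def[abs_def]
  by (rule continuous_on_coordinatewise_then_product) (intro continuous_intros)
 have inj: "inj_on \<phi> Y"
 proof (rule inj_onI)
  fix y y' assume y: "y : Y" "y' : Y" and eq: "\<phi> y = \<phi> y'"
  have "ALL k. dist y (s k) - dist y' (s k) <= 0" using eq by (simp add: \<phi>_def fun_eq_iff)
  hence "dist y y' <= 0" using dist_le_iff_dense[OF s(2) y(2)] by blast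
  thus "y = y'" by simp
 qed
 define g where "g = the_inv_into Y \<phi>"
 have gphi: "g (\<phi> y) = y" if "y : Y" for y unfolding g_def by (rule the_inv_into_f_f[OF inj that])
 have cg: "continuous_on (\<phi> ` Y) g" by (rule continuous_on_inv[OF c Y(1)]) (use gphi in blast)
 have cl: "closed (\<phi> ` Y)" by (rule compact_imp_closed[OF compact_continuous_image[OF c Y(1)]])
 define C where "C = {0..1} Int dec -` (\<phi> ` Y)"
 have C: "closed C" unfolding C_def
  by (intro closed_Int closed_vimage cl continuous_on_dec) simp
 define b where "b v = (if v : C then g (dec v) else y0)" for v
 have bC: "continuous_on C b"
 proof -
  have "continuous_on C (g o dec)"
   by (rule continuous_on_compose[OF continuous_on_subset[OF continuous_on_dec]])
    (auto intro: continuous_on_subset[OF cg] simp: C_def)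
  thus ?thesis by (rule continuous_on_eq) (simp add: b_def)
 qed
 have phi01: "0 <= \<phi> y k & \<phi> y k <= 1" if "y : Y" for y k
  using diameter_bounded_bound[OF compact_imp_bounded[OF Y(1)] that s(1)[of k]] Y(2) by (simp add: \<phi>_def)
 have dc: "dec (enc (\<phi> y)) = \<phi> y" if "y : Y" for y by (rule dec_enc) (rule phi01[OF that])
 show thesis
 proof (rule that[of C b "%y. enc (\<phi> y)"])
  show "C <= {0..1}" by (auto simp: C_def)
  have "(%v. g (dec v)) : Bm (restrict_space borel C)"
   by (rule measurable_cong[THEN iffD1, OF _ borel_measurable_continuous_on_restrict[OF bC]]) (simp add: b_def space_restrict_space)
  moreover have "{v : space borel. v : C} : sets borel" using C by simp
  ultimately show "b : Bm borel" unfolding b_def[abs_def] by (simp add: measurable_If_restrict_space_iff)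
  show "range b <= Y" using y0 gphi by (auto simp: b_def C_def)
  have "\<phi> : Bm (restrict_space borel Y)" by (rule borel_measurable_continuous_on_restrict[OF c])
  thus "(%y. enc (\<phi> y)) : Bm (restrict_space borel Y)" by (rule m_comp[OF _ measurable_enc])
  show cY: "\<forall>y\<in>Y. enc (\<phi> y) : C" using enc_bounds dc by (auto simp: C_def)
  show "\<forall>y\<in>Y. b (enc (\<phi> y)) = y" using cY gphi dc by (simp add: b_def)
 qed (rule C bC)+
qed

text \<open>The closed half of the portmanteau theorem: the continuous functions \<open>F n\<close>
  dominate the indicator of \<open>K\<close> and decrease to it.\<close>

lemma measure_closed_limit_ge:
 fixes L :: "nat => 'a::metric_space measure"
 assumes L: "!!n. prob_space (L n)" "!!n. sets (L n) = sets borel" and La: "prob_space La" "sets La = sets borel"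
  and conv: "!!F :: 'a => real. continuous_on UNIV F ==> (!!x. \<bar>F x\<bar> <= 1) ==> (%n. LINT x|L n. F x) ~~> (LINT x|La. F x)"
  and K: "closed K" and c: "!!n. c <= measure (L n) K" and "0 < c"
 shows "c <= measure La K"
proof -
 have ne: "K ~= {}" using c[of 0] \<open>0 < c\<close> by auto
 define F where "F n x = max 0 (1 - real n * infdist x K)" for n x
 have F: "continuous_on UNIV (F n)" "0 <= F n x & F n x <= 1" for n x
  unfolding F_def[abs_def] by (intro continuous_intros) (auto simp: infdist_nonneg)
 have FK: "F n x = 1" if "x : K" for n x using that by (simp add: F_def)
 have lim: "(%n. F n x) ~~> Ind K x" for x
 proof (cases "x : K")
  case True thus ?thesis by (simp add: FK)
 next
  case False
  hence pos: "0 < infdist x K" using in_closed_iff_infdist_zero[OF K ne] infdist_nonneg[of x K] by (metis less_eq_real_def)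
  obtain m :: nat where m: "1 / infdist x K < m" using reals_Archimedean2 by blast
  have "F n x = 0" if "m <= n" for n
  proof -
   have "1 < real m * infdist x K" using m pos by (simp add: field_simps)
   also have "... <= real n * infdist x K" using that pos by (intro mult_right_mono) auto
   finally show ?thesis by (simp add: F_def)
  qed
  thus ?thesis using False by (auto intro!: tendsto_eventually eventually_sequentiallyI[of m])
 qed
 have "c <= (LINT x|La. F m x)" for m
 proof (rule LIMSEQ_le_const)
  show "(%n. LINT x|L n. F m x) ~~> (LINT x|La. F m x)" by (rule conv[OF F(1)]) (use F(2) in simp)
  have "c <= (LINT x|L n. F m x)" for n
  proof -
   interpret P: prob_space "L n" by (rule L)
   have "measure (L n) K = (LINT x|L n. Ind K x)" using K L(2)[of n] by (simp add: sets_eq_imp_space_eq[OF L(2)])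
   also have "... <= (LINT x|L n. F m x)"
   proof (rule integral_mono)
    show "integrable (L n) (Ind K :: 'a => real)" using K L(2)[of n] by (intro P.integrable_bounded[where B=1] bm_ind) (auto simp: indicator_def)
    have "F m : Bm (L n)" unfolding m_cong_sets[OF L(2) refl] by (rule borel_measurable_continuous_onI[OF F(1)])
    thus "integrable (L n) (F m)" by (rule P.integrable_bounded[where B=1]) (use F(2) in simp)
    show "Ind K x <= F m x" for x using FK[of x m] F(2)[of m x] by (auto simp: indicator_def)
   qed
   finally show ?thesis using c[of n] by simp
  qed
  thus "EX N. \<forall>n\<ge>N. c <= (LINT x|L n. F m x)" by blast
 qed
 thus ?thesis
  by (intro LIMSEQ_le_const[OF closed_integral_limit[OF La K F lim]]) auto
qed

section \<open>Partial diameters and the observable diameter of a model\<close>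

lemma diameter_leI:
 assumes "0 <= d" "!!x y. x : S ==> y : S ==> dist x y <= d"
 shows "diameter S <= d"
 unfolding diameter_def by (auto intro!: cSUP_least assms)

context
 fixes Y :: "'y::metric_space set" and nu :: "'y measure" and \<kappa> :: real
 assumes Y: "compact Y" "diameter Y <= 1" and nu: "prob_space nu" "sets nu = sets (restrict_space borel Y)" and \<kappa>: "0 <= \<kappa>"
begin

lemma sets_subset_Y: "Y0 : sets nu ==> Y0 <= Y"
 using sets.sets_into_space[of Y0 nu] sets_eq_imp_space_eq[OF nu(2)] by (simp add: space_restrict_space)

lemma diameter_nonneg_Y: "Y0 : sets nu ==> 0 <= diameter Y0"
 by (rule diameter_ge_0) (rule bounded_subset[OF compact_imp_bounded[OF Y(1)] sets_subset_Y])

lemma partial_diam_bdd: "bdd_below {D. \<exists>Y0\<in>sets nu. diameter Y0 <= D & measure nu Y0 \<ge> 1 - \<kappa>}"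
 using diameter_nonneg_Y by (intro bdd_belowI[where m=0]) force

lemma space_nu: "space nu = Y"
 using sets_eq_imp_space_eq[OF nu(2)] by (simp add: space_restrict_space)

lemma one_mem_partial_diam: "1 : {D. \<exists>Y0\<in>sets nu. diameter Y0 <= D & measure nu Y0 \<ge> 1 - \<kappa>}"
proof -
 have "measure nu Y = 1" using prob_space.prob_space[OF nu(1)] by (simp add: space_nu)
 moreover have "Y : sets nu" using sets.top[of nu] by (simp add: space_nu)
 ultimately show ?thesis using Y(2) \<kappa> by force
qed

lemma partial_diam_le: "Y0 : sets nu ==> diameter Y0 <= D ==> 1 - \<kappa> <= measure nu Y0 ==> partial_diam nu \<kappa> <= D"
 unfolding partial_diam_def by (rule cInf_lower[OF _ partial_diam_bdd]) blast

lemma partial_diam_le_1: "partial_diam nu \<kappa> <= 1"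
 unfolding partial_diam_def by (rule cInf_lower[OF one_mem_partial_diam partial_diam_bdd])

lemma partial_diam_nonneg: "0 <= partial_diam nu \<kappa>"
 unfolding partial_diam_def using one_mem_partial_diam diameter_nonneg_Y
 by (intro cInf_greatest) (blast, force)

lemma partial_diam_less:
 assumes "partial_diam nu \<kappa> < D"
 obtains Y0 where "Y0 : sets nu" "diameter Y0 < D" "1 - \<kappa> <= measure nu Y0"
proof -
 have "\<exists>D'\<in>{D. \<exists>Y0\<in>sets nu. diameter Y0 <= D & measure nu Y0 \<ge> 1 - \<kappa>}. D' < D"
  using assms one_mem_partial_diam unfolding partial_diam_def by (intro cInf_lessD) blast+
 thus thesis using that by force
qed

end

context sample_model
begin

text \<open>The bound holds for almost every noise, hence against the essential infimum of the
  distance, as for Lipschitz maps on qmm-spaces.\<close>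

definition lip :: "'y::metric_space set => ('a => 'y) set" where
 "lip Y = {f : M ->M restrict_space borel Y. AE z in (M >< M) >< unif.
  dist (f (fst (fst z))) (f (snd (fst z))) <= Ps (fst (fst z)) (snd (fst z)) (snd z)}"

definition obs :: "'y::metric_space set => real => real" where
 "obs Y \<kappa> = (SUP f\<in>lip Y. partial_diam (distr M (restrict_space borel Y) f) \<kappa>)"

lemma lip_measurable: "f : lip Y ==> f : M ->M restrict_space borel Y"
 by (simp add: lip_def)

lemma lip_in: "f : lip Y ==> x : space M ==> f x : Y"
 using measurable_space[OF lip_measurable, of f Y x] by (simp add: space_restrict_space)

lemma obs_bdd:
 assumes "compact Y" "diameter Y <= 1" "0 <= \<kappa>"
 shows "bdd_above ((%f. partial_diam (distr M (restrict_space borel Y) f) \<kappa>) ` lip Y)"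
proof (rule bdd_aboveI2[where M=1])
 fix f assume f: "f : lip Y"
 show "partial_diam (distr M (restrict_space borel Y) f) \<kappa> <= 1"
  by (rule partial_diam_le_1[OF assms(1,2) prob_space_distr[OF lip_measurable[OF f]] _ assms(3)]) simp
qed

lemma obs_upper:
 assumes "compact Y" "diameter Y <= 1" "0 <= \<kappa>" "f : lip Y"
 shows "partial_diam (distr M (restrict_space borel Y) f) \<kappa> <= obs Y \<kappa>"
 unfolding obs_def by (rule cSUP_upper[OF assms(4) obs_bdd[OF assms(1-3)]])

lemma lip_const:
 assumes "y : Y" shows "(%_. y) : lip Y"
proof -
 have "0 <= Ps (fst (fst z)) (snd (fst z)) (snd z)" if "z : space ((M >< M) >< unif)" for z
  using that Ps_bounds by (auto simp: sp_pair)
 thus ?thesis using assms unfolding lip_def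
  by (auto simp: space_restrict_space intro!: measurable_const AE_I2)
qed

text \<open>For empty \<open>Y\<close> the supremum in \<open>obs\<close> runs over the empty set,
  with the same value in every model; comparisons treat this case apart.\<close>

lemma lip_empty: "lip {} = {}"
 using lip_in not_empty by fastforce

lemma obs_nonneg:
 assumes "compact Y" "diameter Y <= 1" "0 <= \<kappa>" "Y ~= {}"
 shows "0 <= obs Y \<kappa>"
proof -
 obtain y where "y : Y" using assms(4) by blast
 hence f: "(%_. y) : lip Y" by (rule lip_const)
 have "0 <= partial_diam (distr M (restrict_space borel Y) (%_. y)) \<kappa>"
  by (rule partial_diam_nonneg[OF assms(1,2) prob_space_distr[OF lip_measurable[OF f]] _ assms(3)]) simp
 with obs_upper[OF assms(1-3) f] show ?thesis by simp
qed

text \<open>Coupling, conditioning and selection in one statement. The events in \<open>\<V>\<close>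
  are saturated for the coordinates \<open>e k\<close> because these are all that compatibility
  controls.\<close>

theorem label_transfer:
 fixes h :: "'a => real" and e :: "nat => real => real"
 assumes h: "h : Bm M" "inj_on h (space M)"
  and La: "prob_space La" "sets La = sets borel" "exchangeable La" "dissociated La"
  and unit: "AE A in La. ALL i. 0 <= A i i & A i i <= 1"
  and marg: "distr La borel offd = law (%_. 0)"
  and e: "!!k. e k : Bm borel"
  and lip: "AE A in La. ALL k. e k (A 0 0) - e k (A 1 1) <= A 0 1"
  and \<V>: "finite \<V>" "!!V. V : \<V> ==> V : sets borel"
   "!!V v v'. V : \<V> ==> (!!k. e k v = e k v') ==> v : V \<longleftrightarrow> v' : V"
  and ep: "0 < ep"
 shows "\<exists>f\<in>Bm M. (AE z in (M >< M) >< unif.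
   ALL k. e k (f (fst (fst z))) - e k (f (snd (fst z))) <= Ps (fst (fst z)) (snd (fst z)) (snd z)) \<and>
  (\<forall>V\<in>\<V>. \<bar>measure M {x : space M. f x : V} - measure La {A. A 0 0 : V}\<bar> < ep)"
proof -
 obtain J where J: "coupling M Ps J" "distr J borel snd = La" using coupling_exists[OF La(1-3) unit marg] by blast
 interpret C: coupling M Ps J by (rule J(1))
 interpret L: prob_space La by (rule La(1))
 interpret LL: pair_prob_space La La ..
 interpret unif: prob_space unif by simp
 interpret MM: prob_space "M >< M" by (intro prob_space_pair prob_space_axioms)
 interpret MMU: pair_sigma_finite "M >< M" unif ..
 have msnd: "snd : J ->M borel" unfolding C.measurable_J by (rule m_snd)
 have AEJ: "AE z in J. P (snd z)" if "AE A in La. P A" for P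
  by (rule AE_distrD[OF msnd]) (simp only: J(2) that)
 have mV: "(%A :: arr. Ind V (A i i) :: real) : Bm borel" if "V : sets borel" for V i
  by (rule m_comp[OF measurable_arr_entry]) (use that in simp)
 have mVLa: "(%A :: arr. Ind V (A i i) :: real) : Bm La" if "V : sets borel" for V i
  unfolding m_cong_sets[OF La(2) refl] by (rule mV[OF that])
 have iJ: "(LINT z|J. G (snd z)) = (LINT A|La. G A)" if "G : Bm borel" for G :: "arr => real"
  unfolding J(2)[symmetric] by (rule integral_distr[OF msnd that, symmetric])
 have iV: "(LINT A|La. Ind V (A i i)) = measure La {A. A i i : V}" if "V : sets borel" for V i
 proof -
  have "{A :: arr. A i i : V} : sets La"
   using measurable_sets[OF measurable_arr_entry that, of i i] by (simp add: La(2) vimage_def)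
  moreover have "(LINT A|La. Ind V (A i i)) = (LINT A|La. Ind {A. A i i : V} A :: real)"
   by (rule b_cong) (auto simp: indicator_def)
  ultimately show ?thesis by (simp add: sets_eq_imp_space_eq[OF La(2)])
 qed
 \<comment> \<open>Indices 0 and 1 are the first even and the first odd one, so dissociation of
   \<open>La\<close> factors the product.\<close>
 have diss: "(LINT z|J. Ind V (snd z 0 0) * Ind V (snd z 1 1)) =
   (LINT z|J. Ind V (snd z 0 0)) * (LINT z|J. Ind V (snd z 0 0) :: real)" if V: "V : sets borel" for V
 proof -
  define g :: "arr => real" where "g A = Ind V (A 0 0)" for A
  have g: "g : Bm borel" "g : Bm La" "\<bar>g A\<bar> <= 1" for A
   unfolding g_def[abs_def] using mV[OF V] mVLa[OF V] by (auto simp: indicator_def)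
  have gg: "(%z. g (fst z) * g (snd z)) : Bm (borel >< borel)"
   by (intro bm_times m_comp[OF m_fst g(1)] m_comp[OF m_snd g(1)])
  have gg': "(%z. g (fst z) * g (snd z)) : Bm (La >< La)"
   by (intro bm_times m_comp[OF m_fst g(2)] m_comp[OF m_snd g(2)])
  have ms: "(%A. (sub evens A, sub odds A)) : La ->M borel >< borel"
   unfolding m_cong_sets[OF La(2) refl] by (intro m_Pair measurable_sub)
  have "(LINT z|J. Ind V (snd z 0 0) * Ind V (snd z 1 1)) = (LINT A|La. Ind V (A 0 0) * Ind V (A 1 1) :: real)"
   by (rule iJ) (intro bm_times mV V)
  also have "... = (LINT A|La. g (fst (sub evens A, sub odds A)) * g (snd (sub evens A, sub odds A)))"
   by (simp add: g_def sub_def evens_def odds_def)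
  also have "... = (LINT z|(La >< La). g (fst z) * g (snd z))"
   unfolding La(4)[unfolded dissociated_def, symmetric] by (rule integral_distr[OF ms gg, symmetric])
  also have "... = (LINT A|La. LINT B|La. g A * g B)"
  proof -
   have "integrable (La >< La) (%z. g (fst z) * g (snd z))"
    by (rule finite_measure.integrable_bounded[OF prob_space.axioms(1)[OF prob_space_pair[OF La(1) La(1)]] gg', where B=1])
     (use g(3) in \<open>simp add: abs_mult mult_le_one\<close>)
   from LL.integral_fst'[OF this] show ?thesis by simp
  qed
  also have "... = (LINT A|La. g A) * (LINT A|La. g A)" by simp
  also have "(LINT A|La. g A) = (LINT z|J. Ind V (snd z 0 0))" using iJ[OF g(1)] by (simp add: g_def)
  finally show ?thesis .
 qed
 have unitJ: "AE z in J. 0 <= snd z 0 0 & snd z 0 0 <= 1"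
  using AEJ[OF unit] by (rule AE_mp) (auto intro!: AE_I2)
 have sub\<V>: "\<V> <= sets borel" using \<V>(2) by blast
 have "\<exists>F :: 'a => real => real. (%p. F (fst p) (snd p)) : Bm (M >< unif) \<and>
  (AE p in (M >< unif) >< (M >< unif). compatible e ((fst (fst p), F (fst (fst p)) (snd (fst p))),
   (fst (snd p), F (fst (snd p)) (snd (snd p))))) \<and>
  (\<forall>V\<in>\<V>. (LINT p|(M >< unif). Ind V (F (fst p) (snd p))) = (LINT z|J. Ind V (snd z 0 0) :: real))"
  by (rule C.conditional_sampler[OF e AEJ[OF lip] unitJ diss \<V>(1) sub\<V>], assumption) (intro exI conjI ballI, assumption+)
 then obtain F :: "'a => real => real" where
  F: "(%p. F (fst p) (snd p)) : Bm (M >< unif)"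
  "AE p in (M >< unif) >< (M >< unif). compatible e ((fst (fst p), F (fst (fst p)) (snd (fst p))),
   (fst (snd p), F (fst (snd p)) (snd (snd p))))"
  "!!V. V : \<V> ==> (LINT p|(M >< unif). Ind V (F (fst p) (snd p))) = (LINT z|J. Ind V (snd z 0 0) :: real)"
  by (elim exE conjE) (rule that, assumption+, erule (1) bspec)
 have "\<exists>f\<in>Bm M. (AE q in M >< M. compatible e ((fst q, f (fst q)), (snd q, f (snd q)))) \<and>
  (\<forall>V\<in>\<V>. \<bar>measure M {x : space M. f x : V} - (LINT p|(M >< unif). Ind V (F (fst p) (snd p)))\<bar> < ep)"
 proof (rule pure_selection[OF h F(1) e F(2) \<V>(1) _ _ ep])
  show "V : sets borel" if "V : \<V>" for V by (rule \<V>(2)[OF that])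
  show "v : V \<longleftrightarrow> v' : V" if "V : \<V>" "!!k. e k v = e k v'" for V v v' by (rule \<V>(3)[OF that])
 qed
 then obtain f where f: "f : Bm M"
  "AE q in M >< M. compatible e ((fst q, f (fst q)), (snd q, f (snd q)))"
  "!!V. V : \<V> ==> \<bar>measure M {x : space M. f x : V} - (LINT p|(M >< unif). Ind V (F (fst p) (snd p)))\<bar> < ep"
  by (elim bexE conjE) (rule that, assumption+, erule (1) bspec)
 show ?thesis
 proof (intro bexI[of _ f] conjI ballI f(1))
  fix V assume V: "V : \<V>"
  show "\<bar>measure M {x : space M. f x : V} - measure La {A. A 0 0 : V}\<bar> < ep"
   using f(3)[OF V] unfolding F(3)[OF V] iJ[OF mV[OF \<V>(2)[OF V]]] iV[OF \<V>(2)[OF V]] .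
 next
  have m1: "(%z. e k (f (fst (fst z)))) : Bm ((M >< M) >< unif)" for k
   by (intro m_comp[OF m_fst] m_comp[OF _ e] f(1))
  have m2: "(%z. e k (f (snd (fst z)))) : Bm ((M >< M) >< unif)" for k
   by (intro m_comp[OF m_fst] m_comp[OF m_snd] m_comp[OF _ e] f(1))
  have m3: "(%z. Ps (fst (fst z)) (snd (fst z)) (snd z)) : Bm ((M >< M) >< unif)"
   by (intro measurable_Ps m_comp[OF m_fst m_fst] m_comp[OF m_fst m_snd] measurable_snd_unif)
  show "AE z in (M >< M) >< unif. ALL k. e k (f (fst (fst z))) - e k (f (snd (fst z))) <= Ps (fst (fst z)) (snd (fst z)) (snd z)"
  proof (rule MMU.AE_pair_measure)
   show "{z : space ((M >< M) >< unif). ALL k. e k (f (fst (fst z))) - e k (f (snd (fst z))) <= Ps (fst (fst z)) (snd (fst z)) (snd z)} : sets ((M >< M) >< unif)"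
    by (intro sets.sets_Collect_countable_All borel_measurable_le borel_measurable_diff m1 m2 m3)
   show "AE q in M >< M. AE u in unif. ALL k. e k (f (fst (fst (q, u)))) - e k (f (snd (fst (q, u)))) <= Ps (fst (fst (q, u))) (snd (fst (q, u))) (snd (q, u))"
    using f(2) AE_space
   proof eventually_elim
    case (elim q)
    have "fst q : space M" "snd q : space M" using elim(2) unfolding sp_pair by (rule SigmaE; simp)+
    from compatible_AE[OF elim(1) this] show ?case by (simp only: fst_conv snd_conv)
   qed
  qed
 qed
qed


text \<open>
 Only finitely many closed neighbourhoods are compared, so no continuity of \<^const>\<open>partial_diam\<close> is needed:
 approximating the label distribution on all unions of cells of a finite cover suffices.
\<close>
theorem obs_ge_of_labels:
 fixes Y :: "'y::metric_space set" and b :: "real => 'y" and h :: "'a => real"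
 assumes Y: "compact Y" "diameter Y <= 1" and \<kappa>: "0 <= \<kappa>"
  and h: "h : Bm M" "inj_on h (space M)"
  and b: "b : Bm borel" "!!v. b v : Y"
  and La: "prob_space La" "sets La = sets borel" "exchangeable La" "dissociated La"
  and unit: "AE A in La. ALL i. 0 <= A i i & A i i <= 1"
  and marg: "distr La borel offd = law (%_. 0)"
  and lip: "AE A in La. dist (b (A 0 0)) (b (A 1 1)) <= A 0 1"
 shows "partial_diam (distr La (restrict_space borel Y) (%A. b (A 0 0))) \<kappa> <= obs Y \<kappa>"
proof (rule field_le_epsilon)
 fix et' :: real assume "0 < et'"
 \<comment> \<open>Four steps through centres of the cover and one for the choice of
   \<open>Y0\<close> add up to five.\<close>
 define et where "et = et' / 5"
 have et: "0 < et" using \<open>0 < et'\<close> by (simp add: et_def)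
 interpret L: prob_space La by (rule La(1))
 have ne: "Y ~= {}" using b(2) by blast
 obtain s where s: "!!k::nat. s k : Y" "!!y et. y : Y ==> 0 < et ==> EX k. dist y (s k) < et"
  using compact_dense_sequence[OF Y(1) ne] by blast
 define e where "e k v = dist (b v) (s k)" for k :: nat and v
 have e: "e k : Bm borel" for k unfolding e_def[abs_def]
  by (rule m_comp[OF b(1) borel_measurable_continuous_onI]) (intro continuous_intros)
 have deq: "dist (b v) (b v') <= r \<longleftrightarrow> (ALL k. e k v - e k v' <= r)" for v v' r
  unfolding e_def by (rule dist_le_iff_dense[where Y=Y], erule (1) s(2), rule b(2))
 have elip: "AE A in La. ALL k. e k (A 0 0) - e k (A 1 1) <= A 0 1" using lip by (simp only: deq)
 have esat: "b v = b v'" if "!!k. e k v = e k v'" for v v'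
 proof -
  have "dist (b v) (b v') <= 0" unfolding deq using that by simp
  thus ?thesis by simp
 qed
 obtain T where T: "finite T" "T <= Y" "Y <= (\<Union>t\<in>T. ball t et)"
  using compact_imp_seq_compact[OF Y(1), THEN seq_compact_imp_totally_bounded, rule_format, OF et] by (elim exE conjE)
 define V where "V I = {v. \<exists>t\<in>I. dist t (b v) < et}" for I
 have mb: "{v. dist t (b v) < et} : sets borel" for t
 proof -
  have "(%v. dist t (b v)) : Bm borel"
   by (rule m_comp[OF b(1) borel_measurable_continuous_onI]) (intro continuous_intros)
  from borel_measurable_less[OF this measurable_const[of et]] show ?thesis by simp
 qed
 have mV: "V I : sets borel" if "I <= T" for I
 proof -
  have "V I = (\<Union>t\<in>I. {v. dist t (b v) < et})" by (auto simp: V_def)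
  thus ?thesis using finite_subset[OF that T(1)] mb by auto
 qed
 define mI0 where "mI0 I = measure La {A. A 0 0 : V I}" for I
 \<comment> \<open>At most every gap below the level \<open>1 - \<kappa>\<close> among the finitely
   many masses: an error smaller than \<open>ep\<close> cannot lift a union of cells up to that
   level.\<close>
 define ep where "ep = Min (insert 1 ((%I. 1 - \<kappa> - mI0 I) ` {I : Pow T. mI0 I < 1 - \<kappa>}))"
 have fin: "finite (insert 1 ((%I. 1 - \<kappa> - mI0 I) ` {I : Pow T. mI0 I < 1 - \<kappa>}))" using T(1) by simp
 have ep: "0 < ep" unfolding ep_def using fin by (subst Min_gr_iff) auto
 have eple: "ep <= 1 - \<kappa> - mI0 I" if "I <= T" "mI0 I < 1 - \<kappa>" for I
  unfolding ep_def by (rule Min_le[OF fin]) (use that in auto)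
 have "\<exists>f\<in>Bm M. (AE z in (M >< M) >< unif.
   ALL k. e k (f (fst (fst z))) - e k (f (snd (fst z))) <= Ps (fst (fst z)) (snd (fst z)) (snd z)) \<and>
  (\<forall>V\<in>V ` Pow T. \<bar>measure M {x : space M. f x : V} - measure La {A. A 0 0 : V}\<bar> < ep)"
 proof (rule label_transfer[OF h La unit marg e elip _ _ _ ep])
  show "finite (V ` Pow T)" using T(1) by simp
  show "U : sets borel" if "U : V ` Pow T" for U using that mV by blast
  show "v : U \<longleftrightarrow> v' : U" if "U : V ` Pow T" "!!k. e k v = e k v'" for U v v'
   using that(1) esat[OF that(2)] by (auto simp: V_def)
 qed
 then obtain f where f: "f : Bm M" "AE z in (M >< M) >< unif.
   ALL k. e k (f (fst (fst z))) - e k (f (snd (fst z))) <= Ps (fst (fst z)) (snd (fst z)) (snd z)"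
  and fV: "\<forall>V\<in>V ` Pow T. \<bar>measure M {x : space M. f x : V} - measure La {A. A 0 0 : V}\<bar> < ep"
  by (elim bexE conjE)
 have mbY: "b : borel ->M restrict_space borel Y" by (rule measurable_restrict_space2[OF _ b(1)]) (use b(2) in simp)
 have gm: "(%x. b (f x)) : M ->M restrict_space borel Y" by (rule m_comp[OF f(1) mbY])
 have g: "(%x. b (f x)) : lip Y" unfolding lip_def using gm f(2) by (simp only: deq mem_Collect_eq simp_thms)
 let ?nu = "distr M (restrict_space borel Y) (%x. b (f x))"
 let ?lam = "distr La (restrict_space borel Y) (%A. b (A 0 0))"
 have bA: "(%A. b (A 0 0)) : La ->M restrict_space borel Y"
  unfolding m_cong_sets[OF La(2) refl] by (rule m_comp[OF measurable_arr_entry mbY])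
 have "partial_diam ?nu \<kappa> < obs Y \<kappa> + et" using obs_upper[OF Y \<kappa> g] et by simp
 then obtain Y0 where Y0: "Y0 : sets ?nu" "diameter Y0 < obs Y \<kappa> + et" "1 - \<kappa> <= measure ?nu Y0"
  using partial_diam_less[OF Y prob_space_distr[OF gm] _ \<kappa>, of "obs Y \<kappa> + et"] by auto
 have Y0Y: "Y0 <= Y" using sets.sets_into_space[OF Y0(1)] by (simp add: space_restrict_space)
 define I where "I = {t : T. \<exists>y\<in>Y0. dist t y < et}"
 have IT: "I <= T" by (auto simp: I_def)
 have sub: "{x : space M. b (f x) : Y0} <= {x : space M. f x : V I}"
 proof
  fix x assume x: "x : {x : space M. b (f x) : Y0}"
  then obtain t where "t : T" "dist t (b (f x)) < et" using T(3) b(2)[of "f x"] by auto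
  thus "x : {x : space M. f x : V I}" using x by (auto simp: I_def V_def)
 qed
 have mfV: "{x : space M. f x : V I} : sets M" using measurable_sets[OF f(1) mV[OF IT]] by (simp add: vimage_def Int_def conj_commute)
 have "1 - \<kappa> <= measure M {x : space M. b (f x) : Y0}"
  using Y0(3) by (subst (asm) measure_distr[OF gm]) (use Y0(1) in \<open>simp_all add: vimage_def Int_def conj_commute\<close>)
 also have "... <= measure M {x : space M. f x : V I}" by (rule finite_measure_mono[OF sub mfV])
 also have "... < mI0 I + ep" using fV[rule_format, of "V I"] IT by (auto simp: mI0_def)
 finally have "~ mI0 I < 1 - \<kappa>" using eple[OF IT] by fastforce
 hence ge: "1 - \<kappa> <= mI0 I" by simp
 define Y1 where "Y1 = {y : Y. \<exists>t\<in>I. dist t y < et}"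
 have Y1: "Y1 : sets ?lam"
 proof -
  have "open (\<Union>t\<in>I. ball t et)" by auto
  hence "Y Int (\<Union>t\<in>I. ball t et) : sets (restrict_space borel Y)" by (auto simp: sets_restrict_space)
  moreover have "Y1 = Y Int (\<Union>t\<in>I. ball t et)" by (auto simp: Y1_def)
  ultimately show ?thesis by simp
 qed
 have "measure ?lam Y1 = mI0 I" unfolding mI0_def
  by (subst measure_distr[OF bA]) (use Y1 b(2) in \<open>auto simp: sets_eq_imp_space_eq[OF La(2)] Y1_def V_def intro!: arg_cong[where f="measure La"]\<close>)
 moreover have "diameter Y1 <= obs Y \<kappa> + et'"
 proof (rule diameter_leI)
  show "0 <= obs Y \<kappa> + et'" using obs_nonneg[OF Y \<kappa> ne] \<open>0 < et'\<close> by simp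
  fix y y' assume "y : Y1" "y' : Y1"
  then obtain t t' where t: "t : I" "dist t y < et" "t' : I" "dist t' y' < et" by (auto simp: Y1_def)
  then obtain z z' where z: "z : Y0" "dist t z < et" "z' : Y0" "dist t' z' < et" by (auto simp: I_def)
  have "dist z z' <= diameter Y0"
   by (rule diameter_bounded_bound[OF bounded_subset[OF compact_imp_bounded[OF Y(1)] Y0Y] z(1,3)])
  moreover have "dist y y' <= dist t y + dist t z + dist z z' + dist t' z' + dist t' y'"
   using dist_triangle[of y y' t] dist_triangle[of t y' z] dist_triangle[of z y' z'] dist_triangle[of z' y' t']
   by (simp add: dist_commute)
  ultimately show "dist y y' <= obs Y \<kappa> + et'" using t z Y0(2) by (simp add: et_def)
 qed
 ultimately show "partial_diam ?lam \<kappa> <= obs Y \<kappa> + et'"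
  using partial_diam_le[OF Y L.prob_space_distr[OF bA] _ \<kappa> Y1] ge by simp
qed

lemma distr_samp_point: "distr (samp M) M (%z. fst z 0) = M"
proof -
 interpret unif: prob_space unif by simp
 have m: "(%z. ((fst z 0, fst z 1), snd z (0, 1))) : samp M ->M (M >< M) >< unif"
  unfolding measurable_unif_eq[symmetric]
  by (intro m_Pair measurable_samp_x) (simp only: measurable_unif_eq measurable_samp_u)
 have "distr (samp M) M (%z. fst z 0) = distr (distr (samp M) ((M >< M) >< unif) (%z. ((fst z 0, fst z 1), snd z (0, 1)))) M (%p. fst (fst p))"
  by (subst distr_distr[OF m_comp[OF m_fst m_fst] m]) (simp add: comp_def)
 also have "... = distr ((M >< M) >< unif) M (%p. fst (fst p))" by (subst distr_samp_pair) simp_all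
 also have "... = distr (distr ((M >< M) >< unif) (M >< M) fst) M fst"
  by (subst distr_distr[OF m_fst m_fst]) (simp add: comp_def)
 also have "... = M" by (simp only: unif.distr_pair_fst distr_pair_fst)
 finally show ?thesis .
qed

lemma label_law:
 fixes Y :: "'y::metric_space set" and b :: "real => 'y"
 assumes b: "b : Bm borel" "!!v. b v : Y"
  and code: "code : Bm (restrict_space borel Y)" "\<forall>y\<in>Y. code y : C" "\<forall>y\<in>Y. b (code y) = y"
  and Y: "compact Y" "Y ~= {}" and C: "closed C" and f: "f : lip Y"
 defines "c \<equiv> %x. code (f x)"
 shows label_measurable: "c : Bm M"
  and label_mem: "AE A in law c. ALL i. A i i : C"
  and label_lip: "AE A in law c. dist (b (A 0 0)) (b (A 1 1)) <= A 0 1"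
  and label_distr: "distr (law c) (restrict_space borel Y) (%A. b (A 0 0)) = distr M (restrict_space borel Y) f"
  and label_offd: "distr (law c) borel offd = law (%_. 0)"
  and label_unit: "C <= {0..1} ==> AE A in law c. ALL i j. 0 <= A i j & A i j <= 1"
proof -
 show c: "c : Bm M" unfolding c_def by (rule m_comp[OF lip_measurable[OF f] code(1)])
 note ms = measurable_smat[OF c]
 have sx: "fst z i : space M" if "z : space (samp M)" for z i
  using that by (auto simp: samp_def sp_pair space_seqs)
 have AEL: "AE A in law c. P A" if "AE z in samp M. P (smat Ps c z)" and "{A. P A} : sets borel" for P
  unfolding law_def using that by (subst AE_distr_iff[OF ms]) simp_all
 have cs: "c (fst z i) : C" "b (c (fst z i)) = f (fst z i)" if "z : space (samp M)" for z i
  using code(2,3) lip_in[OF f sx[OF that]] by (simp_all add: c_def)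
 show "AE A in law c. ALL i. A i i : C"
 proof (rule AEL)
  show "AE z in samp M. ALL i. smat Ps c z i i : C" by (rule AE_I2) (simp add: smat_def cs)
  have "{A :: arr. A i i : C} : sets borel" for i
   using measurable_sets[OF measurable_arr_entry borel_closed[OF C], of i i] by (simp add: vimage_def)
  thus "{A :: arr. ALL i. A i i : C} : sets borel"
   using sets.sets_Collect_countable_All[of borel "%i (A :: arr). A i i : C"] by simp
 qed
 show "AE A in law c. dist (b (A 0 0)) (b (A 1 1)) <= A 0 1"
 proof (rule AEL)
  have m: "(%z. ((fst z 0, fst z 1), snd z (0, 1))) : samp M ->M (M >< M) >< unif"
   by (intro m_Pair measurable_samp_x) (simp only: measurable_unif_eq measurable_samp_u)
  have "AE z in samp M. dist (f (fst z 0)) (f (fst z 1)) <= Ps (fst z 0) (fst z 1) (snd z (0, 1))"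
  proof -
   have "AE p in distr (samp M) ((M >< M) >< unif) (%z. ((fst z 0, fst z 1), snd z (0, 1))).
    dist (f (fst (fst p))) (f (snd (fst p))) <= Ps (fst (fst p)) (snd (fst p)) (snd p)"
    unfolding distr_samp_pair[OF zero_less_one] using f by (simp add: lip_def)
   from AE_distrD[OF m this] show ?thesis by (simp only: fst_conv snd_conv)
  qed
  thus "AE z in samp M. dist (b (smat Ps c z 0 0)) (b (smat Ps c z 1 1)) <= smat Ps c z 0 1"
   using AE_space by eventually_elim (simp add: smat_def cs)
  obtain s where s: "!!k::nat. s k : Y" "!!y et. y : Y ==> 0 < et ==> EX k. dist y (s k) < et"
   using compact_dense_sequence[OF Y] b(2) by blast
  have e: "(%A :: arr. dist (b (A i i)) (s k)) : Bm borel" for i k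
   by (rule m_comp[OF measurable_arr_entry], rule m_comp[OF b(1) borel_measurable_continuous_onI]) (intro continuous_intros)
  have "{A : space borel. ALL k. dist (b (A 0 0)) (s k) - dist (b (A 1 1)) (s k) <= (A :: arr) 0 1} : sets borel"
   by (intro sets.sets_Collect_countable_All borel_measurable_le borel_measurable_diff e measurable_arr_entry)
  moreover have "dist (b v) (b v') <= r \<longleftrightarrow> (ALL k. dist (b v) (s k) - dist (b v') (s k) <= r)" for v v' r
   by (rule dist_le_iff_dense[where Y=Y], erule (1) s(2), rule b(2))
  ultimately show "{A :: arr. dist (b (A 0 0)) (b (A 1 1)) <= A 0 1} : sets borel"
   by (simp only: space_borel UNIV_I simp_thms)
 qed
 have mbY: "b : borel ->M restrict_space borel Y" by (rule measurable_restrict_space2[OF _ b(1)]) (use b(2) in simp)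
 show "distr (law c) (restrict_space borel Y) (%A. b (A 0 0)) = distr M (restrict_space borel Y) f"
 proof -
  have "distr (law c) (restrict_space borel Y) (%A. b (A 0 0)) = distr (samp M) (restrict_space borel Y) (%z. b (smat Ps c z 0 0))"
   unfolding law_def by (subst distr_distr[OF m_comp[OF measurable_arr_entry mbY] ms]) (simp add: comp_def)
  also have "... = distr (samp M) (restrict_space borel Y) (%z. f (fst z 0))"
   by (rule distr_cong[OF refl refl]) (simp add: smat_def cs)
  also have "... = distr (distr (samp M) M (%z. fst z 0)) (restrict_space borel Y) f"
   by (subst distr_distr[OF lip_measurable[OF f] measurable_samp_x]) (simp add: comp_def)
  finally show ?thesis by (simp only: distr_samp_point)
 qed
 show "distr (law c) borel offd = law (%_. 0)"
  unfolding law_def by (subst distr_distr[OF measurable_offd ms]) (auto simp: comp_def offd_def smat_def fun_eq_iff intro!: distr_cong)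
 show "AE A in law c. ALL i j. 0 <= A i j & A i j <= 1" if "C <= {0..1}"
 proof (rule AEL[OF _ sets_arr_unit], rule AE_I2)
  fix z assume z: "z : space (samp M)"
  have "0 <= c (fst z i) & c (fst z i) <= 1" for i using cs(1)[OF z, of i] that by auto
  thus "ALL i j. 0 <= smat Ps c z i j & smat Ps c z i j <= 1" using Ps_bounds sx[OF z] by (simp add: smat_def)
 qed
qed

end


section \<open>Invariance and semicontinuity of the observable diameter\<close>

text \<open>The labelled sample of a Lipschitz map on \<open>M\<close> is already an admissible
  \<open>La\<close> for \<open>N\<close>. No limit is taken, so \<kappa> stays the same.\<close>

lemma obs_le_of_law_eq:
 fixes Y :: "'y::metric_space set" and h :: "'b => real"
 assumes S: "sample_model (M :: 'a measure) Ps" "sample_model (N :: 'b measure) \<Theta>"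
  and h: "h : Bm N" "inj_on h (space N)"
  and eq: "sample_model.law M Ps (%_. 0) = sample_model.law N \<Theta> (%_. 0)"
  and Y: "compact Y" "diameter Y <= 1" "Y ~= {}" and \<kappa>: "0 <= \<kappa>"
 shows "sample_model.obs M Ps Y \<kappa> <= sample_model.obs N \<Theta> Y \<kappa>"
proof -
 interpret A: sample_model M Ps by (rule S)
 interpret B: sample_model N \<Theta> by (rule S)
 from compact_coding[OF Y] obtain C and b :: "real => 'y" and code where C: "closed C" "C <= {0..1}" "continuous_on C b"
  and b0: "b : Bm borel" "range b <= Y"
  and code: "code : Bm (restrict_space borel Y)" "\<forall>y\<in>Y. code y : C" "\<forall>y\<in>Y. b (code y) = y" .
 have bY: "b v : Y" for v using b0(2) by blast
 note b = b0(1) bY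
 show ?thesis unfolding A.obs_def
 proof (rule cSUP_least)
  show "A.lip Y ~= {}" using A.lip_const Y(3) by blast
  fix f assume f: "f : A.lip Y"
  note LL = A.label_law[OF b code Y(1,3) C(1) f]
  have "partial_diam (distr (A.law (%x. code (f x))) (restrict_space borel Y) (%A. b (A 0 0))) \<kappa> <= B.obs Y \<kappa>"
  proof (rule B.obs_ge_of_labels[OF Y(1,2) \<kappa> h b A.prob_space_law[OF LL(1)] A.sets_law A.exchangeable_law[OF LL(1)] A.dissociated_law[OF LL(1)]])
   show "AE A in A.law (%x. code (f x)). ALL i. 0 <= A i i & A i i <= 1"
    using LL(6)[OF C(2)] by eventually_elim simp
   show "distr (A.law (%x. code (f x))) borel offd = B.law (%_. 0)" using LL(5) eq by simp
  qed (rule LL(3))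
  thus "partial_diam (distr M (restrict_space borel Y) f) \<kappa> <= B.obs Y \<kappa>" unfolding LL(4) .
 qed
qed

text \<open>Exchangeability, dissociation and the law of the distances are identities between
  integrals of continuous functions, and the Lipschitz relation is closed on coded labels; all of
  them pass to the limit of the labelled samples.\<close>

theorem obs_usc:
 fixes Y :: "'y::metric_space set" and h :: "'a => real" and N :: "nat => 'b measure"
 assumes S: "sample_model (M :: 'a measure) Ps" "!!n. sample_model (N n) (\<Theta> n)"
  and h: "h : Bm M" "inj_on h (space M)"
  and conv: "!!F :: arr => real. !!B. continuous_on UNIV F ==> (!!A. \<bar>F A\<bar> <= B) ==>
   (%n. LINT A|sample_model.law (N n) (\<Theta> n) (%_. 0). F A) ~~> (LINT A|sample_model.law M Ps (%_. 0). F A)"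
  and Y: "compact Y" "diameter Y <= 1" "Y ~= {}" and \<kappa>: "0 <= \<kappa>'" "\<kappa>' < \<kappa>"
  and a: "!!n. a < sample_model.obs (N n) (\<Theta> n) Y \<kappa>"
 shows "a <= sample_model.obs M Ps Y \<kappa>'"
proof -
 interpret A: sample_model M Ps by (rule S)
 from compact_coding[OF Y] obtain C and b :: "real => 'y" and code where C: "closed C" "C <= {0..1}" "continuous_on C b"
  and b0: "b : Bm borel" "range b <= Y"
  and code: "code : Bm (restrict_space borel Y)" "\<forall>y\<in>Y. code y : C" "\<forall>y\<in>Y. b (code y) = y" .
 have bY: "b v : Y" for v using b0(2) by blast
 note b = b0(1) bY
 have mbY: "b : borel ->M restrict_space borel Y" by (rule measurable_restrict_space2[OF _ b(1)]) (use b(2) in simp)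
 have \<kappa>0: "0 <= \<kappa>" "0 < \<kappa>" using \<kappa> by auto
 have "\<exists>f\<in>sample_model.lip (N n) (\<Theta> n) Y. a < partial_diam (distr (N n) (restrict_space borel Y) f) \<kappa>" for n
 proof -
  interpret B: sample_model "N n" "\<Theta> n" by (rule S)
  have "B.lip Y ~= {}" using B.lip_const Y(3) by blast
  from less_cSUP_iff[OF this B.obs_bdd[OF Y(1,2) \<kappa>0(1)]] a[of n] show ?thesis by (simp add: B.obs_def)
 qed
 then obtain f where f: "!!n. f n : sample_model.lip (N n) (\<Theta> n) Y"
  "!!n. a < partial_diam (distr (N n) (restrict_space borel Y) (f n)) \<kappa>" by metis
 define c where "c n = (%x. code (f n x))" for n
 define L where "L n = sample_model.law (N n) (\<Theta> n) (c n)" for n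
 note LL = sample_model.label_law[OF S(2) b code Y(1,3) C(1) f(1), folded c_def, folded L_def]
 have Lp: "prob_space (L n)" "sets (L n) = sets borel" "exchangeable (L n)" "dissociated (L n)" for n
  unfolding L_def by (rule sample_model.prob_space_law[OF S(2) LL(1)] sample_model.sets_law[OF S(2)]
   sample_model.exchangeable_law[OF S(2) LL(1)] sample_model.dissociated_law[OF S(2) LL(1)])+
 have mL: "L n ->M X = borel ->M X" for n and X :: "'z measure" by (rule m_cong_sets[OF Lp(2) refl])
 have mL': "L n ->M X = borel ->M X" for n and X :: "arr measure" by (rule m_cong_sets[OF Lp(2) refl])
 have mL2: "L n ->M X = borel ->M X" for n and X :: "(arr \<times> arr) measure" by (rule m_cong_sets[OF Lp(2) refl])
 have "\<exists>(r :: nat => nat) (La :: arr measure). strict_mono r & prob_space La & sets La = sets borel & (AE A in La. ALL i j. 0 <= A i j & A i j <= 1) \<and>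
  (\<forall>(F :: arr => real) B. continuous_on UNIV F --> (ALL A. \<bar>F A\<bar> <= B) --> (%n. LINT A|L (r n). F A) ~~> (LINT A|La. F A))"
 proof (rule arr_weak_compactness[OF Lp(1,2) LL(6)[OF C(2)]])
  fix r :: "nat => nat" and La :: "arr measure"
  assume a: "strict_mono r" "prob_space La" "sets La = sets borel" "AE A in La. ALL i j. 0 <= A i j & A i j <= 1"
   "!!(F :: arr => real) B. continuous_on UNIV F ==> (!!A. \<bar>F A\<bar> <= B) ==> (%n. LINT A|L (r n). F A) ~~> (LINT A|La. F A)"
  have "(\<forall>(F :: arr => real) B. continuous_on UNIV F --> (ALL A. \<bar>F A\<bar> <= B) --> (%n. LINT A|L (r n). F A) ~~> (LINT A|La. F A))"
   by (intro allI impI, rule a(5)) (assumption, erule spec)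
  thus ?thesis by (intro exI[of _ r] exI[of _ La] conjI a(1-4))
 qed
 then obtain r :: "nat => nat" and La :: "arr measure" where
  r: "strict_mono r" and La: "prob_space La" "sets La = sets borel" "AE A in La. ALL i j. 0 <= A i j & A i j <= 1"
  and limF: "\<forall>(F :: arr => real) B. continuous_on UNIV F --> (ALL A. \<bar>F A\<bar> <= B) --> (%n. LINT A|L (r n). F A) ~~> (LINT A|La. F A)"
  by (elim exE conjE)
 have lim: "(%n. LINT A|L (r n). F A) ~~> (LINT A|La. F A)" if "continuous_on UNIV F" "!!A. \<bar>F A\<bar> <= B" for F :: "arr => real" and B
  using limF[rule_format, OF that(1), of B] that(2) by simp
 interpret La: prob_space La by (rule La)
 have mLa: "La ->M X = borel ->M X" for X :: "arr measure" by (rule m_cong_sets[OF La(2) refl])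
 have mLa2: "La ->M X = borel ->M X" for X :: "(arr \<times> arr) measure" by (rule m_cong_sets[OF La(2) refl])
 have mLaY: "La ->M X = borel ->M X" for X :: "'y measure" by (rule m_cong_sets[OF La(2) refl])
 have exch: "exchangeable La" unfolding exchangeable_def
 proof (intro allI impI)
  fix pq :: "nat => nat" assume pq: "inj pq"
  show "distr La borel (sub pq) = La"
  proof (rule measure_eqI_continuous[OF La.prob_space_distr _ La(1,2)])
   show ms: "sub pq : Bm La" unfolding mLa by (rule measurable_sub)
   fix F :: "arr => real" assume F: "continuous_on UNIV F" "!!x. 0 <= F x & F x <= 1"
   have F1: "\<bar>F x\<bar> <= 1" for x using F(2)[of x] by simp
   have Fm: "F : Bm borel" by (rule borel_measurable_continuous_onI[OF F(1)])
   have cF: "continuous_on UNIV (%A. F (sub pq A))" by (rule continuous_on_compose2[OF F(1) continuous_on_sub]) simp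
   have "(LINT A|L n. F (sub pq A)) = (LINT A|L n. F A)" for n
   proof -
    have "sub pq : Bm (L n)" unfolding mL' by (rule measurable_sub)
    from integral_distr[OF this Fm] show ?thesis using Lp(3)[of n] pq by (simp add: exchangeable_def)
   qed
   hence "(%n. LINT A|L (r n). F A) ~~> (LINT A|La. F (sub pq A))" using lim[OF cF F1] by simp
   from LIMSEQ_unique[OF this lim[OF F(1) F1]] show "(LINT x|distr La borel (sub pq). F x) = (LINT x|La. F x)"
    by (simp add: integral_distr[OF ms Fm])
  qed simp
 qed
 have diss: "dissociated La" unfolding dissociated_def
 proof (rule pair_measure_eqI_continuous[OF La(1,2) La(1,2) La.prob_space_distr])
  have mb: "(%A. (sub evens A, sub odds A)) : borel ->M borel >< borel" by (intro m_Pair measurable_sub)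
  thus ms: "(%A. (sub evens A, sub odds A)) : La ->M borel >< borel" unfolding mLa2 .
  fix F G :: "arr => real" assume F: "continuous_on UNIV F" "!!x. 0 <= F x & F x <= 1" and G: "continuous_on UNIV G" "!!x. 0 <= G x & G x <= 1"
  have F1: "\<bar>F x\<bar> <= 1" and G1: "\<bar>G x\<bar> <= 1" and FG1: "\<bar>F x * G y\<bar> <= 1" for x y
   using F(2)[of x] G(2)[of x] F(2)[of x] G(2)[of y] by (simp_all add: abs_mult mult_le_one)
  have Fm: "F : Bm borel" and Gm: "G : Bm borel" by (intro borel_measurable_continuous_onI F G)+
  have FGm: "(%z. F (fst z) * G (snd z)) : Bm (borel >< borel)"
   by (intro bm_times m_comp[OF m_fst Fm] m_comp[OF m_snd Gm])
  have cFG: "continuous_on UNIV (%A. F (sub evens A) * G (sub odds A))"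
   by (intro continuous_on_mult continuous_on_compose2[OF F(1) continuous_on_sub] continuous_on_compose2[OF G(1) continuous_on_sub]) simp_all
  have "(LINT A|L n. F (sub evens A) * G (sub odds A)) = (LINT A|L n. F A) * (LINT A|L n. G A)" for n
  proof -
   interpret P: prob_space "L n" by (rule Lp)
   interpret PP: pair_prob_space "L n" "L n" ..
   have ms: "(%A. (sub evens A, sub odds A)) : L n ->M borel >< borel" unfolding mL2 by (rule mb)
   have Fn: "F : Bm (L n)" and Gn: "G : Bm (L n)"
    unfolding m_cong_sets[OF Lp(2) refl] by (rule Fm Gm)+
   have "(LINT A|L n. F (sub evens A) * G (sub odds A)) = (LINT z|(L n >< L n). F (fst z) * G (snd z))"
    using integral_distr[OF ms FGm] Lp(4)[of n] by (simp add: dissociated_def)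
   also have "... = (LINT x|L n. LINT y|L n. F x * G y)"
   proof -
    have "(%z. F (fst z) * G (snd z)) : Bm (L n >< L n)"
     by (intro bm_times m_comp[OF m_fst Fn] m_comp[OF m_snd Gn])
    hence "integrable (L n >< L n) (%z. F (fst z) * G (snd z))"
     by (rule finite_measure.integrable_bounded[OF prob_space.axioms(1)[OF prob_space_pair[OF Lp(1) Lp(1)]]]) (rule FG1)
    from PP.integral_fst'[OF this] show ?thesis by simp
   qed
   finally show ?thesis by simp
  qed
  hence "(%n. (LINT A|L (r n). F A) * (LINT A|L (r n). G A)) ~~> (LINT A|La. F (sub evens A) * G (sub odds A))"
   using lim[OF cFG FG1] by simp
  from LIMSEQ_unique[OF this tendsto_mult[OF lim[OF F(1) F1] lim[OF G(1) G1]]]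
  show "(LINT z|distr La (borel >< borel) (%A. (sub evens A, sub odds A)). F (fst z) * G (snd z)) = (LINT x|La. F x) * (LINT x|La. G x)"
   by (simp add: integral_distr[OF ms FGm])
 qed simp
 have marg: "distr La borel offd = A.law (%_. 0)"
 proof (rule measure_eqI_continuous[OF La.prob_space_distr _ A.prob_space_law A.sets_law])
  show ms: "offd : Bm La" unfolding mLa by (rule measurable_offd)
  fix F :: "arr => real" assume F: "continuous_on UNIV F" "!!x. 0 <= F x & F x <= 1"
  have F1: "\<bar>F x\<bar> <= 1" for x using F(2)[of x] by simp
  have Fm: "F : Bm borel" by (rule borel_measurable_continuous_onI[OF F(1)])
  have cF: "continuous_on UNIV (%A. F (offd A))" by (rule continuous_on_compose2[OF F(1) continuous_on_offd]) simp
  have "(LINT A|L n. F (offd A)) = (LINT A|sample_model.law (N n) (\<Theta> n) (%_. 0). F A)" for n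
  proof -
   have "offd : Bm (L n)" unfolding mL' by (rule measurable_offd)
   from integral_distr[OF this Fm] show ?thesis using LL(5)[of n] by simp
  qed
  hence "(%n. LINT A|L (r n). F (offd A)) ~~> (LINT A|A.law (%_. 0). F A)"
   using LIMSEQ_subseq_LIMSEQ[OF conv[OF F(1) F1] r] by (simp add: comp_def)
  from LIMSEQ_unique[OF lim[OF cF F1] this]
  show "(LINT x|distr La borel offd. F x) = (LINT x|A.law (%_. 0). F x)" by (simp add: integral_distr[OF ms Fm])
 qed simp_all
 have lim1: "(%n. LINT A|L (r n). F A) ~~> (LINT A|La. F A)" if "continuous_on UNIV F" "!!A. \<bar>F A\<bar> <= 1" for F :: "arr => real"
  using lim[OF that] .
 have cle: "c <= measure La K" if "closed K" "!!n. c <= measure (L n) K" "0 < c" for K c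
  by (rule measure_closed_limit_ge[where L="%n. L (r n)", OF Lp(1,2) La(1,2) lim1 that(1) that(2) that(3)])
 have AEcl: "AE A in La. A : K" if K: "closed K" and "!!n. AE A in L n. A : K" for K
 proof -
  have "1 <= measure (L n) K" for n
   using prob_space.prob_eq_1[OF Lp(1)[of n], of K] K that(2)[of n] Lp(2)[of n] by simp
  from cle[OF K this] have "measure La K = 1" using La.prob_le_1[of K] by simp
  thus ?thesis using La.prob_eq_1[of K] K La(2) by simp
 qed
 have centry: "continuous_on S (%A :: arr. A i j)" for S i j by (rule continuous_on_entry[OF continuous_on_id])
 have clC: "closed {A :: arr. A i i : C}" for i
  using continuous_closed_vimage[OF C(1), of "%A :: arr. A i i"] centry[of UNIV i i]
  by (simp add: vimage_def continuous_on_eq_continuous_at)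
 \<comment> \<open>Restricting both labels to \<open>C\<close>, where \<open>b\<close> is
   continuous, makes the Lipschitz relation closed.\<close>
 define K where "K = {A :: arr. A 0 0 : C & A 1 1 : C & dist (b (A 0 0)) (b (A 1 1)) <= A 0 1}"
 have cb: "continuous_on ({A :: arr. A 0 0 : C} Int {A. A 1 1 : C}) (%A. b (A i i))" if "i : {0, 1}" for i
  by (rule continuous_on_compose2[OF C(3) centry]) (use that in auto)
 have K: "closed K"
 proof -
  have "closed {A : {A :: arr. A 0 0 : C} Int {A. A 1 1 : C}. dist (b (A 0 0)) (b (A 1 1)) <= A 0 1}"
   by (rule continuous_on_closed_Collect_le[OF continuous_on_dist[OF cb cb] centry closed_Int[OF clC clC]]) simp_all
  thus ?thesis by (simp add: K_def conj_assoc Int_def)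
 qed
 have "AE A in La. A : K"
 proof (rule AEcl[OF K])
  show "AE A in L n. A : K" for n using LL(2)[of n] LL(3)[of n] by eventually_elim (simp add: K_def)
 qed
 hence lipL: "AE A in La. dist (b (A 0 0)) (b (A 1 1)) <= A 0 1" by eventually_elim (simp add: K_def)
 have unit: "AE A in La. ALL i. 0 <= A i i & A i i <= 1" using La(3) by eventually_elim simp
 let ?lam = "distr La (restrict_space borel Y) (%A. b (A 0 0))"
 have bA: "(%A. b (A 0 0)) : La ->M restrict_space borel Y"
  unfolding mLaY by (rule m_comp[OF measurable_arr_entry mbY])
 have "partial_diam ?lam \<kappa>' <= A.obs Y \<kappa>'"
  by (rule A.obs_ge_of_labels[OF Y(1,2) \<kappa>(1) h b La(1,2) exch diss unit marg lipL])
 moreover have "a <= partial_diam ?lam \<kappa>'"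
 proof (rule ccontr)
  assume "~ a <= partial_diam ?lam \<kappa>'"
  hence "partial_diam ?lam \<kappa>' < a" by simp
  then obtain Y0 where Y0: "Y0 : sets ?lam" "diameter Y0 < a" "1 - \<kappa>' <= measure ?lam Y0"
   using partial_diam_less[OF Y(1,2) La.prob_space_distr[OF bA] _ \<kappa>(1)] by auto
  have Y0Y: "Y0 <= Y" using sets.sets_into_space[OF Y0(1)] by (simp add: space_restrict_space)
  \<comment> \<open>Half the slack, so that the open neighbourhood \<open>U\<close> of
    \<open>Y0\<close> still has diameter at most \<open>a\<close>.\<close>
  define et where "et = (a - diameter Y0) / 2"
  have et: "0 < et" using Y0(2) by (simp add: et_def)
  have dY0: "0 <= diameter Y0" by (rule diameter_ge_0[OF bounded_subset[OF compact_imp_bounded[OF Y(1)] Y0Y]])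
  define U where "U = {y : Y. \<exists>z\<in>Y0. dist y z < et}"
  have U: "U : sets (restrict_space borel Y)"
  proof -
   have "open (\<Union>z\<in>Y0. ball z et)" by auto
   hence "Y Int (\<Union>z\<in>Y0. ball z et) : sets (restrict_space borel Y)" by (auto simp: sets_restrict_space)
   moreover have "U = Y Int (\<Union>z\<in>Y0. ball z et)" by (auto simp: U_def dist_commute)
   ultimately show ?thesis by simp
  qed
  have dU: "diameter U <= a"
  proof (rule diameter_leI)
   show "0 <= a" using dY0 Y0(2) by simp
   fix y y' assume "y : U" "y' : U"
   then obtain z z' where z: "z : Y0" "dist y z < et" "z' : Y0" "dist y' z' < et" by (auto simp: U_def)
   have "dist z z' <= diameter Y0"
    by (rule diameter_bounded_bound[OF bounded_subset[OF compact_imp_bounded[OF Y(1)] Y0Y] z(1,3)])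
   moreover have "dist y y' <= dist y z + dist z z' + dist y' z'"
    using dist_triangle[of y y' z] dist_triangle[of z y' z'] by (simp add: dist_commute)
   ultimately show "dist y y' <= a" using z by (simp add: et_def field_simps)
  qed
  \<comment> \<open>Labels in \<open>C\<close> outside \<open>U\<close> form a closed set of mass
    above \<open>\<kappa>\<close> for every \<open>n\<close>, so at least \<open>\<kappa>\<close>
    remains in the limit. Next to \<open>Y0\<close>, of mass at least \<open>1 - \<kappa>'\<close>,
    that is too much.\<close>
  define KU where "KU = {A :: arr. A 0 0 : C & (\<forall>z\<in>Y0. et <= dist (b (A 0 0)) z)}"
  have KU: "closed KU"
  proof -
   have c0: "continuous_on {A :: arr. A 0 0 : C} (%A. b (A 0 0))"
    by (rule continuous_on_compose2[OF C(3) centry]) auto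
   have "closed {A : {A :: arr. A 0 0 : C}. et <= dist (b (A 0 0)) z}" for z
    by (rule continuous_on_closed_Collect_le[OF continuous_on_const continuous_on_dist[OF c0 continuous_on_const] clC])
   hence "closed ({A :: arr. A 0 0 : C} Int (\<Inter>z\<in>Y0. {A : {A :: arr. A 0 0 : C}. et <= dist (b (A 0 0)) z}))"
    by (intro closed_Int clC closed_INT) auto
   moreover have "KU = {A :: arr. A 0 0 : C} Int (\<Inter>z\<in>Y0. {A : {A :: arr. A 0 0 : C}. et <= dist (b (A 0 0)) z})"
    by (auto simp: KU_def)
   ultimately show ?thesis by simp
  qed
  have "\<kappa> <= measure (L n) KU" for n
  proof -
   interpret P: prob_space "L n" by (rule Lp)
   have bn: "(%A. b (A 0 0)) : L n ->M restrict_space borel Y"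
    unfolding m_cong_sets[OF Lp(2) refl] by (rule m_comp[OF measurable_arr_entry mbY])
   let ?l = "distr (L n) (restrict_space borel Y) (%A. b (A 0 0))"
   have "a < partial_diam ?l \<kappa>" using f(2)[of n] unfolding LL(4) .
   hence "~ 1 - \<kappa> <= measure ?l U"
    using partial_diam_le[OF Y(1,2) P.prob_space_distr[OF bn] _ \<kappa>0(1) _ dU] U by force
   hence lt: "measure (L n) {A. b (A 0 0) : U} < 1 - \<kappa>"
    using measure_distr[OF bn U] by (simp add: vimage_def sets_eq_imp_space_eq[OF Lp(2)])
   have mU: "{A. b (A 0 0) : U} : sets (L n)"
    using measurable_sets[OF bn U] by (simp add: vimage_def sets_eq_imp_space_eq[OF Lp(2)])
   have "measure (L n) KU = measure (L n) (space (L n) - {A. b (A 0 0) : U})"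
   proof (rule P.finite_measure_eq_AE)
    show "AE x in L n. (x : KU) = (x : space (L n) - {A. b (A 0 0) : U})"
     using LL(2)[of n] by eventually_elim (use b(2) in \<open>auto simp: KU_def U_def sets_eq_imp_space_eq[OF Lp(2)] not_less\<close>)
   qed (use KU Lp(2) mU in auto)
   thus ?thesis using P.prob_compl[OF mU] lt by simp
  qed
  from cle[OF KU this \<kappa>0(2)] have KUm: "\<kappa> <= measure La KU" .
  have Y0m: "{A. b (A 0 0) : Y0} : sets La"
   using measurable_sets[OF bA, of Y0] Y0(1) by (simp add: vimage_def sets_eq_imp_space_eq[OF La(2)])
  have "1 - \<kappa>' <= measure La {A. b (A 0 0) : Y0}"
   using Y0(3) measure_distr[OF bA, of Y0] Y0(1) by (simp add: vimage_def sets_eq_imp_space_eq[OF La(2)])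
  moreover have "KU Int {A. b (A 0 0) : Y0} = {}" using et by (force simp: KU_def)
  hence "measure La (KU Un {A. b (A 0 0) : Y0}) = measure La KU + measure La {A. b (A 0 0) : Y0}"
   using KU La(2) Y0m by (intro La.finite_measure_Union) auto
  ultimately show False using KUm \<kappa>(2) La.prob_le_1[of "KU Un {A. b (A 0 0) : Y0}"] by simp
 qed
 ultimately show ?thesis by simp
qed

section \<open>Real coordinates on separable spaces\<close>

lemma (in Metric_space) separable_dense_sequence:
 assumes "separable_space mtopology" "M ~= {}" and N: "space N = M" "sets N = sigma_sets M {U. openin mtopology U}"
 obtains c :: "nat => 'a" where "!!k. c k : M" "!!x r. x : M ==> 0 < r ==> EX k. d x (c k) < r"
  "!!a. a : M ==> (%x. d x a) : Bm N"
proof -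
 obtain C where C: "countable C" "C <= M" "mtopology closure_of C = M"
  using assms(1) unfolding separable_space_def by auto
 have "C ~= {}" using C(3) assms(2) by auto
 have dense: "EX k. d x (from_nat_into C k) < r" if x: "x : M" "0 < r" for x r
 proof -
  have "x : mtopology closure_of C" using C(3) x(1) by simp
  then obtain y where y: "y : C" "d x y < r" using x(2) unfolding metric_closure_of by (auto simp: in_mball)
  obtain k where "from_nat_into C k = y" using from_nat_into_surj[OF C(1) y(1)] by blast
  thus ?thesis using y(2) by blast
 qed
 show thesis
 proof (rule that[of "from_nat_into C"])
  show "from_nat_into C k : M" for k using from_nat_into[OF \<open>C ~= {}\<close>, of k] C(2) by blast
  show "(%x. d x a) : Bm N" if a: "a : M" for a
   unfolding borel_measurable_iff_less
  proof
   fix r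
   have "{w : space N. d w a < r} = mball a r" using a by (auto simp: N(1) in_mball commute)
   thus "{w : space N. d w a < r} : sets N" by (simp add: N(2) sigma_sets.Basic)
  qed
 qed (rule dense)
qed

text \<open>Distances to a dense sequence separate points. They are capped at 1 because
  \<open>enc\<close> codes numbers in [0,1]; small distances, which do the separating, are not
  affected.\<close>

lemma (in Metric_space) separable_injection:
 assumes "separable_space mtopology" "M ~= {}" and N: "space N = M" "sets N = sigma_sets M {U. openin mtopology U}"
 obtains h :: "'a => real" where "h : Bm N" "inj_on h (space N)"
proof -
 obtain c :: "nat => 'a" where c: "!!k. c k : M" "!!x r. x : M ==> 0 < r ==> EX k. d x (c k) < r"
  "!!a. a : M ==> (%x. d x a) : Bm N"
  using separable_dense_sequence[OF assms] by blast
 define p where "p x = (%k. min 1 (d x (c k)))" for x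
 show thesis
 proof (rule that[of "%x. enc (p x)"])
  have "p : Bm N" unfolding p_def[abs_def]
   by (rule measurable_coordinatewise_then_product) (intro borel_measurable_min c, simp_all add: c)
  thus "(%x. enc (p x)) : Bm N" by (rule m_comp[OF _ measurable_enc])
  have p01: "0 <= p x k & p x k <= 1" for x k by (simp add: p_def)
  show "inj_on (%x. enc (p x)) (space N)"
  proof (rule inj_onI)
   fix x y assume xy: "x : space N" "y : space N" and eq: "enc (p x) = enc (p y)"
   hence S: "x : M" "y : M" by (simp_all add: N)
   have "p x = dec (enc (p x))" by (rule dec_enc[symmetric]) (rule p01)
   also have "... = p y" unfolding eq by (rule dec_enc) (rule p01)
   finally have pp: "p x = p y" .
   have "d x y <= 0"
   proof (rule field_le_epsilon)
    fix et :: real assume "0 < et"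
    then obtain k where k: "d x (c k) < min 1 (et / 2)" using c(2)[OF S(1), of "min 1 (et / 2)"] by auto
    hence "d y (c k) < min 1 (et / 2)" using fun_cong[OF pp, of k] by (simp add: p_def min_def split: if_splits)
    thus "d x y <= 0 + et" using k triangle[OF S(1) c(1) S(2), of k] commute[of "c k" y] by simp
   qed
   thus "x = y" using zero[OF S] nonneg[of x y] by simp
  qed
 qed
qed

lemma (in sample_model) lip_iff:
 fixes Y :: "'y::metric_space set"
 assumes Y: "compact Y"
 shows "f : lip Y \<longleftrightarrow> f : M ->M restrict_space borel Y \<and>
  (AE p in M >< M. AE u in unif. dist (f (fst p)) (f (snd p)) <= Ps (fst p) (snd p) u)"
proof (cases "f : M ->M restrict_space borel Y")
 case True
 interpret unif: prob_space unif by simp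
 interpret MM: prob_space "M >< M" by (intro prob_space_pair prob_space_axioms)
 interpret MMU: pair_sigma_finite "M >< M" unif ..
 have fY: "f x : Y" if "x : space M" for x using measurable_space[OF True that] by (simp add: space_restrict_space)
 have fb: "f : Bm M" using True by (simp add: measurable_restrict_space2_iff)
 have "Y ~= {}" using fY not_empty by blast
 then obtain s where s: "!!k::nat. s k : Y" "!!y et. y : Y ==> 0 < et ==> EX k. dist y (s k) < et"
  using compact_dense_sequence[OF Y] by blast
 have e: "(%x. dist (f x) (s k)) : Bm M" for k
  by (rule m_comp[OF fb borel_measurable_continuous_onI]) (intro continuous_intros)
 have m1: "(%z. dist (f (fst (fst z))) (s k)) : Bm ((M >< M) >< unif)" for k
  by (intro m_comp[OF m_fst] m_comp[OF _ e] m_fst)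
 have m2: "(%z. dist (f (snd (fst z))) (s k)) : Bm ((M >< M) >< unif)" for k
  by (intro m_comp[OF m_fst] m_comp[OF m_snd] e)
 have m3: "(%z. Ps (fst (fst z)) (snd (fst z)) (snd z)) : Bm ((M >< M) >< unif)"
  by (intro measurable_Ps m_comp[OF m_fst m_fst] m_comp[OF m_fst m_snd] measurable_snd_unif)
 have "{z : space ((M >< M) >< unif). ALL k. dist (f (fst (fst z))) (s k) - dist (f (snd (fst z))) (s k) <= Ps (fst (fst z)) (snd (fst z)) (snd z)} : sets ((M >< M) >< unif)"
  by (intro sets.sets_Collect_countable_All borel_measurable_le borel_measurable_diff m1 m2 m3)
 moreover have "dist (f (fst (fst z))) (f (snd (fst z))) <= r \<longleftrightarrow> (ALL k. dist (f (fst (fst z))) (s k) - dist (f (snd (fst z))) (s k) <= r)"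
  if "z : space ((M >< M) >< unif)" for z r
 proof (rule dist_le_iff_dense[where Y=Y], erule (1) s(2))
  show "f (snd (fst z)) : Y" using that by (intro fY) (auto simp: sp_pair)
 qed
 ultimately have "{z : space ((M >< M) >< unif). dist (f (fst (fst z))) (f (snd (fst z))) <= Ps (fst (fst z)) (snd (fst z)) (snd z)} : sets ((M >< M) >< unif)"
  by (simp cong: conj_cong)
 from MMU.AE_pair_iff[OF this] show ?thesis using True by (simp add: lip_def)
qed (simp add: lip_def)

lemma standard_borel_injection:
 assumes "standard_borel N" "space N ~= {}"
 obtains h :: "'a => real" where "h : Bm N" "inj_on h (space N)"
proof -
 obtain T where T: "completely_metrizable_space T" "separable_space T" "topspace T = space N"
  "sets N = sigma_sets (space N) {U. openin T U}" using assms(1) unfolding standard_borel_def by blast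
 obtain S d where S: "Metric_space S d" "T = Metric_space.mtopology S d" using T(1) unfolding completely_metrizable_space_def by blast
 interpret Metric_space S d by (rule S)
 have "topspace T = S" using S(2) by simp
 hence "space N = S" using T(3) by simp
 thus thesis using separable_injection[of N] T assms(2) S(2) that by auto
qed

section \<open>Supports and quantiles on the unit interval\<close>

text \<open>The complement of the support is covered by the null sets of a countable basis.\<close>

lemma AE_support:
 assumes nu: "sets nu = sets unit_borel"
 shows "AE t in nu. t : support nu"
proof -
 obtain B :: "real set set" where B: "countable B" "topological_basis B" using ex_countable_basis by blast
 have sp: "space nu = {0..1}" using sets_eq_imp_space_eq[OF nu] by (simp add: space_restrict_space)
 define B0 where "B0 = {U : B. emeasure nu (U Int space nu) = 0}"
 have mU: "U Int space nu : sets nu" if "open U" for U using that unfolding nu sp by (auto simp: sets_restrict_space)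
 have "AE t in nu. \<forall>U\<in>B0. t \<notin> U"
 proof (subst AE_ball_countable)
  show "countable B0" using B(1) by (auto simp: B0_def intro: countable_subset)
  show "\<forall>U\<in>B0. AE t in nu. t \<notin> U"
  proof
   fix U assume U: "U : B0"
   hence "U Int space nu : null_sets nu" using mU topological_basis_open[OF B(2)] by (auto simp: B0_def null_sets_def)
   from AE_not_in[OF this] AE_space show "AE t in nu. t \<notin> U" by eventually_elim simp
  qed
 qed
 with AE_space show ?thesis
 proof eventually_elim
  case (elim t)
  show ?case unfolding support_def
  proof (safe intro!: elim(1))
   fix U :: "real set" assume U: "open U" "t : U"
   obtain U' where U': "U' : B" "t : U'" "U' <= U" using topological_basisE[OF B(2) U] by blast
   have "emeasure nu (U' Int space nu) ~= 0" using elim(2) U' by (auto simp: B0_def)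
   moreover have "emeasure nu (U' Int space nu) <= emeasure nu (U Int space nu)" by (rule emeasure_mono) (use U'(3) mU[OF U(1)] in auto)
   ultimately show "0 < emeasure nu (U Int space nu)" by (metis le_zero_eq not_gr_zero)
  qed
 qed
qed

text \<open>Translates the infimum of the support into an almost sure bound, the form used in
  \<open>lip\<close>.\<close>

lemma le_Inf_support_iff:
 assumes nu: "prob_space nu" "sets nu = sets unit_borel"
 shows "r <= Inf (support nu) \<longleftrightarrow> (AE t in nu. r <= t)"
proof
 interpret prob_space nu by (rule nu)
 have sp: "space nu = {0..1}" using sets_eq_imp_space_eq[OF nu(2)] by (simp add: space_restrict_space)
 have bdd: "bdd_below (support nu)" by (rule bdd_belowI[where m=0]) (auto simp: support_def sp)
 show "AE t in nu. r <= t" if "r <= Inf (support nu)"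
  using AE_support[OF nu(2)] by eventually_elim (use cInf_lower[OF _ bdd] that in force)
 show "r <= Inf (support nu)" if r: "AE t in nu. r <= t"
 proof (rule cInf_greatest)
  show "support nu ~= {}" using AE_support[OF nu(2)] by auto
  fix t assume t: "t : support nu"
  show "r <= t"
  proof (rule ccontr)
   assume "~ r <= t"
   hence "0 < emeasure nu ({..<r} Int space nu)" using t by (auto simp: support_def)
   moreover have "{..<r} Int space nu : sets nu" unfolding nu(2) sp by (auto simp: sets_restrict_space)
   hence "prob ({..<r} Int space nu) = 0" by (subst prob_eq_0) (use r in \<open>auto elim: eventually_mono\<close>)
   ultimately show False by (simp add: emeasure_eq_measure)
  qed
 qed
qed

text \<open>\<open>min 1 u\<close> acts on the null set \<open>u > 1\<close>: there, too, the
  quantile of a point mass at 0 is 0, as \<open>Ps_refl\<close> demands for every real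
  number.\<close>

definition quantile :: "real measure => real => real" where
 "quantile p u = qt (%r. measure p ({0..1} Int {..of_rat r})) (min 1 u)"

lemma quantile_bounds: "0 <= quantile p u" "quantile p u <= 1"
 by (simp_all add: quantile_def qt_bounds)

lemma measurable_quantile:
 assumes "p : N ->M prob_algebra unit_borel" "f : Bm N"
 shows "(%x. quantile (p x) (f x)) : Bm N"
proof -
 have "{0..1} Int {..of_rat r :: real} : sets unit_borel" for r by (auto simp: sets_restrict_space)
 thus ?thesis unfolding quantile_def
  by (intro measurable_qt m_comp[OF assms(1)] measurable_measure_prob_algebra borel_measurable_min assms(2)) simp_all
qed

lemma quantile_law:
 assumes p: "prob_space p" "sets p = sets unit_borel"
 shows "quantile p : unif ->M unit_borel" "distr unif unit_borel (quantile p) = p"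
proof -
 interpret p: prob_space p by (rule p)
 interpret unif: prob_space unif by simp
 have sp: "space p = {0..1}" using sets_eq_imp_space_eq[OF p(2)] by (simp add: space_restrict_space)
 have pm: "A Int {0..1} : sets p" if "A : sets borel" for A using that unfolding p(2) by (auto simp: sets_restrict_space)
 have mT: "quantile p : Bm unif" unfolding m_cong_sets[OF sets_unif refl]
  by (rule measurable_quantile[where p="%_. p"]) (use p in \<open>auto simp: space_prob_algebra\<close>)
 show mT': "quantile p : unif ->M unit_borel" by (rule measurable_restrict_space2[OF _ mT]) (simp add: quantile_bounds)
 have mid: "(%x. x) : Bm p" unfolding m_cong_sets[OF p(2) refl] by (rule measurable_restrict_space1) simp
 have le1: "AE u in unif. u <= 1"
  using unif.prob_eq_1[of "{..1}"] measure_unif_atMost[of 1] by simp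
 have eq: "distr unif borel (quantile p) = distr p borel (%x. x)"
 proof (rule real_measure_eqI)
  show "finite_measure (distr unif borel (quantile p))" "finite_measure (distr p borel (%x. x))"
   using unif.prob_space_distr[OF mT] p.prob_space_distr[OF mid] by (auto simp: prob_space_def)
  fix t :: real
  have e1: "emeasure (distr unif borel (quantile p)) {..<t} = measure unif {u. quantile p u < t}"
   using mT by (subst emeasure_distr) (auto simp: unif.emeasure_eq_measure vimage_def lessThan_def)
  have e2: "emeasure (distr p borel (%x. x)) {..<t} = measure p ({0..1} Int {..<t})"
   using mid by (subst emeasure_distr) (auto simp: p.emeasure_eq_measure sp Int_commute)
  have "measure unif {u. quantile p u < t} = measure p ({0..1} Int {..<t})"
  proof (cases "t <= 0")
   case True
   have "~ quantile p u < t" for u using True quantile_bounds(1)[of p u] by simp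
   hence "{u. quantile p u < t} = {}" by simp
   moreover have "{0..1} Int {..<t} = {}" using True by auto
   ultimately
   show ?thesis by simp
  next
   case False
   show ?thesis
   proof (cases "t <= 1")
    case True
    obtain r :: "nat => rat" where r: "incseq r" "!!k. 0 <= r k" "!!k. of_rat (r k) < t" "!!s. s < t ==> EX k. s <= of_rat (r k)"
     using rat_seq_below[of t] False by auto
    define G where "G r = measure p ({0..1} Int {..of_rat r})" for r :: rat
    have Gq: "(%k. G (r k)) ~~> measure unif {u. qt G u < t}"
    proof (rule qt_law[OF _ _ _ True r(1-3)])
     show "0 <= G r" "G r <= 1" for r by (simp_all add: G_def)
     show "G r <= G s" if "r <= s" for r s unfolding G_def
     proof (rule p.finite_measure_mono)
      have "real_of_rat r <= real_of_rat s" using that by (simp add: of_rat_less_eq)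
      thus "{0..1} Int {..real_of_rat r} <= {0..1} Int {..real_of_rat s}" by auto
      show "{0..1} Int {..real_of_rat s} : sets p" unfolding Int_commute[of "{0..1}"] by (rule pm) simp
     qed
    qed (rule r(4))
    moreover have Gl: "(%k. G (r k)) ~~> measure p (\<Union>k. {0..1} Int {..of_rat (r k)})"
     unfolding G_def
    proof (rule p.finite_Lim_measure_incseq)
     show "range (%k. {0..1} Int {..real_of_rat (r k)}) <= sets p" 
     proof (rule image_subsetI)
      fix k show "{0..1} Int {..real_of_rat (r k)} : sets p" unfolding Int_commute[of "{0..1}"] by (rule pm) simp
     qed
     have "real_of_rat (r m) <= real_of_rat (r n)" if "m <= n" for m n using incseqD[OF r(1) that] by (simp add: of_rat_less_eq)
     thus "incseq (%k. {0..1} Int {..real_of_rat (r k)})" unfolding incseq_def by fastforce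
    qed
    moreover have "(\<Union>k. {0..1} Int {..real_of_rat (r k)}) = {0..1} Int {..<t}"

    proof (intro set_eqI iffI)
     fix x assume "x : (\<Union>k. {0..1} Int {..real_of_rat (r k)})"
     then obtain k where "x : {0..1}" "x <= of_rat (r k)" by auto
     thus "x : {0..1} Int {..<t}" using r(3)[of k] by simp
    next
     fix x assume x: "x : {0..1} Int {..<t}"
     then obtain k where "x <= of_rat (r k)" using r(4)[of x] by auto
     thus "x : (\<Union>k. {0..1} Int {..real_of_rat (r k)})" using x by auto
    qed
    moreover have "measure unif {u. quantile p u < t} = measure unif {u. qt G u < t}"
    proof (rule unif.finite_measure_eq_AE)
     show "AE u in unif. (u : {u. quantile p u < t}) = (u : {u. qt G u < t})"
      using le1 by eventually_elim (simp add: quantile_def G_def[abs_def] min_def)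
     have "(%u. qt G u) : Bm borel" by (rule measurable_qt) auto
     from borel_measurable_less[OF this measurable_const[of t]] show "{u. qt G u < t} : sets unif" by simp
     show "{u. quantile p u < t} : sets unif" using borel_measurable_less[OF mT measurable_const[of t]] by simp
    qed
    ultimately show ?thesis using LIMSEQ_unique[OF Gq Gl] by simp
   next
    case False
    hence "quantile p u < t" for u using quantile_bounds(2)[of p u] by simp
    hence "{u. quantile p u < t} = space unif" "{0..1} Int {..<t} = space p" using False by (auto simp: sp)
    thus ?thesis using p.prob_space unif.prob_space by simp
   qed
  qed
  thus "emeasure (distr unif borel (quantile p)) {..<t} = emeasure (distr p borel (%x. x)) {..<t}" by (simp add: e1 e2)
 qed simp_all
 show "distr unif unit_borel (quantile p) = p"
 proof (rule measure_eqI)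
  fix A assume "A : sets (distr unif unit_borel (quantile p))"
  hence A: "A : sets unit_borel" by simp
  hence Ab: "A : sets borel" and A01: "A <= {0..1}" by (auto simp: sets_restrict_space)
  have "emeasure (distr unif unit_borel (quantile p)) A = emeasure (distr unif borel (quantile p)) A"
   using mT mT' A Ab by (simp add: emeasure_distr)
  also have "... = emeasure p A" unfolding eq using mid Ab A01 by (simp add: emeasure_distr sp Int_absorb2)
  finally show "emeasure (distr unif unit_borel (quantile p)) A = emeasure p A" .
 qed (simp add: p(2))
qed

lemma quantile_return: "quantile (return unit_borel 0) u = 0"
proof -
 have m: "measure (return unit_borel 0) ({0..1} Int {..of_rat r}) = (1::real)" if "0 <= r" for r :: rat
  using that by (subst measure_return) (auto simp: sets_restrict_space indicator_def)
 have "~ 0 < quantile (return unit_borel 0) u"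
 proof
  assume "0 < quantile (return unit_borel 0) u"
  moreover have "quantile (return unit_borel 0) u <= t" if "0 < t" "t <= 1" for t
  proof -
   have "qt (%r. measure (return unit_borel 0) ({0..1} Int {..of_rat r})) (min 1 u) < t"
    using that m[of 0] by (subst qt_less) (auto intro!: exI[of _ 0])
   thus ?thesis by (simp add: quantile_def)
  qed
  from this[of "quantile (return unit_borel 0) u / 2"] quantile_bounds(2)[of "return unit_borel 0" u]
  have "0 < quantile (return unit_borel 0) u ==> quantile (return unit_borel 0) u <= quantile (return unit_borel 0) u / 2" by simp
  ultimately show False by linarith
 qed
 thus ?thesis using quantile_bounds(1)[of "return unit_borel 0" u] by simp
qed

section \<open>The invariant tau as the law of a sampled matrix\<close>

lemma (in sample_model) smat_dist_matrices:
 assumes "z : space (samp M)"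
 shows "smat Ps (%_. 0) z : dist_matrices"
proof -
 have "fst z i : space M" for i using assms by (auto simp: samp_def sp_pair space_seqs)
 thus ?thesis using Ps_bounds by (auto simp: dist_matrices_def smat_def)
qed

lemma (in sample_model) measurable_smat_matrix: "smat Ps (%_. 0) : samp M ->M matrix_borel"
 by (rule measurable_restrict_space2[OF _ measurable_smat]) (use smat_dist_matrices in auto)

lemma (in sample_model) law_eq_distr: "law (%_. 0) = distr (distr (samp M) matrix_borel (smat Ps (%_. 0))) borel (%A. A)"
 unfolding law_def by (subst distr_distr[OF _ measurable_smat_matrix]) (auto simp: comp_def intro: measurable_restrict_space1)

context sample_model
begin

text \<open>Independent noise variables pushed through the maps \<open>Ps (x i) (x j)\<close> stay
  independent, so over the pairs above the diagonal their joint law is the product measure in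
  \<open>qmm_tau\<close>.\<close>

lemma conditional_law:
 fixes q :: "'a => 'a => real measure"
 assumes q: "!!x y. x : space M ==> y : space M ==> distr unif unit_borel (Ps x y) = q x y"
  and x: "x : space (seqs M)"
 shows "distr (\<Pi>\<^sub>M (i, j)\<in>{(i, j). i < j}. q (x i) (x j)) matrix_borel matrix_of_upper =
  distr noise matrix_borel (%u. smat Ps (%_. 0) (x, u))"
proof -
 interpret N: prob_space noise by simp
 let ?I = "{(i, j). i < (j::nat)}"
 define X where "X e u = Ps (x (fst e)) (x (snd e)) (u e)" for e :: "nat \<times> nat" and u :: "nat \<times> nat => real"
 have xs: "x i : space M" for i using x by (simp add: space_seqs)
 have mq: "Ps (x i) (x j) : unif ->M unit_borel" for i j
  by (rule measurable_restrict_space2[OF _ measurable_Ps_section[OF xs xs]]) (use Ps_bounds[OF xs xs] in auto)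
 have lq: "distr unif unit_borel (Ps (x i) (x j)) = q (x i) (x j)" for i j by (rule q[OF xs xs])
 have mc: "(%u. u e) : noise ->M unif" for e unfolding noise_def by (rule measurable_component_singleton) simp
 have mX: "X e : noise ->M unit_borel" for e unfolding X_def[abs_def] by (rule m_comp[OF mc mq])
 have lX: "distr noise unit_borel (X e) = q (x (fst e)) (x (snd e))" for e
 proof -
  have "distr noise unit_borel (X e) = distr (distr noise unif (%u. u e)) unit_borel (Ps (x (fst e)) (x (snd e)))"
   by (subst distr_distr[OF mq mc]) (simp add: comp_def X_def[abs_def])
  also have "distr noise unif (%u. u e) = unif" unfolding noise_def by (rule distr_PiM_component) simp_all
  finally show ?thesis by (simp add: lq)
 qed
 have "N.indep_vars (%_. unif) (%e u. u e) UNIV" unfolding noise_def by (rule indep_vars_PiM_UNIV) simp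
 hence "N.indep_vars (%_. unif) (%e u. u e) ?I" by (rule N.indep_vars_subset) simp
 hence "N.indep_vars (%_. unit_borel) (%e u. Ps (x (fst e)) (x (snd e)) (u e)) ?I" by (rule N.indep_vars_compose2) (rule mq)
 hence iX: "N.indep_vars (%_. unit_borel) X ?I" unfolding X_def[abs_def] .
 have "(0, 1) : ?I" by simp
 hence ne: "?I ~= {}" by blast
 have "distr noise (\<Pi>\<^sub>M e\<in>?I. unit_borel) (%u. \<lambda>e\<in>?I. X e u) = (\<Pi>\<^sub>M e\<in>?I. distr noise unit_borel (X e))"
  using N.indep_vars_iff_distr_eq_PiM'[OF ne mX] iX by simp
 also have "... = (\<Pi>\<^sub>M (i, j)\<in>?I. q (x i) (x j))" by (simp add: lX case_prod_unfold)
 finally have eq: "(\<Pi>\<^sub>M (i, j)\<in>?I. q (x i) (x j)) = distr noise (\<Pi>\<^sub>M e\<in>?I. unit_borel) (%u. \<lambda>e\<in>?I. X e u)" by simp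
 have mr: "(%u. \<lambda>e\<in>?I. X e u) : noise ->M (\<Pi>\<^sub>M e\<in>?I. unit_borel)" by (rule measurable_restrict) (rule mX)
 have mm: "matrix_of_upper : (\<Pi>\<^sub>M e\<in>?I. unit_borel) ->M matrix_borel"
 proof (rule measurable_restrict_space2)
  have t01: "0 <= t (i, j) & t (i, j) <= 1" if "t : space (\<Pi>\<^sub>M e\<in>?I. unit_borel)" "i < j" for t i j
   using that by (auto simp: space_PiM PiE_iff space_restrict_space)
  thus "matrix_of_upper : space (\<Pi>\<^sub>M e\<in>?I. unit_borel) \<rightarrow> dist_matrices"
   by (auto simp: dist_matrices_def matrix_of_upper_def)
  have c: "(%t. t e) : Bm (\<Pi>\<^sub>M e\<in>?I. unit_borel)" if "e : ?I" for e
   by (rule m_comp[OF measurable_component_singleton[OF that] measurable_restrict_space1]) simp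
  show "matrix_of_upper : Bm (\<Pi>\<^sub>M e\<in>?I. unit_borel)"
  proof (rule measurable_arrI)
   fix i j show "(%t. matrix_of_upper t i j) : Bm (\<Pi>\<^sub>M e\<in>?I. unit_borel)"
    unfolding matrix_of_upper_def by (cases "i < j"; cases "j < i") (use c in auto)
  qed
 qed
 show ?thesis unfolding eq
  by (subst distr_distr[OF mm mr])
   (auto simp: comp_def matrix_of_upper_def smat_def X_def fun_eq_iff intro!: distr_cong)
qed

theorem qmm_tau_eq:
 fixes q :: "'a => 'a => real measure"
 assumes q: "!!x y. x : space M ==> y : space M ==> distr unif unit_borel (Ps x y) = q x y"
 shows "qmm_tau M q = distr (samp M) matrix_borel (smat Ps (%_. 0))"
proof -
 interpret N: prob_space noise by simp
 interpret Sq: prob_space "seqs M" by (rule prob_space_seqs) unfold_locales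
 let ?K = "%x. distr noise matrix_borel (%u. smat Ps (%_. 0) (x, u))"
 have b: "qmm_tau M q = seqs M \<bind> ?K" unfolding qmm_tau_def seqs_def[symmetric]
  by (rule bind_cong[OF refl conditional_law]) (rule q, assumption+)
 have ms: "smat Ps (%_. 0) : seqs M >< noise ->M matrix_borel" using measurable_smat_matrix unfolding samp_def .
 have mK: "?K : seqs M ->M subprob_algebra matrix_borel"
 proof (rule measurable_distr2)
  show "case_prod (%x u. smat Ps (%_. 0) (x, u)) : seqs M >< noise ->M matrix_borel" using ms by (simp add: case_prod_unfold)
  show "(%x. noise) : seqs M ->M subprob_algebra noise"
   by (rule measurable_const) (simp add: space_subprob_algebra prob_space_imp_subprob_space)
 qed
 show ?thesis
 proof (rule measure_eqI)
  show "sets (qmm_tau M q) = sets (distr (samp M) matrix_borel (smat Ps (%_. 0)))"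
   unfolding b by (subst sets_bind[where N=matrix_borel]) (auto simp: Sq.not_empty)
  fix A assume "A : sets (qmm_tau M q)"
  hence A: "A : sets matrix_borel" unfolding b by (subst (asm) sets_bind[where N=matrix_borel]) (auto simp: Sq.not_empty)
  have "emeasure (qmm_tau M q) A = (\<integral>\<^sup>+x. emeasure (?K x) A \<partial>seqs M)"
   unfolding b by (rule emeasure_bind[OF Sq.not_empty mK A])
  also have "... = (\<integral>\<^sup>+x. emeasure noise (Pair x -` (smat Ps (%_. 0) -` A Int space (seqs M >< noise))) \<partial>seqs M)"
  proof (rule nn_integral_cong)
   fix x assume x: "x : space (seqs M)"
   have "(%u. smat Ps (%_. 0) (x, u)) : noise ->M matrix_borel" by (rule m_comp[OF measurable_Pair1'[OF x] ms])
   from emeasure_distr[OF this A]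
   show "emeasure (?K x) A = emeasure noise (Pair x -` (smat Ps (%_. 0) -` A Int space (seqs M >< noise)))"
    using x by (simp add: vimage_def Int_def sp_pair)
  qed
  also have "... = emeasure (seqs M >< noise) (smat Ps (%_. 0) -` A Int space (seqs M >< noise))"
   by (rule N.emeasure_pair_measure_alt[symmetric]) (rule measurable_sets[OF ms A])
  also have "... = emeasure (distr (samp M) matrix_borel (smat Ps (%_. 0))) A"
   unfolding samp_def by (rule emeasure_distr[OF ms A, symmetric])
  finally show "emeasure (qmm_tau M q) A = emeasure (distr (samp M) matrix_borel (smat Ps (%_. 0))) A" .
 qed
qed

end

section \<open>qmm-spaces as models\<close>

context qmm_space
begin

abbreviation "\<Theta> x y \<equiv> quantile (q x y)"

lemma q_prob: "x : space M ==> y : space M ==> prob_space (q x y) & sets (q x y) = sets unit_borel"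
 using measurable_space[OF measurable_q, of "(x, y)"] by (simp add: sp_pair space_prob_algebra)

lemma sample_model: "sample_model M \<Theta>"
proof (unfold_locales)
 have "(%z. quantile (case fst z of (x, y) => q x y) (snd z)) : Bm ((M >< M) >< borel)"
  by (rule measurable_quantile[OF m_comp[OF m_fst measurable_q] m_snd])
 thus "(%z. \<Theta> (fst (fst z)) (snd (fst z)) (snd z)) : Bm ((M >< M) >< borel)"
  by (simp add: case_prod_unfold)
 show "\<Theta> x y u = \<Theta> y x u" if "x : space M" "y : space M" for x y u using q_sym[OF that] by simp
 show "0 <= \<Theta> x y u & \<Theta> x y u <= 1" for x y u by (simp add: quantile_bounds)
 show "\<Theta> x x u = 0" if "x : space M" for x u using q_refl[OF that] by (simp add: quantile_return)
qed

sublocale S: sample_model M \<Theta> by (rule sample_model)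

lemma Lip1_eq:
 assumes "compact Y"
 shows "qmm_Lip1 M q Y = S.lip Y"
proof -
 interpret unif: prob_space unif by simp
 have "r <= Inf (support (q (fst p) (snd p))) \<longleftrightarrow> (AE u in unif. r <= \<Theta> (fst p) (snd p) u)" if "p : space (M >< M)" for p r
 proof -
  have "fst p : space M" "snd p : space M" using that by (auto simp: sp_pair)
  from q_prob[OF this] have qp: "prob_space (q (fst p) (snd p))" "sets (q (fst p) (snd p)) = sets unit_borel" by auto
  note Q = quantile_law[OF qp]
  have "{x : space unit_borel. r <= x} : sets unit_borel"
   by (rule borel_measurable_le) (auto intro: measurable_restrict_space1)
  from AE_distr_iff[OF Q(1) this] show ?thesis unfolding Q(2) le_Inf_support_iff[OF qp] by simp
 qed
 hence "(AE (x, x') in M >< M. dist (f x) (f x') <= Inf (support (q x x'))) \<longleftrightarrow>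
  (AE p in M >< M. AE u in unif. dist (f (fst p)) (f (snd p)) <= \<Theta> (fst p) (snd p) u)" for f :: "'a => 'b::metric_space"
  by (intro AE_cong) (simp add: case_prod_unfold)
 thus ?thesis using S.lip_iff[OF assms] unfolding qmm_Lip1_def by auto
qed

lemma ObsDiam_eq: "compact Y ==> qmm_ObsDiam Y M q \<kappa> = S.obs Y \<kappa>"
 by (simp add: qmm_ObsDiam_def S.obs_def Lip1_eq)

lemma law_eq: "S.law (%_. 0) = distr (qmm_tau M q) borel (%A. A)"
 by (subst S.qmm_tau_eq[of q]) (use q_prob quantile_law(2) in \<open>auto simp: S.law_eq_distr\<close>)

end

section \<open>mm-spaces as models\<close>

context mm_space
begin

lemma nonempty: "space M ~= {}" by (rule not_empty)

text \<open>Separability writes \<open>d x y < a\<close> as a countable union of conditions in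
  \<open>d x (c k)\<close> and \<open>d y (c k)\<close>, which places \<open>d\<close> in the
  product sigma-algebra.\<close>

lemma measurable_d: "(%p. d (fst p) (snd p)) : Bm (M >< M)"
proof -
 obtain c :: "nat => 'a" where c: "!!k. c k : space M" "!!x r. x : space M ==> 0 < r ==> EX k. d x (c k) < r"
  "!!a. a : space M ==> (%x. d x a) : Bm M"
  using separable_dense_sequence[OF separable nonempty refl sets_eq_borel] by blast
 show ?thesis unfolding borel_measurable_iff_less
 proof
  fix a
  have "{w : space (M >< M). d (fst w) (snd w) < a} = (\<Union>k. {w : space (M >< M). d (fst w) (c k) + d (snd w) (c k) < a})" (is "?L = ?R")
  proof (intro set_eqI iffI)
   fix w assume w: "w : ?L"
   hence s: "fst w : space M" "snd w : space M" by (auto simp: sp_pair)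
   obtain k where k: "d (fst w) (c k) < (a - d (fst w) (snd w)) / 2" using c(2)[OF s(1), of "(a - d (fst w) (snd w)) / 2"] w by auto
   have "d (snd w) (c k) <= d (snd w) (fst w) + d (fst w) (c k)" by (rule triangle[OF s(2,1) c(1)])
   hence "d (fst w) (c k) + d (snd w) (c k) < a" using k commute[of "snd w" "fst w"] by simp
   thus "w : ?R" using w by auto
  next
   fix w assume "w : ?R"
   then obtain k where w: "w : space (M >< M)" "d (fst w) (c k) + d (snd w) (c k) < a" by auto
   hence s: "fst w : space M" "snd w : space M" by (auto simp: sp_pair)
   show "w : ?L" using triangle[OF s(1) c(1) s(2), of k] commute[of "c k" "snd w"] w by simp
  qed
  moreover have "{w : space (M >< M). d (fst w) (c k) + d (snd w) (c k) < a} : sets (M >< M)" for k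
   by (intro borel_measurable_less borel_measurable_add borel_measurable_const m_comp[OF m_fst c(3)[OF c(1)]] m_comp[OF m_snd c(3)[OF c(1)]])
  ultimately show "{w : space (M >< M). d (fst w) (snd w) < a} : sets (M >< M)" by auto
 qed
qed

lemma sample_model: "sample_model M (%x y u. d x y)"
proof (unfold_locales)
 show "(%z. d (fst (fst z)) (snd (fst z))) : Bm ((M >< M) >< borel)"
  by (rule m_comp[OF m_fst measurable_d])
qed (auto simp: commute diam_le_1)

sublocale S: sample_model M "%x y u. d x y" by (rule sample_model)

lemma mm_tau_eq: "mm_tau M d = distr (samp M) matrix_borel (smat (%x y u. d x y) (%_. 0))"
proof -
 interpret N: prob_space noise by simp
 have fs: "distr (samp M) (seqs M) fst = seqs M" unfolding samp_def by (rule N.distr_pair_fst)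
 define g where "g x = (%i j. d (x i) (x j))" for x :: "nat => 'a"
 have mg: "g : seqs M ->M matrix_borel"
 proof (rule measurable_restrict_space2)
  show "g : space (seqs M) \<rightarrow> dist_matrices" by (auto simp: g_def dist_matrices_def space_seqs diam_le_1 commute)
  show "g : Bm (seqs M)"
  proof (rule measurable_arrI)
   fix i j
   have "(%x. (x i, x j)) : seqs M ->M M >< M" by (intro m_Pair measurable_seqs_component)
   from m_comp[OF this measurable_d] show "(%x. g x i j) : Bm (seqs M)" by (simp only: g_def fst_conv snd_conv)
  qed
 qed
 have mfst: "fst : samp M ->M seqs M" unfolding samp_def by (rule m_fst)
 have "mm_tau M d = distr (distr (samp M) (seqs M) fst) matrix_borel g"
  unfolding fs by (simp add: mm_tau_def seqs_def g_def[abs_def])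
 also have "... = distr (samp M) matrix_borel (%z. g (fst z))"
  by (subst distr_distr[OF mg mfst]) (simp add: comp_def)
 also have "... = distr (samp M) matrix_borel (smat (%x y u. d x y) (%_. 0))"
 proof (rule distr_cong[OF refl refl])
  fix z assume "z : space (samp M)"
  hence "fst z i : space M" for i by (auto simp: samp_def sp_pair space_seqs)
  thus "g (fst z) = smat (%x y u. d x y) (%_. 0) z" by (auto simp: g_def smat_def fun_eq_iff commute)
 qed
 finally show ?thesis .
qed

lemma law_eq: "S.law (%_. 0) = distr (mm_tau M d) borel (%A. A)"
 by (simp add: S.law_eq_distr mm_tau_eq)

lemma Lip1_subset_lip:
 fixes Y :: "'y::metric_space set"
 assumes Y: "compact Y" and f: "f : mm_Lip1 M d Y"
 shows "f : S.lip Y"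
proof -
 have fY: "f : space M \<rightarrow> Y" and lip: "!!x y. x : space M ==> y : space M ==> dist (f x) (f y) <= d x y"
  using f by (auto simp: mm_Lip1_def)
 have "f : Bm M"
 proof (rule borel_measurableI)
  fix U :: "'y set" assume U: "open U"
  have "openin mtopology (f -` U Int space M)" unfolding openin_mtopology
  proof (intro conjI allI impI)
   fix x assume x: "x : f -` U Int space M"
   then obtain r where r: "0 < r" "ball (f x) r <= U" using U by (meson IntD1 open_contains_ball vimageD)
   have "mball x r <= f -` U Int space M"
   proof
    fix y assume y: "y : mball x r"
    hence "y : space M" "d x y < r" by (auto simp: in_mball)
    hence "f y : ball (f x) r" using lip[of x y] x by auto
    thus "y : f -` U Int space M" using r(2) \<open>y : space M\<close> by auto
   qed
   thus "\<exists>r>0. mball x r <= f -` U Int space M" using r(1) by blast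
  qed simp
  thus "f -` U Int space M : sets M" unfolding sets_eq_borel by (intro sigma_sets.Basic) simp
 qed
 hence "f : M ->M restrict_space borel Y" by (rule measurable_restrict_space2[OF fY])
 moreover have "AE p in M >< M. AE u in unif. dist (f (fst p)) (f (snd p)) <= d (fst p) (snd p)"
  by (intro AE_I2) (auto simp: sp_pair lip)
 ultimately show ?thesis by (simp add: S.lip_iff[OF Y])
qed

text \<open>An almost everywhere Lipschitz map is Lipschitz on a set of full measure, which is dense because the
 measure has full support; compactness of \<open>Y\<close> provides the extension.\<close>
lemma lip_imp_Lip1:
 fixes Y :: "'y::metric_space set"
 assumes Y: "compact Y" and f: "f : S.lip Y"
 obtains g where "g : mm_Lip1 M d Y" "AE x in M. g x = f x"
proof -
 interpret MM: pair_prob_space M M ..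
 interpret unif: prob_space unif by simp
 have fY: "f x : Y" if "x : space M" for x by (rule S.lip_in[OF f that])
 have "AE p in M >< M. dist (f (fst p)) (f (snd p)) <= d (fst p) (snd p)"
  using f by (simp add: S.lip_iff[OF Y])
 from MM.AE_pair[OF this] have AE2: "AE x in M. AE y in M. dist (f x) (f y) <= d x y" by simp
 define G where "G = {x : space M. AE y in M. dist (f x) (f y) <= d x y}"
 have AEG: "AE x in M. x : G" using AE2 AE_space by eventually_elim (simp add: G_def)
 \<comment> \<open>Full support enters here: a property valid almost everywhere holds somewhere in
   every ball.\<close>
 have ball_meets: "\<exists>y\<in>space M. P y & d x y < r" if x: "x : space M" "0 < r" and P: "AE y in M. P y" for x r P
 proof (rule ccontr)
  assume no: "~ ?thesis"
  have op: "openin mtopology (mball x r)" by (rule openin_mball)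
  have "mball x r ~= {}" using x by auto
  from full_support[OF op this] have pos: "0 < measure M (mball x r)" .
  have "mball x r : sets M" unfolding sets_eq_borel using op by (intro sigma_sets.Basic) simp
  moreover have "AE y in M. y \<notin> mball x r" using P AE_space by eventually_elim (use no in \<open>auto simp: in_mball\<close>)
  ultimately show False using prob_eq_0[of "mball x r"] pos by simp
 qed
 \<comment> \<open>Compare through a point \<open>z\<close> close to \<open>y\<close> at which the
   bounds for \<open>x\<close> and for \<open>y\<close> both hold.\<close>
 have lipG: "dist (f x) (f y) <= d x y" if x: "x : G" and y: "y : G" for x y
 proof (rule field_le_epsilon)
  fix et :: real assume et: "0 < et"
  have s: "x : space M" "y : space M" using x y by (auto simp: G_def)
  have "AE z in M. dist (f x) (f z) <= d x z & dist (f y) (f z) <= d y z"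
   using x y by (simp add: G_def)
  from ball_meets[OF s(2) _ this, of "et / 2"] et obtain z where z: "z : space M" "dist (f x) (f z) <= d x z" "dist (f y) (f z) <= d y z" "d y z < et / 2"
   by auto
  have "d x z <= d x y + d y z" by (rule triangle[OF s z(1)])
  thus "dist (f x) (f y) <= d x y + et" using dist_triangle2[of "f x" "f y" "f z"] z by linarith
 qed
 \<comment> \<open>A cluster value of \<open>f\<close> along points of \<open>G\<close> tending to
   \<open>x\<close>; passing to a subsequence keeps the rate \<open>1 / Suc n\<close>.\<close>
 have "\<exists>l\<in>Y. EX a. (ALL n. a n : G & d x (a n) < 1 / Suc n) & (%n. f (a n)) ~~> l" if x: "x : space M" for x
 proof -
  have "EX y. y : G & d x y < 1 / Suc n" for n using ball_meets[OF x _ AEG, of "1 / Suc n"] by auto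
  then obtain a where a: "!!n. a n : G" "!!n. d x (a n) < 1 / Suc n" by metis
  have "ALL n. f (a n) : Y" using a(1) fY by (auto simp: G_def)
  hence "\<exists>l\<in>Y. \<exists>r :: nat => nat. strict_mono r & ((%n. f (a n)) o r) ~~> l"
   by (intro compact_imp_seq_compact[OF Y, unfolded seq_compact_def, rule_format]) (erule spec)
  then obtain l r where l: "l : Y" "strict_mono (r :: nat => nat)" "((%n. f (a n)) o r) ~~> l"
   by (elim bexE exE conjE)
  have "d x (a (r n)) < 1 / Suc n" for n
  proof -
   have "1 / real (Suc (r n)) <= 1 / real (Suc n)" using seq_suble[OF l(2), of n] by (simp add: frac_le)
   thus ?thesis using a(2)[of "r n"] by linarith
  qed
  thus ?thesis by (intro bexI[OF _ l(1)] exI[of _ "%n. a (r n)"] conjI allI a(1) l(3)[unfolded comp_def])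
 qed
 hence "\<forall>x\<in>space M. EX p. fst p : Y & (ALL n. snd p n : G & d x (snd p n) < 1 / Suc n) & (%n. f (snd p n)) ~~> fst p"
  by (simp add: split_paired_Ex)  (meson bexE)
 from bchoice[OF this] obtain K where K: "\<forall>x\<in>space M. fst (K x) : Y & (ALL n. snd (K x) n : G & d x (snd (K x) n) < 1 / Suc n) & (%n. f (snd (K x) n)) ~~> fst (K x)" ..
 define g where "g x = fst (K x)" for x
 define A where "A x = snd (K x)" for x
 have g: "!!x. x : space M ==> g x : Y" "!!x n. x : space M ==> A x n : G"
  "!!x n. x : space M ==> d x (A x n) < 1 / Suc n" "!!x. x : space M ==> (%n. f (A x n)) ~~> g x"
  using K by (simp_all add: g_def A_def)
 have GS: "x : space M" if "x : G" for x using that by (simp add: G_def)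
 have lim0: "(%n. c + 2 * (1 / Suc n)) ~~> c + 2 * 0" for c :: real
  by (intro tendsto_add tendsto_mult tendsto_const) (rule LIMSEQ_Suc[OF lim_1_over_n])
 have glip: "dist (g x) (g y) <= d x y" if x: "x : space M" and y: "y : space M" for x y
 proof (rule LIMSEQ_le[OF tendsto_dist[OF g(4)[OF x] g(4)[OF y]]])
  show "(%n. d x y + 2 * (1 / Suc n)) ~~> d x y" using lim0[of "d x y"] by simp
  have "dist (f (A x n)) (f (A y n)) <= d x y + 2 * (1 / Suc n)" for n
  proof -
   have s: "A x n : space M" "A y n : space M" using GS g(2) x y by blast+
   have "d (A x n) (A y n) <= d (A x n) x + d x (A y n)" "d x (A y n) <= d x y + d y (A y n)"
    using triangle[OF s(1) x s(2)] triangle[OF x y s(2)] by auto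
   thus ?thesis using lipG[OF g(2)[OF x] g(2)[OF y], of n n] g(3)[OF x, of n] g(3)[OF y, of n] commute[of "A x n" x] by linarith
  qed
  thus "EX N. \<forall>n\<ge>N. dist (f (A x n)) (f (A y n)) <= d x y + 2 * (1 / Suc n)" by blast
 qed
 have gf: "g x = f x" if x: "x : G" for x
 proof -
  have "dist (g x) (f x) <= 0"
  proof (rule LIMSEQ_le[OF tendsto_dist[OF g(4)[OF GS[OF x]] tendsto_const[of "f x"]]])
   show "(%n. 0 + 2 * (1 / Suc n)) ~~> 0" using lim0[of 0] by simp
   have "dist (f (A x n)) (f x) <= 0 + 2 * (1 / Suc n)" for n
    using lipG[OF g(2)[OF GS[OF x]] x, of n] g(3)[OF GS[OF x], of n] commute[of "A x n" x] nonneg[of x "A x n"] by linarith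
   thus "EX N. \<forall>n\<ge>N. dist (f (A x n)) (f x) <= 0 + 2 * (1 / Suc n)" by blast
  qed
  thus ?thesis by simp
 qed
 show thesis
 proof (rule that[of g])
  show "g : mm_Lip1 M d Y" using g(1) glip by (auto simp: mm_Lip1_def)
  show "AE x in M. g x = f x" using AEG by eventually_elim (rule gf)
 qed
qed

lemma ObsDiam_eq:
 assumes Y: "compact Y"
 shows "mm_ObsDiam Y M d \<kappa> = S.obs Y \<kappa>"
proof -
 have "(%f. partial_diam (distr M (restrict_space borel Y) f) \<kappa>) ` mm_Lip1 M d Y = (%f. partial_diam (distr M (restrict_space borel Y) f) \<kappa>) ` S.lip Y"
 proof (intro equalityI image_subsetI)
  fix f assume "f : mm_Lip1 M d Y"
  thus "partial_diam (distr M (restrict_space borel Y) f) \<kappa> : (%f. partial_diam (distr M (restrict_space borel Y) f) \<kappa>) ` S.lip Y"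
   using Lip1_subset_lip[OF Y] by blast
 next
  fix f assume f: "f : S.lip Y"
  obtain g where g: "g : mm_Lip1 M d Y" "AE x in M. g x = f x" using lip_imp_Lip1[OF Y f] by blast
  have "distr M (restrict_space borel Y) f = distr M (restrict_space borel Y) g"
   by (rule distr_cong_AE) (use g(2) S.lip_measurable[OF f] S.lip_measurable[OF Lip1_subset_lip[OF Y g(1)]] in \<open>auto elim: eventually_mono\<close>)
  thus "partial_diam (distr M (restrict_space borel Y) f) \<kappa> : (%f. partial_diam (distr M (restrict_space borel Y) f) \<kappa>) ` mm_Lip1 M d Y"
   using g(1) by auto
 qed
 thus ?thesis by (simp add: mm_ObsDiam_def S.obs_def)
qed

end

section \<open>Kernels read off from outsourced noise\<close>

text \<open>Reads an outsourced law back as a conditional probability, in the integrated form that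
  \<open>cond_exp_stable\<close> takes.\<close>

lemma outsourced_kernel:
 fixes Ph :: "'n => real => 'b::topological_space" and G :: "'n => real"
 assumes Ph: "(%z. Ph (fst z) (snd z)) : Bm (N >< borel)"
  and P: "prob_space P" "sets P = sets (N >< borel)"
   "P = distr (distr P N fst >< unif) (N >< borel) (%z. (fst z, Ph (fst z) (snd z)))"
  and S: "S : sets borel"
 defines "k \<equiv> %et. LINT u|unif. Ind S (Ph et u) :: real"
 shows "k : Bm N" "0 <= k et & k et <= 1"
  "G : Bm N ==> (!!x. 0 <= G x & G x <= 1) ==>
   (LINT w|P. Ind S (snd w) * G (fst w)) = (LINT w|P. k (fst w) * G (fst w))"
proof -
 interpret unif: prob_space unif by simp
 interpret P: prob_space P by (rule P)
 define Pf where "Pf = distr P N fst"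
 have mfst: "fst : P ->M N" unfolding m_cong_sets[OF P(2) refl] by (rule m_fst)
 interpret Pf: prob_space Pf unfolding Pf_def by (rule P.prob_space_distr[OF mfst])
 interpret PU: pair_prob_space Pf unif ..
 have sPf: "sets Pf = sets N" by (simp add: Pf_def)
 have sPU: "sets (Pf >< unif) = sets (N >< borel)" by (rule sets_pair_measure_cong[OF sPf sets_unif])
 have sNU: "sets (N >< unif) = sets (N >< borel)" by (rule sets_pair_measure_cong[OF refl sets_unif])
 have mI: "(%z. Ind S (Ph (fst z) (snd z)) :: real) : Bm (N >< borel)"
  by (rule m_comp[OF Ph]) (use S in simp)
 hence "(%(et, u). Ind S (Ph et u) :: real) : Bm (N >< unif)"
  unfolding m_cong_sets[OF sNU refl] by (simp add: case_prod_unfold)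
 from unif.borel_measurable_lebesgue_integral[OF this] show mk: "k : Bm N" unfolding k_def .
 have kb: "0 <= k et & k et <= 1" for et
 proof
  show "0 <= k et" unfolding k_def by (rule Bochner_Integration.integral_nonneg) simp
  show "k et <= 1"
  proof (cases "integrable unif (%u. Ind S (Ph et u) :: real)")
   case True
   have "k et <= (LINT u|unif. 1)" unfolding k_def by (rule integral_mono[OF True]) (auto simp: indicator_def)
   thus ?thesis using unif.prob_space by simp
  qed (simp add: k_def not_integrable_integral_eq)
 qed
 show "0 <= k et & k et <= 1" by (rule kb)
 assume G: "G : Bm N" "!!x. 0 <= G x & G x <= 1"
 have m: "(%z. (fst z, Ph (fst z) (snd z))) : Pf >< unif ->M N >< borel"
  unfolding m_cong_sets[OF sPU refl] by (intro m_Pair m_fst Ph)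
 have mSG: "(%w. Ind S (snd w) * G (fst w)) : Bm (N >< borel)"
  by (intro bm_times m_comp[OF m_snd] m_comp[OF m_fst G(1)]) (use S in simp)
 have mIG: "(%z. Ind S (Ph (fst z) (snd z)) * G (fst z)) : Bm (Pf >< unif)"
  unfolding m_cong_sets[OF sPU refl] by (intro bm_times mI m_comp[OF m_fst G(1)])
 have iIG: "integrable (Pf >< unif) (%z. Ind S (Ph (fst z) (snd z)) * G (fst z))"
  by (rule finite_measure.integrable_bounded[OF prob_space.axioms(1)[OF prob_space_pair[OF Pf.prob_space_axioms unif.prob_space_axioms]] mIG, where B=1])
   (use G(2) in \<open>auto simp: indicator_def\<close>)
 have "(LINT w|P. Ind S (snd w) * G (fst w)) = (LINT z|(Pf >< unif). Ind S (Ph (fst z) (snd z)) * G (fst z))"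
  by (subst P(3), fold Pf_def) (simp add: integral_distr[OF m mSG])
 also have "... = (LINT et|Pf. LINT u|unif. Ind S (Ph et u) * G et)" using PU.integral_fst'[OF iIG] by simp
 also have "... = (LINT et|Pf. k et * G et)" unfolding k_def by simp
 also have "... = (LINT w|P. k (fst w) * G (fst w))" unfolding Pf_def
  by (rule integral_distr[OF mfst]) (intro bm_times mk G(1))
 finally show "(LINT w|P. Ind S (snd w) * G (fst w)) = (LINT w|P. k (fst w) * G (fst w))" .
qed

section \<open>Enumerations of the index set\<close>

definition skip :: "nat => nat => nat" where "skip n m = (if m < n then m else Suc m)"
definition unskip :: "nat => nat => nat" where "unskip n i = (if i < n then i else i - 1)"

lemma skip_neq: "skip n m ~= n" and unskip_skip: "unskip n (skip n m) = m" and skip_unskip: "i ~= n ==> skip n (unskip n i) = i"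
 by (auto simp: skip_def unskip_def)

text \<open>Enumerates the numbers other than \<open>i\<close> and \<open>j\<close>: the outer
  \<open>skip\<close> at the minimum raises the omitted \<open>max i j - 1\<close> to
  \<open>max i j\<close>.\<close>

definition skips :: "nat => nat => nat => nat" where "skips i j m = skip (min i j) (skip (max i j - 1) m)"
definition unskips :: "nat => nat => nat => nat" where "unskips i j p = unskip (max i j - 1) (unskip (min i j) p)"

lemma skips_neq: "i ~= j ==> skips i j m ~= i" "i ~= j ==> skips i j m ~= j"
 and unskips_skips: "unskips i j (skips i j m) = m"
 and skips_unskips: "i ~= j ==> p ~= i ==> p ~= j ==> skips i j (unskips i j p) = p"
 by (auto simp: skips_def unskips_def skip_def unskip_def min_def max_def split: if_splits)

lemma nat_mod4_cases:
 fixes a :: nat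
 obtains m where "a = 4 * m" | m where "a = 4 * m + 1" | m where "a = 4 * m + 2" | m where "a = 4 * m + 3"
proof -
 have "a = 4 * (a div 4) + a mod 4" by simp
 moreover have "a mod 4 = 0 \<or> a mod 4 = 1 \<or> a mod 4 = 2 \<or> a mod 4 = 3" by presburger
 ultimately show thesis using that by (metis add_0_right)
qed

text \<open>
 The odd indices form an infinite pool, split into those congruent to 1 and to 3 modulo 4. The standard
 enumerations list the distinguished even indices and then the pool; the extended ones are bijections onto all
 of \<^typ>\<open>nat\<close> which keep the class on which the rows of the distinguished indices are recorded.
\<close>
definition st1 :: "nat => nat => nat" where "st1 n a = (if a = 0 then 2 * n else 2 * a - 1)"
definition st2 :: "nat => nat => nat => nat" where "st2 i j a = (if a = 0 then 2 * i else if a = 1 then 2 * j else 2 * a - 3)"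
definition en1 :: "nat => nat => nat" where
 "en1 n a = (if a = 0 then 2 * n else if odd a then 2 * a - 1 else if a mod 4 = 2 then a + 1 else 2 * skip n (a div 4 - 1))"
definition en2 :: "nat => nat => nat => nat" where
 "en2 i j a = (if a = 0 then 2 * i else if a = 1 then 2 * j else if odd a then 2 * a - 3 else if a mod 4 = 2 then a - 1 else 2 * skips i j (a div 4 - 1))"
definition de1 :: "nat => nat => nat" where
 "de1 n p = (if p = 2 * n then 0 else if even p then 4 * unskip n (p div 2) + 4 else if p mod 4 = 1 then (p + 1) div 2 else p - 1)"
definition de2 :: "nat => nat => nat => nat" where
 "de2 i j p = (if p = 2 * i then 0 else if p = 2 * j then 1 else if even p then 4 * unskips i j (p div 2) + 4
  else if p mod 4 = 1 then p + 1 else (p + 3) div 2)"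

lemma inj_st1: "inj (st1 n)"
proof (rule injI)
 fix a b assume "st1 n a = st1 n b"
 thus "a = b" unfolding st1_def by (auto split: if_splits) presburger+
qed

lemma inj_st2: "i ~= j ==> inj (st2 i j)"
proof (rule injI)
 fix a b assume "i ~= j" "st2 i j a = st2 i j b"
 thus "a = b" unfolding st2_def by (auto split: if_splits) presburger+
qed

lemma en1_de1: "en1 n (de1 n p) = p"
proof (cases "p = 2 * n")
 case False
 show ?thesis
 proof (cases "even p")
  case True
  then obtain i where i: "p = 2 * i" by (elim evenE)
  thus ?thesis using False skip_unskip[of i n] by (simp add: de1_def en1_def)
 next
  case odd: False
  show ?thesis
  proof (cases p rule: nat_mod4_cases)
   case (2 m) thus ?thesis using odd False by (simp add: de1_def en1_def)
  next
   case (4 m) 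
   have "(4 * m + 2) mod 4 = 2" "(4 * m + 3) mod 4 = 3" by presburger+
   thus ?thesis using odd False 4 by (simp add: de1_def en1_def)
  qed (use odd in auto)
 qed
qed (simp add: de1_def en1_def)

lemma de1_en1: "de1 n (en1 n a) = a"
proof (cases "a = 0")
 case False
 show ?thesis
 proof (cases a rule: nat_mod4_cases)
  case (1 m)
  thus ?thesis using False skip_neq[of n "m - 1"] by (simp add: de1_def en1_def unskip_skip)
 next
  case (2 m)
  have "en1 n a = 8 * m + 1" using 2 by (simp add: en1_def)
  moreover have "(8 * m + 1) mod 4 = 1" "8 * m + 1 ~= 2 * n" by presburger+
  ultimately show ?thesis using 2 by (simp add: de1_def)
 next
  case (3 m)
  have "(4 * m + 2) mod 4 = 2" by presburger
  hence "en1 n a = 4 * m + 3" using 3 by (simp add: en1_def)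
  moreover have "(4 * m + 3) mod 4 = 3" "4 * m + 3 ~= 2 * n" by presburger+
  ultimately show ?thesis using 3 by (simp add: de1_def)
 next
  case (4 m)
  have "en1 n a = 8 * m + 5" using 4 by (simp add: en1_def)
  moreover have "(8 * m + 5) mod 4 = 1" "8 * m + 5 ~= 2 * n" by presburger+
  ultimately show ?thesis using 4 by (simp add: de1_def)
 qed
qed (simp add: de1_def en1_def)

lemma en2_de2:
 assumes ij: "i ~= j"
 shows "en2 i j (de2 i j p) = p"
proof (cases "p = 2 * i \<or> p = 2 * j")
 case False
 show ?thesis
 proof (cases "even p")
  case True
  then obtain l where l: "p = 2 * l" by (elim evenE)
  thus ?thesis using False skips_unskips[OF ij, of l] by (simp add: de2_def en2_def)
 next
  case odd: False
  show ?thesis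
  proof (cases p rule: nat_mod4_cases)
   case (2 m)
   have "(4 * m + 1) mod 4 = 1" "(4 * m + 2) mod 4 = 2" by presburger+
   thus ?thesis using odd False 2 by (simp add: de2_def en2_def)
  next
   case (4 m)
   have "(4 * m + 3) mod 4 = 3" by presburger
   hence "de2 i j p = 2 * m + 3" using odd False 4 by (simp add: de2_def)
   thus ?thesis using 4 by (simp add: en2_def)
  qed (use odd in auto)
 qed
qed (use ij in \<open>auto simp: de2_def en2_def\<close>)

lemma de2_en2:
 assumes ij: "i ~= j"
 shows "de2 i j (en2 i j a) = a"
proof (cases "a = 0 \<or> a = 1")
 case False
 show ?thesis
 proof (cases a rule: nat_mod4_cases)
  case (1 m)
  thus ?thesis using False skips_neq[OF ij, of "m - 1"] by (simp add: de2_def en2_def unskips_skips)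
 next
  case (2 m)
  have e: "en2 i j a = 8 * m - 1" using 2 False by (simp add: en2_def)
  obtain t where t: "m = Suc t" using 2 False by (cases m) auto
  have "en2 i j a = 8 * t + 7" using e t by simp
  moreover have "(8 * t + 7) mod 4 = 3" "8 * t + 7 ~= 2 * i" "8 * t + 7 ~= 2 * j" by presburger+
  ultimately show ?thesis using 2 t by (simp add: de2_def)
 next
  case (3 m)
  have "(4 * m + 2) mod 4 = 2" by presburger
  hence "en2 i j a = 4 * m + 1" using 3 by (simp add: en2_def)
  moreover have "(4 * m + 1) mod 4 = 1" "4 * m + 1 ~= 2 * i" "4 * m + 1 ~= 2 * j" by presburger+
  ultimately show ?thesis using 3 by (simp add: de2_def)
 next
  case (4 m)
  have "en2 i j a = 8 * m + 3" using 4 by (simp add: en2_def)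
  moreover have "(8 * m + 3) mod 4 = 3" "8 * m + 3 ~= 2 * i" "8 * m + 3 ~= 2 * j" by presburger+
  ultimately show ?thesis using 4 by (simp add: de2_def)
 qed
qed (use ij in \<open>auto simp: de2_def en2_def\<close>)

lemma inj_en1: "inj (en1 n)" by (rule inj_on_inverseI) (rule de1_en1)
lemma inj_en2: "i ~= j ==> inj (en2 i j)" by (rule inj_on_inverseI) (rule de2_en2)

text \<open>Hides the entries among indices 0 and 1 and their entries at odd positions. After
  reindexing by \<open>st2\<close>, what remains of these two rows are the columns congruent to 1
  modulo 4.\<close>

definition mask :: "arr => arr" where
 "mask B a b = (if (a < 2 & (b < 2 \<or> odd b)) \<or> (b < 2 & (a < 2 \<or> odd a)) then 0 else B a b)"

text \<open>What \<open>mask\<close> leaves after \<open>st2\<close>, assembled from the pool and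
  two rows. Positions 0 and 1 carry the distinguished indices, whence the shift by 2, and row
  entries sit at even positions, whence the division by 2.\<close>

definition build :: "arr => (nat => real) => (nat => real) => arr" where
 "build z x y a b = (if (a < 2 & (b < 2 \<or> odd b)) \<or> (b < 2 & (a < 2 \<or> odd a)) then 0
  else if a < 2 then (if a = 0 then x ((b - 2) div 2) else y ((b - 2) div 2))
  else if b < 2 then (if b = 0 then x ((a - 2) div 2) else y ((a - 2) div 2)) else z (a - 2) (b - 2))"

lemma measurable_if_const:
 "(P ==> f : N ->M N') ==> (~ P ==> g : N ->M N') ==> (%x. if P then f x else g x) : N ->M N'"
 by (cases P) simp_all

lemma measurable_mask: "mask : Bm borel"
 by (rule measurable_arrI, unfold mask_def) (intro measurable_if_const borel_measurable_const measurable_arr_entry)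

lemma measurable_seq_entry: "f : Bm N ==> (%x. (f x :: nat => real) k) : Bm N"
 by (rule measurable_product_then_coordinatewise)

lemma measurable_build:
 assumes "f : Bm N" "g : Bm N" "h : Bm N"
 shows "(%w. build (f w) (g w) (h w)) : Bm N"
proof (rule measurable_arrI)
 fix a b
 show "(%w. build (f w) (g w) (h w) a b) : Bm N"
  unfolding build_def
  by (intro measurable_if_const borel_measurable_const measurable_entry[OF assms(1)] measurable_seq_entry[OF assms(2)] measurable_seq_entry[OF assms(3)])
qed

definition pool :: "arr => arr" where "pool A = sub odds A"
text \<open>Only half of the pool is used for the row: in \<open>en1\<close> the places of the other
  half also accommodate all remaining even indices, and the recorded row stays in place.\<close>

definition srow :: "nat => arr => nat => real" where "srow i A k = A (2 * i) (4 * k + 1)"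

lemma measurable_pool: "pool : Bm borel" unfolding pool_def[abs_def] by (rule measurable_sub)
lemma measurable_srow: "srow i : Bm borel"
 by (rule measurable_coordinatewise_then_product) (simp add: srow_def measurable_arr_entry)

lemma mask_st2:
 assumes "!!p q. A p q = A q p"
 shows "mask (sub (st2 i j) A) = build (pool A) (srow i A) (srow j A)"
proof (intro ext)
 fix a b
 have e: "4 * ((c - 2) div 2) + 1 = 2 * c - 3" if "even c" "2 <= c" for c :: nat using that by presburger
 have o: "2 * (c - 2) + 1 = 2 * c - 3" if "2 <= c" for c :: nat using that by presburger
 show "mask (sub (st2 i j) A) a b = build (pool A) (srow i A) (srow j A) a b"
  using assms[of "2 * a - 3"] e[of a] e[of b] o[of a] o[of b]
  by (auto simp: mask_def build_def sub_def st2_def pool_def odds_def srow_def not_less)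
qed

section \<open>Conditional kernels of an exchangeable dissociated matrix\<close>

text \<open>\<open>ze\<close> lives on \<open>dist_matrices\<close>; its image under
  \<open>%A. A\<close> moves it to all arrays, where reindexings and products are compared.\<close>

locale exch_matrix = prob_space ze for ze :: "arr measure" +
 assumes sets_ze: "sets ze = sets matrix_borel"
  and exch: "!!pq. inj pq ==> distr ze borel (sub pq) = distr ze borel (%A. A)"
  and diss: "distr ze (borel >< borel) (%A. (sub evens A, sub odds A)) = distr ze borel (%A. A) >< distr ze borel (%A. A)"
  and triangle: "AE A in ze. A 0 2 <= A 0 1 + A 1 2 & A 0 1 <= A 1 2 + A 0 2 & A 1 2 <= A 0 1 + A 0 2"
begin

lemma space_ze: "space ze = dist_matrices"
 using sets_eq_imp_space_eq[OF sets_ze] by (simp add: space_restrict_space)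

lemma in_ze: "f : borel ->M N ==> f : ze ->M N"
 unfolding m_cong_sets[OF sets_ze refl] by (rule measurable_restrict_space1)

lemma matrix_sym: "A : space ze ==> A p q = A q p" and matrix_bounds: "A : space ze ==> 0 <= A p q & A p q <= 1"
 and matrix_diag: "A : space ze ==> A p p = 0"
 by (auto simp: space_ze dist_matrices_def)

lemma exch_transfer:
 assumes "inj pq" and g: "g : borel ->M N"
 shows "distr ze N (%A. g (sub pq A)) = distr ze N g"
proof -
 have "distr ze N (%A. g (sub pq A)) = distr (distr ze borel (sub pq)) N g"
  by (subst distr_distr[OF g in_ze[OF measurable_sub]]) (simp add: comp_def)
 also have "... = distr ze N g" unfolding exch[OF assms(1)] by (subst distr_distr[OF g in_ze]) (simp_all add: comp_def)
 finally show ?thesis .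
qed

lemma exch_integral:
 fixes g :: "arr => real"
 assumes pq: "inj pq" and g: "g : Bm borel"
 shows "(LINT A|ze. g (sub pq A)) = (LINT A|ze. g A)"
proof -
 have "(LINT A|ze. g (sub pq A)) = (LINT A|distr ze borel (sub pq). g A)" by (rule integral_distr[OF in_ze[OF measurable_sub] g, symmetric])
 also have "... = (LINT A|ze. g A)" unfolding exch[OF pq] by (rule integral_distr[OF in_ze g]) simp
 finally show ?thesis .
qed

text \<open>\<open>\<sigma>\<close> lists the indices from which the kernel is computed,
  \<open>\<sigma>'\<close> lists further indices too, and \<open>\<tau>\<close> locates the former
  list in the latter. Exchangeability gives the equality in law for \<open>cond_exp_stable\<close>,
  so the kernel remains valid under the larger conditioning.\<close>

lemma stable_kernel:
 fixes Ta k H G :: "arr => real" and Tb :: "arr => arr"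
 assumes T: "Ta : Bm borel" "Tb : Bm borel" "!!B. 0 <= Ta B & Ta B <= 1"
  and k: "k : Bm borel" "!!B. 0 <= k B & k B <= 1"
  and ce: "!!G :: arr => real. G : Bm borel ==> (!!B. 0 <= G B & G B <= 1) ==>
   (LINT A|ze. Ta A * G (Tb A)) = (LINT A|ze. k (Tb A) * G (Tb A))"
  and \<sigma>: "inj \<sigma>" "inj \<sigma>'" "!!A. Ta (sub \<sigma>' A) = Ta (sub \<sigma> A)" "!!A. Tb (sub \<sigma> A) = sub \<tau> (Tb (sub \<sigma>' A))"
  and G: "G : Bm borel" "!!B. 0 <= G B & G B <= 1"
  and H: "!!A. A : space ze ==> H A = G (Tb (sub \<sigma>' A))"
 shows "(LINT A|ze. Ta (sub \<sigma> A) * H A) = (LINT A|ze. k (Tb (sub \<sigma> A)) * H A)"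
proof -
 have m1: "(%A. Ta (sub pq A)) : Bm borel" and m2: "(%A. Tb (sub pq A)) : Bm borel" for pq
  by (rule m_comp[OF measurable_sub T(1)] m_comp[OF measurable_sub T(2)])+
 have mT: "(%A. (Ta A, Tb A)) : borel ->M borel >< borel" by (intro m_Pair T)
 have "(LINT A|ze. Ta (sub \<sigma> A) * G (Tb (sub \<sigma>' A))) = (LINT A|ze. k (Tb (sub \<sigma> A)) * G (Tb (sub \<sigma>' A)))"
 proof (rule cond_exp_stable(2)[where N=borel and \<xi>="%A. Ta (sub \<sigma> A)" and et="%A. Tb (sub \<sigma> A)" and et'="%A. Tb (sub \<sigma>' A)" and \<phi>="sub \<tau>" and k=k])
  show "distr ze (borel >< borel) (%om. (Ta (sub \<sigma> om), Tb (sub \<sigma> om))) = distr ze (borel >< borel) (%om. (Ta (sub \<sigma> om), Tb (sub \<sigma>' om)))"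
   using exch_transfer[OF \<sigma>(1) mT] exch_transfer[OF \<sigma>(2) mT] by (simp add: \<sigma>(3))
  fix G :: "arr => real" assume G: "G : Bm borel" "!!x. 0 <= G x & G x <= 1"
  have a: "(%A. Ta A * G (Tb A)) : Bm borel" by (intro bm_times T m_comp[OF T(2) G(1)])
  have b: "(%A. k (Tb A) * G (Tb A)) : Bm borel" by (intro bm_times m_comp[OF T(2) k(1)] m_comp[OF T(2) G(1)])
  show "(LINT om|ze. Ta (sub \<sigma> om) * G (Tb (sub \<sigma> om))) = (LINT om|ze. k (Tb (sub \<sigma> om)) * G (Tb (sub \<sigma> om)))"
   using exch_integral[OF \<sigma>(1) a] exch_integral[OF \<sigma>(1) b] ce[OF G] by simp
 qed (use T k G in_ze[OF m1] in_ze[OF m2] measurable_sub \<sigma>(4) in simp_all)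
 moreover have "(LINT A|ze. Ta (sub \<sigma> A) * H A) = (LINT A|ze. Ta (sub \<sigma> A) * G (Tb (sub \<sigma>' A)))"
  "(LINT A|ze. k (Tb (sub \<sigma> A)) * H A) = (LINT A|ze. k (Tb (sub \<sigma> A)) * G (Tb (sub \<sigma>' A)))"
  by (intro b_cong refl, simp add: H)+
 ultimately show ?thesis by simp
qed

end

text \<open>\<open>Ph1\<close> draws a row given the pool, \<open>Ph2\<close> an entry given the
  masked array. By exchangeability one pair of functions serves all indices.\<close>

locale exch_kernels = exch_matrix +
 fixes Ph1 :: "arr => real => nat => real" and Ph2 :: "arr => real => real"
 assumes Ph1_meas: "(%z. Ph1 (fst z) (snd z)) : Bm (borel >< borel)"
  and Ph1_bounds: "!!z u k. 0 <= Ph1 z u k & Ph1 z u k <= 1"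
  and Ph1_law: "distr ze (borel >< borel) (%A. (pool A, srow 0 A)) =
   distr (distr (distr ze (borel >< borel) (%A. (pool A, srow 0 A))) borel fst >< unif) (borel >< borel) (%z. (fst z, Ph1 (fst z) (snd z)))"
  and Ph2_meas: "(%z. Ph2 (fst z) (snd z)) : Bm (borel >< borel)"
  and Ph2_bounds: "!!z u. 0 <= Ph2 z u & Ph2 z u <= 1"
  and Ph2_law: "distr ze (borel >< borel) (%A. (mask A, A 0 1)) =
   distr (distr (distr ze (borel >< borel) (%A. (mask A, A 0 1))) borel fst >< unif) (borel >< borel) (%z. (fst z, Ph2 (fst z) (snd z)))"
begin

definition K1 :: "(nat => real) set => arr => real" where "K1 S z = (LINT u|unif. Ind S (Ph1 z u))"
definition K2 :: "real set => arr => real" where "K2 S z = (LINT u|unif. Ind S (Ph2 z u))"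
definition ks :: "real set => arr => (nat => real) => (nat => real) => real" where
 "ks S z x y = (if enc x <= enc y then K2 S (build z x y) else K2 S (build z y x))"

lemma mpr: "(%A. (pool A, srow 0 A)) : ze ->M borel >< borel"
 by (intro in_ze m_Pair measurable_pool measurable_srow)
lemma mmk: "(%A. (mask A, A 0 1)) : ze ->M borel >< borel"
 by (intro in_ze m_Pair measurable_mask measurable_arr_entry)

lemma K1:
 assumes S: "S : sets borel"
 shows "K1 S : Bm borel" "0 <= K1 S z & K1 S z <= 1"
  "G : Bm borel ==> (!!x. 0 <= G x & G x <= 1) ==>
   (LINT A|ze. Ind S (srow 0 A) * G (pool A)) = (LINT A|ze. K1 S (pool A) * G (pool A))"
proof -
 note ok = outsourced_kernel[OF Ph1_meas prob_space_distr[OF mpr] sets_distr Ph1_law S, folded K1_def]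
 show m: "K1 S : Bm borel" by (rule ok(1))
 show "0 <= K1 S z & K1 S z <= 1" by (rule ok(2))
 assume G: "G : Bm borel" "!!x. 0 <= G x & G x <= 1"
 have a: "(%w. Ind S (snd w) * G (fst w)) : Bm (borel >< borel)"
  by (intro bm_times m_comp[OF m_snd] m_comp[OF m_fst G(1)]) (use S in simp)
 have b: "(%w. K1 S (fst w) * G (fst w)) : Bm (borel >< (borel :: (nat => real) measure))"
  by (intro bm_times m_comp[OF m_fst m] m_comp[OF m_fst G(1)])
 show "(LINT A|ze. Ind S (srow 0 A) * G (pool A)) = (LINT A|ze. K1 S (pool A) * G (pool A))"
  using ok(3)[OF G] unfolding integral_distr[OF mpr a] integral_distr[OF mpr b] by (simp only: fst_conv snd_conv)
qed

lemma K2: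
 assumes S: "S : sets borel"
 shows "K2 S : Bm borel" "0 <= K2 S z & K2 S z <= 1"
  "G : Bm borel ==> (!!x. 0 <= G x & G x <= 1) ==>
   (LINT A|ze. Ind S (A 0 1) * G (mask A)) = (LINT A|ze. K2 S (mask A) * G (mask A))"
proof -
 note ok = outsourced_kernel[OF Ph2_meas prob_space_distr[OF mmk] sets_distr Ph2_law S, folded K2_def]
 show m: "K2 S : Bm borel" by (rule ok(1))
 show "0 <= K2 S z & K2 S z <= 1" by (rule ok(2))
 assume G: "G : Bm borel" "!!x. 0 <= G x & G x <= 1"
 have a: "(%w. Ind S (snd w) * G (fst w)) : Bm (borel >< borel)"
  by (intro bm_times m_comp[OF m_snd] m_comp[OF m_fst G(1)]) (use S in simp)
 have b: "(%w. K2 S (fst w) * G (fst w)) : Bm (borel >< (borel :: real measure))"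
  by (intro bm_times m_comp[OF m_fst m] m_comp[OF m_fst G(1)])
 show "(LINT A|ze. Ind S (A 0 1) * G (mask A)) = (LINT A|ze. K2 S (mask A) * G (mask A))"
  using ok(3)[OF G] unfolding integral_distr[OF mmk a] integral_distr[OF mmk b] by (simp only: fst_conv snd_conv)
qed

text \<open>Since \<open>en1 n\<close> reaches every index, the row keeps its conditional law given
  the pool when all entries away from index \<open>2 * n\<close> become known.\<close>

lemma row_kernel:
 fixes H :: "arr => real"
 assumes S: "S : sets borel" and H: "H : Bm borel" "!!A. 0 <= H A & H A <= 1"
  and loc: "!!A. A : space ze ==> H (%p q. if p = 2 * n \<or> q = 2 * n then 0 else A p q) = H A"
 shows "(LINT A|ze. Ind S (srow n A) * H A) = (LINT A|ze. K1 S (pool A) * H A)"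
proof -
 define T1 :: "arr => real" where "T1 B = Ind S (%k. B 0 (2 * k + 1))" for B
 define \<tau> where "\<tau> j = (if even j then j else 2 * j - 1)" for j :: nat
 \<comment> \<open>\<open>H\<close> read through the extended listing; positions drop by 1 because
   \<open>sub Suc\<close> removes the distinguished position 0.\<close>
 define G where "G B = H (%p q. if p = 2 * n \<or> q = 2 * n then 0 else B (de1 n p - 1) (de1 n q - 1))" for B
 have row0: "(%k. sub (st1 m) A 0 (2 * k + 1)) = srow m A" for m A by (simp add: sub_def st1_def srow_def fun_eq_iff)
 have row0': "(%k. sub (en1 m) A 0 (2 * k + 1)) = srow m A" for m A by (simp add: sub_def en1_def srow_def fun_eq_iff)
 have pool0: "sub Suc (sub (st1 m) A) = pool A" for m A by (simp add: sub_def st1_def pool_def odds_def fun_eq_iff)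
 have mT1: "T1 : Bm borel" unfolding T1_def[abs_def]
  by (rule m_comp[where N=borel, OF measurable_coordinatewise_then_product]) (use S in \<open>simp_all add: measurable_arr_entry\<close>)
 have st: "st1 n (Suc j) = en1 n (Suc (\<tau> j))" for j
 proof (cases "even j")
  case True thus ?thesis by (simp add: st1_def en1_def \<tau>_def)
 next
  case False
  then obtain t where t: "j = 2 * t + 1" by (elim oddE)
  have "Suc (\<tau> j) = 4 * t + 2" using t by (simp add: \<tau>_def)
  moreover have "(4 * t + 2) mod 4 = 2" by presburger
  ultimately show ?thesis using t by (simp add: st1_def en1_def)
 qed
 have "(LINT A|ze. T1 (sub (st1 n) A) * H A) = (LINT A|ze. K1 S (sub Suc (sub (st1 n) A)) * H A)"
 proof (rule stable_kernel[where Ta=T1 and Tb="sub Suc" and \<sigma>'="en1 n" and \<tau>=\<tau> and G=G, OF mT1 measurable_sub _ K1(1)[OF S] K1(2)[OF S] _ inj_st1 inj_en1])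
  show "0 <= T1 B & T1 B <= 1" for B by (simp add: T1_def)
  fix G :: "arr => real" assume G: "G : Bm borel" "!!B. 0 <= G B & G B <= 1"
  have a: "(%A. T1 A * G (sub Suc A)) : Bm borel" by (intro bm_times mT1 m_comp[OF measurable_sub G(1)])
  have b: "(%A. K1 S (sub Suc A) * G (sub Suc A)) : Bm borel"
   by (intro bm_times m_comp[OF measurable_sub K1(1)[OF S]] m_comp[OF measurable_sub G(1)])
  have t: "T1 (sub (st1 m) A) = Ind S (srow m A)" for m A unfolding T1_def row0 ..
  show "(LINT A|ze. T1 A * G (sub Suc A)) = (LINT A|ze. K1 S (sub Suc A) * G (sub Suc A))"
   using K1(3)[OF S G] exch_integral[OF inj_st1[of 0] a] exch_integral[OF inj_st1[of 0] b] unfolding t pool0 by simp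
 next
  show "T1 (sub (en1 n) A) = T1 (sub (st1 n) A)" for A unfolding T1_def row0 row0' ..
  show "sub Suc (sub (st1 n) A) = sub \<tau> (sub Suc (sub (en1 n) A))" for A by (simp add: sub_def st fun_eq_iff)
  have "(%B :: arr. (%p q. if p = 2 * n \<or> q = 2 * n then 0 else B (de1 n p - 1) (de1 n q - 1))) : Bm borel"
  proof (rule measurable_arrI)
   fix p q show "(%B :: arr. if p = 2 * n \<or> q = 2 * n then 0 else B (de1 n p - 1) (de1 n q - 1)) : Bm borel"
    by (cases "p = 2 * n \<or> q = 2 * n") (simp_all add: measurable_arr_entry)
  qed
  from m_comp[OF this H(1)] show "G : Bm borel" unfolding G_def[abs_def] .
  show "0 <= G B & G B <= 1" for B unfolding G_def by (rule H(2))
  fix A assume A: "A : space ze"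
  have "Suc (de1 n p - 1) = de1 n p" if "p ~= 2 * n" for p
  proof -
   have "de1 n p ~= 0"
   proof
    assume "de1 n p = 0"
    hence "en1 n 0 = p" using en1_de1[of n p] by simp
    thus False using that by (simp add: en1_def)
   qed
   thus ?thesis by simp
  qed
  hence "(%p q. if p = 2 * n \<or> q = 2 * n then 0 else sub Suc (sub (en1 n) A) (de1 n p - 1) (de1 n q - 1)) =
   (%p q. if p = 2 * n \<or> q = 2 * n then 0 else A p q)" by (auto simp: sub_def en1_de1 fun_eq_iff)
  thus "H A = G (sub Suc (sub (en1 n) A))" using loc[OF A] by (simp add: G_def)
 qed
 thus ?thesis unfolding T1_def row0 pool0 .
qed

text \<open>The entries that \<open>mask\<close> hides in the listing \<open>en2\<close>: the block
  on the two distinguished indices and their columns congruent to 3 modulo 4.\<close>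

definition touches :: "nat => nat => nat => nat => bool" where
 "touches i j p q \<longleftrightarrow> p : {2 * i, 2 * j} & (q : {2 * i, 2 * j} \<or> q mod 4 = 3)"

text \<open>The listing \<open>en2\<close> contains every index, so given the pool and the two
  recorded rows, the entry is conditionally independent of everything the extended mask still
  shows.\<close>

lemma entry_kernel:
 fixes H :: "arr => real"
 assumes S: "S : sets borel" and ij: "i ~= j" and H: "H : Bm borel" "!!A. 0 <= H A & H A <= 1"
  and loc: "!!A. A : space ze ==> H (%p q. if touches i j p q \<or> touches i j q p then 0 else A p q) = H A"
 shows "(LINT A|ze. Ind S (A (2 * i) (2 * j)) * H A) = (LINT A|ze. K2 S (build (pool A) (srow i A) (srow j A)) * H A)"
proof -
 define T1 :: "arr => real" where "T1 B = Ind S (B 0 1)" for B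
 define \<tau> where "\<tau> a = (if a < 2 \<or> odd a then a else 2 * a - 2)" for a :: nat
 define G where "G B = H (sub (de2 i j) B)" for B
 have mT1: "T1 : Bm borel" unfolding T1_def[abs_def] by (rule m_comp[OF measurable_arr_entry]) (use S in simp)
 have st: "st2 i j a = en2 i j (\<tau> a)" for a
 proof (cases "a < 2 \<or> odd a")
  case True thus ?thesis by (auto simp: st2_def en2_def \<tau>_def)
 next
  case False
  then obtain t where t: "a = 2 * t" "t ~= 0" by (auto elim: evenE)
  then obtain s where s: "a = 2 * s + 2" by (cases t) auto
  have "\<tau> a = 4 * s + 2" using s by (simp add: \<tau>_def)
  moreover have "(4 * s + 2) mod 4 = 2" by presburger
  ultimately show ?thesis using s by (simp add: st2_def en2_def)
 qed
 have \<tau>: "\<tau> a < 2 \<longleftrightarrow> a < 2" "a \<ge> 2 ==> odd (\<tau> a) \<longleftrightarrow> odd a" for a by (auto simp: \<tau>_def)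
 have masksub: "mask (sub \<tau> B) = sub \<tau> (mask B)" for B
  using \<tau> by (auto simp: mask_def sub_def fun_eq_iff not_less)
 have "(LINT A|ze. T1 (sub (st2 i j) A) * H A) = (LINT A|ze. K2 S (mask (sub (st2 i j) A)) * H A)"
 proof (rule stable_kernel[where Ta=T1 and Tb=mask and \<sigma>'="en2 i j" and \<tau>=\<tau> and G=G, OF mT1 measurable_mask _ K2(1)[OF S] K2(2)[OF S] _ inj_st2[OF ij] inj_en2[OF ij]])
  show "0 <= T1 B & T1 B <= 1" for B by (simp add: T1_def)
  show "(LINT A|ze. T1 A * G (mask A)) = (LINT A|ze. K2 S (mask A) * G (mask A))"
   if "G : Bm borel" "!!B. 0 <= G B & G B <= 1" for G :: "arr => real"
   unfolding T1_def by (rule K2(3)[OF S that])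
  show "T1 (sub (en2 i j) A) = T1 (sub (st2 i j) A)" for A by (simp add: T1_def sub_def en2_def st2_def)
  show "mask (sub (st2 i j) A) = sub \<tau> (mask (sub (en2 i j) A))" for A
   unfolding masksub[symmetric] by (rule arg_cong[where f=mask]) (simp add: sub_def st fun_eq_iff)
  show "G : Bm borel" unfolding G_def[abs_def] by (rule m_comp[OF measurable_sub H(1)])
  show "0 <= G B & G B <= 1" for B unfolding G_def by (rule H(2))
  fix A assume A: "A : space ze"
  have d1: "de2 i j p < 2 \<longleftrightarrow> p : {2 * i, 2 * j}" for p
   using en2_de2[OF ij, of p] by (auto simp: de2_def en2_def split: if_splits)
  have d2: "odd (de2 i j p) \<longleftrightarrow> p mod 4 = 3" if "p \<notin> {2 * i, 2 * j}" for p
  proof (cases "even p")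
   case True
   hence "p mod 4 ~= 3" by presburger
   thus ?thesis using that True by (simp add: de2_def)
  next
   case False
   show ?thesis
   proof (cases p rule: nat_mod4_cases)
    case (2 m) 
    have "(4 * m + 1) mod 4 = 1" by presburger
    thus ?thesis using that 2 False by (simp add: de2_def)
   next
    case (4 m) 
    have "(4 * m + 3) mod 4 = 3" by presburger
    thus ?thesis using that 4 False by (simp add: de2_def)
   qed (use False in auto)
  qed
  have "sub (de2 i j) (mask (sub (en2 i j) A)) = (%p q. if touches i j p q \<or> touches i j q p then 0 else A p q)"
  proof (intro ext)
   fix p q
   have "((de2 i j p < 2 & (de2 i j q < 2 \<or> odd (de2 i j q))) \<or> (de2 i j q < 2 & (de2 i j p < 2 \<or> odd (de2 i j p)))) \<longleftrightarrow> (touches i j p q \<or> touches i j q p)"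
    using d1[of p] d1[of q] d2[of p] d2[of q] unfolding touches_def by blast
   thus "sub (de2 i j) (mask (sub (en2 i j) A)) p q = (if touches i j p q \<or> touches i j q p then 0 else A p q)"
    by (simp only: sub_def mask_def en2_de2[OF ij])
  qed
  thus "H A = G (mask (sub (en2 i j) A))" using loc[OF A] by (simp add: G_def)
 qed
 moreover have "T1 (sub (st2 i j) A) = Ind S (A (2 * i) (2 * j))" for A by (simp add: T1_def sub_def st2_def)
 moreover have "(LINT A|ze. K2 S (mask (sub (st2 i j) A)) * H A) = (LINT A|ze. K2 S (build (pool A) (srow i A) (srow j A)) * H A)"
  by (rule b_cong[OF refl]) (simp add: mask_st2 matrix_sym)
 ultimately show ?thesis by simp
qed

lemma measurable_ks:
 assumes S: "S : sets borel" and f: "f : Bm N" "g : Bm N" "h : Bm N"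
 shows "(%w. ks S (f w) (g w) (h w)) : Bm N"
 unfolding ks_def
proof (rule measurable_If)
 show "(%w. K2 S (build (f w) (g w) (h w))) : Bm N" "(%w. K2 S (build (f w) (h w) (g w))) : Bm N"
  by (rule m_comp[OF measurable_build[OF f] K2(1)[OF S]], rule m_comp[OF measurable_build[OF f(1,3,2)] K2(1)[OF S]])
 show "{w : space N. enc (g w) <= enc (h w)} : sets N"
  by (intro borel_measurable_le m_comp[OF f(2) measurable_enc] m_comp[OF f(3) measurable_enc])
qed

lemma ks_bounds: "S : sets borel ==> 0 <= ks S z x y & ks S z x y <= 1"
 using K2(2)[of S] by (simp add: ks_def)

lemma integrable_unit:
 fixes f :: "arr => real"
 assumes "f : Bm borel" "!!A. 0 <= f A & f A <= 1"
 shows "integrable ze f"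
 by (rule integrable_bounded[OF in_ze[OF assms(1)], where B=1]) (use assms(2) in simp)

text \<open>Sorting the two rows makes the kernel symmetric by construction; both orders are correct because the matrix is symmetric.\<close>
lemma sorted_kernel:
 fixes H :: "arr => real"
 assumes S: "S : sets borel" and ij: "i ~= j" and H: "H : Bm borel" "!!A. 0 <= H A & H A <= 1"
  and loc: "!!A. A : space ze ==> H (%p q. if touches i j p q \<or> touches i j q p then 0 else A p q) = H A"
 shows "(LINT A|ze. Ind S (A (2 * i) (2 * j)) * H A) = (LINT A|ze. ks S (pool A) (srow i A) (srow j A) * H A)"
proof -
 define c where "c A \<longleftrightarrow> enc (srow i A) <= enc (srow j A)" for A
 define Ha where "Ha A = (if c A then H A else 0)" for A
 define Hb where "Hb A = (if c A then 0 else H A)" for A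
 have mc: "{A : space borel. c A} : sets borel" unfolding c_def
  by (intro borel_measurable_le m_comp[OF measurable_srow measurable_enc])
 have mHa: "Ha : Bm borel" unfolding Ha_def[abs_def] by (rule measurable_If[OF H(1) _ mc]) simp
 have mHb: "Hb : Bm borel" unfolding Hb_def[abs_def] by (rule measurable_If[OF _ H(1) mc]) simp
 have ba: "0 <= Ha A & Ha A <= 1" and bb: "0 <= Hb A & Hb A <= 1" for A using H(2)[of A] by (auto simp: Ha_def Hb_def)
 define zero where "zero A = (%p q. if touches i j p q \<or> touches i j q p then 0 else A p q :: real)" for A
 \<comment> \<open>The order of the rows is read from columns congruent to 1 modulo 4, which
   \<open>touches\<close> leaves alone, so both parts of the split \<open>H\<close> remain
   admissible.\<close>
 have srow0: "srow l (zero A) = srow l A" for l A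
 proof
  fix k
  have "4 * k + 1 ~= 2 * i" "4 * k + 1 ~= 2 * j" "(4 * k + 1) mod 4 ~= 3" by presburger+
  thus "srow l (zero A) k = srow l A k" by (simp add: zero_def srow_def touches_def)
 qed
 have czero: "c (zero A) = c A" for A unfolding c_def srow0 ..
 have tc: "touches j i p q = touches i j p q" for p q by (auto simp: touches_def)
 have mI: "(%A :: arr. Ind S (A p q) :: real) : Bm borel" for p q
  by (rule m_comp[OF measurable_arr_entry]) (use S in simp)
 have mK: "(%A. K2 S (build (pool A) (srow l A) (srow m A))) : Bm borel" for l m
  by (rule m_comp[OF measurable_build[OF measurable_pool measurable_srow measurable_srow] K2(1)[OF S]])
 have 1: "(LINT A|ze. Ind S (A (2 * i) (2 * j)) * Ha A) = (LINT A|ze. K2 S (build (pool A) (srow i A) (srow j A)) * Ha A)"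
 proof (rule entry_kernel[OF S ij mHa ba])
  fix A assume "A : space ze"
  from loc[OF this] show "Ha (%p q. if touches i j p q \<or> touches i j q p then 0 else A p q) = Ha A"
   unfolding zero_def[symmetric] by (simp add: Ha_def czero)
 qed
 have 2: "(LINT A|ze. Ind S (A (2 * j) (2 * i)) * Hb A) = (LINT A|ze. K2 S (build (pool A) (srow j A) (srow i A)) * Hb A)"
 proof (rule entry_kernel[OF S ij[symmetric] mHb bb])
  fix A assume "A : space ze"
  from loc[OF this] show "Hb (%p q. if touches j i p q \<or> touches j i q p then 0 else A p q) = Hb A"
   unfolding tc zero_def[symmetric] by (simp add: Hb_def czero)
 qed
 have u: "0 <= a * b & a * b <= 1" if "0 <= a & a <= 1" "0 <= b & b <= (1::real)" for a b using that by (simp add: mult_le_one)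
 have uI: "0 <= (Ind S x :: real) & Ind S x <= (1::real)" for x by (simp add: indicator_def)
 have iI: "integrable ze (%A. Ind S (A p q) * G A)" if "G : Bm borel" "!!A. 0 <= G A & G A <= 1" for G :: "arr => real" and p q
  by (rule integrable_unit) (intro bm_times mI that(1), rule u[OF uI that(2)])
 have iK: "integrable ze (%A. K2 S (build (pool A) (srow l A) (srow m A)) * G A)" if "G : Bm borel" "!!A. 0 <= G A & G A <= 1" for G :: "arr => real" and l m
  by (rule integrable_unit) (intro bm_times mK that(1), rule u[OF K2(2)[OF S] that(2)])
 have "(LINT A|ze. Ind S (A (2 * i) (2 * j)) * H A) = (LINT A|ze. Ind S (A (2 * i) (2 * j)) * Ha A + Ind S (A (2 * j) (2 * i)) * Hb A)"
  by (rule b_cong[OF refl]) (use matrix_sym in \<open>simp add: Ha_def Hb_def\<close>)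
 also have "... = (LINT A|ze. K2 S (build (pool A) (srow i A) (srow j A)) * Ha A + K2 S (build (pool A) (srow j A) (srow i A)) * Hb A)"
  using 1 2 by (simp only: Bochner_Integration.integral_add[OF iI[OF mHa ba] iI[OF mHb bb]] Bochner_Integration.integral_add[OF iK[OF mHa ba] iK[OF mHb bb]])
 also have "... = (LINT A|ze. ks S (pool A) (srow i A) (srow j A) * H A)"
  by (rule b_cong[OF refl]) (simp add: ks_def Ha_def Hb_def c_def)
 finally show ?thesis .
qed

end

section \<open>Joint law of pool, rows and entries\<close>

definition rows :: "arr => arr" where "rows A i = srow i A"

lemma prod_unit: "(!!e. e : E ==> 0 <= f e & f e <= (1::real)) ==> 0 <= prod f E & prod f E <= 1"
 by (auto intro: prod_nonneg prod_le_1)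

lemma prod_indicator:
 assumes "finite I"
 shows "(\<Prod>i\<in>I. Ind (S i) (x i)) = (if \<forall>i\<in>I. x i : S i then 1 else 0 :: real)"
 using assms by (auto simp: indicator_def intro!: prod.neutral)

text \<open>Coordinates are split into two families indexed by \<open>bool\<close>; \<open>l\<close>
  is a dummy partner of \<open>i\<close>.\<close>

lemma distr_PiM_triple:
 assumes M: "prob_space M" and d: "i ~= j" "i ~= k" "j ~= k" "l ~= i" "l ~= j" "l ~= (k :: 'i)"
 shows "distr (\<Pi>\<^sub>M i\<in>UNIV. M) (M >< (M >< M)) (%x. (x i, (x j, x k))) = M >< (M >< M)"
proof -
 interpret M: prob_space M by (rule M)
 define f where "f b = (if b then l else i)" for b
 define g where "g b = (if b then k else j)" for b
 let ?B = "\<Pi>\<^sub>M b\<in>(UNIV :: bool set). M"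
 interpret B: prob_space ?B by (rule prob_space_PiM) (rule M)
 have fg: "inj f" "inj g" "range f Int range g = {}" using d by (auto simp: f_def g_def inj_def)
 have mc: "(%y. y b) : ?B ->M M" for b by (rule measurable_component_singleton) simp
 have mcI: "(%y. y e) : (\<Pi>\<^sub>M i\<in>UNIV. M) ->M M" for e :: 'i by (rule measurable_component_singleton) simp
 have mre: "(%x b. x (h b)) : (\<Pi>\<^sub>M i\<in>UNIV. M) ->M ?B" for h :: "bool => 'i"
  by (rule measurable_PiM_single') (use mcI in \<open>auto simp: space_PiM PiE_iff\<close>)
 have mfg: "(%x. (%b. x (f b), %b. x (g b))) : (\<Pi>\<^sub>M i\<in>UNIV. M) ->M ?B >< ?B" by (intro m_Pair mre)
 have mp: "(%y. (y False, y True)) : ?B ->M M >< M" by (intro m_Pair mc)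
 have sf: "sigma_finite_measure (distr ?B (M >< M) (%y. (y False, y True)))"
  using B.prob_space_distr[OF mp] by (simp add: prob_space_imp_sigma_finite)
 have mq: "(%(y, y'). (y False, (y' False, y' True))) : ?B >< ?B ->M M >< (M >< M)"
  unfolding case_prod_unfold by (intro m_Pair m_comp[OF m_fst mc] m_comp[OF m_snd mc])
 have "distr (\<Pi>\<^sub>M i\<in>UNIV. M) (M >< (M >< M)) (%x. (x i, (x j, x k))) =
  distr (distr (\<Pi>\<^sub>M i\<in>UNIV. M) (?B >< ?B) (%x. (%b. x (f b), %b. x (g b)))) (M >< (M >< M)) (%(y, y'). (y False, (y' False, y' True)))"
  by (subst distr_distr[OF mq mfg]) (simp add: comp_def f_def g_def)
 also have "... = distr (?B >< ?B) (M >< (M >< M)) (%(y, y'). (y False, (y' False, y' True)))"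
  by (subst distr_PiM_split[OF M fg]) rule
 also have "... = distr ?B M (%y. y False) >< distr ?B (M >< M) (%y. (y False, y True))"
  by (rule pair_measure_distr[OF mc mp sf, symmetric])
 also have "... = M >< (M >< M)"
  using distr_PiM_pair[OF M, of False True] distr_PiM_component[of UNIV "%_ :: bool. M" False] M by simp
 finally show ?thesis .
qed

context exch_kernels
begin

lemma measurable_rows: "rows : Bm borel"
 by (rule measurable_arrI) (simp add: rows_def srow_def measurable_arr_entry)

lemma measurable_snd_row: "(%p. (snd p :: arr) i) : Bm (N >< borel)"
 by (rule measurable_product_then_coordinatewise[OF m_snd])

text \<open>Entries are replaced by kernels one at a time. Another edge has at most one end in
  common with the current one, so the remaining entries, like the pool and the rows, avoid what
  \<open>touches\<close> excludes.\<close>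

lemma edges_kernel:
 fixes h :: "arr \<times> arr => real" and S :: "nat \<times> nat => real set"
 assumes "finite E" "E <= {e. fst e < snd e}" and S: "!!e. S e : sets borel"
  and h: "h : Bm (borel >< borel)" "!!p. 0 <= h p & h p <= 1"
 shows "(LINT A|ze. (\<Prod>e\<in>E. Ind (S e) (A (2 * fst e) (2 * snd e))) * h (pool A, rows A)) =
  (LINT A|ze. (\<Prod>e\<in>E. ks (S e) (pool A) (rows A (fst e)) (rows A (snd e))) * h (pool A, rows A))"
 using assms(1,2) h
proof (induction E arbitrary: h rule: finite_induct)
 case (insert e0 E)
 define H where "H A = (\<Prod>e\<in>E. Ind (S e) (A (2 * fst e) (2 * snd e))) * h (pool A, rows A)" for A
 define h' where "h' p = ks (S e0) (fst p) (snd p (fst e0)) (snd p (snd e0)) * h p" for p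
 have mpr: "(%A. (pool A, rows A)) : borel ->M borel >< borel" by (intro m_Pair measurable_pool measurable_rows)
 have mH: "H : Bm borel" unfolding H_def[abs_def]
 proof (intro bm_times bm_prod m_comp[OF mpr insert.prems(2)])
  show "(%A :: arr. Ind (S e) (A (2 * fst e) (2 * snd e)) :: real) : Bm borel" for e
   by (rule m_comp[OF measurable_arr_entry]) (use S in simp)
 qed
 have Hb: "0 <= H A & H A <= 1" for A
 proof -
  have "0 <= (\<Prod>e\<in>E. Ind (S e) (A (2 * fst e) (2 * snd e)) :: real) & (\<Prod>e\<in>E. Ind (S e) (A (2 * fst e) (2 * snd e))) <= (1::real)"
   by (rule prod_unit) (simp add: indicator_def)
  thus ?thesis using insert.prems(3)[of "(pool A, rows A)"] by (simp add: H_def mult_le_one)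
 qed
 have lt: "fst e0 < snd e0" using insert.prems(1) by auto
 have "(LINT A|ze. Ind (S e0) (A (2 * fst e0) (2 * snd e0)) * H A) = (LINT A|ze. ks (S e0) (pool A) (srow (fst e0) A) (srow (snd e0) A) * H A)"
 proof (rule sorted_kernel[OF S _ mH Hb])
  show "fst e0 ~= snd e0" using lt by simp
  fix A assume "A : space ze"
  define Z where "Z = (%p q. if touches (fst e0) (snd e0) p q \<or> touches (fst e0) (snd e0) q p then 0 else A p q)"
  have "pool Z = pool A"
  proof (intro ext)
   fix a b
   have "2 * a + 1 ~= 2 * fst e0" "2 * a + 1 ~= 2 * snd e0" "2 * b + 1 ~= 2 * fst e0" "2 * b + 1 ~= 2 * snd e0" by presburger+
   thus "pool Z a b = pool A a b" by (simp add: pool_def sub_def odds_def Z_def touches_def)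
  qed
  moreover have "rows Z = rows A"
  proof (intro ext)
   fix l k
   have "4 * k + 1 ~= 2 * fst e0" "4 * k + 1 ~= 2 * snd e0" "(4 * k + 1) mod 4 ~= 3" by presburger+
   thus "rows Z l k = rows A l k" by (simp add: rows_def srow_def Z_def touches_def)
  qed
  moreover have "(\<Prod>e\<in>E. Ind (S e) (Z (2 * fst e) (2 * snd e))) = (\<Prod>e\<in>E. Ind (S e) (A (2 * fst e) (2 * snd e)) :: real)"
  proof (rule prod.cong[OF refl])
   fix e assume e: "e : E"
   hence "e ~= e0" "fst e < snd e" using insert.hyps(2) insert.prems(1) by auto
   hence "~ (touches (fst e0) (snd e0) (2 * fst e) (2 * snd e) \<or> touches (fst e0) (snd e0) (2 * snd e) (2 * fst e))"
   proof -
    have "(2 * fst e) mod 4 ~= 3" "(2 * snd e) mod 4 ~= 3" by presburger+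
    thus ?thesis using \<open>e ~= e0\<close> \<open>fst e < snd e\<close> lt by (auto simp: touches_def prod_eq_iff)
   qed
   thus "Ind (S e) (Z (2 * fst e) (2 * snd e)) = (Ind (S e) (A (2 * fst e) (2 * snd e)) :: real)" by (simp add: Z_def)
  qed
  ultimately have "H Z = H A" by (simp add: H_def)
  thus "H (%p q. if touches (fst e0) (snd e0) p q \<or> touches (fst e0) (snd e0) q p then 0 else A p q) = H A" by (simp add: Z_def)
 qed
 also have "... = (LINT A|ze. (\<Prod>e\<in>E. Ind (S e) (A (2 * fst e) (2 * snd e))) * h' (pool A, rows A))"
  by (rule b_cong[OF refl]) (simp add: H_def h'_def rows_def mult_ac)
 also have "... = (LINT A|ze. (\<Prod>e\<in>E. ks (S e) (pool A) (rows A (fst e)) (rows A (snd e))) * h' (pool A, rows A))"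
 proof (rule insert.IH)
  show "h' : Bm (borel >< borel)" unfolding h'_def[abs_def]
   by (intro bm_times insert.prems(2) measurable_ks[OF S] m_fst measurable_snd_row)
  show "0 <= h' p & h' p <= 1" for p using ks_bounds[OF S] insert.prems(3)[of p] by (simp add: h'_def mult_le_one)
 qed (use insert.prems(1) in auto)
 finally show ?case using insert.hyps by (simp add: H_def h'_def mult_ac)
qed simp

text \<open>Given the pool the rows are independent with the common kernel \<open>K1\<close>: the
  last row is peeled off while the pool and the earlier rows do not involve index
  \<open>2 * n\<close>.\<close>

lemma rows_kernel:
 fixes S :: "nat => (nat => real) set"
 assumes S: "!!i. S i : sets borel" and g: "g : Bm borel" "!!z. 0 <= g z & g z <= (1::real)"
 shows "(LINT A|ze. g (pool A) * (\<Prod>i<n. Ind (S i) (rows A i))) = (LINT A|ze. g (pool A) * (\<Prod>i<n. K1 (S i) (pool A)))"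
 using g
proof (induction n arbitrary: g)
 case (Suc n)
 define H where "H A = g (pool A) * (\<Prod>i<n. Ind (S i) (srow i A))" for A
 have mH: "H : Bm borel" unfolding H_def[abs_def]
  by (intro bm_times bm_prod m_comp[OF measurable_pool Suc.prems(1)] m_comp[OF measurable_srow]) (use S in simp)
 have Hb: "0 <= H A & H A <= 1" for A
 proof -
  have "0 <= (\<Prod>i<n. Ind (S i) (srow i A) :: real) & (\<Prod>i<n. Ind (S i) (srow i A)) <= (1::real)"
   by (rule prod_unit) (simp add: indicator_def)
  thus ?thesis using Suc.prems(2)[of "pool A"] by (simp add: H_def mult_le_one)
 qed
 have "(LINT A|ze. g (pool A) * (\<Prod>i<Suc n. Ind (S i) (rows A i))) = (LINT A|ze. Ind (S n) (srow n A) * H A)"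
  by (rule b_cong[OF refl]) (simp add: H_def rows_def mult_ac)
 also have "... = (LINT A|ze. K1 (S n) (pool A) * H A)"
 proof (rule row_kernel[OF S mH Hb])
  fix A assume "A : space ze"
  define Z where "Z = (%p q. if p = 2 * n \<or> q = 2 * n then 0 else A p q)"
  have "pool Z = pool A"
  proof (intro ext)
   fix a b
   have "2 * a + 1 ~= 2 * n" "2 * b + 1 ~= 2 * n" by presburger+
   thus "pool Z a b = pool A a b" by (simp add: pool_def sub_def odds_def Z_def)
  qed
  moreover have "srow i Z = srow i A" if "i < n" for i
  proof
   fix k have "4 * k + 1 ~= 2 * n" by presburger
   thus "srow i Z k = srow i A k" using that by (simp add: srow_def Z_def)
  qed
  ultimately have "H Z = H A" by (simp add: H_def)
  thus "H (%p q. if p = 2 * n \<or> q = 2 * n then 0 else A p q) = H A" by (simp add: Z_def)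
 qed
 also have "... = (LINT A|ze. (K1 (S n) (pool A) * g (pool A)) * (\<Prod>i<n. Ind (S i) (rows A i)))"
  by (rule b_cong[OF refl]) (simp add: H_def rows_def mult_ac)
 also have "... = (LINT A|ze. (K1 (S n) (pool A) * g (pool A)) * (\<Prod>i<n. K1 (S i) (pool A)))"
 proof (rule Suc.IH)
  show "(%z. K1 (S n) z * g z) : Bm borel" by (intro bm_times K1(1)[OF S] Suc.prems(1))
  show "0 <= K1 (S n) z * g z & K1 (S n) z * g z <= 1" for z using K1(2)[OF S, of n z] Suc.prems(2)[of z] by (simp add: mult_le_one)
 qed
 also have "... = (LINT A|ze. g (pool A) * (\<Prod>i<Suc n. K1 (S i) (pool A)))" by (simp add: mult_ac)
 finally show ?case .
qed simp

definition Lz :: "arr measure" where "Lz = distr ze borel pool"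

lemma Lz: "prob_space Lz" "sets Lz = sets borel" "space Lz = UNIV"
 unfolding Lz_def by (simp_all add: prob_space_distr[OF in_ze[OF measurable_pool]])

lemma measurable_section1: "Ph1 z : Bm borel"
 using m_comp[OF measurable_Pair1' Ph1_meas, of z] by simp

definition sampled :: "arr \<times> (nat => real) => arr \<times> arr" where "sampled w = (fst w, %i. Ph1 (fst w) (snd w i))"

lemma measurable_sampled: "sampled : Lz >< seqs unif ->M borel >< borel"
proof -
 have f: "fst : Lz >< seqs unif ->M borel"
  by (rule m_comp[OF m_fst]) (rule measurable_ident_sets[OF Lz(2)])
 have s: "(%w. snd w i) : Bm (Lz >< seqs unif)" for i
  unfolding measurable_unif_eq[symmetric] by (rule m_comp[OF m_snd measurable_seqs_component])
 have e: "(%w. Ph1 (fst w) (snd w i)) : Bm (Lz >< seqs unif)" for i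
  using m_comp[OF m_Pair[OF f s] Ph1_meas] by (simp only: fst_conv snd_conv)
 show ?thesis unfolding sampled_def[abs_def]
  by (intro m_Pair f measurable_coordinatewise_then_product e)
qed

text \<open>Conditionally iid rows are generated from iid uniform numbers by \<open>Ph1\<close>. It
  suffices to compare an event of the pool times a cylinder over finitely many rows.\<close>

lemma rows_law: "distr ze (borel >< borel) (%A. (pool A, rows A)) = distr (Lz >< seqs unif) (borel >< borel) sampled"
 (is "?P = ?Q")
proof (rule pair_slice_eqI)
 interpret Lz: prob_space Lz by (rule Lz)
 interpret U: prob_space "seqs unif" by (rule prob_space_seqs) simp
 interpret LU: pair_prob_space Lz "seqs unif" ..
 have mpr: "(%A. (pool A, rows A)) : ze ->M borel >< borel" by (intro in_ze m_Pair measurable_pool measurable_rows)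
 interpret P: prob_space ?P by (rule prob_space_distr[OF mpr])
 have pLU: "prob_space (Lz >< seqs unif)" by (rule prob_space_pair[OF Lz(1) U.prob_space_axioms])
 interpret Q: prob_space ?Q by (rule prob_space.prob_space_distr[OF pLU measurable_sampled])
 show "finite_measure ?P" "finite_measure ?Q" by unfold_locales
 show "sets ?P = sets (borel >< borel)" "sets ?Q = sets (borel >< borel)" by simp_all
 fix B :: "arr set" assume B: "B : sets borel"
 show "slice ?P B borel = slice ?Q B borel"
 proof (rule measure_eqI_PiM_infinite[where I=UNIV and M="%_. borel"])
  show "sets (slice ?P B borel) = sets (\<Pi>\<^sub>M i\<in>UNIV. (borel :: (nat => real) measure))" "sets (slice ?Q B borel) = sets (\<Pi>\<^sub>M i\<in>UNIV. (borel :: (nat => real) measure))"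
   by (simp_all only: slice_sets sets_PiM_equal_borel)
  show "finite_measure (slice ?P B borel)" by (rule finite_measure_slice[OF _ _ B]) (simp_all, unfold_locales)
  fix T :: "nat => (nat => real) set" and J :: "nat set" assume J: "finite J" and T: "!!i. i : J ==> T i : sets borel"
  obtain n where n: "J <= {..<n}" using finite_nat_iff_bounded[of J] J by auto
  define S where "S i = (if i : J then T i else UNIV)" for i
  have S: "S i : sets borel" for i using T by (simp add: S_def)
  let ?X = "prod_emb UNIV (%_. borel) J (Pi\<^sub>E J T)"
  have X: "?X = {x. \<forall>i<n. x i : S i}" 
  proof -
   have "?X = {x. \<forall>i\<in>J. x i : T i}" by (auto simp: prod_emb_def PiE_def Pi_def extensional_def restrict_def)
   thus ?thesis using n by (auto simp: S_def)
  qed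
  have "{x :: arr. x i : S i} : sets borel" for i
   using measurable_sets[OF measurable_product_coordinates[of i, where 'b="nat => real"] S[of i]] by (simp add: vimage_def)
  hence "{x :: arr : space borel. \<forall>i\<in>{..<n}. x i : S i} : sets borel" by (intro sets.sets_Collect_finite_All) auto
  hence Xm: "?X : sets borel" unfolding X by (simp only: space_borel UNIV_I simp_thms Ball_def lessThan_iff)
  have BX: "B \<times> ?X : sets (borel >< borel)" by (rule pair_measureI[OF B Xm])
  have ind: "Ind (B \<times> ?X) (z, x) = Ind B z * (\<Prod>i<n. Ind (S i) (x i) :: real)" for z x
   unfolding X by (subst prod_indicator) (auto simp: indicator_def)
  have mind: "(Ind (B \<times> ?X) :: _ => real) : Bm (borel >< borel)" using BX by simp
  have g: "Ind B : Bm (borel :: arr measure)" "0 <= (Ind B z :: real) & Ind B z <= (1::real)" for z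
   using B by (auto simp: indicator_def)
  have mKS: "(%z. Ind B z * (\<Prod>i<n. K1 (S i) z)) : Bm borel"
   by (intro bm_times bm_prod K1(1)[OF S] g(1))
  have "measure ?P (B \<times> ?X) = (LINT w|?P. Ind (B \<times> ?X) w)" using BX by simp
  also have "... = (LINT A|ze. Ind B (pool A) * (\<Prod>i<n. Ind (S i) (rows A i)))"
   by (simp only: integral_distr[OF mpr mind] ind)
  also have "... = (LINT A|ze. Ind B (pool A) * (\<Prod>i<n. K1 (S i) (pool A)))" by (rule rows_kernel[OF S g])
  also have "... = (LINT z|Lz. Ind B z * (\<Prod>i<n. K1 (S i) z))"
   unfolding Lz_def by (rule integral_distr[OF in_ze[OF measurable_pool] mKS, symmetric])
  also have "... = (LINT z|Lz. LINT x|seqs unif. Ind B z * (\<Prod>i<n. Ind (S i) (Ph1 z (x i))))"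
  proof (rule b_cong[OF refl])
   fix z
   have "(LINT x|(\<Pi>\<^sub>M i\<in>(UNIV :: nat set). unif). (\<Prod>i\<in>{..<n}. Ind (S i) (Ph1 z (x i)))) = (\<Prod>i\<in>{..<n}. LINT u|unif. Ind (S i) (Ph1 z u) :: real)"
   proof (rule integral_PiM_prod[where g="%i u. Ind (S i) (Ph1 z u)" and B=1])
    show "(%u. Ind (S i) (Ph1 z u) :: real) : Bm unif" for i
     unfolding m_cong_sets[OF sets_unif refl] by (rule m_comp[OF measurable_section1]) (use S in simp)
   qed (simp_all add: indicator_def)
   thus "Ind B z * (\<Prod>i<n. K1 (S i) z) = (LINT x|seqs unif. Ind B z * (\<Prod>i<n. Ind (S i) (Ph1 z (x i))))"
    by (simp add: seqs_def K1_def)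
  qed
  also have "... = (LINT z|Lz. LINT x|seqs unif. Ind (B \<times> ?X) (sampled (z, x)))"
   by (simp only: sampled_def ind fst_conv snd_conv)
  also have "... = (LINT w|(Lz >< seqs unif). Ind (B \<times> ?X) (sampled w))"
  proof -
   have "integrable (Lz >< seqs unif) (%w. Ind (B \<times> ?X) (sampled w) :: real)"
    by (rule finite_measure.integrable_bounded[OF prob_space.axioms(1)[OF pLU] m_comp[OF measurable_sampled mind], where B=1]) (simp add: indicator_def)
   from LU.integral_fst'[OF this] show ?thesis .
  qed
  also have "... = (LINT w|?Q. Ind (B \<times> ?X) w)" by (rule integral_distr[OF measurable_sampled mind, symmetric])
  also have "... = measure ?Q (B \<times> ?X)" using BX by simp
  finally have "measure ?P (B \<times> ?X) = measure ?Q (B \<times> ?X)" .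
  thus "emeasure (slice ?P B borel) ?X = emeasure (slice ?Q B borel) ?X"
   by (simp add: emeasure_slice[OF _ B Xm] P.emeasure_eq_measure Q.emeasure_eq_measure)
 qed
qed

section \<open>The model obtained by freezing the pool\<close>

text \<open>A uniform number stands for the row it generates over the pool \<open>z\<close>. The
  value 0 at \<open>a = b\<close> provides \<open>Ps_refl\<close> and concerns a null set of samples
  only.\<close>

definition edge_map :: "arr => real => real => real => real" where
 "edge_map z a b u = (if a = b then 0 else if enc (Ph1 z a) <= enc (Ph1 z b)
  then Ph2 (build z (Ph1 z a) (Ph1 z b)) u else Ph2 (build z (Ph1 z b) (Ph1 z a)) u)"

lemma edge_model: "sample_model unif (edge_map z)"
proof (intro sample_model.intro sample_model_axioms.intro)
 let ?N = "(unif >< unif) >< (borel :: real measure)"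
 have a: "(%w. fst (fst w)) : Bm ?N"
  unfolding measurable_unif_eq[symmetric] by (rule m_comp[OF m_fst m_fst])
 have b: "(%w. snd (fst w)) : Bm ?N"
  unfolding measurable_unif_eq[symmetric] by (rule m_comp[OF m_fst m_snd])
 have za: "(%w. Ph1 z (fst (fst w))) : Bm ?N" and zb: "(%w. Ph1 z (snd (fst w))) : Bm ?N"
  by (rule m_comp[OF a measurable_section1] m_comp[OF b measurable_section1])+
 have zz: "(%w. z) : Bm ?N" by simp
 have ph: "(%w. Ph2 (f w) (snd w)) : Bm ?N" if "f : Bm ?N" for f
  using m_comp[OF m_Pair[OF that m_snd] Ph2_meas] by (simp only: fst_conv snd_conv)
 show "(%w. edge_map z (fst (fst w)) (snd (fst w)) (snd w)) : Bm ?N"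
  unfolding edge_map_def
 proof (intro measurable_If ph measurable_build zz za zb)
  show "{w : space ?N. fst (fst w) = snd (fst w)} : sets ?N" by (rule borel_measurable_eq[OF a b])
  show "{w : space ?N. enc (Ph1 z (fst (fst w))) <= enc (Ph1 z (snd (fst w)))} : sets ?N"
   by (intro borel_measurable_le m_comp[OF za measurable_enc] m_comp[OF zb measurable_enc])
 qed simp
 show "edge_map z x y u = edge_map z y x u" for x y u
 proof -
  \<comment> \<open>On a tie of codes the two rows coincide, so either branch gives the same
    value.\<close>
  have "Ph1 z x = Ph1 z y" if "enc (Ph1 z x) <= enc (Ph1 z y)" "enc (Ph1 z y) <= enc (Ph1 z x)"
  proof -
   have "Ph1 z x = dec (enc (Ph1 z x))" by (rule dec_enc[symmetric]) (rule Ph1_bounds)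
   also have "enc (Ph1 z x) = enc (Ph1 z y)" using that by simp
   also have "dec (enc (Ph1 z y)) = Ph1 z y" by (rule dec_enc) (rule Ph1_bounds)
   finally show ?thesis .
  qed
  thus ?thesis by (auto simp: edge_map_def)
 qed
 show "0 <= edge_map z x y u & edge_map z x y u <= 1" for x y u using Ph2_bounds by (simp add: edge_map_def)
 show "edge_map z x x u = 0" for x u by (simp add: edge_map_def)
qed simp

lemma integral_edge_map:
 "a ~= b ==> (LINT u|unif. Ind S (edge_map z a b u)) = ks S z (Ph1 z a) (Ph1 z b)"
 by (simp add: edge_map_def ks_def K2_def)

text \<open>Sampled numbers are almost surely distinct, so \<open>edge_map\<close> avoids its
  exceptional value; given the numbers, the edges are independent with laws
  \<open>ks\<close>.\<close>

lemma sample_boxes: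
 fixes S :: "nat \<times> nat => real set"
 assumes E: "finite E" "E <= {e. fst e < snd e}" and S: "!!e. S e : sets borel"
 shows "(LINT w|samp unif. (\<Prod>e\<in>E. Ind (S e) (smat (edge_map z) (%_. 0) w (fst e) (snd e)))) =
  (LINT x|seqs unif. (\<Prod>e\<in>E. ks (S e) z (Ph1 z (x (fst e))) (Ph1 z (x (snd e)))))"
proof -
 interpret unif: prob_space unif by simp
 interpret M: sample_model unif "edge_map z" by (rule edge_model)
 interpret U: prob_space "seqs unif" by (rule prob_space_seqs) simp
 interpret N: prob_space noise by simp
 interpret UN: pair_prob_space "seqs unif" noise ..
 define F where "F w = (\<Prod>e\<in>E. Ind (S e) (smat (edge_map z) (%_. 0) w (fst e) (snd e)) :: real)" for w
 have ms: "smat (edge_map z) (%_. 0) : Bm (samp unif)" by (rule M.measurable_smat) simp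
 have mF: "F : Bm (samp unif)" unfolding F_def[abs_def]
  by (intro bm_prod m_comp[OF measurable_entry[OF ms]]) (use S in simp)
 have F1: "\<bar>F w\<bar> <= 1" for w
  using prod_unit[of E "%e. Ind (S e) (smat (edge_map z) (%_. 0) w (fst e) (snd e))"] by (simp add: F_def indicator_def)
 have iF: "integrable (seqs unif >< noise) F"
  by (rule finite_measure.integrable_bounded[OF prob_space.axioms(1)[OF prob_space_pair[OF U.prob_space_axioms N.prob_space_axioms]], where B=1])
   (use mF F1 in \<open>simp_all add: samp_def\<close>)
 have "(LINT w|samp unif. F w) = (LINT x|seqs unif. LINT u|noise. F (x, u))" using UN.integral_fst'[OF iF] by (simp add: samp_def)
 also have "... = (LINT x|seqs unif. (\<Prod>e\<in>E. ks (S e) z (Ph1 z (x (fst e))) (Ph1 z (x (snd e)))))"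
 proof (rule integral_cong_AE)
  have "(%(x, u). F (x, u)) : Bm (seqs unif >< noise)" using mF by (simp add: samp_def case_prod_unfold)
  from N.borel_measurable_lebesgue_integral[OF this] show "(%x. LINT u|noise. F (x, u)) : Bm (seqs unif)" .
  have c: "(%x. x i) : Bm (seqs unif)" for i
   unfolding measurable_unif_eq[symmetric] by (rule measurable_seqs_component)
  show "(%x. \<Prod>e\<in>E. ks (S e) z (Ph1 z (x (fst e))) (Ph1 z (x (snd e)))) : Bm (seqs unif)"
   by (intro bm_prod measurable_ks[OF S] borel_measurable_const m_comp[OF c measurable_section1])
  have "AE x in seqs unif. x i ~= x j" if "i ~= j" for i j :: nat
  proof -
   interpret VV: pair_prob_space unif unif ..
   have "AE p in unif >< unif. fst p ~= snd p"
   proof (rule VV.AE_pair_measure)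
    have f: "fst : Bm (unif >< unif)" unfolding measurable_unif_eq[symmetric] by (rule m_fst)
    from borel_measurable_neq[OF f measurable_snd_unif]
    show "{p : space (unif >< unif). fst p ~= snd p} : sets (unif >< unif)" .
    show "AE x in unif. AE y in unif. fst (x, y) ~= snd (x, y)"
    proof (rule AE_I2)
     fix x show "AE y in unif. fst (x, y) ~= snd (x, y)" using AE_unif_neq[of x] by eventually_elim simp
    qed
   qed
   moreover have "distr (seqs unif) (unif >< unif) (%x. (x i, x j)) = unif >< unif"
    unfolding seqs_def by (rule distr_PiM_pair[OF prob_space_unif that])
   ultimately have *: "AE p in distr (seqs unif) (unif >< unif) (%x. (x i, x j)). fst p ~= snd p" by (simp only:)
   have "(%x. (x i, x j)) : seqs unif ->M unif >< unif" by (intro m_Pair measurable_seqs_component)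
   from AE_distrD[OF this *] show ?thesis by simp
  qed
  hence "AE x in seqs unif. ALL i j. i ~= j --> x i ~= x j" by (simp add: AE_all_countable)
  thus "AE x in seqs unif. (LINT u|noise. F (x, u)) = (\<Prod>e\<in>E. ks (S e) z (Ph1 z (x (fst e))) (Ph1 z (x (snd e))))"
  proof eventually_elim
   case (elim x)
   have "(LINT u|noise. F (x, u)) = (LINT u|noise. (\<Prod>e\<in>E. Ind (S e) (edge_map z (x (fst e)) (x (snd e)) (u e))))"
    unfolding F_def by (intro b_cong refl prod.cong) (use E(2) in \<open>auto simp: smat_def\<close>)
   also have "... = (\<Prod>e\<in>E. LINT u|unif. Ind (S e) (edge_map z (x (fst e)) (x (snd e)) u))" unfolding noise_def
   proof (rule integral_PiM_prod[where g="%e u. Ind (S e) (edge_map z (x (fst e)) (x (snd e)) u)" and B=1])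
    show "(%u. Ind (S e) (edge_map z (x (fst e)) (x (snd e)) u) :: real) : Bm unif" for e
     by (rule m_comp[OF M.measurable_Ps_section]) (use S in simp_all)
   qed (simp_all add: E(1) indicator_def)
   also have "... = (\<Prod>e\<in>E. ks (S e) z (Ph1 z (x (fst e))) (Ph1 z (x (snd e))))"
   proof (intro prod.cong refl integral_edge_map)
    fix e assume "e : E"
    hence "fst e ~= snd e" using E(2) by auto
    thus "x (fst e) ~= x (snd e)" using elim by blast
   qed
   finally show ?case .
  qed
 qed
 finally show ?thesis unfolding F_def .
qed

text \<open>Boxes are lists of rational upper bounds on entries above the diagonal: countably many,
  so that one null set serves them all, and closed under intersection by appending lists.
  \<open>bside\<close> gathers the bounds on one edge.\<close>

definition bedges :: "(nat \<times> nat \<times> rat) list => (nat \<times> nat) set" where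
 "bedges l = (%t. (fst t, fst (snd t))) ` {t : set l. fst t < fst (snd t)}"
definition bside :: "(nat \<times> nat \<times> rat) list => nat \<times> nat => real set" where
 "bside l e = {v. \<forall>t\<in>set l. (fst t, fst (snd t)) = e --> v < of_rat (snd (snd t))}"
definition rbox :: "(nat \<times> nat \<times> rat) list => arr set" where
 "rbox l = {A : dist_matrices. \<forall>t\<in>set l. fst t < fst (snd t) --> A (fst t) (fst (snd t)) < of_rat (snd (snd t))}"

lemma bedges: "finite (bedges l)" "bedges l <= {e. fst e < snd e}"
 by (auto simp: bedges_def)

lemma bside: "bside l e : sets borel"
proof -
 have "bside l e = (\<Inter>t\<in>set l. {v. (fst t, fst (snd t)) = e --> v < of_rat (snd (snd t))})" by (auto simp: bside_def)
 moreover have "closed (- {v :: real. P --> v < c})" for P c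
 proof -
  have "- {v :: real. P --> v < c} = (if P then {c..} else {})" by auto
  thus ?thesis by simp
 qed
 hence "open {v :: real. P --> v < c}" for P c by (simp add: closed_def)
 hence "open (\<Inter>t\<in>set l. {v :: real. (fst t, fst (snd t)) = e --> v < of_rat (snd (snd t))})" by (intro open_INT) auto
 ultimately show ?thesis by simp
qed

lemma indicator_box: "A : dist_matrices ==> (\<Prod>e\<in>bedges l. Ind (bside l e) (A (fst e) (snd e))) = (Ind (rbox l) A :: real)"
proof -
 assume A: "A : dist_matrices"
 have "(\<forall>e\<in>bedges l. A (fst e) (snd e) : bside l e) \<longleftrightarrow> A : rbox l"
 proof
  assume L: "\<forall>e\<in>bedges l. A (fst e) (snd e) : bside l e"
  have "A (fst t) (fst (snd t)) < of_rat (snd (snd t))" if t: "t : set l" "fst t < fst (snd t)" for t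
  proof -
   have "(fst t, fst (snd t)) : bedges l" unfolding bedges_def using t by (intro image_eqI[of _ _ t]) simp_all
   from bspec[OF L this] show ?thesis using t(1) by (simp add: bside_def)
  qed
  thus "A : rbox l" using A by (simp add: rbox_def)
 next
  assume R: "A : rbox l"
  show "\<forall>e\<in>bedges l. A (fst e) (snd e) : bside l e"
  proof
   fix e assume e: "e : bedges l"
   hence lt: "fst e < snd e" using bedges(2) by blast
   show "A (fst e) (snd e) : bside l e" unfolding bside_def
   proof (intro CollectI ballI impI)
    fix t assume t: "t : set l" "(fst t, fst (snd t)) = e"
    hence "fst e = fst t" "snd e = fst (snd t)" by auto
    thus "A (fst e) (snd e) < of_rat (snd (snd t))" using R t(1) lt by (simp add: rbox_def)
   qed
  qed
 qed
 thus "(\<Prod>e\<in>bedges l. Ind (bside l e) (A (fst e) (snd e))) = (Ind (rbox l) A :: real)"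
  by (subst prod_indicator[OF bedges(1)]) (simp add: indicator_def)
qed

lemma box_sets: "rbox l : sets matrix_borel"
proof -
 have "{A : space borel. \<forall>t\<in>set l. fst t < fst (snd t) --> (A :: arr) (fst t) (fst (snd t)) < of_rat (snd (snd t))} : sets borel"
 proof (intro sets.sets_Collect_finite_All sets.sets_Collect_imp)
  show "{A : space borel. (A :: arr) (fst t) (fst (snd t)) < of_rat (snd (snd t))} : sets borel" for t :: "nat \<times> nat \<times> rat"
   by (intro borel_measurable_less measurable_arr_entry borel_measurable_const)
 qed auto
 moreover have "rbox l = dist_matrices Int {A : space borel. \<forall>t\<in>set l. fst t < fst (snd t) --> A (fst t) (fst (snd t)) < of_rat (snd (snd t))}"
  by (auto simp: rbox_def)
 ultimately show ?thesis unfolding sets_restrict_space by blast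
qed

lemma sigma_box: "sigma_sets dist_matrices (range rbox) = sets matrix_borel"
proof (intro equalityI)
 have sp: "space matrix_borel = dist_matrices" by (simp add: space_restrict_space)
 show "sigma_sets dist_matrices (range rbox) <= sets matrix_borel"
  using sets.sigma_sets_subset[of "range rbox" matrix_borel] box_sets by (auto simp: sp)
 let ?S = "sigma dist_matrices (range rbox)"
 have PS: "range rbox <= Pow dist_matrices" by (auto simp: rbox_def)
 have sS: "space ?S = dist_matrices" "sets ?S = sigma_sets dist_matrices (range rbox)" using PS by simp_all
 have e: "(%A. A i j) : Bm ?S" if ij: "i < j" for i j
  unfolding borel_measurable_iff_less
 proof
  fix a
  have "{A : space ?S. A i j < a} = (\<Union>r\<in>{r :: rat. of_rat r < a}. rbox [(i, j, r)])" (is "?L = ?R")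
  proof (intro set_eqI iffI)
   fix A assume A: "A : ?L"
   then obtain r :: rat where "A i j < of_rat r" "of_rat r < a" using of_rat_dense[of "A i j" a] by auto
   thus "A : ?R" using A ij sS(1) by (auto simp: rbox_def)
  qed (use ij sS(1) in \<open>auto simp: rbox_def\<close>)
  moreover have "rbox l : sets ?S" for l unfolding sS(2) by (intro sigma_sets.Basic) simp
  hence "?R : sets ?S" by (intro sets.countable_UN') auto
  ultimately show "{A : space ?S. A i j < a} : sets ?S" by simp
 qed
 have d: "A j i = A i j" "0 = A i i" if "A : space ?S" for A i j
  using that unfolding sS(1) by (simp_all add: dist_matrices_def)
 have "(%A. A) : ?S ->M matrix_borel"
 proof (rule measurable_restrict_space2)
  show "(%A. A) : space ?S \<rightarrow> dist_matrices" unfolding sS(1) by simp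
  show "(%A. A) : Bm ?S"
  proof (rule measurable_arrI)
   fix i j :: nat
   consider "i < j" | "j < i" | "i = j" by linarith
   thus "(%A. A i j) : Bm ?S"
   proof cases
    case 2
    show ?thesis by (rule measurable_cong[THEN iffD1, OF _ e[OF 2]]) (rule d(1))
   next
    case 3
    show ?thesis unfolding 3 by (rule measurable_cong[THEN iffD1, OF _ borel_measurable_const[of 0]]) (rule d(2))
   qed (rule e)
  qed
 qed
 note mid = this
 show "sets matrix_borel <= sigma_sets dist_matrices (range rbox)"
 proof
  fix X assume X: "X : sets matrix_borel"
  have "X <= dist_matrices" using sets.sets_into_space[OF X] by (simp add: sp)
  thus "X : sigma_sets dist_matrices (range rbox)" using measurable_sets[OF mid X] unfolding sS by (simp add: Int_absorb2)
 qed
qed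

definition bprob :: "(nat \<times> nat \<times> rat) list => arr => real" where
 "bprob l z = (LINT x|seqs unif. (\<Prod>e\<in>bedges l. ks (bside l e) z (Ph1 z (x (fst e))) (Ph1 z (x (snd e)))))"

text \<open>Integration against an event of the pool turns the kernels back into entries with even
  indices. These are independent of the pool by dissociation, so the conditional probability of a
  box is constant.\<close>

lemma bprob_eq: "AE z in Lz. bprob l z = measure ze (rbox l)"
proof -
 interpret Lz: prob_space Lz by (rule Lz)
 interpret unif: prob_space unif by simp
 interpret U: prob_space "seqs unif" by (rule prob_space_seqs) simp
 interpret LU: pair_prob_space Lz "seqs unif" ..
 let ?L = "distr ze borel (%A. A)"
 have mid: "(%A. A) : Bm ze" by (rule in_ze) simp
 interpret L: prob_space ?L by (rule prob_space_distr[OF mid])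
 interpret LL: pair_prob_space ?L ?L ..
 have pLU: "prob_space (Lz >< seqs unif)" by (rule prob_space_pair[OF Lz(1) U.prob_space_axioms])
 define G where "G p = (\<Prod>e\<in>bedges l. ks (bside l e) (fst p) (snd p (fst e)) (snd p (snd e)))" for p :: "arr \<times> arr"
 have mG: "G : Bm (borel >< borel)" unfolding G_def[abs_def]
  by (intro bm_prod measurable_ks[OF bside] m_fst measurable_snd_row)
 have G1: "0 <= G p & G p <= 1" for p unfolding G_def by (rule prod_unit) (rule ks_bounds[OF bside])
 have mGs: "(%w. G (sampled w)) : Bm (Lz >< seqs unif)" by (rule m_comp[OF measurable_sampled mG])
 have bG: "bprob l z = (LINT x|seqs unif. G (sampled (z, x)))" for z by (simp add: bprob_def G_def sampled_def)
 have "(%(z, x). G (sampled (z, x))) : Bm (Lz >< seqs unif)" using mGs by (simp add: case_prod_unfold)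
 from U.borel_measurable_lebesgue_integral[OF this] have mb: "bprob l : Bm Lz" by (simp add: bG[abs_def])
 have bb: "\<bar>bprob l z\<bar> <= 1" if "z : space Lz" for z
 proof -
  have "(%x. G (sampled (z, x))) : Bm (seqs unif)" by (rule m_comp[OF measurable_Pair1'[OF that] mGs])
  hence "integrable (seqs unif) (%x. G (sampled (z, x)))" by (rule U.integrable_bounded[where B=1]) (use G1 in simp)
  hence "bprob l z <= (LINT x|seqs unif. 1)" unfolding bG by (rule integral_mono) (use G1 in simp_all)
  moreover have "0 <= bprob l z" unfolding bG by (rule Bochner_Integration.integral_nonneg) (use G1 in simp)
  ultimately show ?thesis using U.prob_space by simp
 qed
 define f where "f A = (\<Prod>e\<in>bedges l. Ind (bside l e) (A (fst e) (snd e)) :: real)" for A :: arr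
 have mf: "f : Bm borel" unfolding f_def[abs_def]
  by (intro bm_prod m_comp[OF measurable_arr_entry] bm_ind bside)
 have f1: "0 <= f A & f A <= 1" for A unfolding f_def by (rule prod_unit) (simp add: indicator_def)
 have fc: "(LINT A|?L. f A) = measure ze (rbox l)"
 proof -
  have "(LINT A|?L. f A) = (LINT A|ze. f A)" by (rule integral_distr[OF mid mf])
  also have "... = (LINT A|ze. Ind (rbox l) A)"
   by (rule b_cong[OF refl]) (simp add: f_def indicator_box space_ze)
  finally show ?thesis using box_sets[of l] by (simp add: sets_ze)
 qed
 show ?thesis
 proof (rule density_unique_real)
  show "integrable Lz (bprob l)" by (rule Lz.integrable_bounded[OF mb bb])
  show "integrable Lz (%z. measure ze (rbox l))" by simp
  fix B assume "B : sets Lz"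
  hence B: "B : sets borel" by (simp add: Lz)
  have mB: "Ind B : Bm (borel :: arr measure)" using B by simp
  have I1: "0 <= (Ind B z :: real) & Ind B z <= (1::real)" for z by (simp add: indicator_def)
  have mBG: "(%p. Ind B (fst p) * G p) : Bm (borel >< borel)"
   by (intro bm_times mG m_comp[OF m_fst mB])
  have mBf: "(%p. Ind B (fst p)) : Bm (borel >< (borel :: arr measure))"
   by (rule m_comp[OF m_fst mB])
  have iBG: "integrable (Lz >< seqs unif) (%w. Ind B (fst (sampled w)) * G (sampled w))"
   by (rule finite_measure.integrable_bounded[OF prob_space.axioms(1)[OF pLU] m_comp[OF measurable_sampled mBG], where B=1])
    (use G1 in \<open>simp add: indicator_def\<close>)
  have mpr: "(%A. (pool A, rows A)) : ze ->M borel >< borel" by (intro in_ze m_Pair measurable_pool measurable_rows)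
  have ms: "(%A. (sub evens A, sub odds A)) : ze ->M borel >< borel" by (intro in_ze m_Pair measurable_sub)
  have mfB: "(%p. f (fst p) * Ind B (snd p)) : Bm (borel >< borel)"
   by (intro bm_times m_comp[OF m_fst mf] m_comp[OF m_snd mB])
  have "(LINT z|Lz. Ind B z * bprob l z) = (LINT z|Lz. LINT x|seqs unif. Ind B (fst (sampled (z, x))) * G (sampled (z, x)))"
   by (simp add: bG sampled_def)
  also have "... = (LINT w|(Lz >< seqs unif). Ind B (fst (sampled w)) * G (sampled w))" by (rule LU.integral_fst'[OF iBG])
  also have "... = (LINT p|distr ze (borel >< borel) (%A. (pool A, rows A)). Ind B (fst p) * G p)"
   unfolding rows_law by (rule integral_distr[OF measurable_sampled mBG, symmetric])
  also have "... = (LINT A|ze. G (pool A, rows A) * Ind B (pool A))"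
   unfolding integral_distr[OF mpr mBG] by (simp add: mult.commute)
  also have "... = (LINT A|ze. (\<Prod>e\<in>bedges l. Ind (bside l e) (A (2 * fst e) (2 * snd e))) * Ind B (pool A))"
   using edges_kernel[where S="bside l" and h="%p. Ind B (fst p)", OF bedges bside mBf I1] by (simp add: G_def)
  also have "... = (LINT A|ze. f (fst (sub evens A, sub odds A)) * Ind B (snd (sub evens A, sub odds A)))"
   by (simp add: f_def sub_def evens_def pool_def)
  also have "... = (LINT p|(?L >< ?L). f (fst p) * Ind B (snd p))"
   unfolding diss[symmetric] by (rule integral_distr[OF ms mfB, symmetric])
  also have "... = (LINT A|?L. LINT A'|?L. f A * Ind B A')"
  proof -
   have sLL: "sets (?L >< ?L) = sets (borel >< borel)" by (intro sets_pair_measure_cong) simp_all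
   have "(%p. f (fst p) * Ind B (snd p)) : Bm (?L >< ?L)" unfolding m_cong_sets[OF sLL refl] by (rule mfB)
   hence "integrable (?L >< ?L) (%p. f (fst p) * Ind B (snd p))"
    by (rule finite_measure.integrable_bounded[OF prob_space.axioms(1)[OF prob_space_pair[OF L.prob_space_axioms L.prob_space_axioms]], where B=1])
     (use f1 in \<open>simp add: indicator_def\<close>)
   from LL.integral_fst'[OF this] show ?thesis by simp
  qed
  also have "... = (LINT A|?L. f A) * (LINT A|?L. Ind B A)" by simp
  also have "(LINT A|?L. Ind B A) = (LINT z|Lz. Ind B z)"
  proof -
   have "Lz = ?L" unfolding Lz_def using exch[OF inj_odds] by (simp add: pool_def[abs_def])
   thus ?thesis by simp
  qed
  finally have "(LINT z|Lz. Ind B z * bprob l z) = (LINT z|Lz. Ind B z * measure ze (rbox l))"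
   unfolding fc by (simp add: mult.commute)
  thus "(LINT z:B|Lz. bprob l z) = (LINT z:B|Lz. measure ze (rbox l))"
   by (simp add: set_lebesgue_integral_def)
 qed
qed

text \<open>One null set is excluded for all boxes, and the boxes form a generating pi-system; any
  pool outside that null set may be frozen.\<close>

lemma good_pool: obtains z where "distr (samp unif) matrix_borel (smat (edge_map z) (%_. 0)) = ze"
proof -
 interpret Lz: prob_space Lz by (rule Lz)
 have "AE z in Lz. ALL l. bprob l z = measure ze (rbox l)" unfolding AE_all_countable using bprob_eq by blast
 note ae = this
 have "EX z. ALL l. bprob l z = measure ze (rbox l)"
 proof (rule ccontr)
  assume "~ ?thesis"
  hence "AE z in Lz. False" using ae by (elim eventually_mono) blast
  thus False by (simp only: Lz.AE_False)
 qed
 then obtain z where z: "!!l. bprob l z = measure ze (rbox l)" by blast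
 interpret M: sample_model unif "edge_map z" by (rule edge_model)
 note ms = M.measurable_smat_matrix
 have pS: "prob_space (samp unif)" by (rule prob_space_samp) simp
 interpret D: prob_space "distr (samp unif) matrix_borel (smat (edge_map z) (%_. 0))" by (rule prob_space.prob_space_distr[OF pS ms])
 have "distr (samp unif) matrix_borel (smat (edge_map z) (%_. 0)) = ze"
 proof (rule measure_eqI_generator_eq[where \<Omega>=dist_matrices and E="range rbox" and A="%_. rbox []"])
  show "Int_stable (range rbox)"
  proof (rule Int_stableI_image)
   fix l l' show "\<exists>k\<in>UNIV. rbox l Int rbox l' = rbox k" by (rule bexI[of _ "l @ l'"]) (auto simp: rbox_def)
  qed
  show "range rbox <= Pow dist_matrices" by (auto simp: rbox_def)
  show "sets (distr (samp unif) matrix_borel (smat (edge_map z) (%_. 0))) = sigma_sets dist_matrices (range rbox)" by (simp add: sigma_box)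
  show "sets ze = sigma_sets dist_matrices (range rbox)" by (simp add: sigma_box sets_ze)
  show "(\<Union>i :: nat. rbox []) = dist_matrices" by (simp add: rbox_def)
  show "emeasure (distr (samp unif) matrix_borel (smat (edge_map z) (%_. 0))) (rbox []) ~= \<infinity>" by simp
  fix X assume "X : range rbox"
  then obtain l where X: "X = rbox l" by auto
  have mi: "(Ind (rbox l) :: arr => real) : Bm matrix_borel" using box_sets by simp
  have "measure (distr (samp unif) matrix_borel (smat (edge_map z) (%_. 0))) (rbox l) = (LINT A|distr (samp unif) matrix_borel (smat (edge_map z) (%_. 0)). Ind (rbox l) A)"
   using box_sets by simp
  also have "... = (LINT w|samp unif. Ind (rbox l) (smat (edge_map z) (%_. 0) w))" by (rule integral_distr[OF ms mi])
  also have "... = (LINT w|samp unif. (\<Prod>e\<in>bedges l. Ind (bside l e) (smat (edge_map z) (%_. 0) w (fst e) (snd e))))"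
   by (rule b_cong[OF refl]) (simp add: indicator_box M.smat_dist_matrices)
  also have "... = bprob l z" unfolding bprob_def by (rule sample_boxes[OF bedges bside])
  also have "... = measure ze (rbox l)" by (rule z)
  finally show "emeasure (distr (samp unif) matrix_borel (smat (edge_map z) (%_. 0))) X = emeasure ze X"
   by (simp add: X D.emeasure_eq_measure emeasure_eq_measure)
 qed simp
 thus thesis by (rule that)
qed

end

section \<open>Representation by a qmm-space on the unit interval\<close>

lemma standard_borel_unif: "standard_borel unif"
proof -
 have "second_countable (euclidean :: real topology)"
 proof -
  obtain B :: "real set set" where B: "countable B" "topological_basis B" using ex_countable_basis by blast
  show ?thesis unfolding second_countable_def
  proof (intro exI[of _ B] conjI ballI allI impI)
   show "openin euclidean V" if "V : B" for V using topological_basis_open[OF B(2) that] by simp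
   fix U and x :: real assume "openin euclidean U & x : U"
   hence "open U" "x : U" by simp_all
   from topological_basisE[OF B(2) this] obtain V where "V : B" "x : V" "V <= U" .
   thus "\<exists>V\<in>B. x : V & V <= U" by blast
  qed (rule B(1))
 qed
 hence "separable_space (euclidean :: real topology)" by (rule second_countable_imp_separable_space)
 moreover have "sets unif = sigma_sets (space unif) {U. openin euclidean U}"
  unfolding sets_unif space_unif borel_def open_openin[symmetric] by simp
 ultimately show ?thesis unfolding standard_borel_def
  by (intro exI[of _ euclidean] conjI completely_metrizable_space_euclidean) simp_all
qed

text \<open>The triangle inequalities hold for a sampled matrix, that is, jointly in points and
  noise; Fubini turns this into a statement about almost every triple of points.\<close>

theorem (in sample_model) qmm_space_of_model:
 assumes sb: "standard_borel M"
  and tri: "AE z in samp M. smat Ps (%_. 0) z 0 2 <= smat Ps (%_. 0) z 0 1 + smat Ps (%_. 0) z 1 2 \<and>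
   smat Ps (%_. 0) z 0 1 <= smat Ps (%_. 0) z 1 2 + smat Ps (%_. 0) z 0 2 \<and>
   smat Ps (%_. 0) z 1 2 <= smat Ps (%_. 0) z 0 1 + smat Ps (%_. 0) z 0 2"
 shows "qmm_space M (%x y. distr unif unit_borel (Ps x y))" (is "qmm_space M ?q")
proof (intro qmm_space.intro qmm_space_axioms.intro prob_space_axioms sb)
 interpret unif: prob_space unif by simp
 have m: "Ps x y : unif ->M unit_borel" if "x : space M" "y : space M" for x y
  by (rule measurable_restrict_space2[OF _ measurable_Ps_section[OF that]]) (use Ps_bounds[OF that] in auto)
 show "(%(x, y). ?q x y) : M >< M ->M prob_algebra unit_borel"
 proof -
  have "(%p. distr unif unit_borel (%u. Ps (fst p) (snd p) u)) : M >< M ->M prob_algebra unit_borel"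
  proof (rule measurable_distr_prob_space2[where M=unif])
   show "(%p. unif) : M >< M ->M prob_algebra unif" by (rule measurable_const) (simp add: space_prob_algebra)
   have "(%w. Ps (fst (fst w)) (snd (fst w)) (snd w)) : (M >< M) >< unif ->M unit_borel"
   proof (rule measurable_restrict_space2)
    show "(%w. Ps (fst (fst w)) (snd (fst w)) (snd w)) : Bm ((M >< M) >< unif)"
     by (intro measurable_Ps m_comp[OF m_fst m_fst] m_comp[OF m_fst m_snd] measurable_snd_unif)
   qed (use Ps_bounds in \<open>auto simp: sp_pair\<close>)
   thus "(%(p, u). Ps (fst p) (snd p) u) : (M >< M) >< unif ->M unit_borel" by (simp add: case_prod_unfold)
  qed
  thus ?thesis by (simp add: case_prod_unfold)
 qed
 show "?q x x = return unit_borel 0" if "x : space M" for x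
 proof -
  have "?q x x = distr unif unit_borel (%u. 0)" using that by (intro distr_cong) (simp_all add: Ps_refl)
  also have "... = return unit_borel 0" by (rule unif.distr_const) (simp add: space_restrict_space)
  finally show ?thesis .
 qed
 show "?q x y = ?q y x" if "x : space M" "y : space M" for x y
  by (rule distr_cong) (simp_all add: Ps_sym[OF that])
 show "AE (a, b, c) in M >< (M >< M). AE (r, s, t) in ?q a b >< (?q b c >< ?q a c). t <= r + s & r <= s + t & s <= r + t"
 proof -
  let ?M3 = "M >< (M >< M)" and ?U3 = "unif >< (unif >< unif)"
  interpret M3: prob_space ?M3 by (intro prob_space_pair prob_space_axioms)
  interpret U3: prob_space ?U3 by (intro prob_space_pair prob_space_unif)
  interpret MU: pair_prob_space ?M3 ?U3 ..
  interpret Sq: prob_space "seqs M" by (rule prob_space_seqs) unfold_locales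
  interpret N: prob_space noise by simp
  define p3 where "p3 x = (x 0, (x 1, x 2))" for x :: "nat => 'a"
  define u3 where "u3 u = (u (0, 1), (u (1, 2), u (0, 2)))" for u :: "nat \<times> nat => real"
  have mp: "p3 : seqs M ->M ?M3" unfolding p3_def[abs_def] by (intro m_Pair measurable_seqs_component)
  have mcu: "(%u. u e) : noise ->M unif" for e unfolding noise_def by (rule measurable_component_singleton) simp
  have mu: "u3 : noise ->M ?U3" unfolding u3_def[abs_def] by (intro m_Pair mcu)
  \<comment> \<open>The index 3 here, and the pair (5, 5) for the noise, are dummies distinct from
    the coordinates that are read.\<close>
  have lp: "distr (seqs M) ?M3 p3 = ?M3" unfolding p3_def[abs_def] seqs_def
   by (rule distr_PiM_triple[OF prob_space_axioms, where l=3]) simp_all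
  have lu: "distr noise ?U3 u3 = ?U3" unfolding u3_def[abs_def] noise_def
   by (rule distr_PiM_triple[OF prob_space_unif, where l="(5, 5)"]) simp_all
  have mT: "(%(x, u). (p3 x, u3 u)) : samp M ->M ?M3 >< ?U3" unfolding samp_def case_prod_unfold
   by (intro m_Pair m_comp[OF m_fst mp] m_comp[OF m_snd mu])
  have lT: "distr (samp M) (?M3 >< ?U3) (%(x, u). (p3 x, u3 u)) = ?M3 >< ?U3" unfolding samp_def
   using pair_measure_distr[OF mp mu] by (simp add: lp lu U3.sigma_finite_measure_axioms)
  define Fa where "Fa w = Ps (fst (fst w)) (fst (snd (fst w))) (fst (snd w))" for w :: "('a \<times> 'a \<times> 'a) \<times> (real \<times> real \<times> real)"
  define Fb where "Fb w = Ps (fst (snd (fst w))) (snd (snd (fst w))) (fst (snd (snd w)))" for w :: "('a \<times> 'a \<times> 'a) \<times> (real \<times> real \<times> real)"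
  define Fc where "Fc w = Ps (fst (fst w)) (snd (snd (fst w))) (snd (snd (snd w)))" for w :: "('a \<times> 'a \<times> 'a) \<times> (real \<times> real \<times> real)"
  note mc = m_comp[OF m_fst] m_comp[OF m_snd] m_fst m_snd
  have v1: "(%w. fst (snd w)) : Bm (?M3 >< ?U3)"
   unfolding measurable_unif_eq[symmetric] by (rule m_comp[OF m_snd m_fst])
  have v2: "(%w. fst (snd (snd w))) : Bm (?M3 >< ?U3)"
   unfolding measurable_unif_eq[symmetric] by (rule m_comp[OF m_snd m_comp[OF m_snd m_fst]])
  have v3: "(%w. snd (snd (snd w))) : Bm (?M3 >< ?U3)"
   unfolding measurable_unif_eq[symmetric] by (rule m_comp[OF m_snd m_comp[OF m_snd m_snd]])
  have p1: "(%w. fst (fst w)) : ?M3 >< ?U3 ->M M" by (rule m_comp[OF m_fst m_fst])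
  have p2: "(%w. fst (snd (fst w))) : ?M3 >< ?U3 ->M M" by (rule m_comp[OF m_fst m_comp[OF m_snd m_fst]])
  have p3': "(%w. snd (snd (fst w))) : ?M3 >< ?U3 ->M M" by (rule m_comp[OF m_fst m_comp[OF m_snd m_snd]])
  have mF: "Fa : Bm (?M3 >< ?U3)" "Fb : Bm (?M3 >< ?U3)" "Fc : Bm (?M3 >< ?U3)"
   unfolding Fa_def[abs_def] Fb_def[abs_def] Fc_def[abs_def] by (rule measurable_Ps[OF p1 p2 v1], rule measurable_Ps[OF p2 p3' v2], rule measurable_Ps[OF p1 p3' v3])
  have mset: "{w : space (?M3 >< ?U3). Fc w <= Fa w + Fb w & Fa w <= Fb w + Fc w & Fb w <= Fa w + Fc w} : sets (?M3 >< ?U3)"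
   by (intro sets.sets_Collect_conj borel_measurable_le borel_measurable_add mF)
  have "AE z in samp M. Fc (p3 (fst z), u3 (snd z)) <= Fa (p3 (fst z), u3 (snd z)) + Fb (p3 (fst z), u3 (snd z)) \<and>
   Fa (p3 (fst z), u3 (snd z)) <= Fb (p3 (fst z), u3 (snd z)) + Fc (p3 (fst z), u3 (snd z)) & Fb (p3 (fst z), u3 (snd z)) <= Fa (p3 (fst z), u3 (snd z)) + Fc (p3 (fst z), u3 (snd z))"
   using tri by eventually_elim (simp add: smat_def Fa_def Fb_def Fc_def p3_def u3_def)
  hence "AE w in distr (samp M) (?M3 >< ?U3) (%(x, u). (p3 x, u3 u)). Fc w <= Fa w + Fb w & Fa w <= Fb w + Fc w & Fb w <= Fa w + Fc w"
   by (subst AE_distr_iff[OF mT mset]) (simp add: case_prod_unfold)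
  hence "AE w in ?M3 >< ?U3. Fc w <= Fa w + Fb w & Fa w <= Fb w + Fc w & Fb w <= Fa w + Fc w" unfolding lT .
  from MU.AE_pair[OF this]
  have "AE p in ?M3. AE v in ?U3. Fc (p, v) <= Fa (p, v) + Fb (p, v) & Fa (p, v) <= Fb (p, v) + Fc (p, v) & Fb (p, v) <= Fa (p, v) + Fc (p, v)" .
  hence "AE p in ?M3. AE w in ?q (fst p) (fst (snd p)) >< (?q (fst (snd p)) (snd (snd p)) >< ?q (fst p) (snd (snd p))).
   snd (snd w) <= fst w + fst (snd w) & fst w <= fst (snd w) + snd (snd w) & fst (snd w) <= fst w + snd (snd w)"
   using AE_space
  proof eventually_elim
   case (elim p)
   have s: "fst p : space M" "fst (snd p) : space M" "snd (snd p) : space M" using elim(2) by (auto simp: sp_pair)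
   note ma = m[OF s(1,2)] and mb = m[OF s(2,3)] and mcc = m[OF s(1,3)]
   have sf: "sigma_finite_measure (distr unif unit_borel (Ps (fst p) (snd (snd p))))"
    by (rule prob_space_imp_sigma_finite[OF unif.prob_space_distr[OF mcc]])
   have mbc: "(%(v, w). (Ps (fst (snd p)) (snd (snd p)) v, Ps (fst p) (snd (snd p)) w)) : unif >< unif ->M unit_borel >< unit_borel"
    unfolding case_prod_unfold by (intro m_Pair m_comp[OF m_fst mb] m_comp[OF m_snd mcc])
   have e1: "?q (fst (snd p)) (snd (snd p)) >< ?q (fst p) (snd (snd p)) = distr (unif >< unif) (unit_borel >< unit_borel) (%(v, w). (Ps (fst (snd p)) (snd (snd p)) v, Ps (fst p) (snd (snd p)) w))"
    by (rule pair_measure_distr[OF mb mcc sf])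
   have UU: "prob_space (unif >< unif)" by (intro prob_space_pair prob_space_unif)
   have sf2: "sigma_finite_measure (distr (unif >< unif) (unit_borel >< unit_borel) (%(v, w). (Ps (fst (snd p)) (snd (snd p)) v, Ps (fst p) (snd (snd p)) w)))"
    by (rule prob_space_imp_sigma_finite[OF prob_space.prob_space_distr[OF UU mbc]])
   have mabc: "(%(u, y). (Ps (fst p) (fst (snd p)) u, (%(v, w). (Ps (fst (snd p)) (snd (snd p)) v, Ps (fst p) (snd (snd p)) w)) y)) : ?U3 ->M unit_borel >< (unit_borel >< unit_borel)"
   proof -
    have "(%z. (Ps (fst p) (fst (snd p)) (fst z), (%(v, w). (Ps (fst (snd p)) (snd (snd p)) v, Ps (fst p) (snd (snd p)) w)) (snd z))) : ?U3 ->M unit_borel >< (unit_borel >< unit_borel)"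
     by (intro m_Pair m_comp[OF m_fst ma] m_comp[OF m_snd mbc])
    thus ?thesis by (simp only: case_prod_unfold)
   qed
   have i: "(%x :: real. x) : Bm unit_borel" by (rule measurable_restrict_space1) simp
   have w1: "fst : Bm (unit_borel >< (unit_borel >< unit_borel))" by (rule m_comp[OF m_fst i])
   have w2: "(%w. fst (snd w)) : Bm (unit_borel >< (unit_borel >< unit_borel))"
    by (rule m_comp[OF m_comp[OF m_snd m_fst] i])
   have w3: "(%w. snd (snd w)) : Bm (unit_borel >< (unit_borel >< unit_borel))"
    by (rule m_comp[OF m_comp[OF m_snd m_snd] i])
   have ws: "{w : space (unit_borel >< (unit_borel >< unit_borel)). snd (snd w) <= fst w + fst (snd w) & fst w <= fst (snd w) + snd (snd w) & fst (snd w) <= fst w + snd (snd w)}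
    : sets (unit_borel >< (unit_borel >< unit_borel))"
    by (intro sets.sets_Collect_conj borel_measurable_le borel_measurable_add w1 w2 w3)
   show ?case unfolding e1 pair_measure_distr[OF ma mbc sf2] AE_distr_iff[OF mabc ws]
    using elim(1) by (simp add: case_prod_unfold Fa_def Fb_def Fc_def)
  qed
  thus ?thesis by (simp add: case_prod_unfold)
 qed
qed

theorem (in exch_matrix) representation: "EX q. qmm_space unif q & qmm_tau unif q = ze"
proof -
 have mpr: "(%A. (pool A, srow 0 A)) : ze ->M borel >< borel" by (intro in_ze m_Pair measurable_pool measurable_srow)
 have mmk: "(%A. (mask A, A 0 1)) : ze ->M borel >< borel" by (intro in_ze m_Pair measurable_mask measurable_arr_entry)
 have u1: "AE w in distr ze (borel >< borel) (%A. (pool A, srow 0 A)). ALL k. 0 <= snd w k & snd w k <= 1"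
 proof (subst AE_distr_iff[OF mpr])
  show "{w : space (borel >< borel). ALL k. 0 <= (snd w :: nat => real) k & snd w k <= 1} : sets ((borel :: arr measure) >< borel)"
   by (rule sets_all_unit) (rule measurable_product_then_coordinatewise[OF m_snd])
  show "AE A in ze. ALL k. 0 <= snd (pool A, srow 0 A) k & snd (pool A, srow 0 A) k <= 1"
   by (rule AE_I2) (simp add: srow_def matrix_bounds)
 qed
 have u2: "AE w in distr ze (borel >< borel) (%A. (mask A, A 0 1)). snd w : {0..1}"
 proof (subst AE_distr_iff[OF mmk])
  show "{w : space (borel >< borel). (snd w :: real) : {0..1}} : sets ((borel :: arr measure) >< borel)"
   using measurable_sets[OF m_snd[of "borel :: arr measure" "borel :: real measure"], of "{0..1}"] by (simp add: vimage_def Int_def conj_commute)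
  show "AE A in ze. snd (mask A, A 0 1) : {0..1}" by (rule AE_I2) (simp add: matrix_bounds)
 qed
 have "\<exists>Ph1 :: arr => real => nat => real. (%z. Ph1 (fst z) (snd z)) : Bm (borel >< borel) & (\<forall>et u k. 0 <= Ph1 et u k & Ph1 et u k <= 1) & distr ze (borel >< borel) (%A. (pool A, srow 0 A)) =
   distr (distr (distr ze (borel >< borel) (%A. (pool A, srow 0 A))) borel fst >< unif) (borel >< borel) (%z. (fst z, Ph1 (fst z) (snd z)))"
 proof (rule noise_outsourcing_seq[OF prob_space_distr[OF mpr] sets_distr u1])
  fix Ph1 :: "arr => real => nat => real" assume a: "(%z. Ph1 (fst z) (snd z)) : Bm (borel >< borel)" "!!et u k. 0 <= Ph1 et u k & Ph1 et u k <= 1"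
   "distr ze (borel >< borel) (%A. (pool A, srow 0 A)) =
   distr (distr (distr ze (borel >< borel) (%A. (pool A, srow 0 A))) borel fst >< unif) (borel >< borel) (%z. (fst z, Ph1 (fst z) (snd z)))"
  have b: "\<forall>et u k. 0 <= Ph1 et u k & Ph1 et u k <= 1" using a(2) by simp
  show ?thesis by (intro exI[of _ Ph1] conjI a(1) b a(3))
 qed
 then obtain Ph1 :: "arr => real => nat => real" where
  P1: "(%z. Ph1 (fst z) (snd z)) : Bm (borel >< borel)" "\<forall>et u k. 0 <= Ph1 et u k & Ph1 et u k <= 1"
  "distr ze (borel >< borel) (%A. (pool A, srow 0 A)) =
   distr (distr (distr ze (borel >< borel) (%A. (pool A, srow 0 A))) borel fst >< unif) (borel >< borel) (%z. (fst z, Ph1 (fst z) (snd z)))"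
  by (elim exE conjE)
 have "\<exists>Ph2 :: arr => real => real. (%z. Ph2 (fst z) (snd z)) : Bm (borel >< borel) & (\<forall>et u. 0 <= Ph2 et u & Ph2 et u <= 1) & distr ze (borel >< borel) (%A. (mask A, A 0 1)) =
   distr (distr (distr ze (borel >< borel) (%A. (mask A, A 0 1))) borel fst >< unif) (borel >< borel) (%z. (fst z, Ph2 (fst z) (snd z)))"
 proof (rule noise_outsourcing[OF prob_space_distr[OF mmk] sets_distr u2])
  fix Ph2 :: "arr => real => real" assume a: "(%z. Ph2 (fst z) (snd z)) : Bm (borel >< borel)" "!!et u. 0 <= Ph2 et u & Ph2 et u <= 1"
   "distr ze (borel >< borel) (%A. (mask A, A 0 1)) =
   distr (distr (distr ze (borel >< borel) (%A. (mask A, A 0 1))) borel fst >< unif) (borel >< borel) (%z. (fst z, Ph2 (fst z) (snd z)))"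
  have b: "\<forall>et u. 0 <= Ph2 et u & Ph2 et u <= 1" using a(2) by simp
  show ?thesis by (intro exI[of _ Ph2] conjI a(1) b a(3))
 qed
 then obtain Ph2 :: "arr => real => real" where
  P2: "(%z. Ph2 (fst z) (snd z)) : Bm (borel >< borel)" "\<forall>et u. 0 <= Ph2 et u & Ph2 et u <= 1"
  "distr ze (borel >< borel) (%A. (mask A, A 0 1)) =
   distr (distr (distr ze (borel >< borel) (%A. (mask A, A 0 1))) borel fst >< unif) (borel >< borel) (%z. (fst z, Ph2 (fst z) (snd z)))"
  by (elim exE conjE)
 interpret E: exch_kernels ze Ph1 Ph2
  by unfold_locales (rule P1(1) P1(2)[rule_format] P1(3) P2(1) P2(2)[rule_format] P2(3))+
 obtain z where z: "distr (samp unif) matrix_borel (smat (E.edge_map z) (%_. 0)) = ze" using E.good_pool by blast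
 interpret M: sample_model unif "E.edge_map z" by (rule E.edge_model)
 have "AE w in samp unif. smat (E.edge_map z) (%_. 0) w 0 2 <= smat (E.edge_map z) (%_. 0) w 0 1 + smat (E.edge_map z) (%_. 0) w 1 2 \<and>
   smat (E.edge_map z) (%_. 0) w 0 1 <= smat (E.edge_map z) (%_. 0) w 1 2 + smat (E.edge_map z) (%_. 0) w 0 2 \<and>
   smat (E.edge_map z) (%_. 0) w 1 2 <= smat (E.edge_map z) (%_. 0) w 0 1 + smat (E.edge_map z) (%_. 0) w 0 2"
  by (rule AE_distrD[OF M.measurable_smat_matrix]) (simp only: z triangle)
 from M.qmm_space_of_model[OF standard_borel_unif this] show ?thesis
  by (intro exI[of _ "%x y. distr unif unit_borel (E.edge_map z x y)"] conjI) (simp_all only: M.qmm_tau_eq[OF refl] z)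
qed

lemma (in sample_model) exch_matrix_sample:
 assumes tri: "AE z in samp M. smat Ps (%_. 0) z 0 2 <= smat Ps (%_. 0) z 0 1 + smat Ps (%_. 0) z 1 2 \<and>
   smat Ps (%_. 0) z 0 1 <= smat Ps (%_. 0) z 1 2 + smat Ps (%_. 0) z 0 2 \<and>
   smat Ps (%_. 0) z 1 2 <= smat Ps (%_. 0) z 0 1 + smat Ps (%_. 0) z 0 2"
 shows "exch_matrix (distr (samp M) matrix_borel (smat Ps (%_. 0)))" (is "exch_matrix ?Z")
proof -
 have c0: "(%_. 0 :: real) : Bm M" by simp
 have in_Z: "f : ?Z ->M N" if "f : borel ->M N" for f :: "arr => 'c" and N
  unfolding measurable_distr_eq1 by (rule measurable_restrict_space1[OF that])
 have tr: "distr ?Z N f = distr (law (%_. 0)) N f" if f: "f : borel ->M N" for f :: "arr => 'c" and N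
  unfolding law_eq_distr by (subst distr_distr[OF f in_Z]) (simp_all add: comp_def)
 have id: "distr (law (%_. 0)) borel (%A. A) = law (%_. 0)" by (rule distr_id2) simp
 show ?thesis
 proof (intro exch_matrix.intro exch_matrix_axioms.intro)
  show "prob_space ?Z" by (rule prob_space.prob_space_distr[OF prob_space_samp measurable_smat_matrix]) unfold_locales
  show "distr ?Z borel (sub pq) = distr ?Z borel (%A. A)" if "inj pq" for pq
   using exchangeable_law[OF c0] that by (simp add: tr[OF measurable_sub] tr[of "%A. A" borel] id exchangeable_def)
  have "(%A. (sub evens A, sub odds A)) : borel ->M borel >< borel" by (intro m_Pair measurable_sub)
  from tr[OF this] show "distr ?Z (borel >< borel) (%A. (sub evens A, sub odds A)) = distr ?Z borel (%A. A) >< distr ?Z borel (%A. A)"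
   using dissociated_law[OF c0] by (simp add: tr[of "%A. A" borel] id dissociated_def)
  have "{A : space matrix_borel. A 0 2 <= A 0 1 + A 1 2 & A 0 1 <= A 1 2 + A 0 2 & A 1 2 <= (A :: arr) 0 1 + A 0 2} : sets matrix_borel"
   by (intro sets.sets_Collect_conj borel_measurable_le borel_measurable_add measurable_restrict_space1 measurable_arr_entry)
  from AE_distr_iff[OF measurable_smat_matrix this] tri
  show "AE A in ?Z. A 0 2 <= A 0 1 + A 1 2 & A 0 1 <= A 1 2 + A 0 2 & A 1 2 <= A 0 1 + A 0 2" by blast
 qed simp
qed

lemma (in mm_space) exch_matrix_tau: "exch_matrix (mm_tau M d)"
 unfolding mm_tau_eq
proof (rule S.exch_matrix_sample, rule AE_I2)
 fix z assume "z : space (samp M)"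
 hence s: "fst z i : space M" for i by (auto simp: samp_def sp_pair space_seqs)
 show "smat (%x y u. d x y) (%_. 0) z 0 2 <= smat (%x y u. d x y) (%_. 0) z 0 1 + smat (%x y u. d x y) (%_. 0) z 1 2 \<and>
   smat (%x y u. d x y) (%_. 0) z 0 1 <= smat (%x y u. d x y) (%_. 0) z 1 2 + smat (%x y u. d x y) (%_. 0) z 0 2 \<and>
   smat (%x y u. d x y) (%_. 0) z 1 2 <= smat (%x y u. d x y) (%_. 0) z 0 1 + smat (%x y u. d x y) (%_. 0) z 0 2"
  using triangle[OF s[of 0] s[of 1] s[of 2]] triangle[OF s[of 0] s[of 2] s[of 1]] triangle[OF s[of 1] s[of 0] s[of 2]]
   commute[of "fst z 2" "fst z 1"] commute[of "fst z 1" "fst z 0"] by (simp add: smat_def)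
qed

section \<open>The closure of the space of mm-spaces\<close>

lemma weak_topology_basic_open:
 assumes "continuous_on S f" "bounded (f ` S)" "open (U :: real set)"
 shows "openin (weak_topology S) {nu. prob_space nu & sets nu = sets (restrict_space borel S) & (LINT x|nu. f x) : U}"
 unfolding weak_topology_def by (rule topology_generated_by_Basis) (use assms in blast)

lemma bounded_test:
 fixes F :: "arr => real"
 assumes "continuous_on UNIV F" "!!A. \<bar>F A\<bar> <= B"
 shows "continuous_on dist_matrices F" "bounded (F ` dist_matrices)"
 using continuous_on_subset[OF assms(1)] assms(2) by (auto intro: boundedI[where B=B])

lemma chi_closure_topspace:
 assumes "ze : chi_closure"
 shows "prob_space ze" "sets ze = sets matrix_borel"
proof -
 have "ze : topspace (weak_topology dist_matrices)"
  using assms closure_of_subset_topspace[of "weak_topology dist_matrices" chi] unfolding chi_closure_def by blast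
 thus "prob_space ze" "sets ze = sets matrix_borel" by (auto simp: topspace_weak_topology)
qed

text \<open>Closed conditions are checked on a nearby element of \<open>chi\<close> that matches the
  finitely many integrals involved; this works with neighbourhoods directly, without
  sequences.\<close>

lemma chi_closure_approx:
 fixes Fs :: "(arr => real) set"
 assumes z: "ze : chi_closure" and "finite Fs" "0 < ep"
  and Fs: "!!F. F : Fs ==> continuous_on dist_matrices F & bounded (F ` dist_matrices)"
 shows "\<exists>nu\<in>chi. \<forall>F\<in>Fs. \<bar>(LINT x|nu. F x) - (LINT x|ze. F x)\<bar> < ep"
proof -
 define nb where "nb F = {nu. prob_space nu & sets nu = sets matrix_borel & (LINT x|nu. F x) : ball (LINT x|ze. F x) ep}" for F :: "arr => real"
 have op: "openin (weak_topology dist_matrices) (topspace (weak_topology dist_matrices) Int \<Inter> (nb ` Fs))"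
  using assms(2) Fs
 proof (induction Fs rule: finite_induct)
  case (insert F Fs)
  have "openin (weak_topology dist_matrices) (nb F)" unfolding nb_def by (rule weak_topology_basic_open) (use insert.prems in auto)
  moreover have "openin (weak_topology dist_matrices) (topspace (weak_topology dist_matrices) Int \<Inter> (nb ` Fs))"
   using insert.IH insert.prems by blast
  ultimately have "openin (weak_topology dist_matrices) (nb F Int (topspace (weak_topology dist_matrices) Int \<Inter> (nb ` Fs)))" by (rule openin_Int)
  thus ?case by (simp add: Int_ac)
 qed simp
 have "ze : topspace (weak_topology dist_matrices) Int \<Inter> (nb ` Fs)"
  using chi_closure_topspace[OF z] assms(3) by (simp add: topspace_weak_topology nb_def)
 then obtain nu where "nu : chi" "nu : \<Inter> (nb ` Fs)"
  using z op unfolding chi_closure_def in_closure_of by blast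
 thus ?thesis by (auto simp: nb_def dist_real_def abs_minus_commute intro!: bexI[of _ nu])
qed

lemma exch_matrix_chi: "nu : chi ==> exch_matrix nu"
 unfolding chi_def using mm_space.exch_matrix_tau by blast

text \<open>Exchangeability and dissociation are identities between integrals of continuous
  functions, and the triangle inequalities amount to a vanishing integral of one continuous
  nonnegative function, so all three survive in the closure.\<close>

lemma exch_matrix_chi_closure:
 assumes z: "ze : chi_closure"
 shows "exch_matrix ze"
proof (intro exch_matrix.intro exch_matrix_axioms.intro)
 note zt = chi_closure_topspace[OF z]
 interpret Z: prob_space ze by (rule zt)
 have in_Z: "f : ze ->M N" if "f : borel ->M N" for f :: "arr => 'c" and N
  unfolding m_cong_sets[OF zt(2) refl] by (rule measurable_restrict_space1[OF that])
 have spZ: "space ze = dist_matrices" using sets_eq_imp_space_eq[OF zt(2)] by (simp add: space_restrict_space)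
 have mid: "(%A. A) : Bm ze" by (rule in_Z) simp
 show "prob_space ze" "sets ze = sets matrix_borel" by (rule zt)+
 show "distr ze borel (sub pq) = distr ze borel (%A. A)" if pq: "inj pq" for pq
 proof (rule measure_eqI_continuous[OF Z.prob_space_distr[OF in_Z[OF measurable_sub]] _ Z.prob_space_distr[OF mid]])
  fix F :: "arr => real" assume F: "continuous_on UNIV F" "!!x. 0 <= F x & F x <= 1"
  have Fm: "F : Bm borel" by (rule borel_measurable_continuous_onI[OF F(1)])
  have F1: "\<bar>F x\<bar> <= 1" for x using F(2)[of x] by simp
  have cF: "continuous_on UNIV (%A. F (sub pq A))" by (rule continuous_on_compose2[OF F(1) continuous_on_sub]) simp
  have "\<bar>(LINT A|ze. F (sub pq A)) - (LINT A|ze. F A)\<bar> <= 0 + ep" if ep: "0 < ep" for ep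
  proof -
   have "0 < ep / 2" using ep by simp
   from chi_closure_approx[OF z _ this, of "{F, %A. F (sub pq A)}"] bounded_test[OF F(1) F1] bounded_test[OF cF F1]
   obtain nu where nu: "nu : chi" "\<bar>(LINT x|nu. F x) - (LINT x|ze. F x)\<bar> < ep / 2" "\<bar>(LINT x|nu. F (sub pq x)) - (LINT x|ze. F (sub pq x))\<bar> < ep / 2"
    by auto
   interpret N: exch_matrix nu by (rule exch_matrix_chi[OF nu(1)])
   show ?thesis using nu(2,3) N.exch_integral[OF pq Fm] by linarith
  qed
  hence "(LINT A|ze. F (sub pq A)) = (LINT A|ze. F A)" using field_le_epsilon[of "\<bar>(LINT A|ze. F (sub pq A)) - (LINT A|ze. F A)\<bar>" 0] by simp
  thus "(LINT x|distr ze borel (sub pq). F x) = (LINT x|distr ze borel (%A. A). F x)"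
   by (simp add: integral_distr[OF in_Z[OF measurable_sub] Fm] integral_distr[OF mid Fm])
 qed simp_all
 let ?L = "distr ze borel (%A. A)"
 have mb: "(%A. (sub evens A, sub odds A)) : borel ->M borel >< borel" by (intro m_Pair measurable_sub)
 show "distr ze (borel >< borel) (%A. (sub evens A, sub odds A)) = ?L >< ?L"
 proof (rule pair_measure_eqI_continuous[OF Z.prob_space_distr[OF mid] _ Z.prob_space_distr[OF mid] _ Z.prob_space_distr[OF in_Z[OF mb]]])
  fix F G :: "arr => real" assume F: "continuous_on UNIV F" "!!x. 0 <= F x & F x <= 1" and G: "continuous_on UNIV G" "!!x. 0 <= G x & G x <= 1"
  have F1: "\<bar>F x\<bar> <= 1" and G1: "\<bar>G x\<bar> <= 1" and FG1: "\<bar>F x * G y\<bar> <= 1" for x y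
   using F(2)[of x] G(2)[of x] G(2)[of y] by (simp_all add: abs_mult mult_le_one)
  have Fm: "F : Bm borel" and Gm: "G : Bm borel" by (intro borel_measurable_continuous_onI F G)+
  have FGm: "(%z. F (fst z) * G (snd z)) : Bm (borel >< borel)"
   by (intro bm_times m_comp[OF m_fst Fm] m_comp[OF m_snd Gm])
  have cFG: "continuous_on UNIV (%A. F (sub evens A) * G (sub odds A))"
   by (intro continuous_on_mult continuous_on_compose2[OF F(1) continuous_on_sub] continuous_on_compose2[OF G(1) continuous_on_sub]) simp_all
  have unit: "0 <= (LINT x|nu. H x) & (LINT x|nu. H x) <= 1" if "prob_space nu" "H : Bm nu" "!!x. 0 <= H x & H x <= 1" for H :: "arr => real" and nu
  proof -
   interpret P: prob_space nu by (rule that)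
   have "integrable nu H" by (rule P.integrable_bounded[OF that(2), where B=1]) (use that(3) in simp)
   hence "(LINT x|nu. H x) <= (LINT x|nu. 1)" by (rule integral_mono) (use that(3) in simp_all)
   moreover have "0 <= (LINT x|nu. H x)" by (rule Bochner_Integration.integral_nonneg) (use that(3) in simp)
   ultimately show ?thesis using P.prob_space by simp
  qed
  have "\<bar>(LINT A|ze. F (sub evens A) * G (sub odds A)) - (LINT A|ze. F A) * (LINT A|ze. G A)\<bar> <= 0 + ep" if ep: "0 < ep" for ep
  proof -
   \<comment> \<open>One third for the joint integral and one for each factor, the factors being
     bounded by 1.\<close>
   have "0 < ep / 3" using ep by simp
   from chi_closure_approx[OF z _ this, of "{F, G, %A. F (sub evens A) * G (sub odds A)}"] bounded_test[OF F(1) F1] bounded_test[OF G(1) G1] bounded_test[OF cFG FG1]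
   obtain nu where nu: "nu : chi" "\<bar>(LINT x|nu. F x) - (LINT x|ze. F x)\<bar> < ep / 3" "\<bar>(LINT x|nu. G x) - (LINT x|ze. G x)\<bar> < ep / 3"
    "\<bar>(LINT A|nu. F (sub evens A) * G (sub odds A)) - (LINT A|ze. F (sub evens A) * G (sub odds A))\<bar> < ep / 3" by auto
   interpret N: exch_matrix nu by (rule exch_matrix_chi[OF nu(1)])
   have midN: "(%A. A) : Bm nu" by (rule N.in_ze) simp
   let ?N = "distr nu borel (%A. A)"
   interpret P: prob_space ?N by (rule N.prob_space_distr[OF midN])
   interpret PP: pair_prob_space ?N ?N ..
   have "(LINT A|nu. F (sub evens A) * G (sub odds A)) = (LINT z|(?N >< ?N). F (fst z) * G (snd z))"
    unfolding N.diss[symmetric] integral_distr[OF N.in_ze[OF mb] FGm] by simp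
   also have "... = (LINT x|?N. LINT y|?N. F x * G y)"
   proof -
    have sNN: "sets (?N >< ?N) = sets (borel >< borel)" by (intro sets_pair_measure_cong) simp_all
    have "integrable (?N >< ?N) (%z. F (fst z) * G (snd z))"
     by (rule finite_measure.integrable_bounded[OF prob_space.axioms(1)[OF prob_space_pair[OF P.prob_space_axioms P.prob_space_axioms]], where B=1])
      (use FGm FG1 in \<open>simp_all only: m_cong_sets[OF sNN refl]\<close>)
    from PP.integral_fst'[OF this] show ?thesis by simp
   qed
   also have "... = (LINT x|nu. F x) * (LINT x|nu. G x)" by (simp add: integral_distr[OF midN Fm] integral_distr[OF midN Gm])
   finally have eq: "(LINT A|nu. F (sub evens A) * G (sub odds A)) = (LINT x|nu. F x) * (LINT x|nu. G x)" .
   have u: "\<bar>LINT x|nu. F x\<bar> <= 1" "\<bar>LINT x|ze. G x\<bar> <= 1"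
    using unit[OF N.prob_space_axioms N.in_ze[OF Fm] F(2)] unit[OF zt(1) in_Z[OF Gm] G(2)] by auto
   have "(LINT x|nu. F x) * (LINT x|nu. G x) - (LINT x|ze. F x) * (LINT x|ze. G x) =
    (LINT x|nu. F x) * ((LINT x|nu. G x) - (LINT x|ze. G x)) + ((LINT x|nu. F x) - (LINT x|ze. F x)) * (LINT x|ze. G x)"
    by (simp add: algebra_simps)
   hence "\<bar>(LINT x|nu. F x) * (LINT x|nu. G x) - (LINT x|ze. F x) * (LINT x|ze. G x)\<bar> <=
    \<bar>LINT x|nu. F x\<bar> * \<bar>(LINT x|nu. G x) - (LINT x|ze. G x)\<bar> + \<bar>(LINT x|nu. F x) - (LINT x|ze. F x)\<bar> * \<bar>LINT x|ze. G x\<bar>"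
    by (simp only: abs_mult[symmetric])
   moreover have "\<bar>LINT x|nu. F x\<bar> * \<bar>(LINT x|nu. G x) - (LINT x|ze. G x)\<bar> <= \<bar>(LINT x|nu. G x) - (LINT x|ze. G x)\<bar>"
    by (rule mult_left_le_one_le) (use u in simp_all)
   moreover have "\<bar>(LINT x|nu. F x) - (LINT x|ze. F x)\<bar> * \<bar>LINT x|ze. G x\<bar> <= \<bar>(LINT x|nu. F x) - (LINT x|ze. F x)\<bar>"
    by (rule mult_left_le) (use u in simp_all)
   ultimately show ?thesis using nu(2-4) eq by linarith
  qed
  hence "(LINT A|ze. F (sub evens A) * G (sub odds A)) = (LINT A|ze. F A) * (LINT A|ze. G A)"
   using field_le_epsilon[of "\<bar>(LINT A|ze. F (sub evens A) * G (sub odds A)) - (LINT A|ze. F A) * (LINT A|ze. G A)\<bar>" 0] by simp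
  thus "(LINT z|distr ze (borel >< borel) (%A. (sub evens A, sub odds A)). F (fst z) * G (snd z)) = (LINT x|?L. F x) * (LINT x|?L. G x)"
   by (simp add: integral_distr[OF in_Z[OF mb] FGm] integral_distr[OF mid Fm] integral_distr[OF mid Gm])
 qed simp_all
 \<comment> \<open>Total defect in the three triangle inequalities: continuous, nonnegative, and
   zero exactly when they hold.\<close>
 define T where "T A = max 0 (A 0 2 - A 0 1 - A 1 2) + max 0 (A 0 1 - A 1 2 - A 0 2) + max 0 (A 1 2 - A 0 1 - A 0 2)" for A :: arr
 have cT: "continuous_on S T" for S unfolding T_def[abs_def] by (intro continuous_intros)
 have Tb: "0 <= T A" "A : dist_matrices ==> T A <= 3" for A
 proof -
  show "0 <= T A" by (simp add: T_def)
  assume "A : dist_matrices"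
  hence "0 <= A i j" "A i j <= 1" for i j by (auto simp: dist_matrices_def)
  from this[of 0 1] this[of 0 2] this[of 1 2] show "T A <= 3" unfolding T_def by (auto simp: max_def)
 qed
 have T0: "T A = 0 \<longleftrightarrow> A 0 2 <= A 0 1 + A 1 2 & A 0 1 <= A 1 2 + A 0 2 & A 1 2 <= A 0 1 + A 0 2" for A
  unfolding T_def by (auto simp: max_def)
 have bT: "bounded (T ` dist_matrices)" by (rule boundedI[where B=3]) (use Tb in auto)
 have "(LINT A|ze. T A) <= 0 + ep" if ep: "0 < ep" for ep
 proof -
  from chi_closure_approx[OF z _ ep, of "{T}"] cT bT obtain nu where nu: "nu : chi" "\<bar>(LINT x|nu. T x) - (LINT x|ze. T x)\<bar> < ep" by auto
  interpret N: exch_matrix nu by (rule exch_matrix_chi[OF nu(1)])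
  have "(LINT x|nu. T x) = 0" by (rule integral_eq_zero_AE) (use N.triangle in \<open>simp only: T0\<close>)
  thus ?thesis using nu(2) by linarith
 qed
 hence le0: "(LINT A|ze. T A) <= 0" by (rule field_le_epsilon)
 have mT: "T : Bm ze" by (rule in_Z[OF borel_measurable_continuous_onI[OF cT]])
 have iT: "integrable ze T" by (rule Z.integrable_bounded[OF mT, where B=3]) (use Tb in \<open>simp add: spZ\<close>)
 have "(LINT A|ze. T A) = 0" using le0 Bochner_Integration.integral_nonneg[of ze T] Tb(1) by fastforce
 hence "AE A in ze. T A = 0" using integral_nonneg_eq_0_iff_AE[OF iT] Tb(1) by simp
 thus "AE A in ze. A 0 2 <= A 0 1 + A 1 2 & A 0 1 <= A 1 2 + A 0 2 & A 1 2 <= A 0 1 + A 0 2" by (simp only: T0)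
qed

lemma limitin_weak_topology_integral:
 assumes lim: "limitin (weak_topology S) zes ze sequentially" and f: "continuous_on S f" "bounded (f ` S)"
 shows "(%n. LINT x|zes n. f x) ~~> (LINT x|ze. f x :: real)"
proof (rule topological_tendstoI)
 fix U :: "real set" assume U: "open U" "(LINT x|ze. f x) : U"
 have "ze : {nu. prob_space nu & sets nu = sets (restrict_space borel S) & (LINT x|nu. f x) : U}"
  using lim U(2) by (auto simp: limitin_def topspace_weak_topology)
 hence "\<forall>\<^sub>F n in sequentially. zes n : {nu. prob_space nu & sets nu = sets (restrict_space borel S) & (LINT x|nu. f x) : U}"
  using lim weak_topology_basic_open[OF f U(1)] unfolding limitin_def by blast
 thus "\<forall>\<^sub>F n in sequentially. (LINT x|zes n. f x) : U" by eventually_elim simp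
qed

section \<open>Well-definedness on the closure, and the conclusion\<close>

lemma qmm_injection:
 assumes "qmm_space M q"
 obtains h :: "'a => real" where "h : Bm M" "inj_on h (space M)"
proof -
 interpret qmm_space M q by (rule assms)
 show thesis using standard_borel_injection[OF standard_borel not_empty] that by blast
qed

lemma obs_eq_of_law_eq:
 fixes Y :: "'y::metric_space set" and h :: "'a => real" and h' :: "'b => real"
 assumes S: "sample_model (M :: 'a measure) Ps" "sample_model (N :: 'b measure) \<Theta>"
  and h: "h : Bm M" "inj_on h (space M)" "h' : Bm N" "inj_on h' (space N)"
  and eq: "sample_model.law M Ps (%_. 0) = sample_model.law N \<Theta> (%_. 0)"
  and Y: "compact Y" "diameter Y <= 1" and \<kappa>: "0 <= \<kappa>"
 shows "sample_model.obs M Ps Y \<kappa> = sample_model.obs N \<Theta> Y \<kappa>"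
proof (cases "Y = {}")
 case True
 thus ?thesis using sample_model.lip_empty[OF S(1), where 'b='y] sample_model.lip_empty[OF S(2), where 'b='y]
  by (simp add: sample_model.obs_def[OF S(1)] sample_model.obs_def[OF S(2)])
next
 case False
 show ?thesis
  using obs_le_of_law_eq[OF S h(3,4) eq Y False \<kappa>] obs_le_of_law_eq[OF S(2,1) h(1,2) eq[symmetric] Y False \<kappa>] by simp
qed

text \<open>All qmm-spaces on real carriers with the same tau have the same \<open>obs\<close>, so
  the definite description in \<open>ObsDiam\<close> denotes, and any model with this law, on any
  carrier, computes it.\<close>

lemma ObsDiam_eq_obs:
 fixes Y :: "'y::metric_space set" and h :: "'a => real"
 assumes N: "qmm_space (N :: real measure) p"
  and S: "sample_model (M :: 'a measure) Ps" "h : Bm M" "inj_on h (space M)"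
  and eq: "sample_model.law M Ps (%_. 0) = distr (qmm_tau N p) borel (%A. A)"
  and Y: "compact Y" "diameter Y <= 1" and \<kappa>: "0 <= \<kappa>"
 shows "ObsDiam Y (qmm_tau N p) \<kappa> = sample_model.obs M Ps Y \<kappa>"
proof -
 have *: "qmm_ObsDiam Y N' p' \<kappa> = sample_model.obs M Ps Y \<kappa>" if N': "qmm_space (N' :: real measure) p'" "qmm_tau N' p' = qmm_tau N p" for N' p'
 proof -
  interpret Q: qmm_space N' p' by (rule N')
  obtain h' :: "real => real" where h': "h' : Bm N'" "inj_on h' (space N')" using qmm_injection[OF N'(1)] by blast
  have "Q.S.law (%_. 0) = sample_model.law M Ps (%_. 0)" unfolding Q.law_eq N'(2) eq ..
  from obs_eq_of_law_eq[OF Q.sample_model S(1) h' S(2,3) this Y \<kappa>] show ?thesis by (simp add: Q.ObsDiam_eq[OF Y(1)])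
 qed
 show ?thesis unfolding ObsDiam_def
 proof (rule the_equality)
  show "\<exists>(N' :: real measure) p'. qmm_space N' p' & qmm_tau N' p' = qmm_tau N p & sample_model.obs M Ps Y \<kappa> = qmm_ObsDiam Y N' p' \<kappa>"
   by (intro exI[of _ N] exI[of _ p] conjI N refl *[OF N refl, symmetric])
 qed (use * in auto)
qed

theorem theorem3:
  fixes Y :: "'y::metric_space set" and \<kappa> :: real
  assumes "compact Y" and "diameter Y \<le> 1" and "0 < \<kappa>" and "\<kappa> < 1"
  shows "(\<forall>\<zeta>\<in>chi_closure. \<exists>(M :: real measure) q. qmm_space M q \<and> qmm_tau M q = \<zeta>) \<and>
    (\<forall>(M :: 'a measure) q. qmm_space M q \<and> qmm_tau M q \<in> chi_closure \<longrightarrow>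
       ObsDiam Y (qmm_tau M q) \<kappa> = qmm_ObsDiam Y M q \<kappa>) \<and>
    (\<forall>(M :: 'a measure) d. mm_space M d \<longrightarrow>
       ObsDiam Y (mm_tau M d) \<kappa> = mm_ObsDiam Y M d \<kappa>) \<and>
    (\<forall>\<kappa>' \<zeta>s \<zeta>. 0 < \<kappa>' \<and> \<kappa>' < \<kappa> \<and> (\<forall>n. \<zeta>s n \<in> chi_closure) \<and> \<zeta> \<in> chi_closure \<and>
       limitin (weak_topology dist_matrices) \<zeta>s \<zeta> sequentially \<longrightarrow>
       limsup (\<lambda>n. ereal (ObsDiam Y (\<zeta>s n) \<kappa>)) \<le> ereal (ObsDiam Y \<zeta> \<kappa>'))"
proof (intro conjI ballI allI impI)
 note Y = assms(1,2)
 have \<kappa>0: "0 <= \<kappa>" using assms(3) by simp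
 \<comment> \<open>Models over \<open>unif\<close> are used throughout; their identity map serves as
   the injective real coordinate.\<close>
 have rep: "EX q. qmm_space unif q & qmm_tau unif q = \<zeta>" if "\<zeta> : chi_closure" for \<zeta>
  by (rule exch_matrix.representation[OF exch_matrix_chi_closure[OF that]])
 show "\<exists>(M :: real measure) q. qmm_space M q & qmm_tau M q = \<zeta>" if "\<zeta> : chi_closure" for \<zeta>
  using rep[OF that] by blast
 show "ObsDiam Y (qmm_tau M q) \<kappa> = qmm_ObsDiam Y M q \<kappa>" if "qmm_space M q & qmm_tau M q : chi_closure" for M :: "'a measure" and q
 proof -
  have M: "qmm_space M q" "qmm_tau M q : chi_closure" using that by auto
  interpret Q: qmm_space M q by (rule M)
  obtain p where p: "qmm_space unif p" "qmm_tau unif p = qmm_tau M q" using rep[OF M(2)] by blast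
  obtain h :: "'a => real" where h: "h : Bm M" "inj_on h (space M)" using qmm_injection[OF M(1)] by blast
  have "Q.S.law (%_. 0) = distr (qmm_tau unif p) borel (%A. A)" unfolding Q.law_eq p(2) ..
  from ObsDiam_eq_obs[OF p(1) Q.sample_model h this Y \<kappa>0] show ?thesis by (simp add: p(2) Q.ObsDiam_eq[OF Y(1)])
 qed
 show "ObsDiam Y (mm_tau M d) \<kappa> = mm_ObsDiam Y M d \<kappa>" if M: "mm_space M d" for M :: "'a measure" and d
 proof -
  interpret X: mm_space M d by (rule M)
  obtain p where p: "qmm_space unif p" "qmm_tau unif p = mm_tau M d"
   using exch_matrix.representation[OF X.exch_matrix_tau] by blast
  obtain h :: "'a => real" where h: "h : Bm M" "inj_on h (space M)"
   using X.separable_injection[OF X.separable X.not_empty refl X.sets_eq_borel] by blast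
  have "X.S.law (%_. 0) = distr (qmm_tau unif p) borel (%A. A)" unfolding X.law_eq p(2) ..
  from ObsDiam_eq_obs[OF p(1) X.sample_model h this Y \<kappa>0] show ?thesis by (simp add: p(2) X.ObsDiam_eq[OF Y(1)])
 qed
 fix \<kappa>' \<zeta>s \<zeta>
 assume "0 < \<kappa>' & \<kappa>' < \<kappa> & (ALL n. \<zeta>s n : chi_closure) & \<zeta> : chi_closure & limitin (weak_topology dist_matrices) \<zeta>s \<zeta> sequentially"
 hence \<kappa>': "0 <= \<kappa>'" "\<kappa>' < \<kappa>" and zs: "!!n. \<zeta>s n : chi_closure" and z: "\<zeta> : chi_closure"
  and lim: "limitin (weak_topology dist_matrices) \<zeta>s \<zeta> sequentially" by auto
 have "EX q. ALL n. qmm_space unif (q n) & qmm_tau unif (q n) = \<zeta>s n" using rep[OF zs] by (intro choice) blast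
 then obtain q where q: "!!n. qmm_space unif (q n)" "!!n. qmm_tau unif (q n) = \<zeta>s n" by blast
 obtain p where p: "qmm_space unif p" "qmm_tau unif p = \<zeta>" using rep[OF z] by blast
 define \<Theta> where "\<Theta> n = (%x y. quantile (q n x y))" for n
 define \<Psi> where "\<Psi> = (%x y. quantile (p x y))"
 have Sn: "sample_model unif (\<Theta> n)" for n unfolding \<Theta>_def by (rule qmm_space.sample_model[OF q(1)])
 have S: "sample_model unif \<Psi>" unfolding \<Psi>_def by (rule qmm_space.sample_model[OF p(1)])
 have ln: "sample_model.law unif (\<Theta> n) (%_. 0) = distr (qmm_tau unif (q n)) borel (%A. A)" for n
  unfolding \<Theta>_def by (rule qmm_space.law_eq[OF q(1)])
 have l: "sample_model.law unif \<Psi> (%_. 0) = distr (qmm_tau unif p) borel (%A. A)"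
  unfolding \<Psi>_def by (rule qmm_space.law_eq[OF p(1)])
 have hid: "(%x :: real. x) : Bm unif" "inj_on (%x :: real. x) (space unif)"
  by (simp_all add: measurable_ident_sets)
 have on: "ObsDiam Y (\<zeta>s n) \<kappa> = sample_model.obs unif (\<Theta> n) Y \<kappa>" for n
  using ObsDiam_eq_obs[OF q(1) Sn hid ln Y \<kappa>0] by (simp add: q(2))
 have o: "ObsDiam Y \<zeta> \<kappa>' = sample_model.obs unif \<Psi> Y \<kappa>'"
  using ObsDiam_eq_obs[OF p(1) S hid l Y \<kappa>'(1)] by (simp add: p(2))
 show "limsup (%n. ereal (ObsDiam Y (\<zeta>s n) \<kappa>)) <= ereal (ObsDiam Y \<zeta> \<kappa>')"
 proof (cases "Y = {}")
  case True
  have "sample_model.obs unif (\<Theta> n) Y \<kappa> = sample_model.obs unif \<Psi> Y \<kappa>'" for n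
   unfolding sample_model.obs_def[OF Sn] sample_model.obs_def[OF S] True sample_model.lip_empty[OF Sn] sample_model.lip_empty[OF S] by simp
  thus ?thesis by (simp add: on o Limsup_const)
 next
  case False
  show ?thesis
  proof (rule ccontr)
   assume "~ ?thesis"
   \<comment> \<open>A real number strictly between the two sides. Infinitely many terms exceed it,
     and \<open>obs_usc\<close> is applied along that subsequence.\<close>
   then obtain c where c: "ObsDiam Y \<zeta> \<kappa>' < c" "ereal c < limsup (%n. ereal (ObsDiam Y (\<zeta>s n) \<kappa>))"
    using ereal_dense2[of "ereal (ObsDiam Y \<zeta> \<kappa>')" "limsup (%n. ereal (ObsDiam Y (\<zeta>s n) \<kappa>))"] by (auto simp: not_le)
   have "~ (\<forall>\<^sub>F n in sequentially. ereal (ObsDiam Y (\<zeta>s n) \<kappa>) <= ereal c)"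
    using Limsup_bounded[of "%n. ereal (ObsDiam Y (\<zeta>s n) \<kappa>)" "ereal c" sequentially] c(2) by (auto simp: not_le)
   hence "ALL m. \<exists>n\<ge>m. n : {n. c < ObsDiam Y (\<zeta>s n) \<kappa>}" by (auto simp: eventually_sequentially not_le)
   hence "infinite {n. c < ObsDiam Y (\<zeta>s n) \<kappa>}" unfolding infinite_nat_iff_unbounded_le .
   from infinite_enumerate[OF this] obtain r :: "nat => nat" where r: "strict_mono r" "!!n. c < ObsDiam Y (\<zeta>s (r n)) \<kappa>" by auto
   have "c <= sample_model.obs unif \<Psi> Y \<kappa>'"
   proof (rule obs_usc[where N="%_. unif" and \<Theta>="%n. \<Theta> (r n)" and \<kappa>=\<kappa>, OF S Sn hid _ Y False \<kappa>'])
    show "c < sample_model.obs unif (\<Theta> (r n)) Y \<kappa>" for n using r(2)[of n] by (simp add: on)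
    fix F :: "arr => real" and B assume F: "continuous_on UNIV F" "!!A. \<bar>F A\<bar> <= B"
    have Fm: "F : Bm borel" by (rule borel_measurable_continuous_onI[OF F(1)])
    have i: "(LINT A|distr \<nu> borel (%A. A). F A) = (LINT A|\<nu>. F A)" if "\<nu> : chi_closure" for \<nu>
    proof (rule integral_distr[OF _ Fm])
     show "(%A. A) : Bm \<nu>"
      unfolding m_cong_sets[OF chi_closure_topspace(2)[OF that] refl] by (rule measurable_restrict_space1) simp
    qed
    have "(%n. LINT A|\<zeta>s n. F A) ~~> (LINT A|\<zeta>. F A)"
     by (rule limitin_weak_topology_integral[OF lim bounded_test[OF F]])
    from LIMSEQ_subseq_LIMSEQ[OF this r(1)]
    show "(%n. LINT A|sample_model.law unif (\<Theta> (r n)) (%_. 0). F A) ~~> (LINT A|sample_model.law unif \<Psi> (%_. 0). F A)"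
     by (simp add: ln l q(2) p(2) i[OF zs] i[OF z] comp_def)
   qed
   thus False using c(1) o by simp
  qed
 qed
qed

end
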